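(* Let $X=(X_t)_{t\in[t_0,T]}$ be the solution of the Itô SDE $X_t=x_0+\int_{t_0}^t a(X_s)\,ds+\sum_{j=1}^m\int_{t_0}^t b^j(X_s)\,dW_s^j$ with deterministic initial value $x_0\in\mathbb{R}^d$. Let $n\in\mathbb{N}_0$ and assume $f,a^i,b^{i,j}\in C_P^{2(n+1)}(\mathbb{R}^d,\mathbb{R})$ for $i=1,\dots,d$, $j=1,\dots,m$. Then: (1) For every $t\in[t_0,T]$, $$E^{t_0,x_0}(f(X_t))=\sum_{\substack{\mathbf t\in LTS(I)\\ \rho(\mathbf t)\le n}}\ \sum_{j_1,\dots,j_{s(\mathbf t)/2}=1}^m\frac{F(\mathbf t)(x_0)}{2^{s(\mathbf t)/2}\rho(\mathbf t)!}(t-t_0)^{\rho(\mathbf t)}+\mathcal R_n(t,t_0) =\sum_{\substack{\mathbf t\in TS(I)\\ \rho(\mathbf t)\le n}}\ \sum_{j_1,\dots,j_{s(\mathbf t)/2}=1}^m\frac{\alpha_I(\mathbf t)F(\mathbf t)(x_0)}{2^{s(\mathbf t)/2}\rho(\mathbf t)!}(t-t_0)^{\rho(\mathbf t)}+\mathcal R_n(t,t_0).$$ (2) There exists a random variable $\xi:\Omega\to\,]t_0,t[$ such that $$\mathcal R_n(t,t_0)=\sum_{\substack{\mathbf t\in LTS(I)\\ \rho(\mathbf t)= n+1}}\ \sum_{j_1,\dots,j_{s(\mathbf t)/2}=1}^m\frac{E^{t_0,x_0}(F(\mathbf t)(X_\xi))}{2^{s(\mathbf t)/2}\rho(\mathbf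 t)!}(t-t_0)^{\rho(\mathbf t)} =\sum_{\substack{\mathbf t\in TS(I)\\ \rho(\mathbf t)= n+1}}\ \sum_{j_1,\dots,j_{s(\mathbf t)/2}=1}^m\frac{\alpha_I(\mathbf t)E^{t_0,x_0}(F(\mathbf t)(X_\xi))}{2^{s(\mathbf t)/2}\rho(\mathbf t)!}(t-t_0)^{\rho(\mathbf t)}.$$
   Context: $(\Omega,\mathcal A,P)$ is a probability space with filtration $(\mathcal F_t)_{t\ge0}$, $W=(W^1,\dots,W^m)$ an $m$-dimensional Wiener process w.r.t. it, $0\le t_0<T<\infty$. $a:\mathbb{R}^d\to\mathbb{R}^d$ and $b:\mathbb{R}^d\to\mathbb{R}^{d\times m}$ (columns $b^j$, entries $b^{i,j}$) are Borel measurable and satisfy the global Lipschitz and linear growth conditions of the standard existence and uniqueness theorem, so the SDE has a unique continuous strong solution; $E^{t_0,x_0}$ denotes expectation for this solution. $f:\mathbb{R}^d\to\mathbb{R}$. $C_P^l(\mathbb{R}^d,\mathbb{R})$ is the space of $g\in C^l$ such that there are $K>0$, $r\in\mathbb{N}$ with $|\partial_x^i g(x)|\le K(1+\|x\|^{2r})$ for all $x$ and all partial derivatives of order $\le l$. Trees: a monotonically labelled coloured tree with $l$ nodes consists of nodes $1,\dots,l$, a father map $t':\{2,\dots,l\}\to\{1,\dots,l-1\}$ with $t'(i)<i$ (node 1 is the root), and a colour per node: $\gamma$ (root), $\tau$ (deterministic) or $\sigma_j$ (stochastic, index $j$). $LTS(I)$ is the set of trees obtainable thus: start with the single node $1$ coloured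 $\gamma$; at each step, if the current tree has $\lambda$ nodes and $k-1$ pairs of stochastic nodes have been added so far, either (a) add node $\lambda+1$ coloured $\tau$ with father any node in $\{1,\dots,\lambda\}$, or (b) add nodes $\lambda+1,\lambda+2$, both coloured $\sigma_{j_k}$ ($j_k$ a formal index variable), with fathers $t'(\lambda+1),t'(\lambda+2)\in\{1,\dots,\lambda\}$ (neither new node is the father of the other). $d(\mathbf t)$ = number of $\tau$-nodes, $s(\mathbf t)$ = number of stochastic nodes (even; index variables $j_1,\dots,j_{s/2}$), $\rho(\mathbf t)=d(\mathbf t)+s(\mathbf t)/2$. Two trees of $LTS(I)$ are equivalent if they have the same number of nodes and there are a bijection $\psi$ of node labels with $\psi(1)=1$ and a bijection $\pi$ of index variables such that $\psi$ maps the father relation of one tree onto that of the other and colours correspond after renaming indices by $\pi$. $TS(I)$ is the set of equivalence classes (each represented by one of its trees), and $\alpha_I(\mathbf t)$ is the number of elements of $LTS(I)$ in the class of $\mathbf t$. The index variables $j_1,\dots,j_{s(\mathbf t)/2}$ range over $\{1,\dots,m\}$ in the sums. Elementary differential: $g^{(k)}(x)(v_1,\dots,v_k)$ has $I$-th component $\sum_{J_1,\dots,J_k}\frac{\partial^k g^I(x)}{\partial x^{J_1}\cdots\partial x^{J_k}}v_1^{J_1}\cdots v_k^{J_k}$; for a tree with index values fixed, recursively for node $i$ with children $c_1,\dots,c_k$: $F_i(x)=g_i^{(k)}(x)(F_{c_1}(x),\dots,F_{c_k}(x))$, with $g_i=f$ for $\gamma$, $a$ for $\tau$, $b^j$ for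 $\sigma_j$; $F(\mathbf t):=F_1$. *)

theory Defs
  imports "HOL-Probability.Probability"
begin

definition filtration_on :: "'a measure \<Rightarrow> (real \<Rightarrow> 'a measure) \<Rightarrow> bool" where
  "filtration_on M Fl \<longleftrightarrow>
     (\<forall>t. space (Fl t) = space M \<and> sets (Fl t) \<subseteq> sets M) \<and>
     (\<forall>s t. 0 \<le> s \<longrightarrow> s \<le> t \<longrightarrow> sets (Fl s) \<subseteq> sets (Fl t))"

definition wiener_process ::
  "'a measure \<Rightarrow> (real \<Rightarrow> 'a measure) \<Rightarrow> ('m::finite \<Rightarrow> real \<Rightarrow> 'a \<Rightarrow> real) \<Rightarrow> bool" where
  "wiener_process M Fl W \<longleftrightarrow>
     (\<forall>j. \<forall>\<omega>\<in>space M. W j 0 \<omega> = 0) \<and>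
     (\<forall>j. \<forall>\<omega>\<in>space M. continuous_on {0..} (\<lambda>t. W j t \<omega>)) \<and>
     (\<forall>j. \<forall>t\<ge>0. W j t \<in> borel_measurable (Fl t)) \<and>
     (\<forall>s t. 0 \<le> s \<longrightarrow> s < t \<longrightarrow>
        distr M (PiM UNIV (\<lambda>_::'m. borel)) (\<lambda>\<omega> j. W j t \<omega> - W j s \<omega>)
          = PiM UNIV (\<lambda>_::'m. density lborel (normal_density 0 (sqrt (t - s)))) \<and>
        (\<forall>A\<in>sets (Fl s). \<forall>B\<in>sets (PiM UNIV (\<lambda>_::'m. borel :: real measure)).
           measure M (A \<inter> (\<lambda>\<omega> j. W j t \<omega> - W j s \<omega>) -` B \<inter> space M)
             = measure M A * measure M ((\<lambda>\<omega> j. W j t \<omega> - W j s \<omega>) -` B \<inter> space M)))"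

text \<open>Ito integral of a (continuous, adapted) integrand H against the scalar Brownian
  motion w over [t0,t]: the limit in probability of the left-point Riemann sums as
  the mesh of the partition tends to 0.\<close>
definition ito_integral_is ::
  "'a measure \<Rightarrow> (real \<Rightarrow> 'a \<Rightarrow> real) \<Rightarrow> (real \<Rightarrow> 'a \<Rightarrow> 'v::real_normed_vector)
    \<Rightarrow> real \<Rightarrow> real \<Rightarrow> ('a \<Rightarrow> 'v) \<Rightarrow> bool" where
  "ito_integral_is M w H t0 t I \<longleftrightarrow>
     I \<in> borel_measurable M \<and>
     (\<forall>\<epsilon>>0. \<exists>\<delta>>0. \<forall>(N::nat) (p::nat \<Rightarrow> real).
        p 0 = t0 \<and> p N = t \<and> (\<forall>k<N. p k < p (Suc k) \<and> p (Suc k) - p k < \<delta>) \<longrightarrow>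
        measure M {\<omega>\<in>space M.
           norm ((\<Sum>k<N. (w (p (Suc k)) \<omega> - w (p k) \<omega>) *\<^sub>R H (p k) \<omega>) - I \<omega>) > \<epsilon>} < \<epsilon>)"

definition sde_solution ::
  "'a measure \<Rightarrow> (real \<Rightarrow> 'a measure) \<Rightarrow> ('m::finite \<Rightarrow> real \<Rightarrow> 'a \<Rightarrow> real)
    \<Rightarrow> (real^'d \<Rightarrow> real^'d) \<Rightarrow> (real^'d \<Rightarrow> real^'m^'d) \<Rightarrow> real \<Rightarrow> real \<Rightarrow> real^'d
    \<Rightarrow> (real \<Rightarrow> 'a \<Rightarrow> real^'d) \<Rightarrow> bool" where
  "sde_solution M Fl W a b t0 T x0 X \<longleftrightarrow>
     (\<forall>t\<in>{t0..T}. X t \<in> borel_measurable (Fl t)) \<and>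
     (\<forall>\<omega>\<in>space M. continuous_on {t0..T} (\<lambda>t. X t \<omega>)) \<and>
     (\<forall>t\<in>{t0..T}. \<exists>I :: 'm \<Rightarrow> 'a \<Rightarrow> real^'d.
        (\<forall>j. ito_integral_is M (W j) (\<lambda>s \<omega>. \<chi> i. b (X s \<omega>) $ i $ j) t0 t (I j)) \<and>
        (AE \<omega> in M. X t \<omega> = x0 + integral {t0..t} (\<lambda>s. a (X s \<omega>)) + (\<Sum>j\<in>UNIV. I j \<omega>)))"

fun pd :: "'d::finite list \<Rightarrow> (real^'d \<Rightarrow> real) \<Rightarrow> real^'d \<Rightarrow> real" where
  "pd [] g = g"
| "pd (i # is) g = (\<lambda>x. deriv (\<lambda>h. pd is g (x + h *\<^sub>R axis i 1)) 0)"

definition CP :: "nat \<Rightarrow> (real^'d::finite \<Rightarrow> real) \<Rightarrow> bool" where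
  "CP l g \<longleftrightarrow>
     (\<forall>is::'d list. \<forall>i x. length is < l \<longrightarrow>
        (\<lambda>h. pd is g (x + h *\<^sub>R axis i 1)) differentiable (at 0)) \<and>
     (\<forall>is::'d list. length is \<le> l \<longrightarrow> continuous_on UNIV (pd is g)) \<and>
     (\<exists>K>0. \<exists>r::nat. \<forall>is::'d list. \<forall>x. length is \<le> l \<longrightarrow>
        \<bar>pd is g x\<bar> \<le> K * (1 + norm x ^ (2 * r)))"

text \<open>Colours: root gamma, deterministic tau, stochastic sigma with index variable
  number k (k = 0,1,... stands for j_1, j_2, ...).\<close>
datatype col = Gam | Tau | Sig nat

text \<open>A tree with l nodes is a list of length l; entry i (0-based, node i+1 of the
  paper) is (father, colour); the father entry of the root (entry 0) is a dummy 0.\<close>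
type_synonym tree = "(nat \<times> col) list"

fun is_sig :: "col \<Rightarrow> bool" where
  "is_sig (Sig _) = True" | "is_sig _ = False"

definition nsig :: "tree \<Rightarrow> nat" where
  "nsig tr = length (filter (\<lambda>p. is_sig (snd p)) tr)"

definition ntau :: "tree \<Rightarrow> nat" where
  "ntau tr = length (filter (\<lambda>p. snd p = Tau) tr)"

definition rho :: "tree \<Rightarrow> nat" where
  "rho tr = ntau tr + nsig tr div 2"

inductive_set lts :: "tree set" where
  root: "[(0, Gam)] \<in> lts"
| tau: "tr \<in> lts \<Longrightarrow> p < length tr \<Longrightarrow> tr @ [(p, Tau)] \<in> lts"
| sig: "tr \<in> lts \<Longrightarrow> p < length tr \<Longrightarrow> q < length tr \<Longrightarrow>
          tr @ [(p, Sig (nsig tr div 2)), (q, Sig (nsig tr div 2))] \<in> lts"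

fun ren :: "(nat \<Rightarrow> nat) \<Rightarrow> col \<Rightarrow> col" where
  "ren \<pi> Gam = Gam" | "ren \<pi> Tau = Tau" | "ren \<pi> (Sig k) = Sig (\<pi> k)"

definition tree_equiv :: "tree \<Rightarrow> tree \<Rightarrow> bool" where
  "tree_equiv t1 t2 \<longleftrightarrow> length t1 = length t2 \<and>
     (\<exists>\<psi> \<pi>. bij_betw \<psi> {..<length t1} {..<length t1} \<and> \<psi> 0 = 0 \<and>
        bij_betw \<pi> {..<nsig t1 div 2} {..<nsig t2 div 2} \<and>
        (\<forall>i\<in>{1..<length t1}. fst (t2 ! \<psi> i) = \<psi> (fst (t1 ! i))) \<and>
        (\<forall>i<length t1. snd (t2 ! \<psi> i) = ren \<pi> (snd (t1 ! i))))"

definition tree_rel :: "(tree \<times> tree) set" where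
  "tree_rel = {(t1, t2). t1 \<in> lts \<and> t2 \<in> lts \<and> tree_equiv t1 t2}"

definition ts :: "tree set" where
  "ts = (\<lambda>C. SOME tr. tr \<in> C) ` (lts // tree_rel)"

definition alpha :: "tree \<Rightarrow> nat" where
  "alpha tr = card {t' \<in> lts. tree_equiv tr t'}"

definition children :: "tree \<Rightarrow> nat \<Rightarrow> nat list" where
  "children tr i = filter (\<lambda>c. 0 < c \<and> fst (tr ! c) = i) [0..<length tr]"

fun gcomp :: "(real^'d \<Rightarrow> real^'d) \<Rightarrow> (real^'d \<Rightarrow> real^'m^'d) \<Rightarrow> (nat \<Rightarrow> 'm)
    \<Rightarrow> col \<Rightarrow> 'd \<Rightarrow> real^'d \<Rightarrow> real" where
  "gcomp a b js Tau I = (\<lambda>x. a x $ I)"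
| "gcomp a b js (Sig k) I = (\<lambda>x. b x $ I $ js k)"
| "gcomp a b js Gam I = (\<lambda>x. 0)"

fun edv :: "nat \<Rightarrow> (real^'d::finite \<Rightarrow> real^'d) \<Rightarrow> (real^'d \<Rightarrow> real^'m^'d)
    \<Rightarrow> tree \<Rightarrow> (nat \<Rightarrow> 'm) \<Rightarrow> nat \<Rightarrow> real^'d \<Rightarrow> real^'d" where
  "edv 0 a b tr js i x = 0"
| "edv (Suc k) a b tr js i x =
     (\<chi> I. \<Sum>Js\<in>{Js::'d list. length Js = length (children tr i)}.
        pd Js (gcomp a b js (snd (tr ! i)) I) x *
        (\<Prod>r<length (children tr i). edv k a b tr js (children tr i ! r) x $ (Js ! r)))"

text \<open>F(t)(x) with the index variables j_{k+1} assigned the values js k.\<close>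
definition elem_diff :: "(real^'d::finite \<Rightarrow> real) \<Rightarrow> (real^'d \<Rightarrow> real^'d)
    \<Rightarrow> (real^'d \<Rightarrow> real^'m^'d) \<Rightarrow> tree \<Rightarrow> (nat \<Rightarrow> 'm) \<Rightarrow> real^'d \<Rightarrow> real" where
  "elem_diff f a b tr js x =
     (\<Sum>Js\<in>{Js::'d list. length Js = length (children tr 0)}.
        pd Js f x *
        (\<Prod>r<length (children tr 0). edv (length tr) a b tr js (children tr 0 ! r) x $ (Js ! r)))"

definition lts_sum :: "(nat \<Rightarrow> bool) \<Rightarrow> (tree \<Rightarrow> (nat \<Rightarrow> 'm::finite) \<Rightarrow> real) \<Rightarrow> real" where
  "lts_sum P G = (\<Sum>tr\<in>{tr\<in>lts. P (rho tr)}.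
      \<Sum>js\<in>PiE {..<nsig tr div 2} (\<lambda>_. UNIV :: 'm set).
        G tr js / (2 ^ (nsig tr div 2) * fact (rho tr)))"

definition ts_sum :: "(nat \<Rightarrow> bool) \<Rightarrow> (tree \<Rightarrow> (nat \<Rightarrow> 'm::finite) \<Rightarrow> real) \<Rightarrow> real" where
  "ts_sum P G = (\<Sum>tr\<in>{tr\<in>ts. P (rho tr)}.
      \<Sum>js\<in>PiE {..<nsig tr div 2} (\<lambda>_. UNIV :: 'm set).
        real (alpha tr) * G tr js / (2 ^ (nsig tr div 2) * fact (rho tr)))"

end

theory Submission
  imports Defs
begin

text \<open>
  With \<open>L g = \<Sum>\<^sub>i a\<^sup>i \<partial>\<^sub>i g + 1/2 \<Sum>\<^sub>j \<Sum>\<^sub>i\<^sub>k b\<^sup>i\<^sup>j b\<^sup>k\<^sup>j \<partial>\<^sub>i \<partial>\<^sub>k g\<close> the theorem is Taylor's formula for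
  \<open>t \<mapsto> E (f (X\<^sub>t))\<close>, whose \<open>k\<close>-th derivative is \<open>E ((L\<^sup>k f) (X\<^sub>t))\<close>.  By the product rule, applying
  the drift part of \<open>L\<close> to an elementary differential attaches one deterministic node in all
  possible ways, and the second-order part attaches a pair of stochastic nodes; hence \<open>L\<^sup>k f\<close> is
  the sum of all \<open>2\<^bsup>-s/2\<^esup> F(t)\<close> with \<open>\<rho>(t) = k\<close>.  The Lagrange remainder supplies a constant \<open>\<xi>\<close>.

  The Ito integral is only given as a limit in probability of left-point sums, so Dynkin's formula
  is proved on the grid: \<open>X\<^sub>t - X\<^sub>s\<close> is an almost sure limit of sums of terms (coefficient at the
  left grid point) times (increment), a second-order Taylor expansion of each summand is averaged
  with the moments of the independent Gaussian increments, and the errors are controlled by moment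
  bounds, which in turn come from stopping at level \<open>R\<close> and Gronwall's argument.
\<close>

subsection \<open>Polynomial growth and partial derivatives\<close>

text \<open>The Riemann sums are not an Euler scheme: their coefficients are taken at the solution
  itself, because that is what the definition of the Ito integral offers. A Taylor step of
  \<open>g\<close> along such a sum therefore meets coefficients at one point and derivatives of
  \<open>g\<close> at another, and the two points must be compared in mean. Convergence in
  probability alone says nothing about expectations; it is upgraded by Borel-Cantelli to almost sure
  convergence along a sequence of grids, and bounded second moments then carry expectations to the
  limit. Since \<open>f\<close> and all derivatives are only of polynomial growth, moments of every
  order are consumed. Errors are kept in the form \<open>(t - s) * (e * A + C * (t - s))\<close>
  with \<open>e\<close> arbitrary and \<open>C\<close> depending on \<open>e\<close>: the second
  derivatives of \<open>g\<close> are merely continuous, so no rate is available, but this form is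
  stable under summation over a grid and suffices to differentiate the expectation. The order
  \<open>2 * (n + 1)\<close> is what \<open>n + 1\<close> applications of the generator cost, two
  derivatives each, the last result being only continuous.\<close>

definition poly_cont :: "('v::real_normed_vector \<Rightarrow> real) \<Rightarrow> bool" where
  "poly_cont g \<longleftrightarrow> continuous_on UNIV g \<and> (\<exists>K r. \<forall>x. \<bar>g x\<bar> \<le> K * (1 + norm x) ^ r)"

lemma poly_contE:
  assumes "poly_cont g"
  obtains K r where "0 \<le> K" "\<And>x. \<bar>g x\<bar> \<le> K * (1 + norm x) ^ r"
proof -
  from assms obtain K r where K: "\<And>x. \<bar>g x\<bar> \<le> K * (1 + norm x) ^ r"
    unfolding poly_cont_def by blast
  have "\<bar>g 0\<bar> \<le> K" using K[of 0] by simp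
  then have "0 \<le> K" by linarith
  then show thesis using K that by blast
qed

lemma poly_cont_continuous: "poly_cont g \<Longrightarrow> continuous_on UNIV g"
  by (simp add: poly_cont_def)

lemma poly_cont_measurable: "poly_cont g \<Longrightarrow> g \<in> borel_measurable borel"
  by (simp add: poly_cont_def borel_measurable_continuous_onI)

lemma poly_contI:
  assumes "continuous_on UNIV g" "\<And>x. \<bar>g x\<bar> \<le> K * (1 + norm x) ^ r"
  shows "poly_cont g"
  using assms unfolding poly_cont_def by blast

lemma poly_cont_const: "poly_cont (\<lambda>x. c)"
  by (rule poly_contI[of _ "\<bar>c\<bar>" 0]) auto

lemma poly_cont_add:
  assumes "poly_cont g" "poly_cont h"
  shows "poly_cont (\<lambda>x. g x + h x)"
proof -
  obtain K r where g: "0 \<le> K" "\<And>x. \<bar>g x\<bar> \<le> K * (1 + norm x) ^ r" using poly_contE[OF assms(1)] by blast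
  obtain L s where h: "0 \<le> L" "\<And>x. \<bar>h x\<bar> \<le> L * (1 + norm x) ^ s" using poly_contE[OF assms(2)] by blast
  show ?thesis
  proof (rule poly_contI)
    show "continuous_on UNIV (\<lambda>x. g x + h x)"
      using assms by (intro continuous_intros) (auto simp: poly_cont_def)
    fix x
    have "\<bar>g x\<bar> \<le> K * (1 + norm x) ^ (r + s)"
      by (rule order_trans[OF g(2)]) (intro mult_left_mono power_increasing g, auto)
    moreover have "\<bar>h x\<bar> \<le> L * (1 + norm x) ^ (r + s)"
      by (rule order_trans[OF h(2)]) (intro mult_left_mono power_increasing h, auto)
    ultimately show "\<bar>g x + h x\<bar> \<le> (K + L) * (1 + norm x) ^ (r + s)"
      by (simp add: distrib_right)
  qed
qed

lemma poly_cont_mult: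
  assumes "poly_cont g" "poly_cont h"
  shows "poly_cont (\<lambda>x. g x * h x)"
proof -
  obtain K r where g: "0 \<le> K" "\<And>x. \<bar>g x\<bar> \<le> K * (1 + norm x) ^ r" using poly_contE[OF assms(1)] by blast
  obtain L s where h: "0 \<le> L" "\<And>x. \<bar>h x\<bar> \<le> L * (1 + norm x) ^ s" using poly_contE[OF assms(2)] by blast
  show ?thesis
  proof (rule poly_contI)
    show "continuous_on UNIV (\<lambda>x. g x * h x)"
      using assms by (intro continuous_intros) (auto simp: poly_cont_def)
    fix x
    have "\<bar>g x\<bar> * \<bar>h x\<bar> \<le> (K * (1 + norm x) ^ r) * (L * (1 + norm x) ^ s)"
      by (intro mult_mono g h) (use g in auto)
    then show "\<bar>g x * h x\<bar> \<le> (K * L) * (1 + norm x) ^ (r + s)"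
      by (simp add: abs_mult power_add mult_ac)
  qed
qed

lemma poly_cont_sum:
  assumes "\<And>i. i \<in> A \<Longrightarrow> poly_cont (g i)"
  shows "poly_cont (\<lambda>x. \<Sum>i\<in>A. g i x)"
  using assms by (induction A rule: infinite_finite_induct) (auto intro: poly_cont_const poly_cont_add)

text \<open>Needed for functions of a pair: \<open>l\<close> will be one of the two projections or
  the diagonal embedding.\<close>

lemma poly_cont_compose_linear:
  assumes "poly_cont g" "bounded_linear l"
  shows "poly_cont (\<lambda>x. g (l x))"
proof -
  obtain K r where g: "0 \<le> K" "\<And>x. \<bar>g x\<bar> \<le> K * (1 + norm x) ^ r" using poly_contE[OF assms(1)] by blast
  obtain B where B: "\<And>x. norm (l x) \<le> norm x * B" using bounded_linear.bounded[OF assms(2)] by blast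
  show ?thesis
  proof (rule poly_contI)
    show "continuous_on UNIV (\<lambda>x. g (l x))"
      by (rule continuous_on_compose2[OF poly_cont_continuous[OF assms(1)] linear_continuous_on[OF assms(2)]]) auto
    fix x
    have 1: "1 + norm (l x) \<le> (1 + \<bar>B\<bar>) * (1 + norm x)"
    proof -
      have "norm x * B \<le> norm x * \<bar>B\<bar>" by (intro mult_left_mono) auto
      then show ?thesis using B[of x] by (simp add: algebra_simps) (smt (verit) norm_ge_zero)
    qed
    have "\<bar>g (l x)\<bar> \<le> K * (1 + norm (l x)) ^ r" by (rule g)
    also have "\<dots> \<le> K * ((1 + \<bar>B\<bar>) * (1 + norm x)) ^ r"
      using 1 by (intro mult_left_mono power_mono g) auto
    finally show "\<bar>g (l x)\<bar> \<le> (K * (1 + \<bar>B\<bar>) ^ r) * (1 + norm x) ^ r" by (simp add: power_mult_distrib mult_ac)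
  qed
qed

section \<open>Calculus of iterated partial derivatives\<close>

lemma pd_Cons: "pd (i # is) g = pd [i] (pd is g)"
  by simp

text \<open>\<open>pd\<close> is built on \<open>deriv\<close>, which has a value even where no
  derivative exists. Total differentiability pins that value down, and the rules for sums, products
  and constants are read off from those for \<open>has_derivative\<close>.\<close>

lemma pd_eq_derivative:
  assumes "(g has_derivative D) (at x)"
  shows "pd [i] g x = D (axis i 1)"
proof -
  have "((\<lambda>h. g (x + h *\<^sub>R axis i 1)) has_derivative (\<lambda>h. D (h *\<^sub>R axis i 1))) (at 0)"
    by (rule has_derivative_compose[of "\<lambda>h. x + h *\<^sub>R axis i 1" "\<lambda>h. h *\<^sub>R axis i 1" 0 UNIV g])
       (auto intro!: derivative_eq_intros assms)
  moreover have "(\<lambda>h. D (h *\<^sub>R axis i 1)) = (*) (D (axis i 1))"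
    using has_derivative_linear[OF assms] by (auto simp: linear_cmul)
  ultimately have "((\<lambda>h. g (x + h *\<^sub>R axis i 1)) has_field_derivative D (axis i 1)) (at 0)"
    by (simp add: has_field_derivative_def)
  then show ?thesis by (simp add: DERIV_imp_deriv)
qed

lemma has_derivative_pd:
  fixes g :: "real^'d::finite \<Rightarrow> real"
  assumes "g differentiable (at x)"
  shows "(g has_derivative (\<lambda>v. \<Sum>i\<in>UNIV. v $ i * pd [i] g x)) (at x)"
proof -
  obtain D where D: "(g has_derivative D) (at x)" using assms unfolding differentiable_def by blast
  have "D v = (\<Sum>i\<in>UNIV. v $ i * pd [i] g x)" for v
  proof -
    have "v = (\<Sum>i\<in>UNIV. (v $ i) *\<^sub>R axis i 1)"
      using basis_expansion[of v] by (simp add: scalar_mult_eq_scaleR)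
    then have "D v = D (\<Sum>i\<in>UNIV. (v $ i) *\<^sub>R axis i 1)" by simp
    also have "\<dots> = (\<Sum>i\<in>UNIV. v $ i * D (axis i 1))"
      using has_derivative_linear[OF D] by (simp add: linear_sum linear_cmul)
    finally show ?thesis by (simp add: pd_eq_derivative[OF D] del: pd.simps)
  qed
  then have "D = (\<lambda>v. \<Sum>i\<in>UNIV. v $ i * pd [i] g x)" by blast
  then show ?thesis using D by blast
qed

lemma pd_add:
  fixes g h :: "real^'d::finite \<Rightarrow> real"
  assumes "\<And>x. g differentiable (at x)" "\<And>x. h differentiable (at x)"
  shows "pd [i] (\<lambda>x. g x + h x) = (\<lambda>x. pd [i] g x + pd [i] h x)"
proof
  fix x
  show "pd [i] (\<lambda>x. g x + h x) x = pd [i] g x + pd [i] h x"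
    by (subst pd_eq_derivative[OF has_derivative_add[OF has_derivative_pd[OF assms(1)] has_derivative_pd[OF assms(2)]]])
       (simp add: axis_def if_distrib if_distribR sum.If_cases del: pd.simps)
qed

lemma pd_mult:
  fixes g h :: "real^'d::finite \<Rightarrow> real"
  assumes "\<And>x. g differentiable (at x)" "\<And>x. h differentiable (at x)"
  shows "pd [i] (\<lambda>x. g x * h x) = (\<lambda>x. g x * pd [i] h x + pd [i] g x * h x)"
proof
  fix x
  show "pd [i] (\<lambda>x. g x * h x) x = g x * pd [i] h x + pd [i] g x * h x"
    by (subst pd_eq_derivative[OF has_derivative_mult[OF has_derivative_pd[OF assms(1)] has_derivative_pd[OF assms(2)]]])
       (simp add: axis_def if_distrib if_distribR sum.If_cases del: pd.simps)
qed

lemma pd_const: "pd [i] (\<lambda>x. c) = (\<lambda>x. 0)"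
  by (rule ext, subst pd_eq_derivative[OF has_derivative_const]) simp

lemma pd_sum:
  fixes g :: "'i \<Rightarrow> real^'d::finite \<Rightarrow> real"
  assumes "\<And>k x. k \<in> A \<Longrightarrow> g k differentiable (at x)"
  shows "pd [i] (\<lambda>x. \<Sum>k\<in>A. g k x) = (\<lambda>x. \<Sum>k\<in>A. pd [i] (g k) x)"
  using assms
proof (induction A rule: infinite_finite_induct)
  case (insert k F)
  have "pd [i] (\<lambda>x. g k x + (\<Sum>k\<in>F. g k x)) = (\<lambda>x. pd [i] (g k) x + pd [i] (\<lambda>x. \<Sum>k\<in>F. g k x) x)"
    using insert by (intro pd_add differentiable_sum) auto
  then show ?case using insert by (simp del: pd.simps)
qed (simp_all only: sum.infinite sum.empty pd_const not_False_eq_True)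

lemma pd_prod:
  fixes g :: "'i \<Rightarrow> real^'d::finite \<Rightarrow> real"
  assumes "finite A" "\<And>k x. k \<in> A \<Longrightarrow> g k differentiable (at x)"
  shows "pd [i] (\<lambda>x. \<Prod>k\<in>A. g k x) = (\<lambda>x. \<Sum>k\<in>A. pd [i] (g k) x * (\<Prod>l\<in>A - {k}. g l x))"
proof
  fix x
  have "((\<lambda>x. \<Prod>k\<in>A. g k x) has_derivative (\<lambda>y. \<Sum>k\<in>A. (\<Sum>j\<in>UNIV. y $ j * pd [j] (g k) x) * (\<Prod>l\<in>A - {k}. g l x))) (at x)"
    by (intro has_derivative_prod has_derivative_pd assms)
  then show "pd [i] (\<lambda>x. \<Prod>k\<in>A. g k x) x = (\<Sum>k\<in>A. pd [i] (g k) x * (\<Prod>l\<in>A - {k}. g l x))"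
    by (simp only: pd_eq_derivative)
       (simp add: axis_def if_distrib if_distribR sum.If_cases del: pd.simps)
qed

text \<open>A form of \<open>CP\<close> made for induction: the order is peeled off one partial
  derivative at a time, and differentiability is total rather than along the axes. Growth exponents
  may vary from one derivative to the next, so that closure under sums and products needs no
  bookkeeping.\<close>

primrec smoothp :: "nat \<Rightarrow> (real^'d::finite \<Rightarrow> real) \<Rightarrow> bool" where
  "smoothp 0 g \<longleftrightarrow> poly_cont g"
| "smoothp (Suc l) g \<longleftrightarrow> poly_cont g \<and> (\<forall>x. g differentiable (at x)) \<and> (\<forall>i. smoothp l (pd [i] g))"

lemma smoothp_poly_cont: "smoothp l g \<Longrightarrow> poly_cont g"
  by (cases l) auto

lemma smoothp_differentiable: "smoothp l g \<Longrightarrow> 0 < l \<Longrightarrow> g differentiable (at x)"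
  by (cases l) auto

lemma smoothp_mono: "smoothp l g \<Longrightarrow> k \<le> l \<Longrightarrow> smoothp k g"
proof (induction l arbitrary: k g)
  case (Suc l)
  then show ?case
    by (cases k) (auto simp del: pd.simps)
qed simp

lemma smoothp_pd: "smoothp l g \<Longrightarrow> length is \<le> l \<Longrightarrow> smoothp (l - length is) (pd is g)"
proof (induction "is")
  case (Cons i "is")
  then have "smoothp (l - length is) (pd is g)" by simp
  moreover have "l - length is = Suc (l - length (i # is))" using Cons.prems by auto
  ultimately have "smoothp (l - length (i # is)) (pd [i] (pd is g))" by (simp del: pd.simps)
  then show ?case by (simp only: pd_Cons[of i "is"])
qed simp

lemma smoothp_const: "smoothp l (\<lambda>x. c)"
proof (induction l arbitrary: c)
  case (Suc l)
  then show ?case by (simp add: poly_cont_const pd_const del: pd.simps)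
qed (simp add: poly_cont_const)

lemma smoothp_add: "smoothp l g \<Longrightarrow> smoothp l h \<Longrightarrow> smoothp l (\<lambda>x. g x + h x)"
proof (induction l arbitrary: g h)
  case (Suc l)
  then show ?case
    by (auto simp add: poly_cont_add pd_add simp del: pd.simps)
qed (simp add: poly_cont_add)

lemma smoothp_mult: "smoothp l g \<Longrightarrow> smoothp l h \<Longrightarrow> smoothp l (\<lambda>x. g x * h x)"
proof (induction l arbitrary: g h)
  case (Suc l)
  then have "smoothp l g" "smoothp l h" by (auto intro: smoothp_mono[OF _ le_SucI] simp del: smoothp.simps)
  then show ?case using Suc
    by (auto simp add: poly_cont_mult pd_mult smoothp_add simp del: pd.simps)
qed (simp add: poly_cont_mult)

lemma smoothp_sum: "(\<And>k. k \<in> A \<Longrightarrow> smoothp l (g k)) \<Longrightarrow> smoothp l (\<lambda>x. \<Sum>k\<in>A. g k x)"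
  by (induction A rule: infinite_finite_induct) (auto intro: smoothp_const smoothp_add)

lemma smoothp_prod: "(\<And>k. k \<in> A \<Longrightarrow> smoothp l (g k)) \<Longrightarrow> smoothp l (\<lambda>x. \<Prod>k\<in>A. g k x)"
  by (induction A rule: infinite_finite_induct) (auto intro: smoothp_const smoothp_mult)

text \<open>The point \<open>x\<close> is joined to \<open>x + h\<close> by switching on one
  coordinate of \<open>h\<close> after the other. The mean value theorem on each of these
  axis-parallel segments, together with the continuity of the partial derivatives at
  \<open>x\<close>, controls the error.\<close>

lemma differentiable_of_partials:
  fixes g :: "real^'d::finite \<Rightarrow> real"
  assumes ax: "\<And>i y. (\<lambda>h. g (y + h *\<^sub>R axis i 1)) differentiable (at 0)"
    and cont: "\<And>i. continuous_on UNIV (pd [i] g)"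
  shows "g differentiable (at x)"
proof -
  have der: "((\<lambda>u. g (y + u *\<^sub>R axis i 1)) has_real_derivative pd [i] g (y + u *\<^sub>R axis i 1)) (at u)" for y i u
  proof -
    have "((\<lambda>h. g ((y + u *\<^sub>R axis i 1) + h *\<^sub>R axis i 1)) has_real_derivative pd [i] g (y + u *\<^sub>R axis i 1)) (at 0)"
      using ax[of "y + u *\<^sub>R axis i 1" i]
      by (simp add: field_differentiable_derivI real_differentiable_def field_differentiable_def DERIV_deriv_iff_real_differentiable)
    then have "((\<lambda>h. g (y + (u + h) *\<^sub>R axis i 1)) has_real_derivative pd [i] g (y + u *\<^sub>R axis i 1)) (at 0)"
      by (simp add: algebra_simps del: pd.simps)
    then show ?thesis
      using DERIV_at_within_shift[of "\<lambda>u. g (y + u *\<^sub>R axis i 1)" "pd [i] g (y + u *\<^sub>R axis i 1)" u 0 UNIV] by (simp del: pd.simps)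
  qed
  have est: "\<bar>g (x + h) - g x - (\<Sum>i\<in>UNIV. h $ i * pd [i] g x)\<bar> \<le> e * (\<Sum>i\<in>UNIV. \<bar>h $ i\<bar>)"
    if e: "\<And>i y. norm (y - x) < \<delta> \<Longrightarrow> \<bar>pd [i] g y - pd [i] g x\<bar> \<le> e" and h: "norm h < \<delta>" for e \<delta> h
  proof -
    have "\<bar>g (x + (\<chi> i. if i \<in> S then h $ i else 0)) - g x - (\<Sum>i\<in>S. h $ i * pd [i] g x)\<bar> \<le> e * (\<Sum>i\<in>S. \<bar>h $ i\<bar>)" for S
    proof (induction S rule: infinite_finite_induct)
      case empty
      have "(\<chi> i::'d. (0::real)) = 0" by (simp add: vec_eq_iff)
      then show ?case by simp
    next
      case (insert k S)
      let ?h = "\<lambda>S. \<chi> i. if i \<in> S then h $ i else (0::real)"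
      let ?y = "x + ?h S"
      have ins: "x + ?h (insert k S) = ?y + (h $ k) *\<^sub>R axis k 1"
        using insert by (auto simp: vec_eq_iff axis_def)
      \<comment> \<open>Every point of the segment differs from \<open>x\<close> by a vector
        dominated by \<open>h\<close> in each coordinate, so the modulus of continuity at
        \<open>x\<close> applies there.\<close>
      have nb: "norm (?h S + u *\<^sub>R axis k 1) < \<delta>" if "\<bar>u\<bar> \<le> \<bar>h $ k\<bar>" for u
      proof -
        have "norm (?h S + u *\<^sub>R axis k 1) \<le> norm h"
          using insert(2) that by (intro norm_le_componentwise_cart) (auto simp: axis_def)
        then show ?thesis using h by simp
      qed
      have "\<exists>u. \<bar>u\<bar> \<le> \<bar>h $ k\<bar> \<and> g (?y + (h $ k) *\<^sub>R axis k 1) - g ?y = h $ k * pd [k] g (?y + u *\<^sub>R axis k 1)"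
      proof (cases "h $ k = 0")
        case False
        have "\<exists>u. \<bar>u - 0\<bar> \<le> \<bar>h $ k - 0\<bar> \<and> g (?y + (h $ k) *\<^sub>R axis k 1) - g (?y + 0 *\<^sub>R axis k 1) = (h $ k - 0) * pd [k] g (?y + u *\<^sub>R axis k 1)"
        proof (cases "h $ k > 0")
          case True
          from MVT2[OF this der[of ?y k]] obtain z where "0 < z" "z < h $ k"
            "g (?y + (h $ k) *\<^sub>R axis k 1) - g (?y + 0 *\<^sub>R axis k 1) = (h $ k - 0) * pd [k] g (?y + z *\<^sub>R axis k 1)" by blast
          then show ?thesis by (intro exI[of _ z]) (simp del: pd.simps)
        next
          case neg: False
          with False have "h $ k < 0" by simp
          from MVT2[OF this der[of ?y k]] obtain z where "h $ k < z" "z < 0"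
            "g (?y + 0 *\<^sub>R axis k 1) - g (?y + (h $ k) *\<^sub>R axis k 1) = (0 - h $ k) * pd [k] g (?y + z *\<^sub>R axis k 1)" by blast
          then have "g (?y + (h $ k) *\<^sub>R axis k 1) - g (?y + 0 *\<^sub>R axis k 1) = (h $ k - 0) * pd [k] g (?y + z *\<^sub>R axis k 1)"
            unfolding left_diff_distrib by linarith
          then show ?thesis using \<open>h $ k < z\<close> \<open>z < 0\<close> by (intro exI[of _ z] conjI) auto
        qed
        then show ?thesis by (simp del: pd.simps)
      qed (auto)
      then obtain u where u: "\<bar>u\<bar> \<le> \<bar>h $ k\<bar>" "g (?y + (h $ k) *\<^sub>R axis k 1) - g ?y = h $ k * pd [k] g (?y + u *\<^sub>R axis k 1)" by blast
      have "\<bar>pd [k] g (?y + u *\<^sub>R axis k 1) - pd [k] g x\<bar> \<le> e"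
        using nb[OF u(1)] by (intro e) (simp add: add.assoc del: pd.simps)
      then have "\<bar>h $ k * (pd [k] g (?y + u *\<^sub>R axis k 1) - pd [k] g x)\<bar> \<le> \<bar>h $ k\<bar> * e"
        by (simp add: abs_mult mult_left_mono del: pd.simps)
      then have "\<bar>g (x + ?h (insert k S)) - g ?y - h $ k * pd [k] g x\<bar> \<le> \<bar>h $ k\<bar> * e"
        unfolding ins u(2) by (simp add: right_diff_distrib del: pd.simps)
      then show ?case using insert by (simp add: algebra_simps del: pd.simps)
    qed (simp add: infinite_UNIV_char_0)
    from this[of UNIV] show ?thesis by simp
  qed
  have "(g has_derivative (\<lambda>v. \<Sum>i\<in>UNIV. v $ i * pd [i] g x)) (at x)"
    unfolding has_derivative_within_alt
  proof (intro conjI allI impI)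
    show "bounded_linear (\<lambda>v. \<Sum>i\<in>UNIV. v $ i * pd [i] g x)"
      by (intro bounded_linear_sum bounded_linear_mult_const bounded_linear_vec_nth)
    fix e :: real assume e: "0 < e"
    \<comment> \<open>The sum of the absolute coordinates of \<open>y - x\<close> is at most
      \<open>CARD('d)\<close> times its norm.\<close>
    define e' where "e' = e / real CARD('d)"
    have e': "0 < e'" using e by (simp add: e'_def)
    have "\<forall>i. \<exists>\<delta>>0. \<forall>y. norm (y - x) < \<delta> \<longrightarrow> \<bar>pd [i] g y - pd [i] g x\<bar> \<le> e'"
    proof
      fix i
      have "isCont (pd [i] g) x" using cont[of i] by (simp add: continuous_on_eq_continuous_at del: pd.simps)
      then obtain d where "d > 0" "\<And>y. dist y x < d \<Longrightarrow> dist (pd [i] g y) (pd [i] g x) < e'"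
        using e' unfolding continuous_at_eps_delta by blast
      then show "\<exists>\<delta>>0. \<forall>y. norm (y - x) < \<delta> \<longrightarrow> \<bar>pd [i] g y - pd [i] g x\<bar> \<le> e'"
        by (intro exI[of _ d]) (auto simp: dist_norm less_imp_le simp del: pd.simps)
    qed
    then obtain \<delta> where \<delta>: "\<And>i. \<delta> i > 0" "\<And>i y. norm (y - x) < \<delta> i \<Longrightarrow> \<bar>pd [i] g y - pd [i] g x\<bar> \<le> e'" by metis
    define d where "d = Min (range \<delta>)"
    have d: "d > 0" "\<And>i. d \<le> \<delta> i" using \<delta>(1) by (auto simp: d_def)
    show "\<exists>d>0. \<forall>y\<in>UNIV. norm (y - x) < d \<longrightarrow>
            norm (g y - g x - (\<Sum>i\<in>UNIV. (y - x) $ i * pd [i] g x)) \<le> e * norm (y - x)"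
    proof (intro exI[of _ d] conjI ballI impI d)
      fix y assume y: "norm (y - x) < d"
      have "\<bar>g (x + (y - x)) - g x - (\<Sum>i\<in>UNIV. (y - x) $ i * pd [i] g x)\<bar> \<le> e' * (\<Sum>i\<in>UNIV. \<bar>(y - x) $ i\<bar>)"
        by (rule est[OF _ y]) (meson \<delta>(2) d(2) less_le_trans)
      also have "\<dots> \<le> e' * (\<Sum>i\<in>(UNIV :: 'd set). norm (y - x))"
        using e' by (intro mult_left_mono sum_mono component_le_norm_cart) auto
      also have "\<dots> = e * norm (y - x)" by (simp add: e'_def)
      finally show "norm (g y - g x - (\<Sum>i\<in>UNIV. (y - x) $ i * pd [i] g x)) \<le> e * norm (y - x)"
        by (simp del: pd.simps)
    qed
  qed
  then show ?thesis by (auto simp: differentiable_def simp del: pd.simps)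
qed

text \<open>\<open>CP\<close> provides derivatives along the axes only. At each order the continuity
  of the next partial derivatives upgrades this to total differentiability; the induction is on the
  remaining order, for all index lists at once.\<close>

lemma CP_imp_smoothp:
  fixes g :: "real^'d::finite \<Rightarrow> real"
  assumes "CP l g" shows "smoothp l g"
proof -
  obtain K r where K: "K > 0" and gr: "\<And>is x. length is \<le> l \<Longrightarrow> \<bar>pd is g x\<bar> \<le> K * (1 + norm x ^ (2 * r))"
    using assms unfolding CP_def by blast
  have pc: "poly_cont (pd is g)" if "length is \<le> l" for "is"
  proof (rule poly_contI)
    show "continuous_on UNIV (pd is g)" using assms that by (auto simp: CP_def)
    fix x :: "real^'d"
    have "norm x ^ (2 * r) \<le> (1 + norm x) ^ (2 * r)" by (intro power_mono) auto
    moreover have "1 \<le> (1 + norm x) ^ (2 * r)" by (rule one_le_power) simp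
    ultimately have "K * (1 + norm x ^ (2 * r)) \<le> K * (2 * (1 + norm x) ^ (2 * r))" using K by (intro mult_left_mono) linarith+
    with gr[OF that, of x] show "\<bar>pd is g x\<bar> \<le> (2 * K) * (1 + norm x) ^ (2 * r)" by simp
  qed
  have "length is + k \<le> l \<Longrightarrow> smoothp k (pd is g)" for k "is"
  proof (induction k arbitrary: "is")
    case (Suc k)
    have 1: "smoothp k (pd [i] (pd is g))" for i
      using Suc.IH[of "i # is"] Suc.prems by (simp only: pd_Cons[of i "is"]) simp
    have 2: "continuous_on UNIV (pd [i] (pd is g))" for i
      using smoothp_poly_cont[OF 1] by (rule poly_cont_continuous)
    have 3: "(\<lambda>h. pd is g (y + h *\<^sub>R axis i 1)) differentiable at 0" for y i
      using assms Suc.prems by (auto simp: CP_def)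
    show ?case using differentiable_of_partials[of "pd is g", OF 3 2] 1 pc[of "is"] Suc.prems
      by (simp del: pd.simps)
  qed (simp add: pc)
  from this[of "[]" l] show ?thesis by simp
qed

section \<open>Symmetry of partial derivatives and second-order Taylor expansion\<close>

lemma line_derivative:
  fixes g :: "real^'d::finite \<Rightarrow> real"
  assumes "\<And>x. g differentiable (at x)"
  shows "((\<lambda>u. g (z + u *\<^sub>R y)) has_real_derivative (\<Sum>i\<in>UNIV. y $ i * pd [i] g (z + u *\<^sub>R y))) (at u)"
proof -
  have "((\<lambda>u. g (z + u *\<^sub>R y)) has_derivative (\<lambda>h. \<Sum>i\<in>UNIV. (h *\<^sub>R y) $ i * pd [i] g (z + u *\<^sub>R y))) (at u)"
    by (rule has_derivative_compose[OF _ has_derivative_pd[OF assms]])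
       (auto intro!: derivative_eq_intros)
  moreover have "(\<lambda>h. \<Sum>i\<in>UNIV. (h *\<^sub>R y) $ i * pd [i] g (z + u *\<^sub>R y)) = (*) (\<Sum>i\<in>UNIV. y $ i * pd [i] g (z + u *\<^sub>R y))"
    by (auto simp: sum_distrib_left mult_ac simp del: pd.simps)
  ultimately show ?thesis by (simp add: has_field_derivative_def del: pd.simps)
qed

lemma axis_derivative:
  fixes g :: "real^'d::finite \<Rightarrow> real"
  assumes "\<And>x. g differentiable (at x)"
  shows "((\<lambda>u. g (z + u *\<^sub>R axis i 1)) has_real_derivative pd [i] g (z + u *\<^sub>R axis i 1)) (at u)"
  using line_derivative[OF assms, of z "axis i 1" u]
  by (simp add: axis_def if_distrib if_distribR sum.If_cases del: pd.simps)

text \<open>Two applications of the mean value theorem to the second difference of \<^term>\<open>g\<close>.\<close>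
lemma second_difference_mvt:
  fixes g :: "real^'d::finite \<Rightarrow> real"
  assumes "smoothp 2 g" "h > 0"
  shows "\<exists>y. norm (y - x) \<le> 2 * h \<and>
     g (x + h *\<^sub>R axis i 1 + h *\<^sub>R axis j 1) - g (x + h *\<^sub>R axis i 1) - g (x + h *\<^sub>R axis j 1) + g x = h\<^sup>2 * pd [j, i] g y"
proof -
  have dg: "g differentiable at y" and dgi: "pd [i] g differentiable at y" for y
    using assms(1) by (auto simp: numeral_2_eq_2 simp del: pd.simps)
  let ?D = "\<lambda>s. pd [i] g (x + h *\<^sub>R axis j 1 + s *\<^sub>R axis i 1) - pd [i] g (x + s *\<^sub>R axis i 1)"
  have "((\<lambda>s. g (x + h *\<^sub>R axis j 1 + s *\<^sub>R axis i 1) - g (x + s *\<^sub>R axis i 1)) has_real_derivative ?D s) (at s)" for s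
    by (intro DERIV_diff axis_derivative dg)
  from MVT2[OF assms(2) this] obtain s where s: "0 < s" "s < h"
    and "g (x + h *\<^sub>R axis j 1 + h *\<^sub>R axis i 1) - g (x + h *\<^sub>R axis i 1) -
        (g (x + h *\<^sub>R axis j 1 + 0 *\<^sub>R axis i 1) - g (x + 0 *\<^sub>R axis i 1)) = (h - 0) * ?D s" by blast
  then have 1: "g (x + h *\<^sub>R axis i 1 + h *\<^sub>R axis j 1) - g (x + h *\<^sub>R axis i 1) - g (x + h *\<^sub>R axis j 1) + g x = h * ?D s"
    by (simp add: add_ac del: pd.simps)
  have "((\<lambda>u. pd [i] g (x + s *\<^sub>R axis i 1 + u *\<^sub>R axis j 1)) has_real_derivative
          pd [j] (pd [i] g) (x + s *\<^sub>R axis i 1 + u *\<^sub>R axis j 1)) (at u)" for u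
    by (intro axis_derivative dgi)
  from MVT2[OF assms(2) this] obtain u where u: "0 < u" "u < h"
    and 2: "pd [i] g (x + s *\<^sub>R axis i 1 + h *\<^sub>R axis j 1) - pd [i] g (x + s *\<^sub>R axis i 1 + 0 *\<^sub>R axis j 1) =
      (h - 0) * pd [j] (pd [i] g) (x + s *\<^sub>R axis i 1 + u *\<^sub>R axis j 1)" by blast
  let ?y = "x + s *\<^sub>R axis i 1 + u *\<^sub>R axis j 1"
  have "?D s = h * pd [j] (pd [i] g) ?y" using 2 by (simp add: add_ac del: pd.simps)
  then have "h * ?D s = h\<^sup>2 * pd [j, i] g ?y"
    by (simp only: pd_Cons[of j "[i]"] power2_eq_square mult.assoc)
  moreover have "norm (?y - x) \<le> 2 * h"
  proof -
    have "norm (?y - x) \<le> norm (s *\<^sub>R axis i (1::real)) + norm (u *\<^sub>R axis j (1::real))"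
      by (metis add.assoc add_diff_cancel_left' norm_triangle_ineq)
    then show ?thesis using s u by simp
  qed
  ultimately show ?thesis using 1 by metis
qed

text \<open>Schwarz's theorem. The second difference of \<open>g\<close> does not depend on the
  order of the two directions, so the intermediate points \<open>y n\<close> and \<open>z n\<close>
  give equal mixed derivatives at step size \<open>1 / Suc n\<close>; both points tend to
  \<open>x\<close>, where the mixed derivatives are continuous.\<close>

lemma pd_commute:
  fixes g :: "real^'d::finite \<Rightarrow> real"
  assumes g: "smoothp 2 g"
  shows "pd [i, j] g = pd [j, i] g"
proof
  fix x
  have cont: "isCont (pd [k, l] g) x" for k l
  proof -
    have "smoothp 0 (pd [k, l] g)" using smoothp_pd[OF g, of "[k, l]"] by (simp del: pd.simps)
    then show ?thesis by (simp add: poly_cont_def continuous_on_eq_continuous_at del: pd.simps)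
  qed
  let ?h = "\<lambda>n. 1 / real (Suc n)"
  have "\<forall>n. \<exists>y. norm (y - x) \<le> 2 * ?h n \<and>
     g (x + ?h n *\<^sub>R axis i 1 + ?h n *\<^sub>R axis j 1) - g (x + ?h n *\<^sub>R axis i 1) - g (x + ?h n *\<^sub>R axis j 1) + g x = (?h n)\<^sup>2 * pd [j, i] g y"
    by (intro allI second_difference_mvt[OF g]) simp
  then obtain y where y: "\<And>n. norm (y n - x) \<le> 2 * ?h n" and
    y': "\<And>n. g (x + ?h n *\<^sub>R axis i 1 + ?h n *\<^sub>R axis j 1) - g (x + ?h n *\<^sub>R axis i 1) - g (x + ?h n *\<^sub>R axis j 1) + g x = (?h n)\<^sup>2 * pd [j, i] g (y n)"
    by metis
  have "\<forall>n. \<exists>y. norm (y - x) \<le> 2 * ?h n \<and>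
     g (x + ?h n *\<^sub>R axis j 1 + ?h n *\<^sub>R axis i 1) - g (x + ?h n *\<^sub>R axis j 1) - g (x + ?h n *\<^sub>R axis i 1) + g x = (?h n)\<^sup>2 * pd [i, j] g y"
    by (intro allI second_difference_mvt[OF g]) simp
  then obtain z where z: "\<And>n. norm (z n - x) \<le> 2 * ?h n" and
    z': "\<And>n. g (x + ?h n *\<^sub>R axis j 1 + ?h n *\<^sub>R axis i 1) - g (x + ?h n *\<^sub>R axis j 1) - g (x + ?h n *\<^sub>R axis i 1) + g x = (?h n)\<^sup>2 * pd [i, j] g (z n)"
    by metis
  have lim: "w \<longlonglongrightarrow> x" if "\<And>n. norm (w n - x) \<le> 2 * ?h n" for w
  proof -
    have "(\<lambda>n. 2 * ?h n) \<longlonglongrightarrow> 2 * 0"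
      by (intro tendsto_mult tendsto_const) (use LIMSEQ_inverse_real_of_nat in \<open>simp add: inverse_eq_divide\<close>)
    then have "(\<lambda>n. 2 * ?h n) \<longlonglongrightarrow> 0" by simp
    then have "(\<lambda>n. w n - x) \<longlonglongrightarrow> 0"
      by (rule Lim_null_comparison[rotated]) (use that in \<open>intro always_eventually allI, simp\<close>)
    then show ?thesis by (simp add: LIM_zero_iff)
  qed
  have eq: "pd [j, i] g (y n) = pd [i, j] g (z n)" for n
  proof -
    have "g (x + ?h n *\<^sub>R axis j 1 + ?h n *\<^sub>R axis i 1) = g (x + ?h n *\<^sub>R axis i 1 + ?h n *\<^sub>R axis j 1)"
      by (simp only: add.assoc add.commute[of "?h n *\<^sub>R axis j 1"])
    then have "(?h n)\<^sup>2 * pd [j, i] g (y n) = (?h n)\<^sup>2 * pd [i, j] g (z n)"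
      using y'[of n] z'[of n] by linarith
    moreover have "(?h n)\<^sup>2 \<noteq> 0" by simp
    ultimately show ?thesis by (metis mult_cancel_left)
  qed
  have "(\<lambda>n. pd [j, i] g (y n)) \<longlonglongrightarrow> pd [j, i] g x"
    by (rule isCont_tendsto_compose[OF cont lim[OF y]])
  moreover have "(\<lambda>n. pd [j, i] g (y n)) \<longlonglongrightarrow> pd [i, j] g x"
    unfolding eq by (rule isCont_tendsto_compose[OF cont lim[OF z]])
  ultimately show "pd [i, j] g x = pd [j, i] g x" by (rule LIMSEQ_unique[symmetric])
qed

lemma pd_move:
  assumes "smoothp l g" "Suc (length xs + length ys) \<le> l"
  shows "pd (xs @ i # ys) g = pd (i # xs @ ys) g"
  using assms(2)
proof (induction xs)
  case (Cons x xs)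
  have "smoothp (l - length (xs @ ys)) (pd (xs @ ys) g)" using Cons.prems assms(1) by (intro smoothp_pd) auto
  then have 2: "smoothp 2 (pd (xs @ ys) g)" by (rule smoothp_mono) (use Cons.prems in auto)
  have "pd ((x # xs) @ i # ys) g = pd [x] (pd (xs @ i # ys) g)" by simp
  also have "\<dots> = pd [x] (pd (i # xs @ ys) g)" using Cons by (simp only: append_Cons length_Cons)
  also have "\<dots> = pd [x, i] (pd (xs @ ys) g)" by simp
  also have "\<dots> = pd [i, x] (pd (xs @ ys) g)" by (rule pd_commute[OF 2])
  finally show ?case by simp
qed simp

text \<open>The order of differentiation matters twice later: a new child is appended at the end of
  a list of children while \<open>pd\<close> differentiates at its head, and an isomorphism of trees
  permutes the children of a node.\<close>

lemma pd_mset: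
  assumes "smoothp l g" "length xs \<le> l" "mset xs = mset ys"
  shows "pd xs g = pd ys g"
  using assms(2,3)
proof (induction xs arbitrary: ys)
  case (Cons x xs)
  then have "x \<in> set ys" by (metis list.set_intros(1) mset_eq_setD)
  then obtain us vs where ys: "ys = us @ x # vs" by (meson split_list)
  have m: "mset xs = mset (us @ vs)" using Cons.prems ys by simp
  then have len: "length xs = length (us @ vs)" by (rule mset_eq_length)
  have "pd (x # xs) g = pd [x] (pd (us @ vs) g)" using Cons.IH[OF _ m] Cons.prems by (simp only: pd_Cons[of x xs] length_Cons)
  also have "\<dots> = pd (x # us @ vs) g" by simp
  also have "\<dots> = pd ys g" unfolding ys
    by (rule pd_move[OF assms(1), symmetric]) (use Cons.prems len in auto)
  finally show ?case .
qed simp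

text \<open>Maclaurin's formula with Lagrange remainder along the segment from \<open>z\<close> to
  \<open>z + y\<close>, parametrised by the unit interval; \<open>D\<close> lists the function on
  the segment and its first two derivatives.\<close>

lemma taylor_second_order:
  fixes g :: "real^'d::finite \<Rightarrow> real"
  assumes g: "smoothp 2 g"
  shows "\<exists>u. 0 < u \<and> u < 1 \<and> g (z + y) = g z + (\<Sum>i\<in>UNIV. y $ i * pd [i] g z) +
     (\<Sum>i\<in>UNIV. \<Sum>k\<in>UNIV. y $ i * y $ k * pd [k, i] g (z + u *\<^sub>R y)) / 2"
proof -
  have dg: "g differentiable at x" and dgi: "pd [i] g differentiable at x" for x i
    using g by (auto simp: numeral_2_eq_2 simp del: pd.simps)
  define D where "D m u = (if m = 0 then g (z + u *\<^sub>R y) else if m = 1 then \<Sum>i\<in>UNIV. y $ i * pd [i] g (z + u *\<^sub>R y)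
     else \<Sum>i\<in>UNIV. \<Sum>k\<in>UNIV. y $ i * y $ k * pd [k, i] g (z + u *\<^sub>R y))" for m :: nat and u
  have d0: "DERIV (D 0) u :> D 1 u" for u
    unfolding D_def using line_derivative[OF dg] by (simp del: pd.simps)
  have d1: "DERIV (D 1) u :> D 2 u" for u
  proof -
    have "((\<lambda>u. \<Sum>i\<in>UNIV. y $ i * pd [i] g (z + u *\<^sub>R y)) has_real_derivative
       (\<Sum>i\<in>UNIV. y $ i * (\<Sum>k\<in>UNIV. y $ k * pd [k] (pd [i] g) (z + u *\<^sub>R y)))) (at u)"
      by (intro DERIV_sum DERIV_cmult line_derivative dgi)
    then show ?thesis
      unfolding D_def by (simp add: sum_distrib_left mult.assoc pd_Cons[symmetric] del: pd.simps)
  qed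
  have "\<forall>m t. m < 2 \<and> 0 \<le> t \<and> t \<le> 1 \<longrightarrow> DERIV (D m) t :> D (Suc m) t"
    using d0 d1 by (metis One_nat_def Suc_1 less_2_cases)
  from Maclaurin[of 1 2 D "D 0", OF _ _ _ this] obtain u where u: "0 < u" "u < 1"
    "D 0 1 = (\<Sum>m<2. D m 0 / fact m * 1 ^ m) + D 2 u / fact 2 * 1\<^sup>2" by auto
  have "D 0 1 = D 0 0 + D 1 0 + D 2 u / 2" using u(3) by (simp add: numeral_2_eq_2)
  then have "g (z + y) = g z + (\<Sum>i\<in>UNIV. y $ i * pd [i] g z) +
     (\<Sum>i\<in>UNIV. \<Sum>k\<in>UNIV. y $ i * y $ k * pd [k, i] g (z + u *\<^sub>R y)) / 2"
    by (simp add: D_def del: pd.simps)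
  then show ?thesis using u by blast
qed

text \<open>Polynomial growth absorbs the lack of uniform continuity at infinity: beyond radius
  \<^term>\<open>2 * K / e\<close> one extra power of the weight beats the constant.\<close>
lemma poly_cont_modulus:
  fixes G :: "'v::euclidean_space \<Rightarrow> real"
  assumes "poly_cont G"
  obtains p where "\<And>e. 0 < e \<Longrightarrow> \<exists>C\<ge>0. \<forall>z y. \<bar>G (z + y) - G z\<bar> \<le> e * (1 + norm z + norm y) ^ p + C * norm y ^ 4"
proof -
  obtain K r where K: "0 \<le> K" and gr: "\<And>x. \<bar>G x\<bar> \<le> K * (1 + norm x) ^ r" using poly_contE[OF assms] by blast
  have gr2: "\<bar>G (z + y) - G z\<bar> \<le> 2 * K * (1 + norm z + norm y) ^ r" for z y
  proof -
    have "K * (1 + norm (z + y)) ^ r \<le> K * (1 + norm z + norm y) ^ r"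
      using norm_triangle_ineq[of z y] by (intro mult_left_mono power_mono K) auto
    moreover have "K * (1 + norm z) ^ r \<le> K * (1 + norm z + norm y) ^ r"
      by (intro mult_left_mono power_mono K) auto
    ultimately show ?thesis using gr[of z] gr[of "z + y"] by linarith
  qed
  have "\<exists>C\<ge>0. \<forall>z y. \<bar>G (z + y) - G z\<bar> \<le> e * (1 + norm z + norm y) ^ Suc r + C * norm y ^ 4" if e: "0 < e" for e
  proof -
    define R where "R = 2 * K / e"
    have R: "0 \<le> R" using K e by (simp add: R_def)
    have "uniformly_continuous_on (cball 0 (2 * R)) G"
      by (intro compact_uniformly_continuous continuous_on_subset[OF poly_cont_continuous[OF assms]]) auto
    then obtain d where d: "d > 0" and ud: "\<And>x x'. x \<in> cball 0 (2 * R) \<Longrightarrow> x' \<in> cball 0 (2 * R) \<Longrightarrow> dist x' x < d \<Longrightarrow> dist (G x') (G x) < e"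
      using e unfolding uniformly_continuous_on_def by metis
    \<comment> \<open>Inside the ball, increments with \<open>norm y \<ge> d\<close> are met by the
      crude bound \<open>2 * K * R ^ r\<close>, turned into a multiple of
      \<open>norm y ^ 4\<close>.\<close>
    define C where "C = 2 * K * R ^ r / d ^ 4"
    have C: "C \<ge> 0" using K R d by (simp add: C_def)
    have "\<bar>G (z + y) - G z\<bar> \<le> e * (1 + norm z + norm y) ^ Suc r + C * norm y ^ 4" for z y
    proof (cases "R \<le> 1 + norm z + norm y")
      case True
      have "2 * K * (1 + norm z + norm y) ^ r = e * R * (1 + norm z + norm y) ^ r" using e by (simp add: R_def)
      also have "\<dots> \<le> e * (1 + norm z + norm y) * (1 + norm z + norm y) ^ r"
        using True e by (intro mult_right_mono mult_left_mono) auto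
      finally have "2 * K * (1 + norm z + norm y) ^ r \<le> e * (1 + norm z + norm y) ^ Suc r" by simp
      then show ?thesis using gr2[of z y] C by (smt (verit) mult_nonneg_nonneg norm_ge_zero zero_le_power)
    next
      case False
      have one: "e \<le> e * (1 + norm z + norm y) ^ Suc r"
        using e one_le_power[of "1 + norm z + norm y" "Suc r"] by (simp add: mult_le_cancel_left1 del: power_Suc)
      show ?thesis
      proof (cases "norm y < d")
        case True
        have "norm (z + y) \<le> norm z + norm y" by (rule norm_triangle_ineq)
        then have "norm z \<le> 2 * R" "norm (z + y) \<le> 2 * R"
          using False R norm_ge_zero[of y] by linarith+
        then have "\<bar>G (z + y) - G z\<bar> < e"
          using ud[of z "z + y", unfolded mem_cball dist_0_norm] True by (simp add: dist_norm)
        then show ?thesis using one C by (smt (verit) mult_nonneg_nonneg norm_ge_zero zero_le_power)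
      next
        case y: False
        have "\<bar>G (z + y) - G z\<bar> \<le> 2 * K * (1 + norm z + norm y) ^ r" by (rule gr2)
        also have "\<dots> \<le> 2 * K * R ^ r" using False K by (intro mult_left_mono power_mono) auto
        also have "\<dots> = C * d ^ 4" using d by (simp add: C_def)
        also have "\<dots> \<le> C * norm y ^ 4" using y d C by (intro mult_left_mono power_mono) auto
        also have "\<dots> \<le> e * (1 + norm z + norm y) ^ Suc r + C * norm y ^ 4" using e by simp
        finally show ?thesis .
      qed
    qed
    then show ?thesis using C by blast
  qed
  then show thesis using that by blast
qed

text \<open>The Lagrange remainder evaluates the second derivatives off \<open>z\<close>, and
  \<open>poly_cont_modulus\<close> bounds the difference. For an increment \<open>y\<close> of the
  order of the square root of \<open>h\<close>, the first error term is of order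
  \<open>e * h\<close>, and the second, with its six powers of \<open>norm y\<close>, of order
  \<open>h ^ 3\<close>.\<close>

lemma taylor_second_order_bound:
  fixes g :: "real^'d::finite \<Rightarrow> real"
  assumes g: "smoothp 2 g"
  obtains p where "\<And>e. 0 < e \<Longrightarrow> \<exists>C\<ge>0. \<forall>z y. \<bar>g (z + y) - g z - (\<Sum>i\<in>UNIV. y $ i * pd [i] g z) -
     (\<Sum>i\<in>UNIV. \<Sum>k\<in>UNIV. y $ i * y $ k * pd [k, i] g z) / 2\<bar> \<le> (norm y)\<^sup>2 * (e * (1 + norm z + norm y) ^ p + C * norm y ^ 4)"
proof -
  let ?N = "(real CARD('d))\<^sup>2"
  have pc: "poly_cont (pd [k, i] g)" for k i
    using smoothp_pd[OF g, of "[k, i]"] by (simp del: pd.simps)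
  have "\<forall>i k. \<exists>p. \<forall>e>0. \<exists>C\<ge>0. \<forall>z y. \<bar>pd [k, i] g (z + y) - pd [k, i] g z\<bar> \<le> e * (1 + norm z + norm y) ^ p + C * norm y ^ 4"
    using poly_cont_modulus[OF pc] by metis
  then obtain p where p: "\<And>i k e. e > 0 \<Longrightarrow> \<exists>C\<ge>0. \<forall>z y. \<bar>pd [k, i] g (z + y) - pd [k, i] g z\<bar> \<le> e * (1 + norm z + norm y) ^ p i k + C * norm y ^ 4"
    by metis
  define P where "P = (\<Sum>i\<in>UNIV. \<Sum>k\<in>UNIV. p i k)"
  have pP: "p i k \<le> P" for i k
    unfolding P_def by (rule order_trans[OF member_le_sum[of k UNIV "p i"] member_le_sum[of i UNIV "\<lambda>i. \<Sum>k\<in>UNIV. p i k"]]) auto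
  have "\<exists>C\<ge>0. \<forall>z y. \<bar>g (z + y) - g z - (\<Sum>i\<in>UNIV. y $ i * pd [i] g z) -
     (\<Sum>i\<in>UNIV. \<Sum>k\<in>UNIV. y $ i * y $ k * pd [k, i] g z) / 2\<bar> \<le> (norm y)\<^sup>2 * (e * (1 + norm z + norm y) ^ P + C * norm y ^ 4)"
    if e: "0 < e" for e
  proof -
    define e' where "e' = e / ?N"
    have e': "e' > 0" using e by (simp add: e'_def)
    have "\<forall>i k. \<exists>C\<ge>0. \<forall>z y. \<bar>pd [k, i] g (z + y) - pd [k, i] g z\<bar> \<le> e' * (1 + norm z + norm y) ^ p i k + C * norm y ^ 4"
      using p[OF e'] by blast
    then obtain C where C: "\<And>i k. C i k \<ge> 0" and est:
      "\<And>i k z y. \<bar>pd [k, i] g (z + y) - pd [k, i] g z\<bar> \<le> e' * (1 + norm z + norm y) ^ p i k + C i k * norm y ^ 4"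
      by metis
    define D where "D = (\<Sum>i\<in>UNIV. \<Sum>k\<in>UNIV. C i k)"
    have CD: "C i k \<le> D" for i k
      unfolding D_def by (rule order_trans[OF member_le_sum[of k UNIV "C i"] member_le_sum[of i UNIV "\<lambda>i. \<Sum>k\<in>UNIV. C i k"]])
         (auto intro: C sum_nonneg)
    have D: "D \<ge> 0" by (auto simp: D_def intro!: sum_nonneg C)
    have "\<bar>g (z + y) - g z - (\<Sum>i\<in>UNIV. y $ i * pd [i] g z) -
     (\<Sum>i\<in>UNIV. \<Sum>k\<in>UNIV. y $ i * y $ k * pd [k, i] g z) / 2\<bar> \<le> (norm y)\<^sup>2 * (e * (1 + norm z + norm y) ^ P + (?N * D) * norm y ^ 4)" for z y
    proof -
      obtain u where u: "0 < u" "u < 1" and eq: "g (z + y) = g z + (\<Sum>i\<in>UNIV. y $ i * pd [i] g z) +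
        (\<Sum>i\<in>UNIV. \<Sum>k\<in>UNIV. y $ i * y $ k * pd [k, i] g (z + u *\<^sub>R y)) / 2"
        using taylor_second_order[OF g] by blast
      have nu: "norm (u *\<^sub>R y) \<le> norm y" using u mult_right_mono[of u 1 "norm y"] by simp
      let ?B = "e' * (1 + norm z + norm y) ^ P + D * norm y ^ 4"
      have B: "\<bar>pd [k, i] g (z + u *\<^sub>R y) - pd [k, i] g z\<bar> \<le> ?B" for k i
      proof -
        have "e' * (1 + norm z + norm (u *\<^sub>R y)) ^ p i k \<le> e' * (1 + norm z + norm y) ^ p i k"
          using nu e' by (intro mult_left_mono power_mono) auto
        also have "\<dots> \<le> e' * (1 + norm z + norm y) ^ P"
          using e' pP by (intro mult_left_mono power_increasing) auto
        finally have 1: "e' * (1 + norm z + norm (u *\<^sub>R y)) ^ p i k \<le> e' * (1 + norm z + norm y) ^ P" .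
        have 2: "C i k * norm (u *\<^sub>R y) ^ 4 \<le> D * norm y ^ 4"
          using nu CD C D by (intro mult_mono power_mono) auto
        show ?thesis using est[of k i z "u *\<^sub>R y"] 1 2 by linarith
      qed
  have halve: "\<bar>a + b + c / 2 - a - b - d / 2\<bar> = \<bar>c - d\<bar> / 2" for a b c d :: real
        by (auto simp: abs_if field_simps)
      have Bn: "0 \<le> ?B" using e' D by simp
      have "\<bar>g (z + y) - g z - (\<Sum>i\<in>UNIV. y $ i * pd [i] g z) - (\<Sum>i\<in>UNIV. \<Sum>k\<in>UNIV. y $ i * y $ k * pd [k, i] g z) / 2\<bar>
        = \<bar>\<Sum>i\<in>UNIV. \<Sum>k\<in>UNIV. y $ i * y $ k * (pd [k, i] g (z + u *\<^sub>R y) - pd [k, i] g z)\<bar> / 2"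
        unfolding eq right_diff_distrib sum_subtractf by (rule halve)
      also have "\<dots> \<le> (\<Sum>i\<in>UNIV. \<Sum>k\<in>UNIV. \<bar>y $ i * y $ k * (pd [k, i] g (z + u *\<^sub>R y) - pd [k, i] g z)\<bar>) / 2"
        by (intro divide_right_mono order_trans[OF sum_abs] sum_mono) (auto simp del: pd.simps)
      also have "\<dots> \<le> (\<Sum>i\<in>(UNIV::'d set). \<Sum>k\<in>(UNIV::'d set). (norm y)\<^sup>2 * ?B) / 2"
      proof (intro divide_right_mono sum_mono)
        fix i k :: 'd
        have "\<bar>y $ i\<bar> * \<bar>y $ k\<bar> * \<bar>pd [k, i] g (z + u *\<^sub>R y) - pd [k, i] g z\<bar> \<le> (norm y * norm y) * ?B"
          by (intro mult_mono B component_le_norm_cart) auto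
        then show "\<bar>y $ i * y $ k * (pd [k, i] g (z + u *\<^sub>R y) - pd [k, i] g z)\<bar> \<le> (norm y)\<^sup>2 * ?B"
          by (simp only: abs_mult power2_eq_square)
      qed simp
      also have "\<dots> \<le> ?N * ((norm y)\<^sup>2 * ?B)"
      proof -
        have nn: "0 \<le> (norm y)\<^sup>2 * ?B" using Bn by (intro mult_nonneg_nonneg) auto
        have aux: "(\<Sum>i\<in>(UNIV::'d set). \<Sum>k\<in>(UNIV::'d set). c) / 2 \<le> ?N * c" if "0 \<le> c" for c :: real
          using that by (simp add: power2_eq_square)
        show ?thesis by (rule aux[OF nn])
      qed
      also have "\<dots> = (norm y)\<^sup>2 * (e * (1 + norm z + norm y) ^ P + (?N * D) * norm y ^ 4)"
        by (simp add: e'_def field_simps)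
      finally show ?thesis .
    qed
    then show ?thesis using D by (intro exI[of _ "?N * D"]) (auto simp del: pd.simps)
  qed
  then show thesis using that by blast
qed

subsection \<open>Trees and elementary differentials\<close>

lemma nsig_append: "nsig (tr @ tr') = nsig tr + nsig tr'"
  by (simp add: nsig_def)

lemma lts_even_nsig: "tr \<in> lts \<Longrightarrow> even (nsig tr)"
  by (induction rule: lts.induct) (auto simp: nsig_append nsig_def)

lemma rho_append_tau: "rho (tr @ [(p, Tau)]) = Suc (rho tr)"
  by (simp add: rho_def nsig_def ntau_def)

lemma nsig_append_tau: "nsig (tr @ [(p, Tau)]) = nsig tr"
  by (simp add: nsig_def)

lemma nsig_append_sig: "nsig (tr @ [(p, Sig k), (q, Sig k)]) = nsig tr + 2"
  by (simp add: nsig_def)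

lemma rho_append_sig: "rho (tr @ [(p, Sig k), (q, Sig k)]) = Suc (rho tr)"
  by (simp add: rho_def nsig_def ntau_def)

lemma lts_length: "tr \<in> lts \<Longrightarrow> length tr = 1 + ntau tr + nsig tr"
  by (induction rule: lts.induct) (auto simp: nsig_def ntau_def)

text \<open>A deterministic node adds one node per unit of \<open>rho\<close>, a stochastic pair
  adds two. A node of a tree with \<open>rho tr = k\<close> thus has at most \<open>2 * k\<close>
  children, which is why derivatives up to order \<open>2 * k\<close> suffice.\<close>

lemma lts_length_le: "tr \<in> lts \<Longrightarrow> length tr \<le> 1 + 2 * rho tr"
  using lts_length[of tr] lts_even_nsig[of tr] by (simp add: rho_def)

lemma lts_length_pos: "tr \<in> lts \<Longrightarrow> 0 < length tr"
  using lts_length[of tr] by simp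

lemma lts_root: "tr \<in> lts \<Longrightarrow> tr ! 0 = (0, Gam)"
proof (induction rule: lts.induct)
  case (tau tr p)
  then show ?case using lts_length_pos[of tr] by (simp add: nth_append)
next
  case (sig tr p q)
  then show ?case using lts_length_pos[of tr] by (simp add: nth_append)
qed simp

lemma lts_father_less: "tr \<in> lts \<Longrightarrow> 0 < i \<Longrightarrow> i < length tr \<Longrightarrow> fst (tr ! i) < i"
  by (induction arbitrary: i rule: lts.induct) (auto simp: nth_append nth_Cons' less_Suc_eq split: if_splits)

lemma lts_Sig_less: "tr \<in> lts \<Longrightarrow> i < length tr \<Longrightarrow> snd (tr ! i) = Sig k \<Longrightarrow> k < nsig tr div 2"
proof (induction arbitrary: i rule: lts.induct)
  case (tau tr p)
  then show ?case by (auto simp: nth_append nth_Cons' nsig_append_tau split: if_splits)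
next
  case (sig tr p q)
  have *: "nsig (tr @ [(p, Sig (nsig tr div 2)), (q, Sig (nsig tr div 2))]) div 2 = Suc (nsig tr div 2)"
    unfolding nsig_append_sig by simp
  consider "i < length tr" | "i = length tr" | "i = Suc (length tr)" using sig.prems(1) by fastforce
  then show ?case
    unfolding * using sig.IH[of i] sig.prems(2) by cases (auto simp: nth_append)
qed simp

lemma lts_not_Gam: "tr \<in> lts \<Longrightarrow> i < length tr \<Longrightarrow> 0 < i \<Longrightarrow> snd (tr ! i) \<noteq> Gam"
  by (induction arbitrary: i rule: lts.induct) (auto simp: nth_append nth_Cons' less_Suc_eq split: if_splits)

lemma lts_level_0: "{tr \<in> lts. rho tr = 0} = {[(0, Gam)]}"
proof -
  have "rho tr = 0 \<Longrightarrow> tr = [(0, Gam)]" if "tr \<in> lts" for tr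
    using that by (cases rule: lts.cases) (auto simp: rho_append_tau rho_append_sig)
  moreover have "rho [(0, Gam)] = 0" by (simp add: rho_def ntau_def nsig_def)
  ultimately show ?thesis using lts.root by blast
qed

text \<open>The arguments are tupled so that a level of \<open>lts\<close> becomes a union of images
  of \<open>Sigma\<close> sets and sums over it can be reindexed.\<close>

definition add_tau :: "tree \<times> nat \<Rightarrow> tree" where
  "add_tau = (\<lambda>(tr, p). tr @ [(p, Tau)])"

definition add_sig :: "tree \<times> nat \<times> nat \<Rightarrow> tree" where
  "add_sig = (\<lambda>(tr, p, q). tr @ [(p, Sig (nsig tr div 2)), (q, Sig (nsig tr div 2))])"

lemma lts_level_Suc:
  "{tr \<in> lts. rho tr = Suc k} =
     add_tau ` (SIGMA tr:{tr \<in> lts. rho tr = k}. {..<length tr}) \<union>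
     add_sig ` (SIGMA tr:{tr \<in> lts. rho tr = k}. {..<length tr} \<times> {..<length tr})"
  (is "?L = ?T \<union> ?S")
proof
  show "?L \<subseteq> ?T \<union> ?S"
  proof
    fix tr assume "tr \<in> ?L"
    then have "tr \<in> lts" "rho tr = Suc k" by auto
    then show "tr \<in> ?T \<union> ?S"
    proof (cases rule: lts.cases)
      case root
      then have "rho tr = 0" by (simp add: rho_def ntau_def nsig_def)
      then show ?thesis using \<open>rho tr = Suc k\<close> by simp
    next
      case (tau tr' p)
      then have "tr = add_tau (tr', p)" "(tr', p) \<in> (SIGMA tr:{tr \<in> lts. rho tr = k}. {..<length tr})"
        using \<open>rho tr = Suc k\<close> by (auto simp: add_tau_def rho_append_tau)
      then show ?thesis by blast
    next
      case (sig tr' p q)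
      then have "tr = add_sig (tr', p, q)" "(tr', p, q) \<in> (SIGMA tr:{tr \<in> lts. rho tr = k}. {..<length tr} \<times> {..<length tr})"
        using \<open>rho tr = Suc k\<close> by (auto simp: add_sig_def rho_append_sig)
      then show ?thesis by blast
    qed
  qed
  show "?T \<union> ?S \<subseteq> ?L"
    by (auto simp: add_tau_def add_sig_def rho_append_tau rho_append_sig intro: lts.intros)
qed

lemma finite_lts_level: "finite {tr \<in> lts. rho tr = k}"
proof (induction k)
  case (Suc k)
  then show ?case unfolding lts_level_Suc by (intro finite_UnI finite_imageI finite_SigmaI) auto
qed (simp add: lts_level_0)

lemma finite_lts_le: "finite {tr \<in> lts. rho tr \<le> k}"
proof -
  have "{tr \<in> lts. rho tr \<le> k} = (\<Union>j\<le>k. {tr \<in> lts. rho tr = j})" by auto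
  then show ?thesis by (simp add: finite_lts_level)
qed

text \<open>A tree in \<open>lts\<close> records its own history: the colour of the last node tells
  which rule was applied, and each rule is injective. Hence every tree of the next level arises
  exactly once.\<close>

lemma sum_lts_level_Suc:
  fixes V :: "tree \<Rightarrow> real"
  shows "(\<Sum>tr\<in>{tr \<in> lts. rho tr = Suc k}. V tr) =
    (\<Sum>tr\<in>{tr \<in> lts. rho tr = k}. (\<Sum>p<length tr. V (add_tau (tr, p))) +
       (\<Sum>p<length tr. \<Sum>q<length tr. V (add_sig (tr, p, q))))"
proof -
  let ?A = "SIGMA tr:{tr \<in> lts. rho tr = k}. {..<length tr}"
  let ?B = "SIGMA tr:{tr \<in> lts. rho tr = k}. {..<length tr} \<times> {..<length tr}"
  have fin: "finite ?A" "finite ?B" by (auto intro!: finite_SigmaI finite_lts_level)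
  have "last (add_tau y) \<noteq> last (add_sig z)" for y z
    by (cases y; cases z) (auto simp: add_tau_def add_sig_def)
  then have disj: "add_tau ` ?A \<inter> add_sig ` ?B = {}" by (metis (no_types, lifting) disjoint_iff imageE)
  have injA: "inj_on add_tau ?A" by (auto simp: inj_on_def add_tau_def)
  have injB: "inj_on add_sig ?B" by (auto simp: inj_on_def add_sig_def)
  have "(\<Sum>tr\<in>{tr \<in> lts. rho tr = Suc k}. V tr) = (\<Sum>y\<in>?A. V (add_tau y)) + (\<Sum>y\<in>?B. V (add_sig y))"
    unfolding lts_level_Suc using fin disj
    by (subst sum.union_disjoint) (auto simp: sum.reindex[OF injA] sum.reindex[OF injB])
  also have "(\<Sum>y\<in>?A. V (add_tau y)) = (\<Sum>tr\<in>{tr \<in> lts. rho tr = k}. \<Sum>p<length tr. V (add_tau (tr, p)))"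
    by (subst sum.Sigma) (auto simp: finite_lts_level)
  also have "(\<Sum>y\<in>?B. V (add_sig y)) = (\<Sum>tr\<in>{tr \<in> lts. rho tr = k}. \<Sum>pq\<in>{..<length tr} \<times> {..<length tr}. V (add_sig (tr, pq)))"
    by (subst sum.Sigma) (auto simp: finite_lts_level)
  also have "\<dots> = (\<Sum>tr\<in>{tr \<in> lts. rho tr = k}. \<Sum>p<length tr. \<Sum>q<length tr. V (add_sig (tr, p, q)))"
    by (intro sum.cong refl) (simp add: sum.cartesian_product)
  finally show ?thesis by (simp add: sum.distrib)
qed

section \<open>Elementary differentials as flat sums over index assignments\<close>

lemma children_set: "set (children tr i) = {c. 0 < c \<and> c < length tr \<and> fst (tr ! c) = i}"
  by (auto simp: children_def)

lemma children_distinct: "distinct (children tr i)"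
  by (simp add: children_def)

lemma children_length: "length (children tr i) \<le> length tr - 1"
proof -
  have "length (children tr i) = card (set (children tr i))" by (simp add: children_distinct distinct_card)
  also have "\<dots> \<le> card {1..<length tr}" by (intro card_mono) (auto simp: children_set)
  finally show ?thesis by simp
qed

lemma children_snoc:
  assumes "tr \<noteq> []"
  shows "children (tr @ [(p, c)]) i = (if i = p then children tr i @ [length tr] else children tr i)"
proof -
  have "filter (\<lambda>c'. 0 < c' \<and> fst ((tr @ [(p, c)]) ! c') = i) [0..<length tr] = children tr i"
    unfolding children_def by (intro filter_cong refl) (auto simp: nth_append)
  then show ?thesis using assms by (simp add: children_def[of "tr @ [(p, c)]"])
qed

lemma sum_PiE_Un:
  fixes F :: "('i \<Rightarrow> 'c::finite) \<Rightarrow> real"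
  assumes "finite A" "finite B" "A \<inter> B = {}"
  shows "(\<Sum>J\<in>PiE (A \<union> B) (\<lambda>_. UNIV). F J) =
    (\<Sum>J\<in>PiE A (\<lambda>_. UNIV). \<Sum>K\<in>PiE B (\<lambda>_. UNIV). F (\<lambda>c. if c \<in> A then J c else K c))"
  unfolding sum.cartesian_product
  by (rule sum.reindex_bij_witness[of _ "\<lambda>(J, K) c. if c \<in> A then J c else K c" "\<lambda>J. (restrict J A, restrict J B)"])
     (use assms in \<open>auto simp: PiE_def extensional_def restrict_def fun_eq_iff intro!: arg_cong[of _ _ F]\<close>)

lemma sum_PiE_insert:
  fixes F :: "('i \<Rightarrow> 'c::finite) \<Rightarrow> real"
  assumes "finite A" "k \<notin> A"
  shows "(\<Sum>J\<in>PiE (insert k A) (\<lambda>_. UNIV). F J) = (\<Sum>J\<in>PiE A (\<lambda>_. UNIV). \<Sum>I\<in>UNIV. F (J(k := I)))"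
proof -
  have "(\<Sum>K\<in>PiE {k} (\<lambda>_. UNIV). F (\<lambda>c. if c \<in> A then J c else K c)) = (\<Sum>I\<in>UNIV. F (J(k := I)))"
    if "J \<in> PiE A (\<lambda>_. UNIV)" for J
    by (rule sum.reindex_bij_witness[of _ "\<lambda>I. (\<lambda>c. if c = k then I else undefined)" "\<lambda>K. K k"])
       (use assms that in \<open>auto simp: PiE_def extensional_def fun_eq_iff intro!: arg_cong[of _ _ F]\<close>)
  then show ?thesis using sum_PiE_Un[of A "{k}" F] assms by simp
qed

text \<open>An elementary differential written as one sum over assignments of component indices to all
  nodes; \<^term>\<open>h i I\<close> is the \<^term>\<open>I\<close>-th component of the function attached to node \<^term>\<open>i\<close>.\<close>
definition flat :: "(nat \<Rightarrow> 'd \<Rightarrow> real^'d::finite \<Rightarrow> real) \<Rightarrow> tree \<Rightarrow> real^'d \<Rightarrow> real" where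
  "flat h tr x = (\<Sum>J\<in>PiE {1..<length tr} (\<lambda>_. UNIV).
     \<Prod>i<length tr. pd (map J (children tr i)) (h i (J i)) x)"

text \<open>The root carries the scalar \<open>f\<close> whatever the index \<open>I\<close> is, so
  that the product in \<open>flat\<close> can treat all nodes alike.\<close>

definition node_fun :: "(real^'d::finite \<Rightarrow> real) \<Rightarrow> (real^'d \<Rightarrow> real^'d) \<Rightarrow> (real^'d \<Rightarrow> real^'m^'d)
    \<Rightarrow> tree \<Rightarrow> (nat \<Rightarrow> 'm) \<Rightarrow> nat \<Rightarrow> 'd \<Rightarrow> real^'d \<Rightarrow> real" where
  "node_fun f a b tr js i I = (if snd (tr ! i) = Gam then f else gcomp a b js (snd (tr ! i)) I)"

text \<open>Passes from the positional index lists of \<open>elem_diff\<close> and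
  \<open>edv\<close> to assignments indexed by the child nodes themselves. Distinctness makes the
  position of a child unique, so that \<open>THE\<close> recovers it.\<close>

lemma sum_lists_PiE:
  fixes F :: "'d::finite list \<Rightarrow> real"
  assumes "distinct cs"
  shows "(\<Sum>Js\<in>{Js. length Js = length cs}. F Js) = (\<Sum>K\<in>PiE (set cs) (\<lambda>_. UNIV). F (map K cs))"
proof (rule sum.reindex_bij_witness[of _ "\<lambda>K. map K cs" "\<lambda>Js c. if c \<in> set cs then Js ! (THE r. r < length cs \<and> cs ! r = c) else undefined"])
  have the: "(THE r. r < length cs \<and> cs ! r = cs ! k) = k" if "k < length cs" for k
    using assms that by (intro the_equality) (auto simp: nth_eq_iff_index_eq)
  fix Js :: "'d list" assume Js: "Js \<in> {Js. length Js = length cs}"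
  show "map (\<lambda>c. if c \<in> set cs then Js ! (THE r. r < length cs \<and> cs ! r = c) else undefined) cs = Js"
    using Js the by (intro nth_equalityI) auto
  then show "F (map (\<lambda>c. if c \<in> set cs then Js ! (THE r. r < length cs \<and> cs ! r = c) else undefined) cs) = F Js"
    by simp
  show "(\<lambda>c. if c \<in> set cs then Js ! (THE r. r < length cs \<and> cs ! r = c) else undefined) \<in> PiE (set cs) (\<lambda>_. UNIV)"
    by (auto simp: PiE_def extensional_def)
next
  have the: "(THE r. r < length cs \<and> cs ! r = cs ! k) = k" if "k < length cs" for k
    using assms that by (intro the_equality) (auto simp: nth_eq_iff_index_eq)
  fix K :: "_ \<Rightarrow> 'd" assume K: "K \<in> PiE (set cs) (\<lambda>_. UNIV)"
  show "(\<lambda>c. if c \<in> set cs then map K cs ! (THE r. r < length cs \<and> cs ! r = c) else undefined) = K"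
    using K the by (auto simp: PiE_def extensional_def fun_eq_iff in_set_conv_nth)
qed auto

lemma prod_nth_distinct:
  assumes "distinct cs"
  shows "(\<Prod>r<length cs. F (cs ! r)) = (\<Prod>c\<in>set cs. F c)"
  using prod.reindex_bij_betw[OF bij_betw_nth[OF assms refl refl]] by simp

text \<open>Children carry larger labels than their father, so at most \<open>length tr - i\<close>
  generations start at node \<open>i\<close>, and fuel beyond that number does not change the
  value.\<close>

lemma edv_fuel:
  fixes a :: "real^'d::finite \<Rightarrow> real^'d"
  assumes "tr \<in> lts"
  shows "i < length tr \<Longrightarrow> length tr - i \<le> k \<Longrightarrow> length tr - i \<le> k' \<Longrightarrow>
    edv k a b tr js i x = edv k' a b tr js i x"
proof (induction k arbitrary: k' i)
  case (Suc k)
  then obtain l where l: "k' = Suc l" by (cases k') auto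
  have "edv k a b tr js (children tr i ! r) x = edv l a b tr js (children tr i ! r) x"
    if "r < length (children tr i)" for r
  proof (rule Suc.IH)
    have "children tr i ! r \<in> set (children tr i)" using that by simp
    then have c: "0 < children tr i ! r" "children tr i ! r < length tr" "fst (tr ! (children tr i ! r)) = i"
      by (auto simp: children_set)
    then have "i < children tr i ! r" using lts_father_less[OF assms c(1,2)] by simp
    then show "children tr i ! r < length tr" "length tr - children tr i ! r \<le> k" "length tr - children tr i ! r \<le> l"
      using c Suc.prems l by auto
  qed
  then have "(\<Prod>r<length (children tr i). edv k a b tr js (children tr i ! r) x $ (Js ! r)) =
      (\<Prod>r<length (children tr i). edv l a b tr js (children tr i ! r) x $ (Js ! r))" for Js
    by (intro prod.cong refl arg_cong[of _ _ "\<lambda>v. v $ _"]) (simp only: lessThan_iff)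
  then show ?case by (simp only: l edv.simps)
qed simp

text \<open>One extra unit of fuel changes nothing, so the recursion holds with the same fuel on
  both sides.\<close>

lemma edv_unfold:
  fixes a :: "real^'d::finite \<Rightarrow> real^'d"
  assumes "tr \<in> lts" "i < length tr"
  shows "edv (length tr) a b tr js i x $ I =
    (\<Sum>K\<in>PiE (set (children tr i)) (\<lambda>_. UNIV). pd (map K (children tr i)) (gcomp a b js (snd (tr ! i)) I) x *
      (\<Prod>c\<in>set (children tr i). edv (length tr) a b tr js c x $ K c))"
proof -
  have "edv (length tr) a b tr js i x = edv (Suc (length tr)) a b tr js i x"
    using assms by (intro edv_fuel) auto
  then have "edv (length tr) a b tr js i x $ I =
    (\<Sum>Js\<in>{Js::'d list. length Js = length (children tr i)}.
        pd Js (gcomp a b js (snd (tr ! i)) I) x *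
        (\<Prod>r<length (children tr i). edv (length tr) a b tr js (children tr i ! r) x $ (Js ! r)))" by simp
  also have "\<dots> = (\<Sum>K\<in>PiE (set (children tr i)) (\<lambda>_. UNIV). pd (map K (children tr i)) (gcomp a b js (snd (tr ! i)) I) x *
      (\<Prod>c\<in>set (children tr i). edv (length tr) a b tr js c x $ K c))"
    unfolding sum_lists_PiE[OF children_distinct]
    by (intro sum.cong refl arg_cong2[of _ _ _ _ "(*)"])
       (simp add: prod_nth_distinct[OF children_distinct, of "\<lambda>c. edv (length tr) a b tr js c x $ _ c", symmetric])
  finally show ?thesis .
qed

text \<open>The nodes are expanded in increasing order; after step \<^term>\<open>k\<close> the remaining recursive
  factors belong to the nodes \<^term>\<open>c \<ge> k\<close> whose father is smaller than \<^term>\<open>k\<close>.\<close>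
lemma elem_diff_flat:
  fixes a :: "real^'d::finite \<Rightarrow> real^'d"
  assumes tr: "tr \<in> lts"
  shows "elem_diff f a b tr js x = flat (node_fun f a b tr js) tr x"
proof -
  define N where "N = length tr"
  define E where "E c = edv N a b tr js c x" for c
  define T where "T i J = pd (map J (children tr i)) (node_fun f a b tr js i (J i)) x" for i J
  \<comment> \<open>The non-root nodes whose component index has been introduced, that is, whose
    father has been expanded.\<close>
  define V where "V k = {c. 0 < c \<and> c < N \<and> fst (tr ! c) < k}" for k
  have N: "0 < N" using lts_length_pos[OF tr] by (simp add: N_def)
  have finV: "finite (V k)" for k by (auto simp: V_def)
  have "elem_diff f a b tr js x = (\<Sum>J\<in>PiE (V (Suc k)) (\<lambda>_. UNIV). (\<Prod>i<Suc k. T i J) * (\<Prod>c\<in>{c \<in> V (Suc k). Suc k \<le> c}. E c $ J c))"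
    if "Suc k \<le> N" for k
    using that
  proof (induction k)
    case 0
    have V1: "V (Suc 0) = set (children tr 0)" "{c \<in> V (Suc 0). Suc 0 \<le> c} = set (children tr 0)"
      by (auto simp: V_def children_set N_def)
    have "elem_diff f a b tr js x = (\<Sum>K\<in>PiE (set (children tr 0)) (\<lambda>_. UNIV). pd (map K (children tr 0)) f x *
      (\<Prod>c\<in>set (children tr 0). E c $ K c))"
      unfolding elem_diff_def sum_lists_PiE[OF children_distinct]
      by (intro sum.cong refl arg_cong2[of _ _ _ _ "(*)"])
         (simp add: E_def N_def prod_nth_distinct[OF children_distinct, of "\<lambda>c. edv (length tr) a b tr js c x $ _ c", symmetric])
    then show ?case unfolding V1(2) unfolding V1(1) by (simp add: T_def node_fun_def lts_root[OF tr])
  next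
    case (Suc k)
    let ?k = "Suc k"
    let ?C = "set (children tr ?k)"
    have kN: "?k < N" using Suc.prems by simp
    have kV: "?k \<in> V ?k" using lts_father_less[OF tr, of ?k] kN by (simp add: V_def N_def)
    have VS: "V (Suc ?k) = V ?k \<union> ?C" by (auto simp: V_def children_set N_def)
    have disj: "V ?k \<inter> ?C = {}" by (auto simp: V_def children_set N_def)
    have Cgt: "c \<in> ?C \<Longrightarrow> Suc ?k \<le> c" for c using lts_father_less[OF tr, of c] by (auto simp: children_set)
    have fr: "{c \<in> V ?k. ?k \<le> c} = insert ?k {c \<in> V ?k. Suc ?k \<le> c}" using kV by auto
    have fr': "{c \<in> V (Suc ?k). Suc ?k \<le> c} = {c \<in> V ?k. Suc ?k \<le> c} \<union> ?C" using Cgt unfolding VS by auto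
    define G where "G J = (\<Prod>i<Suc ?k. T i J) * (\<Prod>c\<in>{c \<in> V (Suc ?k). Suc ?k \<le> c}. E c $ J c)" for J
    have "elem_diff f a b tr js x = (\<Sum>J\<in>PiE (V (Suc ?k)) (\<lambda>_. UNIV). G J)"
    proof -
      have Ek: "E ?k $ I = (\<Sum>K\<in>PiE ?C (\<lambda>_. UNIV). pd (map K (children tr ?k)) (gcomp a b js (snd (tr ! ?k)) I) x * (\<Prod>c\<in>?C. E c $ K c))" for I
        unfolding E_def N_def using edv_unfold[OF tr] kN by (simp add: N_def del: edv.simps)
      have "elem_diff f a b tr js x = (\<Sum>J\<in>PiE (V ?k) (\<lambda>_. UNIV). (\<Prod>i<?k. T i J) * (\<Prod>c\<in>{c \<in> V ?k. ?k \<le> c}. E c $ J c))"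
        using Suc by simp
      also have "\<dots> = (\<Sum>J\<in>PiE (V ?k) (\<lambda>_. UNIV). \<Sum>K\<in>PiE ?C (\<lambda>_. UNIV).
          (\<Prod>i<?k. T i J) * (pd (map K (children tr ?k)) (gcomp a b js (snd (tr ! ?k)) (J ?k)) x * (\<Prod>c\<in>?C. E c $ K c)) * (\<Prod>c\<in>{c \<in> V ?k. Suc ?k \<le> c}. E c $ J c))"
        unfolding fr using finV by (simp add: Ek sum_distrib_left sum_distrib_right mult_ac)
      also have "\<dots> = (\<Sum>J\<in>PiE (V ?k) (\<lambda>_. UNIV). \<Sum>K\<in>PiE ?C (\<lambda>_. UNIV).
          G (\<lambda>c. if c \<in> V ?k then J c else K c))"
      proof (intro sum.cong refl)
        fix J K :: "nat \<Rightarrow> 'd"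
        let ?J = "\<lambda>c. if c \<in> V ?k then J c else K c"
        have T1: "T i ?J = T i J" if "i < ?k" for i
        proof -
          have "map ?J (children tr i) = map J (children tr i)"
            using that by (auto simp: V_def children_set N_def)
          moreover have "node_fun f a b tr js i (?J i) = node_fun f a b tr js i (J i)"
          proof (cases "i = 0")
            case True
            then show ?thesis by (simp add: node_fun_def lts_root[OF tr])
          next
            case False
            then have "i \<in> V ?k" using that lts_father_less[OF tr, of i] kN by (auto simp: V_def N_def)
            then show ?thesis by simp
          qed
          ultimately show ?thesis unfolding T_def by (simp only:)
        qed
        have T2: "T ?k ?J = pd (map K (children tr ?k)) (gcomp a b js (snd (tr ! ?k)) (J ?k)) x"
        proof -
          have "map ?J (children tr ?k) = map K (children tr ?k)"
            using disj by auto
          moreover have "snd (tr ! ?k) \<noteq> Gam"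
            using kN tr by (auto simp: N_def dest: lts_not_Gam)
          ultimately show ?thesis using kV unfolding T_def node_fun_def by (simp only: if_True if_False)
        qed
        have P: "(\<Prod>c\<in>{c \<in> V (Suc ?k). Suc ?k \<le> c}. E c $ ?J c) = (\<Prod>c\<in>{c \<in> V ?k. Suc ?k \<le> c}. E c $ J c) * (\<Prod>c\<in>?C. E c $ K c)"
        proof -
          have "(\<Prod>c\<in>?C. E c $ ?J c) = (\<Prod>c\<in>?C. E c $ K c)" using disj by (intro prod.cong) auto
          then show ?thesis unfolding fr' using finV disj by (subst prod.union_disjoint) auto
        qed
        have Q: "(\<Prod>i<Suc ?k. T i ?J) = (\<Prod>i<?k. T i J) * pd (map K (children tr ?k)) (gcomp a b js (snd (tr ! ?k)) (J ?k)) x"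
        proof -
          have "(\<Prod>i<?k. T i ?J) = (\<Prod>i<?k. T i J)" by (intro prod.cong refl T1) simp
          then show ?thesis by (simp only: prod.lessThan_Suc[of _ ?k] T2)
        qed
        show "(\<Prod>i<?k. T i J) * (pd (map K (children tr ?k)) (gcomp a b js (snd (tr ! ?k)) (J ?k)) x * (\<Prod>c\<in>?C. E c $ K c)) * (\<Prod>c\<in>{c \<in> V ?k. Suc ?k \<le> c}. E c $ J c)
          = G ?J"
          unfolding G_def P Q by (simp only: mult_ac)
      qed
      also have "\<dots> = (\<Sum>J\<in>PiE (V (Suc ?k)) (\<lambda>_. UNIV). G J)"
        unfolding VS by (rule sum_PiE_Un[symmetric]) (use finV disj in auto)
      finally show ?thesis .
    qed
    then show ?case by (simp only: G_def)
  qed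
  from this[of "N - 1"] N have "elem_diff f a b tr js x = (\<Sum>J\<in>PiE (V N) (\<lambda>_. UNIV). (\<Prod>i<N. T i J) * (\<Prod>c\<in>{c \<in> V N. N \<le> c}. E c $ J c))" by simp
  moreover have e: "{c \<in> V N. N \<le> c} = {}" by (auto simp: V_def)
  moreover have "V N = {1..<N}" using less_trans[OF lts_father_less[OF tr]] by (auto simp: V_def N_def)
  ultimately have "elem_diff f a b tr js x = (\<Sum>J\<in>PiE {1..<N} (\<lambda>_. UNIV). \<Prod>i<N. T i J)"
    by (simp only: prod.empty mult_1_right)
  then show ?thesis by (simp only: flat_def T_def N_def)
qed

subsection \<open>Powers of the generator\<close>

lemma pd_cmult:
  fixes g :: "real^'d::finite \<Rightarrow> real"
  assumes "\<And>x. g differentiable (at x)"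
  shows "pd [i] (\<lambda>x. c * g x) = (\<lambda>x. c * pd [i] g x)"
  using pd_mult[of "\<lambda>x. c" g i] assms by (simp add: pd_const del: pd.simps)

lemma flat_cong:
  assumes "\<And>i I. i < length tr \<Longrightarrow> h i I = h' i I"
  shows "flat h tr = flat h' tr"
  unfolding flat_def by (intro ext sum.cong prod.cong refl) (simp add: assms)

lemma smoothp_pd_le:
  assumes "smoothp l g" "length is \<le> k" "k \<le> l"
  shows "smoothp (l - k) (pd is g)"
  using smoothp_mono[OF smoothp_pd[OF assms(1)]] assms(2,3) by simp

text \<open>A factor loses one derivative for each child of its node, and no node has more than
  \<open>length tr - 1\<close> children.\<close>

lemma smoothp_flat:
  assumes "\<And>i I. i < length tr \<Longrightarrow> smoothp l (h i I)" "length tr \<le> Suc l"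
  shows "smoothp (l - (length tr - 1)) (flat h tr)"
  unfolding flat_def
  by (intro smoothp_sum smoothp_prod smoothp_pd_le) (use assms children_length[of tr] in auto)

text \<open>The product rule in combinatorial form: differentiating the product over the nodes in
  direction \<open>I\<close> acts on one node \<open>p\<close> at a time and adds \<open>I\<close>
  to its indices, exactly as a new child of \<open>p\<close> with component \<open>I\<close> would.
  The new leaf itself has no children and contributes its function underived.\<close>

lemma flat_leaf:
  assumes wf: "\<And>i. 0 < i \<Longrightarrow> i < length tr \<Longrightarrow> fst (tr ! i) < length tr" and ne: "tr \<noteq> []"
    and sm: "\<And>i I. i < length tr \<Longrightarrow> smoothp l (h i I)" and l: "length tr \<le> l"
  shows "(\<Sum>p<length tr. flat h (tr @ [(p, c)]) x) = (\<Sum>I\<in>UNIV. h (length tr) I x * pd [I] (flat h tr) x)"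
proof -
  define N where "N = length tr"
  define T where "T i J = pd (map J (children tr i)) (h i (J i))" for i J
  have N: "0 < N" using ne by (simp add: N_def)
  have chl: "length (children tr i) < l" for i using children_length[of tr i] l N unfolding N_def by arith
  have lN: "0 < l - (N - 1)" using l N unfolding N_def by arith
  have chN: "children tr N = []"
  proof -
    have "c \<notin> set (children tr N)" for c using wf[of c] by (auto simp: children_set N_def)
    then show ?thesis by (cases "children tr N") auto
  qed
  have Tsm: "smoothp (l - (N - 1)) (T i J)" if "i \<in> {..<N}" for i J
    unfolding T_def
    by (rule smoothp_pd_le[OF sm]) (use that l N children_length[of tr i] in \<open>auto simp: N_def\<close>)
  have Tdiff: "T i J differentiable (at y)" if "i < N" for i J y
  proof -
    have "smoothp (l - length (children tr i)) (T i J)"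
      unfolding T_def by (rule smoothp_pd_le[OF sm]) (use that chl[of i] in \<open>auto simp: N_def\<close>)
    then show ?thesis by (rule smoothp_differentiable) (use chl[of i] in auto)
  qed
  \<comment> \<open>The outer derivative stands at the head of the index list but the new child at
    its end; the symmetry of partial derivatives moves it.\<close>
  have pdT: "pd [I] (T i J) = pd (map J (children tr i) @ [I]) (h i (J i))" if "i < N" for i J I
  proof -
    have "pd [I] (T i J) = pd (I # map J (children tr i)) (h i (J i))" by (simp add: T_def)
    also have "\<dots> = pd (map J (children tr i) @ [I]) (h i (J i))"
      by (rule pd_mset[OF sm]) (use that chl[of i] in \<open>auto simp: N_def\<close>)
    finally show ?thesis .
  qed
  have R: "pd [I] (flat h tr) x = (\<Sum>J\<in>PiE {1..<N} (\<lambda>_. UNIV). \<Sum>p<N. pd [I] (T p J) x * (\<Prod>i\<in>{..<N} - {p}. T i J x))" for I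
  proof -
    have f: "flat h tr = (\<lambda>x. \<Sum>J\<in>PiE {1..<N} (\<lambda>_. UNIV). \<Prod>i<N. T i J x)"
      by (simp add: flat_def T_def N_def fun_eq_iff)
    have "pd [I] (flat h tr) = (\<lambda>x. \<Sum>J\<in>PiE {1..<N} (\<lambda>_. UNIV). pd [I] (\<lambda>x. \<Prod>i<N. T i J x) x)"
      unfolding f by (rule pd_sum) (rule smoothp_differentiable[OF smoothp_prod[OF Tsm] lN], simp)
    also have "\<dots> = (\<lambda>x. \<Sum>J\<in>PiE {1..<N} (\<lambda>_. UNIV). \<Sum>p<N. pd [I] (T p J) x * (\<Prod>i\<in>{..<N} - {p}. T i J x))"
      by (subst pd_prod) (auto intro!: Tdiff simp del: pd.simps)
    finally show ?thesis by simp
  qed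
  have L: "flat h (tr @ [(p, c)]) x = (\<Sum>J\<in>PiE {1..<N} (\<lambda>_. UNIV). \<Sum>I\<in>UNIV. h N I x * (pd [I] (T p J) x * (\<Prod>i\<in>{..<N} - {p}. T i J x)))"
    if p: "p < N" for p
  proof -
    define F where "F J = (\<Prod>i<Suc N. pd (map J (children (tr @ [(p, c)]) i)) (h i (J i)) x)" for J
    have "{1..<length (tr @ [(p, c)])} = insert N {1..<N}" using N unfolding N_def by (auto simp: Suc_le_eq)
    then have "flat h (tr @ [(p, c)]) x = (\<Sum>J\<in>PiE (insert N {1..<N}) (\<lambda>_. UNIV). F J)"
      by (simp add: flat_def N_def F_def)
    also have "\<dots> = (\<Sum>J\<in>PiE {1..<N} (\<lambda>_. UNIV). \<Sum>I\<in>UNIV. F (J(N := I)))"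
      by (rule sum_PiE_insert) auto
    also have "\<dots> = (\<Sum>J\<in>PiE {1..<N} (\<lambda>_. UNIV). \<Sum>I\<in>UNIV. h N I x * (pd [I] (T p J) x * (\<Prod>i\<in>{..<N} - {p}. T i J x)))"
    proof (intro sum.cong refl)
      fix J :: "nat \<Rightarrow> 'a" and I
      let ?J = "J(N := I)"
      have mp: "map ?J (children tr i) = map J (children tr i)" for i
        by (auto simp: children_set N_def)
      have "N \<noteq> p" using p by simp
      then have "pd (map ?J (children (tr @ [(p, c)]) N)) (h N (?J N)) x = h N I x"
        using chN by (simp add: children_snoc[OF ne])
      moreover have "pd (map ?J (children (tr @ [(p, c)]) p)) (h p (?J p)) x = pd [I] (T p J) x"
      proof -
        have "map ?J (children (tr @ [(p, c)]) p) = map J (children tr p) @ [I]"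
          using mp[of p] by (simp add: children_snoc[OF ne] N_def[symmetric])
        moreover have "?J p = J p" using p by simp
        ultimately show ?thesis by (simp only: pdT[OF p])
      qed
      moreover have "(\<Prod>i\<in>{..<N} - {p}. pd (map ?J (children (tr @ [(p, c)]) i)) (h i (?J i)) x) = (\<Prod>i\<in>{..<N} - {p}. T i J x)"
      proof (intro prod.cong refl)
        fix i assume "i \<in> {..<N} - {p}"
        then have "children (tr @ [(p, c)]) i = children tr i" "?J i = J i" by (auto simp: children_snoc[OF ne])
        then show "pd (map ?J (children (tr @ [(p, c)]) i)) (h i (?J i)) x = T i J x" by (simp only: mp T_def)
      qed
      moreover have "(\<Prod>i<N. F i) = F p * (\<Prod>i\<in>{..<N} - {p}. F i)" for F :: "nat \<Rightarrow> real"
        using prod.remove[of "{..<N}" p F] p by simp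
      ultimately show "F ?J = h N I x * (pd [I] (T p J) x * (\<Prod>i\<in>{..<N} - {p}. T i J x))"
        by (simp only: F_def prod.lessThan_Suc[of _ N] mult.commute[of "h N I x"])
    qed
    finally show ?thesis .
  qed
  have "(\<Sum>p<length tr. flat h (tr @ [(p, c)]) x) = (\<Sum>p<N. \<Sum>J\<in>PiE {1..<N} (\<lambda>_. UNIV). \<Sum>I\<in>UNIV. h N I x * (pd [I] (T p J) x * (\<Prod>i\<in>{..<N} - {p}. T i J x)))"
    by (simp add: L N_def del: pd.simps)
  also have "\<dots> = (\<Sum>I\<in>UNIV. \<Sum>J\<in>PiE {1..<N} (\<lambda>_. UNIV). \<Sum>p<N. h N I x * (pd [I] (T p J) x * (\<Prod>i\<in>{..<N} - {p}. T i J x)))"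
  proof -
    have "(\<Sum>p<N. \<Sum>J\<in>Q. \<Sum>I\<in>UNIV. F p J I) = (\<Sum>I\<in>UNIV. \<Sum>J\<in>Q. \<Sum>p<N. F p J I)"
      for F :: "nat \<Rightarrow> (nat \<Rightarrow> 'a) \<Rightarrow> 'a \<Rightarrow> real" and Q
    proof -
      have "(\<Sum>p<N. \<Sum>J\<in>Q. \<Sum>I\<in>UNIV. F p J I) = (\<Sum>J\<in>Q. \<Sum>p<N. \<Sum>I\<in>UNIV. F p J I)" by (rule sum.swap)
      also have "\<dots> = (\<Sum>J\<in>Q. \<Sum>I\<in>UNIV. \<Sum>p<N. F p J I)" by (intro sum.cong refl sum.swap)
      also have "\<dots> = (\<Sum>I\<in>UNIV. \<Sum>J\<in>Q. \<Sum>p<N. F p J I)" by (rule sum.swap)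
      finally show ?thesis .
    qed
    then show ?thesis .
  qed
  also have "\<dots> = (\<Sum>I\<in>UNIV. h N I x * pd [I] (flat h tr) x)"
    by (simp only: R sum_distrib_left)
  finally show ?thesis by (simp only: N_def)
qed

text \<open>The second leaf is attached by a further derivative, in which the first leaf must not
  participate: its function is frozen at the evaluation point.\<close>
lemma flat_two_leaves:
  assumes wf: "\<And>i. 0 < i \<Longrightarrow> i < length tr \<Longrightarrow> fst (tr ! i) < length tr" and ne: "tr \<noteq> []"
    and sm: "\<And>i I. i < length tr \<Longrightarrow> smoothp l (h i I)" and l: "Suc (length tr) \<le> l"
  shows "(\<Sum>p<length tr. \<Sum>q<length tr. flat h (tr @ [(p, c), (q, c')]) y) =
    (\<Sum>I\<in>UNIV. \<Sum>K\<in>UNIV. h (length tr) I y * h (Suc (length tr)) K y * pd [K, I] (flat h tr) y)"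
proof -
  define N where "N = length tr"
  define h' where "h' = h(N := \<lambda>I _. h N I y)"
  have N: "0 < N" using ne by (simp add: N_def)
  have sm': "smoothp l (h' i I)" if "i < Suc N" for i I
    using that sm[of i I] by (auto simp: h'_def N_def less_Suc_eq smoothp_const)
  have fh: "flat h' tr = flat h tr" by (rule flat_cong) (simp add: h'_def N_def)
  have ch: "children (tr @ [(p, c), (q, c')]) i =
      (if i = p then children tr i @ [N] else children tr i) @ (if i = q then [Suc N] else [])" for p q i
    using children_snoc[of "tr @ [(p, c)]" q c' i] unfolding children_snoc[OF ne, of p c i] by (simp add: N_def)
  have chN: "children tr N = []"
  proof -
    have "c \<notin> set (children tr N)" for c using wf[of c] by (auto simp: children_set N_def)
    then show ?thesis by (cases "children tr N") auto
  qed
  have 1: "flat h (tr @ [(p, c), (q, c')]) y = flat h' ((tr @ [(p, c)]) @ [(q, c')]) y" if "p < N" "q < N" for p q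
    unfolding flat_def
  proof (intro sum.cong prod.cong, goal_cases)
    case (3 J i)
    show ?case using chN that by (cases "i = N") (simp_all add: h'_def ch)
  qed auto
  \<comment> \<open>The second leaf on top of the first would differentiate a constant. This zero
    term extends the sum over \<open>q\<close> to all nodes of the enlarged tree, as
    \<open>flat_leaf\<close> requires.\<close>
  have 2: "flat h' ((tr @ [(p, c)]) @ [(N, c')]) y = 0" if "p < N" for p
  proof -
    have "(\<Prod>i<length ((tr @ [(p, c)]) @ [(N, c')]). pd (map J (children ((tr @ [(p, c)]) @ [(N, c')]) i)) (h' i (J i)) y) = 0" for J
    proof (rule prod_zero)
      have "pd (map J (children ((tr @ [(p, c)]) @ [(N, c')]) N)) (h' N (J N)) y = pd [J (Suc N)] (\<lambda>x. h N (J N) y) y"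
        using chN that by (simp add: ch h'_def del: pd.simps)
      then show "\<exists>i\<in>{..<length ((tr @ [(p, c)]) @ [(N, c')])}. pd (map J (children ((tr @ [(p, c)]) @ [(N, c')]) i)) (h' i (J i)) y = 0"
        unfolding pd_const by (intro bexI[of _ N]) (auto simp: N_def)
    qed simp
    then show ?thesis unfolding flat_def by (simp only: sum.neutral_const)
  qed
  have 3: "(\<Sum>q<N. flat h (tr @ [(p, c), (q, c')]) y) = (\<Sum>K\<in>UNIV. h (Suc N) K y * pd [K] (flat h' (tr @ [(p, c)])) y)"
    if p: "p < N" for p
  proof -
    have "(\<Sum>q<N. flat h (tr @ [(p, c), (q, c')]) y) = (\<Sum>q<length (tr @ [(p, c)]). flat h' ((tr @ [(p, c)]) @ [(q, c')]) y)"
    proof -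
      have "(\<Sum>q<N. flat h (tr @ [(p, c), (q, c')]) y) = (\<Sum>q<N. flat h' ((tr @ [(p, c)]) @ [(q, c')]) y)"
        by (rule sum.cong[OF refl]) (use 1[OF p] in auto)
      then show ?thesis using 2[OF p] by (simp add: N_def)
    qed
    also have "\<dots> = (\<Sum>K\<in>UNIV. h' (length (tr @ [(p, c)])) K y * pd [K] (flat h' (tr @ [(p, c)])) y)"
    proof (rule flat_leaf)
      show "fst ((tr @ [(p, c)]) ! i) < length (tr @ [(p, c)])" if "0 < i" "i < length (tr @ [(p, c)])" for i
        using that wf[of i] p by (auto simp: nth_append N_def less_Suc_eq)
      show "smoothp l (h' i I)" if "i < length (tr @ [(p, c)])" for i I using that by (intro sm') (simp add: N_def)
    qed (use l in auto)
    finally show ?thesis by (simp add: h'_def N_def del: pd.simps)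
  qed
  have d1: "flat h' (tr @ [(p, c)]) differentiable (at x)" for p x
    by (rule smoothp_differentiable[OF smoothp_flat[of _ l]]) (use sm' l in \<open>auto simp: N_def\<close>)
  have s2: "smoothp (l - (N - 1)) (flat h tr)"
    unfolding N_def by (rule smoothp_flat[of _ l]) (use sm l in auto)
  then have s2': "smoothp (l - (N - 1) - 1) (pd [I] (flat h tr))" for I
    by (rule smoothp_pd_le) (use l N in \<open>auto simp: N_def\<close>)
  have d2: "pd [I] (flat h tr) differentiable (at x)" for I x
    by (rule smoothp_differentiable[OF s2']) (use l N in \<open>auto simp: N_def\<close>)
  have 4: "(\<Sum>p<N. pd [K] (flat h' (tr @ [(p, c)])) y) = (\<Sum>I\<in>UNIV. h N I y * pd [K, I] (flat h tr) y)" for K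
  proof -
    have "(\<Sum>p<N. pd [K] (flat h' (tr @ [(p, c)])) y) = pd [K] (\<lambda>x. \<Sum>p<N. flat h' (tr @ [(p, c)]) x) y"
      by (subst pd_sum) (auto intro: d1 simp del: pd.simps)
    also have "(\<lambda>x. \<Sum>p<N. flat h' (tr @ [(p, c)]) x) = (\<lambda>x. \<Sum>I\<in>UNIV. h' N I x * pd [I] (flat h' tr) x)"
      unfolding N_def by (rule ext, rule flat_leaf[OF wf ne, of l]) (use sm' l in \<open>auto simp: N_def\<close>)
    also have "\<dots> = (\<lambda>x. \<Sum>I\<in>UNIV. h N I y * pd [I] (flat h tr) x)"
      unfolding fh by (simp add: h'_def del: pd.simps)
    also have "pd [K] \<dots> y = (\<Sum>I\<in>UNIV. h N I y * pd [K] (pd [I] (flat h tr)) y)"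
    proof -
      have "(\<lambda>x. h N I y * pd [I] (flat h tr) x) differentiable (at x)" for I x
        by (intro differentiable_mult differentiable_const d2)
      then show ?thesis by (simp only: pd_sum pd_cmult[OF d2])
    qed
    finally show ?thesis by (simp only: pd_Cons[of K "[_]"])
  qed
  have "(\<Sum>p<N. \<Sum>q<N. flat h (tr @ [(p, c), (q, c')]) y) = (\<Sum>p<N. \<Sum>K\<in>UNIV. h (Suc N) K y * pd [K] (flat h' (tr @ [(p, c)])) y)"
    by (rule sum.cong) (simp_all add: 3 del: pd.simps)
  also have "\<dots> = (\<Sum>K\<in>UNIV. h (Suc N) K y * (\<Sum>p<N. pd [K] (flat h' (tr @ [(p, c)])) y))"
    by (subst sum.swap) (simp add: sum_distrib_left del: pd.simps)
  also have "\<dots> = (\<Sum>K\<in>UNIV. \<Sum>I\<in>UNIV. h N I y * h (Suc N) K y * pd [K, I] (flat h tr) y)"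
    by (simp only: 4 sum_distrib_left mult_ac)
  also have "\<dots> = (\<Sum>I\<in>UNIV. \<Sum>K\<in>UNIV. h N I y * h (Suc N) K y * pd [K, I] (flat h tr) y)"
    by (rule sum.swap)
  finally show ?thesis by (simp only: N_def)
qed

definition gen :: "(real^'d::finite \<Rightarrow> real^'d) \<Rightarrow> (real^'d \<Rightarrow> real^'m::finite^'d) \<Rightarrow> (real^'d \<Rightarrow> real) \<Rightarrow> real^'d \<Rightarrow> real" where
  "gen a b G x = (\<Sum>I\<in>UNIV. a x $ I * pd [I] G x) +
     (\<Sum>j\<in>UNIV. \<Sum>I\<in>UNIV. \<Sum>K\<in>UNIV. b x $ I $ j * b x $ K $ j * pd [K, I] G x) / 2"

lemma smoothp_gen:
  assumes "smoothp (Suc (Suc l)) G" "\<And>i. smoothp l (\<lambda>x. a x $ i)" "\<And>i j. smoothp l (\<lambda>x. b x $ i $ j)"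
  shows "smoothp l (gen a b G)"
proof -
  have 1: "smoothp l (pd [I] G)" for I using smoothp_mono[OF smoothp_pd[OF assms(1), of "[I]"], of l] by (simp del: pd.simps)
  have 2: "smoothp l (pd [K, I] G)" for I K using smoothp_pd[OF assms(1), of "[K, I]"] by (simp del: pd.simps)
  have "smoothp l (\<lambda>x. (\<Sum>I\<in>UNIV. a x $ I * pd [I] G x) +
     (\<Sum>j\<in>UNIV. \<Sum>I\<in>UNIV. \<Sum>K\<in>UNIV. b x $ I $ j * b x $ K $ j * pd [K, I] G x) * (1 / 2))"
    by (intro smoothp_add smoothp_mult smoothp_sum smoothp_const 1 2 assms)
  then show ?thesis by (simp add: gen_def[abs_def] del: pd.simps)
qed

lemma gen_sum:
  assumes "\<And>k. k \<in> A \<Longrightarrow> smoothp 2 (G k)"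
  shows "gen a b (\<lambda>x. \<Sum>k\<in>A. c k * G k x) x = (\<Sum>k\<in>A. c k * gen a b (G k) x)"
proof -
  have d1: "G k differentiable (at y)" if "k \<in> A" for k y
    using smoothp_differentiable[OF assms[OF that]] by simp
  have d2: "pd [I] (G k) differentiable (at y)" if "k \<in> A" for I k y
    using smoothp_differentiable[OF smoothp_pd[OF assms[OF that], of "[I]"]] by (simp del: pd.simps)
  have 1: "pd [I] (\<lambda>x. \<Sum>k\<in>A. c k * G k x) = (\<lambda>x. \<Sum>k\<in>A. c k * pd [I] (G k) x)" for I
    by (subst pd_sum) (auto intro!: differentiable_mult differentiable_const d1 simp add: pd_cmult d1 simp del: pd.simps)
  have 2: "pd [K, I] (\<lambda>x. \<Sum>k\<in>A. c k * G k x) = (\<lambda>x. \<Sum>k\<in>A. c k * pd [K, I] (G k) x)" for K I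
    unfolding pd_Cons[of K "[I]"] 1
    by (subst pd_sum) (auto intro!: differentiable_mult differentiable_const d2 simp add: pd_cmult d2 simp del: pd.simps)
  have "(\<Sum>I\<in>UNIV. a x $ I * (\<Sum>k\<in>A. c k * pd [I] (G k) x)) = (\<Sum>k\<in>A. c k * (\<Sum>I\<in>UNIV. a x $ I * pd [I] (G k) x))"
    unfolding sum_distrib_left by (subst sum.swap) (simp only: mult.left_commute)
  moreover have "(\<Sum>j\<in>UNIV. \<Sum>I\<in>UNIV. \<Sum>K\<in>UNIV. b x $ I $ j * b x $ K $ j * (\<Sum>k\<in>A. c k * pd [K, I] (G k) x)) =
     (\<Sum>k\<in>A. c k * (\<Sum>j\<in>UNIV. \<Sum>I\<in>UNIV. \<Sum>K\<in>UNIV. b x $ I $ j * b x $ K $ j * pd [K, I] (G k) x))"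
  proof -
    have "(\<Sum>j\<in>UNIV. \<Sum>I\<in>UNIV. \<Sum>K\<in>UNIV. \<Sum>k\<in>A. F j I K k) = (\<Sum>k\<in>A. \<Sum>j\<in>UNIV. \<Sum>I\<in>UNIV. \<Sum>K\<in>UNIV. F j I K k)"
      for F :: "'m \<Rightarrow> 'd \<Rightarrow> 'd \<Rightarrow> _ \<Rightarrow> real"
      by (simp only: sum.swap[of _ A])
    then show ?thesis unfolding sum_distrib_left by (simp only: mult.left_commute)
  qed
  ultimately show ?thesis
    unfolding gen_def 1 2
    by (simp only: sum.distrib distrib_left sum_divide_distrib[symmetric] times_divide_eq_right)
qed

text \<open>The power of two collects the factors \<open>1 / 2\<close> of the second-order part of
  \<open>gen\<close>, one for each stochastic pair.\<close>

definition tree_term :: "(real^'d::finite \<Rightarrow> real) \<Rightarrow> (real^'d \<Rightarrow> real^'d) \<Rightarrow> (real^'d \<Rightarrow> real^'m::finite^'d) \<Rightarrow> tree \<Rightarrow> real^'d \<Rightarrow> real" where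
  "tree_term f a b tr x = (\<Sum>js\<in>PiE {..<nsig tr div 2} (\<lambda>_. UNIV :: 'm set). (1 / 2 ^ (nsig tr div 2)) * elem_diff f a b tr js x)"

lemma smoothp_node_fun:
  assumes "smoothp l f" "\<And>i. smoothp l (\<lambda>x. a x $ i)" "\<And>i j. smoothp l (\<lambda>x. b x $ i $ j)"
  shows "smoothp l (node_fun f a b tr js i I)"
  using assms by (cases "snd (tr ! i)") (auto simp: node_fun_def)

lemma smoothp_elem_diff:
  assumes "smoothp l f" "\<And>i. smoothp l (\<lambda>x. a x $ i)" "\<And>i j. smoothp l (\<lambda>x. b x $ i $ j)"
    and "tr \<in> lts" "2 * rho tr \<le> l"
  shows "smoothp (l - 2 * rho tr) (elem_diff f a b tr js)"
proof -
  have "smoothp (l - (length tr - 1)) (flat (node_fun f a b tr js) tr)"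
    by (rule smoothp_flat[OF smoothp_node_fun]) (use assms lts_length_le[OF assms(4)] in auto)
  then have "smoothp (l - 2 * rho tr) (flat (node_fun f a b tr js) tr)"
    by (rule smoothp_mono) (use lts_length_le[OF assms(4)] in auto)
  then show ?thesis by (simp only: elem_diff_flat[OF assms(4), abs_def])
qed

lemma gen_tree_term:
  fixes a :: "real^'d::finite \<Rightarrow> real^'d" and b :: "real^'d \<Rightarrow> real^'m::finite^'d"
  assumes sm: "smoothp l f" "\<And>i. smoothp l (\<lambda>x. a x $ i)" "\<And>i j. smoothp l (\<lambda>x. b x $ i $ j)"
    and tr: "tr \<in> lts" and l: "2 * rho tr + 2 \<le> l"
  shows "gen a b (tree_term f a b tr) x =
    (\<Sum>p<length tr. tree_term f a b (add_tau (tr, p)) x) + (\<Sum>p<length tr. \<Sum>q<length tr. tree_term f a b (add_sig (tr, p, q)) x)"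
proof -
  define s where "s = nsig tr div 2"
  define N where "N = length tr"
  note le = lts_length_le[OF tr]
  have ne: "tr \<noteq> []" using lts_length_pos[OF tr] by auto
  have wf: "fst (tr ! i) < length tr" if "0 < i" "i < length tr" for i
    using lts_father_less[OF tr that] that by simp
  have s2: "smoothp 2 (elem_diff f a b tr js)" for js
    by (rule smoothp_mono[OF smoothp_elem_diff[OF sm tr]]) (use l in auto)
  have ed: "elem_diff f a b tr js = flat (node_fun f a b tr js) tr" for js using elem_diff_flat[OF tr] by blast
  have tau: "(\<Sum>p<N. elem_diff f a b (add_tau (tr, p)) js x) = (\<Sum>I\<in>UNIV. a x $ I * pd [I] (elem_diff f a b tr js) x)" for js
  proof -
    have "elem_diff f a b (add_tau (tr, p)) js x = flat ((node_fun f a b tr js)(N := \<lambda>I x. a x $ I)) (tr @ [(p, Tau)]) x" if "p < N" for p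
    proof -
      have "add_tau (tr, p) \<in> lts" using lts.tau[OF tr, of p] that by (simp add: add_tau_def N_def)
      from elem_diff_flat[OF this] have "elem_diff f a b (add_tau (tr, p)) js x = flat (node_fun f a b (add_tau (tr, p)) js) (tr @ [(p, Tau)]) x"
        by (simp add: add_tau_def)
      also have "flat (node_fun f a b (add_tau (tr, p)) js) (tr @ [(p, Tau)]) = flat ((node_fun f a b tr js)(N := \<lambda>I x. a x $ I)) (tr @ [(p, Tau)])"
        by (rule flat_cong) (auto simp: node_fun_def add_tau_def nth_append N_def fun_eq_iff less_Suc_eq)
      finally show ?thesis .
    qed
    then have "(\<Sum>p<N. elem_diff f a b (add_tau (tr, p)) js x) = (\<Sum>p<length tr. flat ((node_fun f a b tr js)(N := \<lambda>I x. a x $ I)) (tr @ [(p, Tau)]) x)"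
      by (simp add: N_def)
    also have "\<dots> = (\<Sum>I\<in>UNIV. a x $ I * pd [I] (flat ((node_fun f a b tr js)(N := \<lambda>I x. a x $ I)) tr) x)"
      by (subst flat_leaf[OF wf ne, of l]) (use le l in \<open>auto simp: N_def intro!: smoothp_node_fun sm simp del: pd.simps\<close>)
    also have "flat ((node_fun f a b tr js)(N := \<lambda>I x. a x $ I)) tr = elem_diff f a b tr js"
      unfolding ed by (rule flat_cong) (simp add: N_def)
    finally show ?thesis .
  qed
  have sig: "(\<Sum>p<N. \<Sum>q<N. elem_diff f a b (add_sig (tr, p, q)) (js(s := j)) x) =
     (\<Sum>I\<in>UNIV. \<Sum>K\<in>UNIV. b x $ I $ j * b x $ K $ j * pd [K, I] (elem_diff f a b tr js) x)" for js j
  proof -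
    let ?h = "(node_fun f a b tr js)(N := \<lambda>I x. b x $ I $ j, Suc N := \<lambda>I x. b x $ I $ j)"
    have "elem_diff f a b (add_sig (tr, p, q)) (js(s := j)) x = flat ?h (tr @ [(p, Sig s), (q, Sig s)]) x" if "p < N" "q < N" for p q
    proof -
      have "add_sig (tr, p, q) \<in> lts" using lts.sig[OF tr, of p q] that by (simp add: add_sig_def N_def)
      from elem_diff_flat[OF this] have "elem_diff f a b (add_sig (tr, p, q)) (js(s := j)) x =
          flat (node_fun f a b (tr @ [(p, Sig s), (q, Sig s)]) (js(s := j))) (tr @ [(p, Sig s), (q, Sig s)]) x"
        by (simp add: add_sig_def s_def)
      also have "flat (node_fun f a b (tr @ [(p, Sig s), (q, Sig s)]) (js(s := j))) (tr @ [(p, Sig s), (q, Sig s)]) = flat ?h (tr @ [(p, Sig s), (q, Sig s)])"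
      proof (rule flat_cong)
        fix i I assume i: "i < length (tr @ [(p, Sig s), (q, Sig s)])"
        consider "i < N" | "i = N" | "i = Suc N" using i by (fastforce simp: N_def)
        then show "node_fun f a b (tr @ [(p, Sig s), (q, Sig s)]) (js(s := j)) i I = ?h i I"
        proof cases
          case 1
          \<comment> \<open>The indices in \<open>tr\<close> are below \<open>s\<close>, so giving
            the fresh index variable \<open>s\<close> the value \<open>j\<close> leaves the old
            nodes unchanged.\<close>
          have "gcomp a b (js(s := j)) (snd (tr ! i)) I = gcomp a b js (snd (tr ! i)) I"
            using lts_Sig_less[OF tr, of i] 1 by (cases "snd (tr ! i)") (auto simp: N_def s_def)
          then show ?thesis using 1 by (simp add: node_fun_def nth_append N_def)
        qed (simp_all add: node_fun_def nth_append N_def)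
      qed
      finally show ?thesis .
    qed
    then have "(\<Sum>p<N. \<Sum>q<N. elem_diff f a b (add_sig (tr, p, q)) (js(s := j)) x) =
      (\<Sum>p<length tr. \<Sum>q<length tr. flat ?h (tr @ [(p, Sig s), (q, Sig s)]) x)" by (simp add: N_def)
    also have "\<dots> = (\<Sum>I\<in>UNIV. \<Sum>K\<in>UNIV. b x $ I $ j * b x $ K $ j * pd [K, I] (flat ?h tr) x)"
      by (subst flat_two_leaves[OF wf ne, of l]) (use le l in \<open>auto simp: N_def intro!: smoothp_node_fun sm simp del: pd.simps\<close>)
    also have "flat ?h tr = elem_diff f a b tr js"
      unfolding ed by (rule flat_cong) (simp add: N_def)
    finally show ?thesis .
  qed
  have T: "(\<Sum>p<N. tree_term f a b (add_tau (tr, p)) x) =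
     (\<Sum>js\<in>PiE {..<s} (\<lambda>_. UNIV). (1 / 2 ^ s) * (\<Sum>I\<in>UNIV. a x $ I * pd [I] (elem_diff f a b tr js) x))"
  proof -
    have "(\<Sum>p<N. tree_term f a b (add_tau (tr, p)) x) = (\<Sum>p<N. \<Sum>js\<in>PiE {..<s} (\<lambda>_. UNIV). (1 / 2 ^ s) * elem_diff f a b (add_tau (tr, p)) js x)"
      unfolding tree_term_def s_def by (simp add: add_tau_def nsig_append_tau)
    also have "\<dots> = (\<Sum>js\<in>PiE {..<s} (\<lambda>_. UNIV). (1 / 2 ^ s) * (\<Sum>p<N. elem_diff f a b (add_tau (tr, p)) js x))"
      unfolding sum_distrib_left by (rule sum.swap)
    finally show ?thesis unfolding tau .
  qed
  have S: "(\<Sum>p<N. \<Sum>q<N. tree_term f a b (add_sig (tr, p, q)) x) =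
     (\<Sum>js\<in>PiE {..<s} (\<lambda>_. UNIV). (1 / 2 ^ s) * ((\<Sum>j\<in>UNIV. \<Sum>I\<in>UNIV. \<Sum>K\<in>UNIV. b x $ I $ j * b x $ K $ j * pd [K, I] (elem_diff f a b tr js) x) / 2))"
  proof -
    \<comment> \<open>The tree with the new pair has one more index variable. Summing over its value
      \<open>j\<close> is the sum over the Wiener components in \<open>gen\<close>, and the extra
      power of two is the factor \<open>1 / 2\<close> there.\<close>
    have "tree_term f a b (add_sig (tr, p, q)) x = (\<Sum>js\<in>PiE {..<s} (\<lambda>_. UNIV). \<Sum>j\<in>UNIV. (1 / 2 ^ Suc s) * elem_diff f a b (add_sig (tr, p, q)) (js(s := j)) x)" for p q
    proof -
      have e: "nsig (add_sig (tr, p, q)) div 2 = Suc s" unfolding add_sig_def by (simp add: nsig_append_sig s_def)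
      show ?thesis unfolding tree_term_def e lessThan_Suc by (rule sum_PiE_insert) auto
    qed
    then have "(\<Sum>p<N. \<Sum>q<N. tree_term f a b (add_sig (tr, p, q)) x) =
       (\<Sum>p<N. \<Sum>q<N. \<Sum>js\<in>PiE {..<s} (\<lambda>_. UNIV). \<Sum>j\<in>UNIV. (1 / 2 ^ Suc s) * elem_diff f a b (add_sig (tr, p, q)) (js(s := j)) x)" by simp
    also have "\<dots> = (\<Sum>js\<in>PiE {..<s} (\<lambda>_. UNIV). \<Sum>j\<in>UNIV. (1 / 2 ^ Suc s) * (\<Sum>p<N. \<Sum>q<N. elem_diff f a b (add_sig (tr, p, q)) (js(s := j)) x))"
    proof -
      have "(\<Sum>p<N. \<Sum>q<N. \<Sum>js\<in>PiE {..<s} (\<lambda>_. UNIV). \<Sum>j\<in>UNIV. F p q js j) = (\<Sum>js\<in>PiE {..<s} (\<lambda>_. UNIV). \<Sum>j\<in>UNIV. \<Sum>p<N. \<Sum>q<N. F p q js j)"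
        for F :: "nat \<Rightarrow> nat \<Rightarrow> (nat \<Rightarrow> 'm) \<Rightarrow> 'm \<Rightarrow> real"
      proof -
        have "(\<Sum>p<N. \<Sum>q<N. \<Sum>js\<in>PiE {..<s} (\<lambda>_. UNIV). \<Sum>j\<in>UNIV. F p q js j) = (\<Sum>js\<in>PiE {..<s} (\<lambda>_. UNIV). \<Sum>p<N. \<Sum>q<N. \<Sum>j\<in>UNIV. F p q js j)"
          by (simp only: sum.swap[of _ "PiE {..<s} (\<lambda>_. UNIV)"])
        also have "\<dots> = (\<Sum>js\<in>PiE {..<s} (\<lambda>_. UNIV). \<Sum>j\<in>UNIV. \<Sum>p<N. \<Sum>q<N. F p q js j)"
          by (rule sum.cong[OF refl]) (simp only: sum.swap[of _ "UNIV :: 'm set"])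
        finally show ?thesis .
      qed
      then show ?thesis by (simp only: sum_distrib_left)
    qed
    moreover have "(\<Sum>j\<in>UNIV. (1 / 2 ^ Suc s) * Y j) = (1 / 2 ^ s) * ((\<Sum>j\<in>UNIV. Y j) / 2)" for Y :: "'m \<Rightarrow> real"
      by (simp add: sum_distrib_left sum_divide_distrib mult_ac)
    ultimately show ?thesis unfolding sig by (simp only:)
  qed
  have "gen a b (tree_term f a b tr) x = (\<Sum>js\<in>PiE {..<s} (\<lambda>_. UNIV). (1 / 2 ^ s) * gen a b (elem_diff f a b tr js) x)"
    unfolding tree_term_def[abs_def] s_def[symmetric] by (rule gen_sum) (rule s2)
  then show ?thesis unfolding N_def[symmetric] T S by (simp only: gen_def distrib_left sum.distrib)
qed

text \<open>In the induction step the trees of level \<open>k\<close> have used \<open>2 * k\<close>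
  of the \<open>2 * Suc k\<close> available derivatives, so each tree term still admits one
  application of \<open>gen\<close>.\<close>

lemma gen_power_tree_sum:
  fixes a :: "real^'d::finite \<Rightarrow> real^'d" and b :: "real^'d \<Rightarrow> real^'m::finite^'d"
  assumes sm: "smoothp (2 * k) f" "\<And>i. smoothp (2 * k) (\<lambda>x. a x $ i)" "\<And>i j. smoothp (2 * k) (\<lambda>x. b x $ i $ j)"
  shows "(gen a b ^^ k) f = (\<lambda>x. \<Sum>tr\<in>{tr \<in> lts. rho tr = k}. tree_term f a b tr x)"
  using assms
proof (induction k)
  case 0
  have c: "children [(0, Gam)] 0 = []" by (simp add: children_def)
  have n: "nsig [(0, Gam)] = 0" by (simp add: nsig_def)
  show ?case by (auto simp: fun_eq_iff tree_term_def lts_level_0 elem_diff_def c n)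
next
  case (Suc k)
  have sm': "smoothp (2 * k) f" "smoothp (2 * k) (\<lambda>x. a x $ i)" "smoothp (2 * k) (\<lambda>x. b x $ i' $ j)" for i i' j
    by (rule smoothp_mono[OF Suc.prems(1)] smoothp_mono[OF Suc.prems(2)] smoothp_mono[OF Suc.prems(3)], simp)+
  have s2: "smoothp 2 (tree_term f a b tr)" if "tr \<in> {tr \<in> lts. rho tr = k}" for tr
    unfolding tree_term_def[abs_def]
    by (intro smoothp_sum smoothp_mult smoothp_const, rule smoothp_mono[OF smoothp_elem_diff[OF Suc.prems]]) (use that in auto)
  show ?case
  proof
    fix x
    have "(gen a b ^^ Suc k) f x = gen a b (\<lambda>x. \<Sum>tr\<in>{tr \<in> lts. rho tr = k}. 1 * tree_term f a b tr x) x"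
      using Suc.IH[OF sm'] by simp
    also have "\<dots> = (\<Sum>tr\<in>{tr \<in> lts. rho tr = k}. 1 * gen a b (tree_term f a b tr) x)"
      by (rule gen_sum) (rule s2)
    also have "\<dots> = (\<Sum>tr\<in>{tr \<in> lts. rho tr = Suc k}. tree_term f a b tr x)"
      unfolding sum_lts_level_Suc
    proof (intro sum.cong refl, goal_cases)
      case (1 tr)
      then show ?case unfolding mult_1_left by (intro gen_tree_term[OF Suc.prems]) auto
    qed
    finally show "(gen a b ^^ Suc k) f x = (\<Sum>tr\<in>{tr \<in> lts. rho tr = Suc k}. tree_term f a b tr x)" .
  qed
qed

subsection \<open>Equivalence of trees\<close>

lemma ren_ren: "ren f (ren g c) = ren (f \<circ> g) c"
  by (cases c) auto

lemma ren_id: "ren id c = c"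
  by (cases c) auto

lemma ren_eqI: "(\<And>k. c = Sig k \<Longrightarrow> f k = k) \<Longrightarrow> ren f c = c"
  by (cases c) auto

text \<open>Applied with \<open>Q\<close> saying that a colour is stochastic, or that it is
  \<open>Tau\<close>; this makes \<open>nsig\<close> and \<open>rho\<close> invariants of the
  class.\<close>

lemma card_colour_invariant:
  assumes "bij_betw \<psi> {..<length t1} {..<length t1}" "length t1 = length t2"
    and "\<And>i. i < length t1 \<Longrightarrow> Q (snd (t2 ! \<psi> i)) = Q (snd (t1 ! i))"
  shows "length (filter (\<lambda>p. Q (snd p)) t2) = length (filter (\<lambda>p. Q (snd p)) t1)"
proof -
  have "{i. i < length t2 \<and> Q (snd (t2 ! i))} = \<psi> ` {i. i < length t1 \<and> Q (snd (t1 ! i))}"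
  proof (intro set_eqI iffI)
    fix i assume "i \<in> {i. i < length t2 \<and> Q (snd (t2 ! i))}"
    then have i: "i < length t1" "Q (snd (t2 ! i))" using assms(2) by auto
    then have "i \<in> \<psi> ` {..<length t1}" using assms(1) by (auto simp: bij_betw_def)
    then obtain k where "k < length t1" "i = \<psi> k" by auto
    then show "i \<in> \<psi> ` {i. i < length t1 \<and> Q (snd (t1 ! i))}" using i assms(3) by auto
  next
    fix i assume "i \<in> \<psi> ` {i. i < length t1 \<and> Q (snd (t1 ! i))}"
    then obtain k where k: "k < length t1" "Q (snd (t1 ! k))" "i = \<psi> k" by auto
    then have "\<psi> k < length t1" using assms(1) by (auto simp: bij_betw_def)
    then show "i \<in> {i. i < length t2 \<and> Q (snd (t2 ! i))}" using k assms(2,3) by auto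
  qed
  moreover have "inj_on \<psi> {i. i < length t1 \<and> Q (snd (t1 ! i))}"
    using assms(1) by (auto simp: bij_betw_def inj_on_def)
  ultimately show ?thesis by (simp add: length_filter_conv_card card_image)
qed

lemma tree_equiv_nsig: "tree_equiv t1 t2 \<Longrightarrow> nsig t2 = nsig t1"
  and tree_equiv_rho: "tree_equiv t1 t2 \<Longrightarrow> rho t2 = rho t1"
proof -
  assume "tree_equiv t1 t2"
  then obtain \<psi> \<pi> where l: "length t1 = length t2" and b: "bij_betw \<psi> {..<length t1} {..<length t1}"
    and c: "\<And>i. i < length t1 \<Longrightarrow> snd (t2 ! \<psi> i) = ren \<pi> (snd (t1 ! i))"
    unfolding tree_equiv_def by blast
  have 1: "is_sig (ren \<pi> x) = is_sig x" for x by (cases x) auto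
  have 2: "(ren \<pi> x = Tau) = (x = Tau)" for x by (cases x) auto
  show "nsig t2 = nsig t1"
    unfolding nsig_def by (rule card_colour_invariant[OF b l]) (simp add: c 1)
  moreover have "ntau t2 = ntau t1"
    unfolding ntau_def by (rule card_colour_invariant[OF b l]) (simp add: c 2)
  ultimately show "rho t2 = rho t1" by (simp add: rho_def)
qed

lemma tree_equiv_refl: "tree_equiv t t"
  unfolding tree_equiv_def
  by (intro conjI refl exI[of _ id] exI[of _ id]) (auto simp: ren_id)

text \<open>The father relation can be pulled back along the inverse of \<open>\<psi>\<close>
  because fathers are labels of the tree, and the colours along the inverse of \<open>\<pi>\<close>
  because only the first \<open>nsig t1 div 2\<close> index variables occur. Both facts come from
  membership in \<open>lts\<close>.\<close>

lemma tree_equiv_sym: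
  assumes t1: "t1 \<in> lts" and t2: "t2 \<in> lts" and eq: "tree_equiv t1 t2"
  shows "tree_equiv t2 t1"
proof -
  obtain \<psi> \<pi> where l: "length t1 = length t2" and b: "bij_betw \<psi> {..<length t1} {..<length t1}" and z: "\<psi> 0 = 0"
    and p: "bij_betw \<pi> {..<nsig t1 div 2} {..<nsig t2 div 2}"
    and f: "\<And>i. 0 < i \<Longrightarrow> i < length t1 \<Longrightarrow> fst (t2 ! \<psi> i) = \<psi> (fst (t1 ! i))"
    and c: "\<And>i. i < length t1 \<Longrightarrow> snd (t2 ! \<psi> i) = ren \<pi> (snd (t1 ! i))"
    using eq unfolding tree_equiv_def by (auto simp: Suc_le_eq)
  define \<psi>' where "\<psi>' = inv_into {..<length t1} \<psi>"
  define \<pi>' where "\<pi>' = inv_into {..<nsig t1 div 2} \<pi>"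
  have inj: "inj_on \<psi> {..<length t1}" using b by (simp add: bij_betw_def)
  have b': "bij_betw \<psi>' {..<length t1} {..<length t1}" unfolding \<psi>'_def by (rule bij_betw_inv_into[OF b])
  have p': "bij_betw \<pi>' {..<nsig t2 div 2} {..<nsig t1 div 2}" unfolding \<pi>'_def by (rule bij_betw_inv_into[OF p])
  have l': "\<psi>' (\<psi> i) = i" if "i < length t1" for i unfolding \<psi>'_def using inj that by (simp add: inv_into_f_f)
  have r': "\<psi> (\<psi>' i) = i" if "i < length t1" for i
    unfolding \<psi>'_def by (rule f_inv_into_f) (use b that in \<open>simp add: bij_betw_def\<close>)
  have z': "\<psi>' 0 = 0" using l'[of 0] z lts_length_pos[OF t1] by simp
  have lt': "\<psi>' i < length t1" if "i < length t1" for i using b' that by (auto simp: bij_betw_def)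
  have fst': "fst (t1 ! \<psi>' i) = \<psi>' (fst (t2 ! i))" if i: "0 < i" "i < length t1" for i
  proof -
    have k: "0 < \<psi>' i" using r'[OF i(2)] z i by (metis gr0I less_irrefl)
    have "fst (t2 ! i) = \<psi> (fst (t1 ! \<psi>' i))" using f[OF k lt'[OF i(2)]] r'[OF i(2)] by simp
    moreover have "fst (t1 ! \<psi>' i) < length t1" using lts_father_less[OF t1 k lt'[OF i(2)]] lt'[OF i(2)] by simp
    ultimately show ?thesis by (simp add: l')
  qed
  have snd': "snd (t1 ! \<psi>' i) = ren \<pi>' (snd (t2 ! i))" if i: "i < length t1" for i
  proof -
    have "snd (t2 ! i) = ren \<pi> (snd (t1 ! \<psi>' i))" using c[OF lt'[OF i]] r'[OF i] by simp
    moreover have "ren (\<pi>' \<circ> \<pi>) (snd (t1 ! \<psi>' i)) = snd (t1 ! \<psi>' i)"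
    proof (rule ren_eqI)
      fix k assume "snd (t1 ! \<psi>' i) = Sig k"
      then have "k < nsig t1 div 2" by (rule lts_Sig_less[OF t1 lt'[OF i]])
      then show "(\<pi>' \<circ> \<pi>) k = k" using p by (simp add: \<pi>'_def bij_betw_def inv_into_f_f)
    qed
    ultimately show ?thesis by (simp add: ren_ren)
  qed
  show ?thesis
    unfolding tree_equiv_def
    by (rule conjI, use l in simp, rule exI[of _ \<psi>'], rule exI[of _ \<pi>']) (use b' p' z' fst' snd' l in auto)
qed

lemma tree_equiv_trans:
  assumes "tree_equiv t1 t2" "tree_equiv t2 t3"
  shows "tree_equiv t1 t3"
proof -
  obtain \<psi> \<pi> where l: "length t1 = length t2" and b: "bij_betw \<psi> {..<length t1} {..<length t1}" and z: "\<psi> 0 = 0"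
    and p: "bij_betw \<pi> {..<nsig t1 div 2} {..<nsig t2 div 2}"
    and f: "\<And>i. 0 < i \<Longrightarrow> i < length t1 \<Longrightarrow> fst (t2 ! \<psi> i) = \<psi> (fst (t1 ! i))"
    and c: "\<And>i. i < length t1 \<Longrightarrow> snd (t2 ! \<psi> i) = ren \<pi> (snd (t1 ! i))"
    using assms(1) unfolding tree_equiv_def by (auto simp: Suc_le_eq)
  obtain \<psi>' \<pi>' where l': "length t2 = length t3" and b': "bij_betw \<psi>' {..<length t2} {..<length t2}" and z': "\<psi>' 0 = 0"
    and p': "bij_betw \<pi>' {..<nsig t2 div 2} {..<nsig t3 div 2}"
    and f': "\<And>i. 0 < i \<Longrightarrow> i < length t2 \<Longrightarrow> fst (t3 ! \<psi>' i) = \<psi>' (fst (t2 ! i))"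
    and c': "\<And>i. i < length t2 \<Longrightarrow> snd (t3 ! \<psi>' i) = ren \<pi>' (snd (t2 ! i))"
    using assms(2) unfolding tree_equiv_def by (auto simp: Suc_le_eq)
  have lt: "\<psi> i < length t1" if "i < length t1" for i using b that by (auto simp: bij_betw_def)
  have pos: "0 < \<psi> i" if "0 < i" "i < length t1" for i
  proof (rule ccontr)
    assume "\<not> 0 < \<psi> i"
    then have "\<psi> i = \<psi> 0" using z by simp
    moreover have "i \<in> {..<length t1}" "0 \<in> {..<length t1}" using that by auto
    ultimately have "i = 0" using b unfolding bij_betw_def inj_on_def by blast
    then show False using that by simp
  qed
  show ?thesis
    unfolding tree_equiv_def
  proof (rule conjI, use l l' in simp, rule exI[of _ "\<psi>' \<circ> \<psi>"], rule exI[of _ "\<pi>' \<circ> \<pi>"], intro conjI ballI allI impI)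
    show "bij_betw (\<psi>' \<circ> \<psi>) {..<length t1} {..<length t1}" using bij_betw_trans[OF b] b' l by simp
    show "bij_betw (\<pi>' \<circ> \<pi>) {..<nsig t1 div 2} {..<nsig t3 div 2}" by (rule bij_betw_trans[OF p p'])
    show "fst (t3 ! (\<psi>' \<circ> \<psi>) i) = (\<psi>' \<circ> \<psi>) (fst (t1 ! i))" if "i \<in> {1..<length t1}" for i
      using that f[of i] f'[of "\<psi> i"] lt[of i] pos[of i] l by auto
    show "snd (t3 ! (\<psi>' \<circ> \<psi>) i) = ren (\<pi>' \<circ> \<pi>) (snd (t1 ! i))" if "i < length t1" for i
      using that c[of i] c'[of "\<psi> i"] lt[of i] l by (simp add: ren_ren)
  qed (use l l' z z' in auto)
qed

lemma equiv_tree_rel: "equiv lts tree_rel"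
  by (rule equivI)
     (auto simp: tree_rel_def refl_on_def sym_def trans_def intro: tree_equiv_refl tree_equiv_sym tree_equiv_trans)

text \<open>The map \<open>rep\<close> sends a tree to the chosen representative of its class. Its
  fibre over a representative is the whole class, with \<open>alpha\<close> elements, so grouping
  the sum over \<open>lts\<close> by fibres produces the weights.\<close>

lemma ts_weighted_sum:
  fixes V :: "tree \<Rightarrow> real"
  assumes inv: "\<And>t t'. t \<in> lts \<Longrightarrow> t' \<in> lts \<Longrightarrow> P (rho t) \<Longrightarrow> tree_equiv t t' \<Longrightarrow> V t' = V t"
    and fin: "finite {tr \<in> lts. P (rho tr)}"
  shows "(\<Sum>tr\<in>{tr \<in> ts. P (rho tr)}. real (alpha tr) * V tr) = (\<Sum>tr\<in>{tr \<in> lts. P (rho tr)}. V tr)"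
proof -
  define rep where "rep t = (SOME u. u \<in> tree_rel `` {t})" for t
  have rep: "rep t \<in> lts" "tree_equiv t (rep t)" if "t \<in> lts" for t
  proof -
    have "t \<in> tree_rel `` {t}" using that by (simp add: tree_rel_def tree_equiv_refl)
    then have "rep t \<in> tree_rel `` {t}" unfolding rep_def by (rule someI)
    then show "rep t \<in> lts" "tree_equiv t (rep t)" by (auto simp: tree_rel_def)
  qed
  have rep_eq: "rep t = rep u" if "t \<in> lts" "u \<in> lts" "tree_equiv t u" for t u
  proof -
    have "tree_rel `` {t} = tree_rel `` {u}"
      by (rule equiv_class_eq[OF equiv_tree_rel]) (use that in \<open>simp add: tree_rel_def\<close>)
    then show ?thesis by (simp add: rep_def)
  qed
  have "lts // tree_rel = (\<lambda>t. tree_rel `` {t}) ` lts" by (auto simp: quotient_def)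
  then have ts: "ts = rep ` lts" by (simp add: ts_def image_image rep_def)
  have idem: "rep y = y" if y: "y \<in> ts" for y
  proof -
    obtain t where t: "t \<in> lts" "y = rep t" using y unfolding ts by blast
    then show ?thesis using rep_eq[OF t(1) rep(1)[OF t(1)] rep(2)[OF t(1)]] by simp
  qed
  have ts_lts: "ts \<subseteq> lts" using rep(1) unfolding ts by blast
  have fints: "finite {tr \<in> ts. P (rho tr)}" by (rule finite_subset[OF _ fin]) (use ts_lts in auto)
  have img: "rep ` {tr \<in> lts. P (rho tr)} \<subseteq> {tr \<in> ts. P (rho tr)}"
    using tree_equiv_rho[OF rep(2)] unfolding ts by auto
  have cls: "{t \<in> {tr \<in> lts. P (rho tr)}. rep t = y} = {t' \<in> lts. tree_equiv y t'}" if "y \<in> {tr \<in> ts. P (rho tr)}" for y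
  proof (intro set_eqI iffI)
    fix t assume "t \<in> {t \<in> {tr \<in> lts. P (rho tr)}. rep t = y}"
    then have t: "t \<in> lts" "rep t = y" by auto
    then have "tree_equiv y t" using tree_equiv_sym[OF t(1) rep(1)[OF t(1)] rep(2)[OF t(1)]] by simp
    then show "t \<in> {t' \<in> lts. tree_equiv y t'}" using t by simp
  next
    fix t assume "t \<in> {t' \<in> lts. tree_equiv y t'}"
    then have t: "t \<in> lts" "tree_equiv y t" by auto
    have y: "y \<in> lts" "y \<in> ts" "P (rho y)" using that ts_lts by auto
    have "rep t = y" using rep_eq[OF y(1) t] idem[OF y(2)] by simp
    then show "t \<in> {t \<in> {tr \<in> lts. P (rho tr)}. rep t = y}" using t y tree_equiv_rho[OF t(2)] by simp
  qed
  have "(\<Sum>tr\<in>{tr \<in> lts. P (rho tr)}. V tr) = (\<Sum>y\<in>{tr \<in> ts. P (rho tr)}. \<Sum>t\<in>{t \<in> {tr \<in> lts. P (rho tr)}. rep t = y}. V t)"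
    by (rule sum.group[OF fin fints img, symmetric])
  also have "\<dots> = (\<Sum>y\<in>{tr \<in> ts. P (rho tr)}. real (alpha y) * V y)"
  proof (rule sum.cong[OF refl])
    fix y assume y: "y \<in> {tr \<in> ts. P (rho tr)}"
    have "(\<Sum>t\<in>{t' \<in> lts. tree_equiv y t'}. V t) = (\<Sum>t\<in>{t' \<in> lts. tree_equiv y t'}. V y)"
      using y ts_lts by (intro sum.cong refl inv) auto
    then show "(\<Sum>t\<in>{t \<in> {tr \<in> lts. P (rho tr)}. rep t = y}. V t) = real (alpha y) * V y"
      unfolding cls[OF y] by (simp add: alpha_def)
  qed
  finally show ?thesis by simp
qed

text \<open>Invariance is required only after summation over the index values, since a single
  summand depends on how the index variables are numbered.\<close>

lemma lts_sum_eq_ts_sum: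
  fixes G :: "tree \<Rightarrow> (nat \<Rightarrow> 'm::finite) \<Rightarrow> real"
  assumes inv: "\<And>t t'. t \<in> lts \<Longrightarrow> t' \<in> lts \<Longrightarrow> P (rho t) \<Longrightarrow> tree_equiv t t' \<Longrightarrow>
      (\<Sum>js\<in>PiE {..<nsig t' div 2} (\<lambda>_. UNIV). G t' js) = (\<Sum>js\<in>PiE {..<nsig t div 2} (\<lambda>_. UNIV). G t js)"
    and fin: "finite {tr \<in> lts. P (rho tr)}"
  shows "lts_sum P G = ts_sum P G"
proof -
  define V where "V tr = (\<Sum>js\<in>PiE {..<nsig tr div 2} (\<lambda>_. UNIV). G tr js) / (2 ^ (nsig tr div 2) * fact (rho tr))" for tr
  have "(\<Sum>tr\<in>{tr \<in> ts. P (rho tr)}. real (alpha tr) * V tr) = (\<Sum>tr\<in>{tr \<in> lts. P (rho tr)}. V tr)"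
  proof (rule ts_weighted_sum[OF _ fin])
    fix t t' assume t: "t \<in> lts" "t' \<in> lts" "P (rho t)" and e: "tree_equiv t t'"
    show "V t' = V t"
      unfolding V_def unfolding inv[OF t e] unfolding tree_equiv_nsig[OF e] tree_equiv_rho[OF e] by (rule refl)
  qed
  then show ?thesis
    unfolding lts_sum_def ts_sum_def V_def
    by (simp add: sum_divide_distrib sum_distrib_left)
qed

section \<open>Invariance of elementary differentials under relabelling\<close>

lemma sum_PiE_reindex:
  fixes F :: "('i \<Rightarrow> 'c::finite) \<Rightarrow> real"
  assumes b: "bij_betw \<phi> A A"
  shows "(\<Sum>J\<in>PiE A (\<lambda>_. UNIV). F (restrict (J \<circ> \<phi>) A)) = (\<Sum>J\<in>PiE A (\<lambda>_. UNIV). F J)"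
proof -
  define \<phi>' where "\<phi>' = inv_into A \<phi>"
  have mem: "\<phi> c \<in> A" "\<phi>' c \<in> A" "\<phi> (\<phi>' c) = c" "\<phi>' (\<phi> c) = c" if "c \<in> A" for c
    using b that bij_betw_inv_into[OF b] unfolding \<phi>'_def
    by (auto simp: bij_betw_def inv_into_f_f f_inv_into_f inv_into_into)
  show ?thesis
    by (rule sum.reindex_bij_witness[of _ "\<lambda>J. restrict (J \<circ> \<phi>') A" "\<lambda>J. restrict (J \<circ> \<phi>) A"])
       (auto simp: PiE_def extensional_def restrict_def fun_eq_iff mem)
qed

lemma elem_diff_js_cong:
  fixes a :: "real^'d::finite \<Rightarrow> real^'d"
  assumes tr: "tr \<in> lts" and js: "\<And>k. k < nsig tr div 2 \<Longrightarrow> js k = js' k"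
  shows "elem_diff f a b tr js x = elem_diff f a b tr js' x"
proof -
  have "flat (node_fun f a b tr js) tr = flat (node_fun f a b tr js') tr"
  proof (rule flat_cong)
    fix i I assume i: "i < length tr"
    show "node_fun f a b tr js i I = node_fun f a b tr js' i I"
      using js lts_Sig_less[OF tr i] by (cases "snd (tr ! i)") (auto simp: node_fun_def)
  qed
  then show ?thesis by (simp add: elem_diff_flat[OF tr])
qed

text \<open>In the form \<open>flat\<close> an isomorphism is a change of variables:
  \<open>\<psi>\<close> permutes the factors, and composition with \<open>\<psi>\<close> permutes
  the assignments. The children of a node may come in a different order, which the symmetry of
  partial derivatives absorbs; only their multisets are compared.\<close>

lemma elem_diff_relabel:
  fixes a :: "real^'d::finite \<Rightarrow> real^'d" and b :: "real^'d \<Rightarrow> real^'m^'d"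
  assumes sm: "smoothp l f" "\<And>i. smoothp l (\<lambda>x. a x $ i)" "\<And>i j. smoothp l (\<lambda>x. b x $ i $ j)"
    and t1: "t1 \<in> lts" and t2: "t2 \<in> lts" and l: "length t1 \<le> Suc l"
    and len: "length t1 = length t2" and b: "bij_betw \<psi> {..<length t1} {..<length t1}" and z: "\<psi> 0 = 0"
    and f: "\<And>i. i \<in> {1..<length t1} \<Longrightarrow> fst (t2 ! \<psi> i) = \<psi> (fst (t1 ! i))"
    and c: "\<And>i. i < length t1 \<Longrightarrow> snd (t2 ! \<psi> i) = ren \<pi> (snd (t1 ! i))"
  shows "elem_diff f a b t2 js x = elem_diff f a b t1 (js \<circ> \<pi>) x"
proof -
  define N where "N = length t1"
  define h where "h = node_fun f a b t1 (js \<circ> \<pi>)"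
  have N: "0 < N" using lts_length_pos[OF t1] by (simp add: N_def)
  have inj: "inj_on \<psi> {..<N}" and img: "\<psi> ` {..<N} = {..<N}" using b by (auto simp: bij_betw_def N_def)
  have split: "{..<N} = insert 0 {1..<N}" using N by auto
  \<comment> \<open>As \<open>\<psi>\<close> fixes the root, it also permutes the nodes that carry a
    component index.\<close>
  have b1: "bij_betw \<psi> {1..<N} {1..<N}"
  proof -
    have "bij_betw \<psi> ({..<N} - {0}) ({..<N} - {0})"
      using b z N by (metis DiffD2 N_def bij_betw_DiffI bij_betw_singletonI empty_subsetI insert_subset lessThan_iff)
    moreover have "{..<N} - {0} = {1..<N}" by auto
    ultimately show ?thesis by simp
  qed
  have hh: "node_fun f a b t2 js (\<psi> i) I = h i I" if "i < N" for i I
    using c[of i] that unfolding h_def node_fun_def by (cases "snd (t1 ! i)") (auto simp: N_def)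
  have ch: "mset (children t2 (\<psi> i)) = image_mset \<psi> (mset (children t1 i))" if i: "i < N" for i
  proof -
    have "set (children t2 (\<psi> i)) = \<psi> ` set (children t1 i)"
    proof (intro set_eqI iffI)
      fix c' assume "c' \<in> set (children t2 (\<psi> i))"
      then have c': "c' \<in> {1..<N}" "fst (t2 ! c') = \<psi> i" by (auto simp: children_set N_def len)
      have "c' \<in> \<psi> ` {1..<N}" using c'(1) b1 unfolding bij_betw_def by blast
      then obtain k where k: "k \<in> {1..<N}" "c' = \<psi> k" by blast
      have "fst (t1 ! k) < N" using lts_father_less[OF t1, of k] k by (auto simp: N_def)
      moreover have "\<psi> (fst (t1 ! k)) = \<psi> i" using f[of k] k c' by (simp add: N_def)
      ultimately have "fst (t1 ! k) = i" using inj i by (auto dest: inj_onD)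
      then show "c' \<in> \<psi> ` set (children t1 i)" using k by (auto simp: children_set N_def)
    next
      fix c' assume "c' \<in> \<psi> ` set (children t1 i)"
      then obtain k where k': "k \<in> set (children t1 i)" and k3: "c' = \<psi> k" by blast
      from k' have k: "k \<in> {1..<N}" "fst (t1 ! k) = i" by (auto simp: children_set N_def)
      note k = k k3
      have "c' \<in> {1..<N}" using k b1 unfolding bij_betw_def by blast
      moreover have "fst (t2 ! c') = \<psi> i" using f[of k] k by (simp add: N_def)
      ultimately show "c' \<in> set (children t2 (\<psi> i))" by (auto simp: children_set N_def len)
    qed
    moreover have "inj_on \<psi> (set (children t1 i))"
      by (rule inj_on_subset[OF inj]) (auto simp: children_set N_def)
    ultimately show ?thesis
      by (simp add: mset_set_set[OF children_distinct, symmetric] image_mset_mset_set)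
  qed
  have fac: "pd (map J (children t2 (\<psi> i))) (node_fun f a b t2 js (\<psi> i) (J (\<psi> i))) x =
       pd (map (restrict (J \<circ> \<psi>) {1..<N}) (children t1 i)) (h i (restrict (J \<circ> \<psi>) {1..<N} i)) x" if i: "i < N" for J i
  proof -
    \<comment> \<open>\<open>restrict\<close> gives no meaningful index to the root, but the
      function at the root does not depend on it.\<close>
    have "h i (restrict (J \<circ> \<psi>) {1..<N} i) = h i (J (\<psi> i))"
    proof (cases "i = 0")
      case True
      then show ?thesis by (simp add: h_def node_fun_def lts_root[OF t1])
    next
      case False
      then show ?thesis using i by simp
    qed
    moreover have "map (restrict (J \<circ> \<psi>) {1..<N}) (children t1 i) = map (J \<circ> \<psi>) (children t1 i)"
      by (auto simp: children_set N_def)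
    moreover have "pd (map (J \<circ> \<psi>) (children t1 i)) (h i I) = pd (map J (children t2 (\<psi> i))) (h i I)" for I
    proof (rule pd_mset)
      show "smoothp l (h i I)" unfolding h_def by (rule smoothp_node_fun[OF sm])
      show "length (map (J \<circ> \<psi>) (children t1 i)) \<le> l" using children_length[of t1 i] l by simp
      show "mset (map (J \<circ> \<psi>) (children t1 i)) = mset (map J (children t2 (\<psi> i)))"
        using ch[OF i] by (simp add: multiset.map_comp)
    qed
    ultimately show ?thesis by (simp only: hh[OF i])
  qed
  define F where "F J = (\<Prod>i<N. pd (map J (children t1 i)) (h i (J i)) x)" for J
  have "elem_diff f a b t2 js x = (\<Sum>J\<in>PiE {1..<N} (\<lambda>_. UNIV). \<Prod>i<N. pd (map J (children t2 i)) (node_fun f a b t2 js i (J i)) x)"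
    by (simp add: elem_diff_flat[OF t2] flat_def N_def len)
  also have "\<dots> = (\<Sum>J\<in>PiE {1..<N} (\<lambda>_. UNIV). \<Prod>i<N. pd (map J (children t2 (\<psi> i))) (node_fun f a b t2 js (\<psi> i) (J (\<psi> i))) x)"
    by (intro sum.cong refl prod.reindex_bij_betw[OF b[folded N_def], symmetric])
  also have "\<dots> = (\<Sum>J\<in>PiE {1..<N} (\<lambda>_. UNIV). F (restrict (J \<circ> \<psi>) {1..<N}))"
    unfolding F_def by (intro sum.cong prod.cong refl fac) simp
  also have "\<dots> = (\<Sum>J\<in>PiE {1..<N} (\<lambda>_. UNIV). F J)" by (rule sum_PiE_reindex[OF b1])
  also have "\<dots> = elem_diff f a b t1 (js \<circ> \<pi>) x"
    by (simp add: elem_diff_flat[OF t1] flat_def N_def F_def h_def)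
  finally show ?thesis .
qed

text \<open>After the relabelling, the renaming \<open>\<pi>\<close> is a mere permutation of the
  summation variables; \<open>restrict\<close> brings \<open>js \<circ> \<pi>\<close> back into the
  index set.\<close>

lemma elem_diff_sum_equiv:
  fixes a :: "real^'d::finite \<Rightarrow> real^'d" and b :: "real^'d \<Rightarrow> real^'m::finite^'d"
  assumes sm: "smoothp l f" "\<And>i. smoothp l (\<lambda>x. a x $ i)" "\<And>i j. smoothp l (\<lambda>x. b x $ i $ j)"
    and t1: "t1 \<in> lts" and t2: "t2 \<in> lts" and l: "2 * rho t1 \<le> l" and eq: "tree_equiv t1 t2"
  shows "(\<Sum>js\<in>PiE {..<nsig t2 div 2} (\<lambda>_. UNIV). elem_diff f a b t2 js x) =
    (\<Sum>js\<in>PiE {..<nsig t1 div 2} (\<lambda>_. UNIV). elem_diff f a b t1 js x)"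
proof -
  define S where "S = {..<nsig t1 div 2}"
  obtain \<psi> \<pi> where len: "length t1 = length t2" and b: "bij_betw \<psi> {..<length t1} {..<length t1}" and z: "\<psi> 0 = 0"
    and p: "bij_betw \<pi> S S"
    and f: "\<And>i. i \<in> {1..<length t1} \<Longrightarrow> fst (t2 ! \<psi> i) = \<psi> (fst (t1 ! i))"
    and c: "\<And>i. i < length t1 \<Longrightarrow> snd (t2 ! \<psi> i) = ren \<pi> (snd (t1 ! i))"
    using eq unfolding tree_equiv_def S_def tree_equiv_nsig[OF eq] by blast
  have "length t1 \<le> Suc l" using lts_length_le[OF t1] l by simp
  note rl = elem_diff_relabel[OF sm t1 t2 this len b z f c]
  have "elem_diff f a b t2 js x = elem_diff f a b t1 (restrict (js \<circ> \<pi>) S) x" for js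
    by (rule trans[OF rl elem_diff_js_cong[OF t1]]) (simp_all add: S_def)
  then have "(\<Sum>js\<in>PiE S (\<lambda>_. UNIV). elem_diff f a b t2 js x) = (\<Sum>js\<in>PiE S (\<lambda>_. UNIV). elem_diff f a b t1 (restrict (js \<circ> \<pi>) S) x)"
    by simp
  also have "\<dots> = (\<Sum>js\<in>PiE S (\<lambda>_. UNIV). elem_diff f a b t1 js x)" by (rule sum_PiE_reindex[OF p])
  finally show ?thesis by (simp add: S_def tree_equiv_nsig[OF eq])
qed

subsection \<open>Wiener increments\<close>

text \<open>The larger of the two absolute values dominates both factors.\<close>

lemma young_power:
  fixes x y :: real
  shows "\<bar>y\<bar> ^ k * \<bar>x\<bar> ^ l \<le> \<bar>y\<bar> ^ (k + l) + \<bar>x\<bar> ^ (k + l)"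
proof (cases "\<bar>x\<bar> \<le> \<bar>y\<bar>")
  case True
  then have "\<bar>y\<bar> ^ k * \<bar>x\<bar> ^ l \<le> \<bar>y\<bar> ^ k * \<bar>y\<bar> ^ l" by (intro mult_left_mono power_mono) auto
  then show ?thesis by (simp add: power_add add_increasing2)
next
  case False
  then have "\<bar>y\<bar> ^ k * \<bar>x\<bar> ^ l \<le> \<bar>x\<bar> ^ k * \<bar>x\<bar> ^ l" by (intro mult_right_mono power_mono) auto
  then show ?thesis by (simp add: power_add add_increasing)
qed

text \<open>Every summand is dominated by the largest one, whose power is one term of the right-hand
  side.\<close>

lemma power_sum_le:
  fixes x :: "'i \<Rightarrow> real"
  assumes "finite A" "0 < n"
  shows "\<bar>\<Sum>i\<in>A. x i\<bar> ^ n \<le> real (card A) ^ n * (\<Sum>i\<in>A. \<bar>x i\<bar> ^ n)"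
proof (cases "A = {}")
  case False
  obtain k where k: "k \<in> A" "Max ((\<lambda>i. \<bar>x i\<bar>) ` A) = \<bar>x k\<bar>"
  proof -
    have "Max ((\<lambda>i. \<bar>x i\<bar>) ` A) \<in> (\<lambda>i. \<bar>x i\<bar>) ` A" using assms(1) False by (intro Max_in) auto
    then show thesis using that by blast
  qed
  have "\<bar>\<Sum>i\<in>A. x i\<bar> \<le> (\<Sum>i\<in>A. \<bar>x i\<bar>)" by (rule sum_abs)
  also have "\<dots> \<le> (\<Sum>i\<in>A. \<bar>x k\<bar>)" unfolding k(2)[symmetric] using assms(1) by (intro sum_mono Max_ge) auto
  finally have "\<bar>\<Sum>i\<in>A. x i\<bar> ^ n \<le> (real (card A) * \<bar>x k\<bar>) ^ n" by (intro power_mono) auto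
  also have "\<dots> = real (card A) ^ n * \<bar>x k\<bar> ^ n" by (rule power_mult_distrib)
  also have "\<dots> \<le> real (card A) ^ n * (\<Sum>i\<in>A. \<bar>x i\<bar> ^ n)"
    using k(1) assms(1) by (intro mult_left_mono member_le_sum) auto
  finally show ?thesis .
qed (use assms in \<open>auto simp: zero_power\<close>)

text \<open>Taylor's formula in \<open>e\<close>, with the linear term kept exact. Once
  \<open>e\<close> is a noise increment, the Wiener part of that term has mean zero, and this
  cancellation would be lost in an estimate by absolute values.\<close>

lemma even_power_expansion:
  assumes q: "0 < q"
  obtains C :: real where "0 \<le> C" "\<And>y e. (y + e) ^ (2 * q) \<le> y ^ (2 * q) + 2 * real q * (y ^ (2 * q - 1) * e) + C * (y ^ (2 * q - 2) * e\<^sup>2 + e ^ (2 * q))"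
proof -
  \<comment> \<open>The first two factors come from the second derivative; the power of two comes
    from splitting the power at the intermediate point between \<open>y\<close> and
    \<open>e\<close>.\<close>
  define C where "C = real (2 * q) * real (2 * q - 1) * 2 ^ (2 * q)"
  have C: "0 \<le> C" by (simp add: C_def)
  have "(y + e) ^ (2 * q) \<le> y ^ (2 * q) + 2 * real q * (y ^ (2 * q - 1) * e) + C * (y ^ (2 * q - 2) * e\<^sup>2 + e ^ (2 * q))" for y e :: real
  proof -
    define D where "D m u = (if m = 0 then (y + u * e) ^ (2 * q) else if m = 1 then real (2 * q) * (y + u * e) ^ (2 * q - 1) * e
       else real (2 * q) * (real (2 * q - 1) * (y + u * e) ^ (2 * q - 2) * e) * e)" for m :: nat and u
    have d0: "DERIV (D 0) u :> D 1 u" for u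
      unfolding D_def by (auto intro!: derivative_eq_intros)
    have d1: "DERIV (D 1) u :> D 2 u" for u
      unfolding D_def using q by (auto intro!: derivative_eq_intros simp: numeral_2_eq_2)
    have "\<forall>m t. m < 2 \<and> 0 \<le> t \<and> t \<le> 1 \<longrightarrow> DERIV (D m) t :> D (Suc m) t"
      using d0 d1 by (metis One_nat_def Suc_1 less_2_cases)
    from Maclaurin[of 1 2 D "D 0", OF _ _ _ this] obtain u where u: "0 < u" "u < 1"
      "D 0 1 = (\<Sum>m<2. D m 0 / fact m * 1 ^ m) + D 2 u / fact 2 * 1\<^sup>2" by auto
    have "D 0 1 = D 0 0 + D 1 0 + D 2 u / 2" using u(3) by (simp add: numeral_2_eq_2)
    then have eq: "(y + e) ^ (2 * q) = y ^ (2 * q) + 2 * real q * (y ^ (2 * q - 1) * e) + real (2 * q) * real (2 * q - 1) / 2 * ((y + u * e) ^ (2 * q - 2) * e\<^sup>2)"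
      by (simp add: D_def power2_eq_square)
    have "(y + u * e) ^ (2 * q - 2) \<le> 2 ^ (2 * q) * (y ^ (2 * q - 2) + e ^ (2 * q - 2))"
    proof -
      have ev: "even (2 * q - 2)" using q by simp
      have "\<bar>y + u * e\<bar> \<le> 2 * max \<bar>y\<bar> \<bar>e\<bar>"
      proof -
        have "\<bar>y + u * e\<bar> \<le> \<bar>y\<bar> + \<bar>u * e\<bar>" by (rule abs_triangle_ineq)
        also have "\<bar>u * e\<bar> \<le> 1 * \<bar>e\<bar>" unfolding abs_mult using u by (intro mult_right_mono) auto
        finally show ?thesis by (simp add: max_def)
      qed
      then have "\<bar>y + u * e\<bar> ^ (2 * q - 2) \<le> (2 * max \<bar>y\<bar> \<bar>e\<bar>) ^ (2 * q - 2)" by (intro power_mono) auto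
      also have "\<dots> = 2 ^ (2 * q - 2) * max \<bar>y\<bar> \<bar>e\<bar> ^ (2 * q - 2)" by (rule power_mult_distrib)
      also have "\<dots> \<le> 2 ^ (2 * q) * (\<bar>y\<bar> ^ (2 * q - 2) + \<bar>e\<bar> ^ (2 * q - 2))"
        by (intro mult_mono power_increasing) (auto simp: max_def)
      finally show ?thesis using ev by (simp add: power_even_abs)
    qed
    then have F: "(y + u * e) ^ (2 * q - 2) * e\<^sup>2 \<le> 2 ^ (2 * q) * (y ^ (2 * q - 2) + e ^ (2 * q - 2)) * e\<^sup>2"
      by (rule mult_right_mono) simp
    have "2 * q - 2 + 2 = 2 * q" using q by simp
    then have "e ^ (2 * q - 2) * e\<^sup>2 = e ^ (2 * q)" by (metis power_add)
    then have E: "2 ^ (2 * q) * (y ^ (2 * q - 2) + e ^ (2 * q - 2)) * e\<^sup>2 = 2 ^ (2 * q) * (y ^ (2 * q - 2) * e\<^sup>2 + e ^ (2 * q))"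
      by (simp add: algebra_simps)
    have B: "(y + u * e) ^ (2 * q - 2) * e\<^sup>2 \<le> 2 ^ (2 * q) * (y ^ (2 * q - 2) * e\<^sup>2 + e ^ (2 * q))" using F unfolding E .
    have nn: "0 \<le> y ^ (2 * q - 2) * e\<^sup>2 + e ^ (2 * q)" using q by (intro add_nonneg_nonneg mult_nonneg_nonneg) (auto simp: zero_le_even_power)
    have "real (2 * q) * real (2 * q - 1) / 2 * ((y + u * e) ^ (2 * q - 2) * e\<^sup>2) \<le> real (2 * q) * real (2 * q - 1) / 2 * (2 ^ (2 * q) * (y ^ (2 * q - 2) * e\<^sup>2 + e ^ (2 * q)))"
      using B by (intro mult_left_mono) auto
    also have "\<dots> = C / 2 * (y ^ (2 * q - 2) * e\<^sup>2 + e ^ (2 * q))" by (simp add: C_def)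
    also have "\<dots> \<le> C * (y ^ (2 * q - 2) * e\<^sup>2 + e ^ (2 * q))" using C nn by (intro mult_right_mono) auto
    finally show ?thesis unfolding eq by simp
  qed
  then show thesis using C that by blast
qed

text \<open>The \<open>k\<close>-th moment of a centred normal variable with variance
  \<open>h\<close>.\<close>

definition gmom :: "real \<Rightarrow> nat \<Rightarrow> real" where
  "gmom h k = (\<integral>x. normal_density 0 (sqrt h) x * x ^ k \<partial>lborel)"

lemma gmom_odd: "0 < h \<Longrightarrow> gmom h (2 * k + 1) = 0"
  using integral_normal_moment_odd[of "sqrt h" 0 k] by (simp add: gmom_def)

lemma gmom_even: "0 < h \<Longrightarrow> gmom h (2 * k) = fact (2 * k) / (2 ^ k * fact k) * h ^ k"
  using integral_normal_moment_even[of "sqrt h" 0 k] by (simp add: gmom_def power_divide)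

section \<open>Independence and moments of Wiener increments\<close>

locale wiener = prob_space M for M :: "'a measure" +
  fixes Fl :: "real \<Rightarrow> 'a measure" and W :: "'m::finite \<Rightarrow> real \<Rightarrow> 'a \<Rightarrow> real"
  assumes filtration: "filtration_on M Fl" and wiener: "wiener_process M Fl W"
begin

lemma space_Fl: "space (Fl t) = space M"
  using filtration by (simp add: filtration_on_def)

lemma measurable_Fl_M: "f \<in> borel_measurable (Fl t) \<Longrightarrow> f \<in> borel_measurable M"
  using filtration by (intro measurable_mono[of borel borel "Fl t" M, THEN subsetD]) (auto simp: filtration_on_def)

lemma measurable_Fl_mono: "0 \<le> s \<Longrightarrow> s \<le> t \<Longrightarrow> f \<in> borel_measurable (Fl s) \<Longrightarrow> f \<in> borel_measurable (Fl t)"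
  using filtration by (intro measurable_mono[of borel borel "Fl s" "Fl t", THEN subsetD]) (auto simp: filtration_on_def)

lemma W_measurable: "0 \<le> t \<Longrightarrow> W j t \<in> borel_measurable (Fl t)"
  using wiener by (simp add: wiener_process_def)

definition incr :: "real \<Rightarrow> real \<Rightarrow> 'a \<Rightarrow> 'm \<Rightarrow> real" where
  "incr s t \<omega> = (\<lambda>j. W j t \<omega> - W j s \<omega>)"

lemma incr_measurable: "0 \<le> s \<Longrightarrow> s \<le> t \<Longrightarrow> incr s t \<in> measurable M (PiM UNIV (\<lambda>_. borel))"
  unfolding incr_def
  by (intro measurable_PiM_single') (auto intro!: borel_measurable_diff measurable_Fl_M[OF W_measurable])

lemma incr_distr: "0 \<le> s \<Longrightarrow> s < t \<Longrightarrow>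
    distr M (PiM UNIV (\<lambda>_. borel)) (incr s t) = PiM UNIV (\<lambda>_. density lborel (normal_density 0 (sqrt (t - s))))"
  using wiener unfolding wiener_process_def incr_def by blast

text \<open>Preimages of Borel sets already form a sigma-algebra. The product formula of
  \<open>wiener_process\<close> for events is therefore the independence of the two generated
  sigma-algebras, without an argument on generators.\<close>

lemma incr_indep:
  fixes U :: "'a \<Rightarrow> real" and \<phi> :: "('m \<Rightarrow> real) \<Rightarrow> real"
  assumes st: "0 \<le> s" "s < t" and U: "U \<in> borel_measurable (Fl s)" and \<phi>: "\<phi> \<in> borel_measurable (PiM UNIV (\<lambda>_. borel))"
  shows "indep_var borel U borel (\<lambda>\<omega>. \<phi> (incr s t \<omega>))"
  unfolding indep_var_eq
proof (intro conjI)
  show "random_variable borel U" by (rule measurable_Fl_M[OF U])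
  have inc: "incr s t \<in> measurable M (PiM UNIV (\<lambda>_. borel))" using st by (intro incr_measurable) auto
  show "random_variable borel (\<lambda>\<omega>. \<phi> (incr s t \<omega>))"
    by (rule measurable_compose[OF inc \<phi>])
  have sb: "sigma_sets UNIV (sets borel) = sets (borel :: real measure)" using sets.sigma_sets_eq[of borel] by simp
  have 1: "sigma_sets (space M) {V -` A \<inter> space M |A. A \<in> sets borel} = {V -` A \<inter> space M |A. A \<in> sets borel}" for V :: "'a \<Rightarrow> real"
    by (rule sigma_sets_vimage_commute[of V "space M" UNIV "sets borel", unfolded sb, symmetric]) auto
  show "indep_set (sigma_sets (space M) {U -` A \<inter> space M |A. A \<in> sets borel})
     (sigma_sets (space M) {(\<lambda>\<omega>. \<phi> (incr s t \<omega>)) -` A \<inter> space M |A. A \<in> sets borel})"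
    unfolding 1
  proof (rule indep_setI)
    show "{U -` A \<inter> space M |A. A \<in> sets borel} \<subseteq> events"
      using measurable_sets[OF measurable_Fl_M[OF U]] by auto
    show "{(\<lambda>\<omega>. \<phi> (incr s t \<omega>)) -` A \<inter> space M |A. A \<in> sets borel} \<subseteq> events"
      using measurable_sets[OF measurable_compose[OF inc \<phi>]] by auto
    fix a b assume "a \<in> {U -` A \<inter> space M |A. A \<in> sets borel}" "b \<in> {(\<lambda>\<omega>. \<phi> (incr s t \<omega>)) -` A \<inter> space M |A. A \<in> sets borel}"
    then obtain A B where a: "a = U -` A \<inter> space M" "A \<in> sets borel" and b: "b = (\<lambda>\<omega>. \<phi> (incr s t \<omega>)) -` B \<inter> space M" "B \<in> sets borel" by blast
    have aF: "a \<in> sets (Fl s)" using measurable_sets[OF U a(2)] by (simp add: a space_Fl)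
    define B' where "B' = \<phi> -` B \<inter> space (PiM UNIV (\<lambda>_::'m. borel :: real measure))"
    have B': "B' \<in> sets (PiM UNIV (\<lambda>_::'m. borel :: real measure))" unfolding B'_def by (rule measurable_sets[OF \<phi> b(2)])
    have b': "b = incr s t -` B' \<inter> space M"
      unfolding b B'_def using measurable_space[OF inc] by auto
    have "measure M (a \<inter> (incr s t -` B' \<inter> space M)) = measure M a * measure M (incr s t -` B' \<inter> space M)"
      using wiener st aF B' unfolding wiener_process_def incr_def by (metis (no_types, lifting) Int_assoc)
    then show "prob (a \<inter> b) = prob a * prob b" by (simp add: b')
  qed
qed

text \<open>The joint law of the increments is a product of normal laws, so mixed moments
  factorise.\<close>

lemma incr_monomial:
  assumes st: "0 \<le> s" "s < t"
  shows "integrable M (\<lambda>\<omega>. \<Prod>j\<in>UNIV. incr s t \<omega> j ^ e j)" "(\<integral>\<omega>. (\<Prod>j\<in>UNIV. incr s t \<omega> j ^ e j) \<partial>M) = (\<Prod>j\<in>UNIV. gmom (t - s) (e j))"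
proof -
  let ?N = "density lborel (normal_density 0 (sqrt (t - s)))"
  have pos: "0 < sqrt (t - s)" using st by simp
  interpret N: prob_space ?N by (rule prob_space_normal_density[OF pos])
  interpret P: product_sigma_finite "\<lambda>_::'m. ?N" by standard
  have i: "integrable ?N (\<lambda>x. x ^ k)" for k
    using integrable_normal_moment[OF pos, of 0 k] by (subst integrable_density) auto
  have e: "integral\<^sup>L ?N (\<lambda>x. x ^ k) = gmom (t - s) k" for k
    unfolding gmom_def by (subst integral_density) auto
  have inc: "incr s t \<in> measurable M (PiM UNIV (\<lambda>_. borel))" using st by (intro incr_measurable) auto
  have mp: "(\<lambda>x. \<Prod>j\<in>UNIV. x j ^ e j) \<in> borel_measurable (PiM (UNIV::'m set) (\<lambda>_. borel :: real measure))"
    by measurable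
  have "integrable (PiM UNIV (\<lambda>_::'m. ?N)) (\<lambda>x. \<Prod>j\<in>UNIV. x j ^ e j)"
    by (rule P.product_integrable_prod) (auto intro: i)
  then show "integrable M (\<lambda>\<omega>. \<Prod>j\<in>UNIV. incr s t \<omega> j ^ e j)"
    unfolding incr_distr[OF st, symmetric] by (subst (asm) integrable_distr_eq[OF inc mp])
  have "(\<integral>\<omega>. (\<Prod>j\<in>UNIV. incr s t \<omega> j ^ e j) \<partial>M) = (\<integral>x. (\<Prod>j\<in>UNIV. x j ^ e j) \<partial>PiM UNIV (\<lambda>_::'m. ?N))"
    unfolding incr_distr[OF st, symmetric] by (rule integral_distr[OF inc mp, symmetric])
  also have "\<dots> = (\<Prod>j\<in>UNIV. integral\<^sup>L ?N (\<lambda>x. x ^ e j))"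
    by (rule P.product_integral_prod) (auto intro: i)
  finally show "(\<integral>\<omega>. (\<Prod>j\<in>UNIV. incr s t \<omega> j ^ e j) \<partial>M) = (\<Prod>j\<in>UNIV. gmom (t - s) (e j))" by (simp add: e)
qed

lemma mult_incr_monomial:
  assumes st: "0 \<le> s" "s < t" and U: "U \<in> borel_measurable (Fl s)" "integrable M U"
  shows "integrable M (\<lambda>\<omega>. U \<omega> * (\<Prod>j\<in>UNIV. incr s t \<omega> j ^ e j))"
    "(\<integral>\<omega>. U \<omega> * (\<Prod>j\<in>UNIV. incr s t \<omega> j ^ e j) \<partial>M) = (\<integral>\<omega>. U \<omega> \<partial>M) * (\<Prod>j\<in>UNIV. gmom (t - s) (e j))"
proof -
  have mp: "(\<lambda>x. \<Prod>j\<in>UNIV. x j ^ e j) \<in> borel_measurable (PiM (UNIV::'m set) (\<lambda>_. borel :: real measure))"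
    by measurable
  note iv = incr_indep[OF st U(1) mp]
  show "integrable M (\<lambda>\<omega>. U \<omega> * (\<Prod>j\<in>UNIV. incr s t \<omega> j ^ e j))"
    by (rule indep_var_integrable[OF iv U(2) incr_monomial(1)[OF st]])
  show "(\<integral>\<omega>. U \<omega> * (\<Prod>j\<in>UNIV. incr s t \<omega> j ^ e j) \<partial>M) = (\<integral>\<omega>. U \<omega> \<partial>M) * (\<Prod>j\<in>UNIV. gmom (t - s) (e j))"
    using indep_var_lebesgue_integral[OF iv U(2) incr_monomial(1)[OF st]] incr_monomial(2)[OF st] by simp
qed

text \<open>Index \<^term>\<open>None\<close> stands for the time increment, so that drift and diffusion are treated alike.\<close>
definition noise :: "real \<Rightarrow> real \<Rightarrow> 'm option \<Rightarrow> 'a \<Rightarrow> real" where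
  "noise u h c \<omega> = (case c of None \<Rightarrow> h | Some j \<Rightarrow> W j (u + h) \<omega> - W j u \<omega>)"

lemma noise_Some: "noise u h (Some j) \<omega> = incr u (u + h) \<omega> j"
  by (simp add: noise_def incr_def)

lemma noise_None: "noise u h None \<omega> = h"
  by (simp add: noise_def)

lemma noise_measurable:
  assumes "0 \<le> u" "0 \<le> h" shows "noise u h c \<in> borel_measurable (Fl (u + h))"
proof (cases c)
  case (Some j)
  have "W j u \<in> borel_measurable (Fl (u + h))"
    by (rule measurable_Fl_mono[OF assms(1) _ W_measurable]) (use assms in auto)
  moreover have "W j (u + h) \<in> borel_measurable (Fl (u + h))" by (rule W_measurable) (use assms in auto)
  ultimately show ?thesis using Some by (simp add: noise_def[abs_def])
qed (simp add: noise_def[abs_def])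

lemma prod_if_single:
  fixes g :: "nat \<Rightarrow> real"
  assumes "g 0 = 1" shows "(\<Prod>l\<in>UNIV. g (if l = (j::'m) then k else 0)) = g k"
proof -
  have "(\<Prod>l\<in>UNIV. g (if l = j then k else 0)) = (\<Prod>l\<in>UNIV. if l = j then g k else 1)"
    by (intro prod.cong) (auto simp: assms)
  then show ?thesis by simp
qed

lemma gmom_0: "0 < h \<Longrightarrow> gmom h 0 = 1"
  using gmom_even[of h 0] by simp

lemma gmom_1: "0 < h \<Longrightarrow> gmom h 1 = 0"
  using gmom_odd[of h 0] by simp

lemma gmom_2: "0 < h \<Longrightarrow> gmom h 2 = h"
  using gmom_even[of h 1] by (simp add: fact_2)

lemma mult_noise_power:
  assumes u: "0 \<le> u" "0 < h" and U: "U \<in> borel_measurable (Fl u)" "integrable M U"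
  shows "integrable M (\<lambda>\<omega>. U \<omega> * noise u h c \<omega> ^ k)"
    "(\<integral>\<omega>. U \<omega> * noise u h c \<omega> ^ k \<partial>M) = (\<integral>\<omega>. U \<omega> \<partial>M) * (case c of None \<Rightarrow> h ^ k | Some j \<Rightarrow> gmom h k)"
proof -
  have "integrable M (\<lambda>\<omega>. U \<omega> * noise u h c \<omega> ^ k) \<and>
    (\<integral>\<omega>. U \<omega> * noise u h c \<omega> ^ k \<partial>M) = (\<integral>\<omega>. U \<omega> \<partial>M) * (case c of None \<Rightarrow> h ^ k | Some j \<Rightarrow> gmom h k)"
  proof (cases c)
    case None
    then show ?thesis using U by (simp add: noise_None)
  next
    case (Some j)
    have st: "0 \<le> u" "u < u + h" using u by auto
    have "(\<Prod>l\<in>UNIV. incr u (u + h) \<omega> l ^ (if l = j then k else 0)) = noise u h c \<omega> ^ k" for \<omega>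
    proof -
      have "(\<Prod>l\<in>UNIV. incr u (u + h) \<omega> l ^ (if l = j then k else 0)) = (\<Prod>l\<in>UNIV. if l = j then incr u (u + h) \<omega> j ^ k else 1)"
        by (intro prod.cong) auto
      then show ?thesis using Some by (simp add: noise_Some)
    qed
    moreover have "(\<Prod>l\<in>UNIV. gmom (u + h - u) (if l = j then k else 0)) = gmom h k"
      using prod_if_single[of "gmom h" j k] gmom_0[OF u(2)] by simp
    ultimately show ?thesis
      using mult_incr_monomial[OF st U, of "\<lambda>l. if l = j then k else 0"] Some by simp
  qed
  then show "integrable M (\<lambda>\<omega>. U \<omega> * noise u h c \<omega> ^ k)"
    "(\<integral>\<omega>. U \<omega> * noise u h c \<omega> ^ k \<partial>M) = (\<integral>\<omega>. U \<omega> \<partial>M) * (case c of None \<Rightarrow> h ^ k | Some j \<Rightarrow> gmom h k)" by auto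
qed

lemma mult_noise_mean:
  assumes u: "0 \<le> u" "0 < h" and U: "U \<in> borel_measurable (Fl u)" "integrable M U"
  shows "integrable M (\<lambda>\<omega>. U \<omega> * noise u h c \<omega>)"
    "(\<integral>\<omega>. U \<omega> * noise u h c \<omega> \<partial>M) = (if c = None then h * (\<integral>\<omega>. U \<omega> \<partial>M) else 0)"
  using mult_noise_power[OF assms, of c 1] gmom_1[OF u(2)] by (auto split: option.splits)

text \<open>The multiplication table of Ito calculus in mean: the product of two distinct noises
  averages to zero, a squared Wiener increment has mean \<open>h\<close>, and the squared time
  increment contributes only \<open>h\<^sup>2\<close>.\<close>

lemma mult_noise_noise:
  assumes u: "0 \<le> u" "0 < h" and U: "U \<in> borel_measurable (Fl u)" "integrable M U"
  shows "integrable M (\<lambda>\<omega>. U \<omega> * (noise u h c \<omega> * noise u h c' \<omega>))"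
    "(\<integral>\<omega>. U \<omega> * (noise u h c \<omega> * noise u h c' \<omega>) \<partial>M) = (\<integral>\<omega>. U \<omega> \<partial>M) * (if c = c' then if c = None then h\<^sup>2 else h else 0)"
proof -
  have "integrable M (\<lambda>\<omega>. U \<omega> * (noise u h c \<omega> * noise u h c' \<omega>)) \<and>
    (\<integral>\<omega>. U \<omega> * (noise u h c \<omega> * noise u h c' \<omega>) \<partial>M) = (\<integral>\<omega>. U \<omega> \<partial>M) * (if c = c' then if c = None then h\<^sup>2 else h else 0)"
  proof (cases "c = c'")
    case True
    then show ?thesis using mult_noise_power[OF u U, of c 2] gmom_2[OF u(2)] by (auto simp: power2_eq_square split: option.splits)
  next
    case ne: False
    show ?thesis
    proof (cases "c = None \<or> c' = None")
      case True
      have hU: "(\<lambda>\<omega>. h * U \<omega>) \<in> borel_measurable (Fl u)" "integrable M (\<lambda>\<omega>. h * U \<omega>)" using U by auto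
      from True ne show ?thesis
        using mult_noise_mean[OF u hU, of c] mult_noise_mean[OF u hU, of c'] by (auto simp: noise_None mult_ac)
    next
      case False
      then obtain i j where ij: "c = Some i" "c' = Some j" "i \<noteq> j" using ne by (cases c; cases c') auto
      have st: "0 \<le> u" "u < u + h" using u by auto
      let ?e = "\<lambda>l. if l = i \<or> l = j then 1 else 0 :: nat"
      have "(\<Prod>l\<in>UNIV. incr u (u + h) \<omega> l ^ ?e l) = noise u h c \<omega> * noise u h c' \<omega>" for \<omega>
      proof -
        have "(\<Prod>l\<in>UNIV. incr u (u + h) \<omega> l ^ ?e l) = (\<Prod>l\<in>{i, j}. incr u (u + h) \<omega> l ^ ?e l)"
          by (rule prod.mono_neutral_right) auto
        then show ?thesis using ij by (simp add: noise_Some)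
      qed
      moreover have "(\<Prod>l\<in>UNIV. gmom (u + h - u) (?e l)) = 0"
        by (rule prod_zero) (use gmom_1[OF u(2)] in \<open>auto intro!: bexI[of _ i]\<close>)
      ultimately show ?thesis using mult_incr_monomial[OF st U, of ?e] ij by simp
    qed
  qed
  then show "integrable M (\<lambda>\<omega>. U \<omega> * (noise u h c \<omega> * noise u h c' \<omega>))"
    "(\<integral>\<omega>. U \<omega> * (noise u h c \<omega> * noise u h c' \<omega>) \<partial>M) = (\<integral>\<omega>. U \<omega> \<partial>M) * (if c = c' then if c = None then h\<^sup>2 else h else 0)" by auto
qed

lemma mult_noise_even_le:
  obtains g :: real where "0 \<le> g" "\<And>u h U c. 0 \<le> u \<Longrightarrow> 0 < h \<Longrightarrow> h \<le> 1 \<Longrightarrow> U \<in> borel_measurable (Fl u) \<Longrightarrow> integrable M U \<Longrightarrow>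
    (\<And>\<omega>. 0 \<le> U \<omega>) \<Longrightarrow> (\<integral>\<omega>. U \<omega> * noise u h c \<omega> ^ (2 * k) \<partial>M) \<le> g * h ^ k * (\<integral>\<omega>. U \<omega> \<partial>M)"
proof
  \<comment> \<open>The \<open>1\<close> covers the time increment, where
    \<open>h ^ (2 * k) \<le> h ^ k\<close> because \<open>h \<le> 1\<close>; the fraction is the
    normal moment of order \<open>2 * k\<close> for unit variance.\<close>
  define g :: real where "g = 1 + fact (2 * k) / (2 ^ k * fact k)"
  show "0 \<le> g" by (simp add: g_def add_nonneg_nonneg)
  fix u h :: real and U :: "'a \<Rightarrow> real" and c :: "'m option" assume u: "0 \<le> u" "0 < h" "h \<le> 1" and U: "U \<in> borel_measurable (Fl u)" "integrable M U" and nn: "\<And>\<omega>. 0 \<le> U \<omega>"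
  have I: "0 \<le> (\<integral>\<omega>. U \<omega> \<partial>M)" by (rule Bochner_Integration.integral_nonneg) (simp add: nn)
  have "(case c of None \<Rightarrow> h ^ (2 * k) | Some j \<Rightarrow> gmom h (2 * k)) \<le> g * h ^ k"
  proof (cases c)
    case None
    have "h ^ (2 * k) \<le> 1 * h ^ k" using u power_decreasing[of k "2 * k" h] by simp
    also have "\<dots> \<le> g * h ^ k" using u by (intro mult_right_mono) (auto simp: g_def)
    finally show ?thesis using None by simp
  next
    case (Some j)
    have "gmom h (2 * k) \<le> g * h ^ k" unfolding gmom_even[OF u(2)] using u by (intro mult_right_mono) (auto simp: g_def)
    then show ?thesis using Some by simp
  qed
  then have "(\<integral>\<omega>. U \<omega> \<partial>M) * (case c of None \<Rightarrow> h ^ (2 * k) | Some j \<Rightarrow> gmom h (2 * k)) \<le> (\<integral>\<omega>. U \<omega> \<partial>M) * (g * h ^ k)"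
    using I by (rule mult_left_mono)
  then show "(\<integral>\<omega>. U \<omega> * noise u h c \<omega> ^ (2 * k) \<partial>M) \<le> g * h ^ k * (\<integral>\<omega>. U \<omega> \<partial>M)"
    unfolding mult_noise_power(2)[OF u(1,2) U] by (simp only: mult.commute)
qed

text \<open>One step of a discrete Gronwall estimate. The coefficients are known at time
  \<open>u\<close> and hence independent of the increment, so in the first-order term only the time
  increment survives. It is of order \<open>h\<close>, as are the remaining terms. Mixed powers of
  \<open>y\<close> and the coefficients are separated by \<open>young_power\<close>.\<close>

lemma moment_step:
  assumes q: "0 < q"
  obtains C :: real where "0 \<le> C" "\<And>u h y \<kappa>. 0 \<le> u \<Longrightarrow> 0 < h \<Longrightarrow> h \<le> 1 \<Longrightarrow> y \<in> borel_measurable (Fl u) \<Longrightarrow>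
     (\<And>c. \<kappa> c \<in> borel_measurable (Fl u)) \<Longrightarrow> integrable M (\<lambda>\<omega>. y \<omega> ^ (2 * q)) \<Longrightarrow> (\<And>c. integrable M (\<lambda>\<omega>. \<kappa> c \<omega> ^ (2 * q))) \<Longrightarrow>
     integrable M (\<lambda>\<omega>. (y \<omega> + (\<Sum>c\<in>UNIV. \<kappa> c \<omega> * noise u h c \<omega>)) ^ (2 * q)) \<and>
     (\<integral>\<omega>. (y \<omega> + (\<Sum>c\<in>UNIV. \<kappa> c \<omega> * noise u h c \<omega>)) ^ (2 * q) \<partial>M) \<le>
       (\<integral>\<omega>. y \<omega> ^ (2 * q) \<partial>M) + C * h * ((\<integral>\<omega>. y \<omega> ^ (2 * q) \<partial>M) + (\<Sum>c\<in>UNIV. \<integral>\<omega>. \<kappa> c \<omega> ^ (2 * q) \<partial>M))"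
proof -
  obtain C0 where C0: "0 \<le> C0" and pow: "\<And>y e :: real. (y + e) ^ (2 * q) \<le> y ^ (2 * q) + 2 * real q * (y ^ (2 * q - 1) * e) + C0 * (y ^ (2 * q - 2) * e\<^sup>2 + e ^ (2 * q))"
    using even_power_expansion[OF q] by metis
  obtain g1 where g1: "0 \<le> g1" "\<And>u h U c. 0 \<le> u \<Longrightarrow> 0 < h \<Longrightarrow> h \<le> 1 \<Longrightarrow> U \<in> borel_measurable (Fl u) \<Longrightarrow> integrable M U \<Longrightarrow>
    (\<And>\<omega>. 0 \<le> U \<omega>) \<Longrightarrow> (\<integral>\<omega>. U \<omega> * noise u h c \<omega> ^ (2 * 1) \<partial>M) \<le> g1 * h ^ 1 * (\<integral>\<omega>. U \<omega> \<partial>M)"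
    using mult_noise_even_le[of 1] by blast
  obtain gq where gq: "0 \<le> gq" "\<And>u h U c. 0 \<le> u \<Longrightarrow> 0 < h \<Longrightarrow> h \<le> 1 \<Longrightarrow> U \<in> borel_measurable (Fl u) \<Longrightarrow> integrable M U \<Longrightarrow>
    (\<And>\<omega>. 0 \<le> U \<omega>) \<Longrightarrow> (\<integral>\<omega>. U \<omega> * noise u h c \<omega> ^ (2 * q) \<partial>M) \<le> gq * h ^ q * (\<integral>\<omega>. U \<omega> \<partial>M)"
    using mult_noise_even_le[of q] by blast
  define m where "m = real (card (UNIV :: 'm option set))"
  have m: "0 \<le> m" by (simp add: m_def)
  \<comment> \<open>The three contributions belong to \<open>T1\<close>, \<open>T2\<close> and
    \<open>T3\<close> below. \<open>m\<close> is the number of noise sources; its powers stem from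
    \<open>power_sum_le\<close> and from summing over the sources.\<close>
  define C where "C = 2 * real q + C0 * (m\<^sup>2 * (m * g1) + m ^ (2 * q) * gq)"
  have C: "0 \<le> C" unfolding C_def using C0 m g1(1) gq(1) by (intro add_nonneg_nonneg mult_nonneg_nonneg) auto
  show thesis
  proof (rule that[OF C])
    fix u h :: real and y :: "'a \<Rightarrow> real" and \<kappa> :: "'m option \<Rightarrow> 'a \<Rightarrow> real"
    assume u: "0 \<le> u" "0 < h" "h \<le> 1" and ym: "y \<in> borel_measurable (Fl u)" and km: "\<And>c. \<kappa> c \<in> borel_measurable (Fl u)"
      and yi: "integrable M (\<lambda>\<omega>. y \<omega> ^ (2 * q))" and ki: "\<And>c. integrable M (\<lambda>\<omega>. \<kappa> c \<omega> ^ (2 * q))"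
    define e where "e \<omega> = (\<Sum>c\<in>UNIV. \<kappa> c \<omega> * noise u h c \<omega>)" for \<omega>
    define Ey where "Ey = (\<integral>\<omega>. y \<omega> ^ (2 * q) \<partial>M)"
    define Ek where "Ek c = (\<integral>\<omega>. \<kappa> c \<omega> ^ (2 * q) \<partial>M)" for c
    define K where "K = Ey + (\<Sum>c\<in>UNIV. Ek c)"
    have Ey: "0 \<le> Ey" unfolding Ey_def by (rule Bochner_Integration.integral_nonneg) (simp add: zero_le_even_power)
    have Ek: "0 \<le> Ek c" for c unfolding Ek_def by (rule Bochner_Integration.integral_nonneg) (simp add: zero_le_even_power)
    have EkK: "Ey + Ek c \<le> K" for c unfolding K_def using member_le_sum[of c UNIV Ek] Ek by simp
    have K0: "0 \<le> K" using EkK[of None] Ek[of None] Ey by simp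
    have ymM: "y \<in> borel_measurable M" and kmM: "\<kappa> c \<in> borel_measurable M" for c using ym km by (auto intro: measurable_Fl_M)
    have mix: "integrable M (\<lambda>\<omega>. y \<omega> ^ k * \<kappa> c \<omega> ^ l)" "\<bar>\<integral>\<omega>. y \<omega> ^ k * \<kappa> c \<omega> ^ l \<partial>M\<bar> \<le> K" if kl: "k + l = 2 * q" for k l c
    proof -
      have b: "\<bar>y \<omega> ^ k * \<kappa> c \<omega> ^ l\<bar> \<le> y \<omega> ^ (2 * q) + \<kappa> c \<omega> ^ (2 * q)" for \<omega>
        using young_power[of "y \<omega>" k "\<kappa> c \<omega>" l] kl by (simp add: abs_mult power_abs[symmetric] zero_le_even_power)
      show i: "integrable M (\<lambda>\<omega>. y \<omega> ^ k * \<kappa> c \<omega> ^ l)"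
      proof (rule Bochner_Integration.integrable_bound[OF Bochner_Integration.integrable_add[OF yi ki[of c]]])
        show "(\<lambda>\<omega>. y \<omega> ^ k * \<kappa> c \<omega> ^ l) \<in> borel_measurable M"
          by (intro borel_measurable_times borel_measurable_power ymM kmM)
        have "norm (y \<omega> ^ k * \<kappa> c \<omega> ^ l) \<le> norm (y \<omega> ^ (2 * q) + \<kappa> c \<omega> ^ (2 * q))" for \<omega>
          unfolding real_norm_def by (rule order_trans[OF b abs_ge_self])
        then show "AE \<omega> in M. norm (y \<omega> ^ k * \<kappa> c \<omega> ^ l) \<le> norm (y \<omega> ^ (2 * q) + \<kappa> c \<omega> ^ (2 * q))" by simp
      qed
      have "\<bar>\<integral>\<omega>. y \<omega> ^ k * \<kappa> c \<omega> ^ l \<partial>M\<bar> \<le> (\<integral>\<omega>. \<bar>y \<omega> ^ k * \<kappa> c \<omega> ^ l\<bar> \<partial>M)" by (rule integral_abs_bound)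
      also have "\<dots> \<le> (\<integral>\<omega>. y \<omega> ^ (2 * q) + \<kappa> c \<omega> ^ (2 * q) \<partial>M)"
        using b i yi ki by (intro integral_mono integrable_abs Bochner_Integration.integrable_add) auto
      also have "\<dots> = Ey + Ek c" unfolding Ey_def Ek_def using yi ki by (rule Bochner_Integration.integral_add)
      finally show "\<bar>\<integral>\<omega>. y \<omega> ^ k * \<kappa> c \<omega> ^ l \<partial>M\<bar> \<le> K" using EkK[of c] by simp
    qed
    \<comment> \<open>The terms of the expansion, sorted by noise source: linear in the noise,
      quadratic with a power of \<open>y\<close> left over, and the pure power of order
      \<open>2 * q\<close>.\<close>
    define T1 where "T1 c \<omega> = (y \<omega> ^ (2 * q - 1) * \<kappa> c \<omega> ^ 1) * noise u h c \<omega>" for c \<omega>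
    define T2 where "T2 c \<omega> = (y \<omega> ^ (2 * q - 2) * \<kappa> c \<omega> ^ 2) * noise u h c \<omega> ^ (2 * 1)" for c \<omega>
    define T3 where "T3 c \<omega> = \<kappa> c \<omega> ^ (2 * q) * noise u h c \<omega> ^ (2 * q)" for c \<omega>
    have T1i: "integrable M (T1 c)" and T1e: "(\<integral>\<omega>. T1 c \<omega> \<partial>M) = (if c = None then h * (\<integral>\<omega>. y \<omega> ^ (2 * q - 1) * \<kappa> c \<omega> ^ 1 \<partial>M) else 0)" for c
    proof -
      have q1: "2 * q - 1 + 1 = 2 * q" using q by simp
      have "(\<lambda>\<omega>. y \<omega> ^ (2 * q - 1) * \<kappa> c \<omega> ^ 1) \<in> borel_measurable (Fl u)"
        by (intro borel_measurable_times borel_measurable_power ym km)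
      note mult_noise_mean[OF u(1,2) this mix(1)[OF q1]]
      then show "integrable M (T1 c)" "(\<integral>\<omega>. T1 c \<omega> \<partial>M) = (if c = None then h * (\<integral>\<omega>. y \<omega> ^ (2 * q - 1) * \<kappa> c \<omega> ^ 1 \<partial>M) else 0)"
        unfolding T1_def by blast+
    qed
    have q2: "2 * q - 2 + 2 = 2 * q" using q by simp
    have T2i: "integrable M (T2 c)" for c
      unfolding T2_def by (intro mult_noise_power(1)[OF u(1,2)] borel_measurable_times borel_measurable_power ym km mix q2)
    have T2e: "(\<integral>\<omega>. T2 c \<omega> \<partial>M) \<le> g1 * h * K" for c
    proof -
      have "(\<integral>\<omega>. T2 c \<omega> \<partial>M) \<le> g1 * h ^ 1 * (\<integral>\<omega>. y \<omega> ^ (2 * q - 2) * \<kappa> c \<omega> ^ 2 \<partial>M)"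
        unfolding T2_def by (intro g1(2)[OF u] borel_measurable_times borel_measurable_power ym km mix q2)
           (auto intro!: mult_nonneg_nonneg simp: zero_le_even_power)
      also have "\<dots> \<le> g1 * h ^ 1 * K" using mix(2)[OF q2, of c] g1(1) u by (intro mult_left_mono) auto
      finally show ?thesis by simp
    qed
    have T3i: "integrable M (T3 c)" for c
      unfolding T3_def by (intro mult_noise_power(1)[OF u(1,2)] borel_measurable_power km ki)
    have T3e: "(\<integral>\<omega>. T3 c \<omega> \<partial>M) \<le> gq * h * Ek c" for c
    proof -
      have "(\<integral>\<omega>. T3 c \<omega> \<partial>M) \<le> gq * h ^ q * Ek c"
        unfolding T3_def Ek_def by (intro gq(2)[OF u] borel_measurable_power km ki) (simp add: zero_le_even_power)
      also have "\<dots> \<le> gq * h * Ek c"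
        using gq(1) Ek u q power_decreasing[of 1 q h] by (intro mult_right_mono mult_left_mono) auto
      finally show ?thesis .
    qed
    define G where "G \<omega> = y \<omega> ^ (2 * q) + 2 * real q * (\<Sum>c\<in>UNIV. T1 c \<omega>) + C0 * (m\<^sup>2 * (\<Sum>c\<in>UNIV. T2 c \<omega>) + m ^ (2 * q) * (\<Sum>c\<in>UNIV. T3 c \<omega>))" for \<omega>
    have le: "(y \<omega> + e \<omega>) ^ (2 * q) \<le> G \<omega>" for \<omega>
    proof -
      have 1: "y \<omega> ^ (2 * q - 1) * e \<omega> = (\<Sum>c\<in>UNIV. T1 c \<omega>)"
        by (simp add: e_def T1_def sum_distrib_left mult.assoc)
      have "(e \<omega>)\<^sup>2 \<le> m\<^sup>2 * (\<Sum>c\<in>UNIV. (\<kappa> c \<omega> * noise u h c \<omega>)\<^sup>2)"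
        using power_sum_le[of "UNIV :: 'm option set" 2 "\<lambda>c. \<kappa> c \<omega> * noise u h c \<omega>"] by (simp add: e_def m_def)
      then have "y \<omega> ^ (2 * q - 2) * (e \<omega>)\<^sup>2 \<le> y \<omega> ^ (2 * q - 2) * (m\<^sup>2 * (\<Sum>c\<in>UNIV. (\<kappa> c \<omega> * noise u h c \<omega>)\<^sup>2))"
        by (rule mult_left_mono) (simp add: zero_le_even_power)
      also have "\<dots> = m\<^sup>2 * (\<Sum>c\<in>UNIV. T2 c \<omega>)"
        by (simp add: T2_def sum_distrib_left power_mult_distrib mult_ac)
      finally have 2: "y \<omega> ^ (2 * q - 2) * (e \<omega>)\<^sup>2 \<le> m\<^sup>2 * (\<Sum>c\<in>UNIV. T2 c \<omega>)" .
      have 3: "e \<omega> ^ (2 * q) \<le> m ^ (2 * q) * (\<Sum>c\<in>UNIV. T3 c \<omega>)"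
        using power_sum_le[of "UNIV :: 'm option set" "2 * q" "\<lambda>c. \<kappa> c \<omega> * noise u h c \<omega>"] q
        by (simp add: e_def m_def T3_def power_mult_distrib power_even_abs)
      have "(y \<omega> + e \<omega>) ^ (2 * q) \<le> y \<omega> ^ (2 * q) + 2 * real q * (y \<omega> ^ (2 * q - 1) * e \<omega>) + C0 * (y \<omega> ^ (2 * q - 2) * (e \<omega>)\<^sup>2 + e \<omega> ^ (2 * q))"
        by (rule pow)
      also have "\<dots> \<le> G \<omega>" unfolding G_def 1 using 2 3 C0 by (intro add_left_mono mult_left_mono add_mono) auto
      finally show ?thesis .
    qed
    have Gi: "integrable M G"
      unfolding G_def using yi T1i T2i T3i
      by (intro Bochner_Integration.integrable_add integrable_mult_right Bochner_Integration.integrable_sum) auto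
    have em: "e \<in> borel_measurable M"
      unfolding e_def using measurable_Fl_M[OF noise_measurable] u
      by (intro borel_measurable_sum borel_measurable_times kmM) auto
    have i: "integrable M (\<lambda>\<omega>. (y \<omega> + e \<omega>) ^ (2 * q))"
    proof (rule Bochner_Integration.integrable_bound[OF Gi])
      show "(\<lambda>\<omega>. (y \<omega> + e \<omega>) ^ (2 * q)) \<in> borel_measurable M" by (intro borel_measurable_power borel_measurable_add ymM em)
      have "norm ((y \<omega> + e \<omega>) ^ (2 * q)) \<le> norm (G \<omega>)" for \<omega>
      proof -
        have "0 \<le> (y \<omega> + e \<omega>) ^ (2 * q)" by (simp add: zero_le_even_power)
        then show ?thesis using le[of \<omega>] unfolding real_norm_def by linarith
      qed
      then show "AE \<omega> in M. norm ((y \<omega> + e \<omega>) ^ (2 * q)) \<le> norm (G \<omega>)" by simp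
    qed
    have "(\<integral>\<omega>. (y \<omega> + e \<omega>) ^ (2 * q) \<partial>M) \<le> (\<integral>\<omega>. G \<omega> \<partial>M)" by (rule integral_mono[OF i Gi le])
    also have "\<dots> = Ey + 2 * real q * (\<Sum>c\<in>UNIV. \<integral>\<omega>. T1 c \<omega> \<partial>M) + C0 * (m\<^sup>2 * (\<Sum>c\<in>UNIV. \<integral>\<omega>. T2 c \<omega> \<partial>M) + m ^ (2 * q) * (\<Sum>c\<in>UNIV. \<integral>\<omega>. T3 c \<omega> \<partial>M))"
      unfolding G_def Ey_def using yi T1i T2i T3i by simp
    also have "\<dots> \<le> Ey + 2 * real q * (h * K) + C0 * (m\<^sup>2 * (m * g1 * h * K) + m ^ (2 * q) * (gq * h * K))"
    proof -
      have "(\<Sum>c\<in>UNIV. \<integral>\<omega>. T1 c \<omega> \<partial>M) = h * (\<integral>\<omega>. y \<omega> ^ (2 * q - 1) * \<kappa> None \<omega> ^ 1 \<partial>M)"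
        unfolding T1e by simp
      also have "\<dots> \<le> h * K" using mix(2)[of "2 * q - 1" 1 None] q u by (intro mult_left_mono) auto
      finally have 1: "(\<Sum>c\<in>UNIV. \<integral>\<omega>. T1 c \<omega> \<partial>M) \<le> h * K" .
      have "(\<Sum>c\<in>UNIV. \<integral>\<omega>. T2 c \<omega> \<partial>M) \<le> (\<Sum>c\<in>(UNIV :: 'm option set). g1 * h * K)" by (intro sum_mono T2e)
      then have 2: "(\<Sum>c\<in>UNIV. \<integral>\<omega>. T2 c \<omega> \<partial>M) \<le> m * g1 * h * K" by (simp add: m_def)
      have "(\<Sum>c\<in>UNIV. \<integral>\<omega>. T3 c \<omega> \<partial>M) \<le> (\<Sum>c\<in>UNIV. gq * h * Ek c)" by (intro sum_mono T3e)
      also have "\<dots> = gq * h * (\<Sum>c\<in>UNIV. Ek c)" by (simp add: sum_distrib_left)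
      also have "\<dots> \<le> gq * h * K" unfolding K_def using gq(1) u Ey by (intro mult_left_mono) auto
      finally have 3: "(\<Sum>c\<in>UNIV. \<integral>\<omega>. T3 c \<omega> \<partial>M) \<le> gq * h * K" .
      show ?thesis using 1 2 3 C0 m by (intro add_mono mult_left_mono order_refl) auto
    qed
    also have "\<dots> = Ey + C * h * K" by (simp add: C_def algebra_simps)
    finally show "integrable M (\<lambda>\<omega>. (y \<omega> + (\<Sum>c\<in>UNIV. \<kappa> c \<omega> * noise u h c \<omega>)) ^ (2 * q)) \<and>
     (\<integral>\<omega>. (y \<omega> + (\<Sum>c\<in>UNIV. \<kappa> c \<omega> * noise u h c \<omega>)) ^ (2 * q) \<partial>M) \<le>
       (\<integral>\<omega>. y \<omega> ^ (2 * q) \<partial>M) + C * h * ((\<integral>\<omega>. y \<omega> ^ (2 * q) \<partial>M) + (\<Sum>c\<in>UNIV. \<integral>\<omega>. \<kappa> c \<omega> ^ (2 * q) \<partial>M))"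
      using i by (simp add: e_def Ey_def Ek_def K_def)
  qed
qed

section \<open>Moments of left-point Riemann sums\<close>

definition rsum :: "real \<Rightarrow> real \<Rightarrow> nat \<Rightarrow> (real \<Rightarrow> 'm option \<Rightarrow> 'a \<Rightarrow> real) \<Rightarrow> 'a \<Rightarrow> real" where
  "rsum s h N \<kappa> \<omega> = (\<Sum>k<N. \<Sum>c\<in>UNIV. \<kappa> (s + real k * h) c \<omega> * noise (s + real k * h) h c \<omega>)"

lemma rsum_Suc: "rsum s h (Suc N) \<kappa> \<omega> = rsum s h N \<kappa> \<omega> + (\<Sum>c\<in>UNIV. \<kappa> (s + real N * h) c \<omega> * noise (s + real N * h) h c \<omega>)"
  by (simp add: rsum_def)

lemma rsum_measurable:
  assumes s: "0 \<le> s" "0 \<le> h"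
  shows "(\<And>k c. k < N \<Longrightarrow> \<kappa> (s + real k * h) c \<in> borel_measurable (Fl (s + real k * h))) \<Longrightarrow> rsum s h N \<kappa> \<in> borel_measurable (Fl (s + real N * h))"
proof (induction N)
  case (Suc N)
  have nn: "0 \<le> s + real N * h" "s + real N * h \<le> s + real (Suc N) * h" using s by (auto simp: algebra_simps)
  have e: "s + real (Suc N) * h = (s + real N * h) + h" by (simp add: algebra_simps)
  have nm: "noise (s + real N * h) h c \<in> borel_measurable (Fl (s + real (Suc N) * h))" for c
    unfolding e by (rule noise_measurable[OF nn(1) s(2)])
  have "rsum s h N \<kappa> \<in> borel_measurable (Fl (s + real (Suc N) * h))"
    by (rule measurable_Fl_mono[OF nn]) (use Suc in auto)
  moreover have "(\<lambda>\<omega>. \<Sum>c\<in>UNIV. \<kappa> (s + real N * h) c \<omega> * noise (s + real N * h) h c \<omega>) \<in> borel_measurable (Fl (s + real (Suc N) * h))"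
    by (intro borel_measurable_sum borel_measurable_times measurable_Fl_mono[OF nn Suc.prems] nm) simp
  ultimately show ?case unfolding rsum_Suc[abs_def] by (rule borel_measurable_add)
qed (simp add: rsum_def[abs_def])

text \<open>Iteration of \<open>moment_step\<close>. The bounds \<open>D\<close> on the coefficients
  are left open instead of being tied to \<open>y\<close>, so that the same estimate serves for the
  stopped coefficients, where they grow from step to step, and later for the true ones, where they
  are constant.\<close>

lemma moment_rsum:
  assumes q: "0 < q"
  obtains C :: real where "0 \<le> C" "\<And>s h N y \<kappa> D. 0 \<le> s \<Longrightarrow> 0 < h \<Longrightarrow> h \<le> 1 \<Longrightarrow> y \<in> borel_measurable (Fl s) \<Longrightarrow> integrable M (\<lambda>\<omega>. y \<omega> ^ (2 * q)) \<Longrightarrow>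
     (\<And>k c. k < N \<Longrightarrow> \<kappa> (s + real k * h) c \<in> borel_measurable (Fl (s + real k * h))) \<Longrightarrow>
     (\<And>k c. k < N \<Longrightarrow> integrable M (\<lambda>\<omega>. \<kappa> (s + real k * h) c \<omega> ^ (2 * q))) \<Longrightarrow>
     (\<And>k. k < N \<Longrightarrow> (\<Sum>c\<in>UNIV. \<integral>\<omega>. \<kappa> (s + real k * h) c \<omega> ^ (2 * q) \<partial>M) \<le> D k) \<Longrightarrow>
     integrable M (\<lambda>\<omega>. (y \<omega> + rsum s h N \<kappa> \<omega>) ^ (2 * q)) \<and>
     (\<integral>\<omega>. (y \<omega> + rsum s h N \<kappa> \<omega>) ^ (2 * q) \<partial>M) \<le>
       exp (C * (real N * h)) * ((\<integral>\<omega>. y \<omega> ^ (2 * q) \<partial>M) + C * (h * (\<Sum>k<N. D k)))"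
proof -
  obtain C where C: "0 \<le> C" and step: "\<And>u h y \<kappa>. 0 \<le> u \<Longrightarrow> 0 < h \<Longrightarrow> h \<le> 1 \<Longrightarrow> y \<in> borel_measurable (Fl u) \<Longrightarrow>
     (\<And>c. \<kappa> c \<in> borel_measurable (Fl u)) \<Longrightarrow> integrable M (\<lambda>\<omega>. y \<omega> ^ (2 * q)) \<Longrightarrow> (\<And>c. integrable M (\<lambda>\<omega>. \<kappa> c \<omega> ^ (2 * q))) \<Longrightarrow>
     integrable M (\<lambda>\<omega>. (y \<omega> + (\<Sum>c\<in>UNIV. \<kappa> c \<omega> * noise u h c \<omega>)) ^ (2 * q)) \<and>
     (\<integral>\<omega>. (y \<omega> + (\<Sum>c\<in>UNIV. \<kappa> c \<omega> * noise u h c \<omega>)) ^ (2 * q) \<partial>M) \<le>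
       (\<integral>\<omega>. y \<omega> ^ (2 * q) \<partial>M) + C * h * ((\<integral>\<omega>. y \<omega> ^ (2 * q) \<partial>M) + (\<Sum>c\<in>UNIV. \<integral>\<omega>. \<kappa> c \<omega> ^ (2 * q) \<partial>M))"
    using moment_step[OF q] by blast
  show thesis
  proof (rule that[OF C])
    fix s h :: real and N and y :: "'a \<Rightarrow> real" and \<kappa> :: "real \<Rightarrow> 'm option \<Rightarrow> 'a \<Rightarrow> real" and D :: "nat \<Rightarrow> real"
    assume s: "0 \<le> s" "0 < h" "h \<le> 1" and ym: "y \<in> borel_measurable (Fl s)" and yi: "integrable M (\<lambda>\<omega>. y \<omega> ^ (2 * q))"
    show "(\<And>k c. k < N \<Longrightarrow> \<kappa> (s + real k * h) c \<in> borel_measurable (Fl (s + real k * h))) \<Longrightarrow>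
     (\<And>k c. k < N \<Longrightarrow> integrable M (\<lambda>\<omega>. \<kappa> (s + real k * h) c \<omega> ^ (2 * q))) \<Longrightarrow>
     (\<And>k. k < N \<Longrightarrow> (\<Sum>c\<in>UNIV. \<integral>\<omega>. \<kappa> (s + real k * h) c \<omega> ^ (2 * q) \<partial>M) \<le> D k) \<Longrightarrow>
     integrable M (\<lambda>\<omega>. (y \<omega> + rsum s h N \<kappa> \<omega>) ^ (2 * q)) \<and>
     (\<integral>\<omega>. (y \<omega> + rsum s h N \<kappa> \<omega>) ^ (2 * q) \<partial>M) \<le>
       exp (C * (real N * h)) * ((\<integral>\<omega>. y \<omega> ^ (2 * q) \<partial>M) + C * (h * (\<Sum>k<N. D k)))"
    proof (induction N)
      case 0
      then show ?case using yi by (simp add: rsum_def)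
    next
      case (Suc N)
      define u where "u = s + real N * h"
      define Y where "Y \<omega> = y \<omega> + rsum s h N \<kappa> \<omega>" for \<omega>
      define E where "E = (\<integral>\<omega>. Y \<omega> ^ (2 * q) \<partial>M)"
      define S where "S = (\<integral>\<omega>. y \<omega> ^ (2 * q) \<partial>M) + C * (h * (\<Sum>k<N. D k))"
      have IH: "integrable M (\<lambda>\<omega>. Y \<omega> ^ (2 * q))" "E \<le> exp (C * (real N * h)) * S"
        unfolding Y_def E_def S_def using Suc by auto
      have u: "0 \<le> u" "s \<le> u" using s by (auto simp: u_def)
      have Ym: "Y \<in> borel_measurable (Fl u)"
        unfolding Y_def u_def
        by (intro borel_measurable_add rsum_measurable measurable_Fl_mono[OF _ _ ym]) (use s Suc.prems in auto)
      have D0: "0 \<le> D N"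
        by (rule order_trans[OF sum_nonneg[OF Bochner_Integration.integral_nonneg] Suc.prems(3)]) (auto simp: zero_le_even_power)
      have st: "integrable M (\<lambda>\<omega>. (Y \<omega> + (\<Sum>c\<in>UNIV. \<kappa> u c \<omega> * noise u h c \<omega>)) ^ (2 * q)) \<and>
        (\<integral>\<omega>. (Y \<omega> + (\<Sum>c\<in>UNIV. \<kappa> u c \<omega> * noise u h c \<omega>)) ^ (2 * q) \<partial>M) \<le>
          E + C * h * (E + (\<Sum>c\<in>UNIV. \<integral>\<omega>. \<kappa> u c \<omega> ^ (2 * q) \<partial>M))"
        unfolding E_def by (rule step[OF u(1) s(2,3) Ym _ IH(1)]) (use Suc.prems in \<open>auto simp: u_def\<close>)
      have eq: "y \<omega> + rsum s h (Suc N) \<kappa> \<omega> = Y \<omega> + (\<Sum>c\<in>UNIV. \<kappa> u c \<omega> * noise u h c \<omega>)" for \<omega>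
        by (simp add: Y_def rsum_Suc u_def)
      have "E + C * h * (E + (\<Sum>c\<in>UNIV. \<integral>\<omega>. \<kappa> u c \<omega> ^ (2 * q) \<partial>M)) \<le> E + C * h * (E + D N)"
        using Suc.prems(3)[of N] C s by (intro add_left_mono mult_left_mono) (auto simp: u_def)
      also have "\<dots> = (1 + C * h) * E + C * h * D N" by (simp add: algebra_simps)
      also have "\<dots> \<le> exp (C * h) * (exp (C * (real N * h)) * S) + C * h * D N"
      proof -
        have E0: "0 \<le> E" unfolding E_def by (rule Bochner_Integration.integral_nonneg) (simp add: zero_le_even_power)
        have "(1 + C * h) * E \<le> exp (C * h) * E" using exp_ge_add_one_self[of "C * h"] E0 by (intro mult_right_mono) auto
        also have "\<dots> \<le> exp (C * h) * (exp (C * (real N * h)) * S)" using IH(2) by (intro mult_left_mono) auto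
        finally show ?thesis by simp
      qed
      also have "exp (C * h) * (exp (C * (real N * h)) * S) = exp (C * (real (Suc N) * h)) * S"
        by (simp add: exp_add[symmetric] algebra_simps)
      also have "exp (C * (real (Suc N) * h)) * S + C * h * D N \<le> exp (C * (real (Suc N) * h)) * (S + C * (h * D N))"
      proof -
        have "1 * (C * h * D N) \<le> exp (C * (real (Suc N) * h)) * (C * h * D N)"
          using C s D0 by (intro mult_right_mono) auto
        then show ?thesis by (simp add: algebra_simps)
      qed
      also have "S + C * (h * D N) = (\<integral>\<omega>. y \<omega> ^ (2 * q) \<partial>M) + C * (h * (\<Sum>k<Suc N. D k))"
        by (simp add: S_def algebra_simps)
      finally show ?case unfolding eq using st by linarith
    qed
  qed
qed

end

subsection \<open>Riemann sums of the solution\<close>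

text \<open>Fatou's lemma, carried over from the extended nonnegative integral so that integrability
  of the limit comes with the bound.\<close>

lemma (in prob_space) fatou_bound:
  fixes f :: "nat \<Rightarrow> 'a \<Rightarrow> real"
  assumes int: "\<And>n. integrable M (f n)" and nn: "\<And>n \<omega>. 0 \<le> f n \<omega>" and B: "\<And>n. (\<integral>\<omega>. f n \<omega> \<partial>M) \<le> B"
    and lim: "AE \<omega> in M. (\<lambda>n. f n \<omega>) \<longlonglongrightarrow> g \<omega>" and g: "g \<in> borel_measurable M" "\<And>\<omega>. 0 \<le> g \<omega>"
  shows "integrable M g" "(\<integral>\<omega>. g \<omega> \<partial>M) \<le> B"
proof -
  have B0: "0 \<le> B" using B[of 0] Bochner_Integration.integral_nonneg[of M "f 0"] nn by (meson order_trans)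
  have "(\<integral>\<^sup>+ \<omega>. ennreal (g \<omega>) \<partial>M) = (\<integral>\<^sup>+ \<omega>. liminf (\<lambda>n. ennreal (f n \<omega>)) \<partial>M)"
  proof (rule nn_integral_cong_AE)
    show "AE \<omega> in M. ennreal (g \<omega>) = liminf (\<lambda>n. ennreal (f n \<omega>))"
      using lim by eventually_elim (rule lim_imp_Liminf[symmetric], simp, rule tendsto_ennrealI)
  qed
  also have "\<dots> \<le> liminf (\<lambda>n. \<integral>\<^sup>+ \<omega>. ennreal (f n \<omega>) \<partial>M)"
    using int by (intro nn_integral_liminf) auto
  also have "(\<lambda>n. \<integral>\<^sup>+ \<omega>. ennreal (f n \<omega>) \<partial>M) = (\<lambda>n. ennreal (\<integral>\<omega>. f n \<omega> \<partial>M))"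
    using int nn by (intro ext nn_integral_eq_integral) auto
  also have "liminf (\<lambda>n. ennreal (\<integral>\<omega>. f n \<omega> \<partial>M)) \<le> liminf (\<lambda>n. ennreal B)"
    using B by (intro Liminf_mono always_eventually allI ennreal_leI) auto
  also have "\<dots> = ennreal B" by (simp add: Liminf_const)
  finally have le: "(\<integral>\<^sup>+ \<omega>. ennreal (g \<omega>) \<partial>M) \<le> ennreal B" .
  show "integrable M g"
    using g le by (intro integrableI_nonneg) (auto simp: less_top[symmetric] top_unique)
  then have "(\<integral>\<^sup>+ \<omega>. ennreal (g \<omega>) \<partial>M) = ennreal (\<integral>\<omega>. g \<omega> \<partial>M)"
    using g by (intro nn_integral_eq_integral) auto
  then show "(\<integral>\<omega>. g \<omega> \<partial>M) \<le> B" using le B0 by (simp add: ennreal_le_iff)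
qed

lemma (in prob_space) integrable_of_square:
  assumes "f \<in> borel_measurable M" "integrable M (\<lambda>\<omega>. (f \<omega>)\<^sup>2)"
  shows "integrable M (f :: 'a \<Rightarrow> real)"
proof (rule Bochner_Integration.integrable_bound[OF _ assms(1)])
  show "integrable M (\<lambda>\<omega>. 1 + (f \<omega>)\<^sup>2)" using assms(2) by simp
  have "\<bar>x\<bar> \<le> 1 + x\<^sup>2" for x :: real
  proof -
    have "0 \<le> (\<bar>x\<bar> - 1)\<^sup>2" by simp
    then have "2 * \<bar>x\<bar> \<le> 1 + x\<^sup>2" by (simp add: power2_diff)
    then show ?thesis by linarith
  qed
  then show "AE \<omega> in M. norm (f \<omega>) \<le> norm (1 + (f \<omega>)\<^sup>2)" by (simp add: abs_of_nonneg add_nonneg_nonneg)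
qed

text \<open>Bounded second moments give uniform integrability. Concretely, the distance from the
  limit is cut off at a level \<open>K\<close>: the bounded part vanishes by dominated convergence,
  and the excess is at most the second moment divided by \<open>K\<close>.\<close>

lemma (in prob_space) expectation_tendsto_of_square_bound:
  fixes f :: "nat \<Rightarrow> 'a \<Rightarrow> real"
  assumes fm: "\<And>n. f n \<in> borel_measurable M" and int: "\<And>n. integrable M (\<lambda>\<omega>. (f n \<omega>)\<^sup>2)" and B: "\<And>n. (\<integral>\<omega>. (f n \<omega>)\<^sup>2 \<partial>M) \<le> B"
    and lim: "AE \<omega> in M. (\<lambda>n. f n \<omega>) \<longlonglongrightarrow> g \<omega>" and g: "g \<in> borel_measurable M"
  shows "integrable M g" "(\<lambda>n. \<integral>\<omega>. f n \<omega> \<partial>M) \<longlonglongrightarrow> (\<integral>\<omega>. g \<omega> \<partial>M)"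
proof -
  have lim2: "AE \<omega> in M. (\<lambda>n. (f n \<omega>)\<^sup>2) \<longlonglongrightarrow> (g \<omega>)\<^sup>2"
    using lim by eventually_elim (rule tendsto_power)
  note g2 = fatou_bound[OF int _ B lim2 borel_measurable_power[OF g], simplified]
  show gi: "integrable M g" by (rule integrable_of_square[OF g g2(1)])
  have fi: "integrable M (f n)" for n by (rule integrable_of_square[OF fm int])
  have B0: "0 \<le> B" by (rule order_trans[OF Bochner_Integration.integral_nonneg g2(2)]) simp
  define D where "D n \<omega> = \<bar>f n \<omega> - g \<omega>\<bar>" for n \<omega>
  have Dm: "D n \<in> borel_measurable M" for n unfolding D_def using fm g by simp
  have Di: "integrable M (D n)" for n unfolding D_def using fi gi by simp
  have D2: "(D n \<omega>)\<^sup>2 \<le> 2 * (f n \<omega>)\<^sup>2 + 2 * (g \<omega>)\<^sup>2" for n \<omega>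
  proof -
    have "0 \<le> (f n \<omega> + g \<omega>)\<^sup>2" by simp
    then show ?thesis by (simp add: D_def power2_sum power2_diff)
  qed
  have D2i: "integrable M (\<lambda>\<omega>. (D n \<omega>)\<^sup>2)" for n
    by (rule Bochner_Integration.integrable_bound[of M "\<lambda>\<omega>. 2 * (f n \<omega>)\<^sup>2 + 2 * (g \<omega>)\<^sup>2"])
       (use int g2(1) D2 Dm in \<open>auto simp: abs_of_nonneg add_nonneg_nonneg\<close>)
  have D2e: "(\<integral>\<omega>. (D n \<omega>)\<^sup>2 \<partial>M) \<le> 4 * B" for n
  proof -
    have "(\<integral>\<omega>. (D n \<omega>)\<^sup>2 \<partial>M) \<le> (\<integral>\<omega>. 2 * (f n \<omega>)\<^sup>2 + 2 * (g \<omega>)\<^sup>2 \<partial>M)"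
      using D2i int g2(1) D2 by (intro integral_mono) auto
    also have "\<dots> = 2 * (\<integral>\<omega>. (f n \<omega>)\<^sup>2 \<partial>M) + 2 * (\<integral>\<omega>. (g \<omega>)\<^sup>2 \<partial>M)" using int g2(1) by simp
    finally show ?thesis using B[of n] g2(2) by linarith
  qed
  have "(\<lambda>n. \<integral>\<omega>. D n \<omega> \<partial>M) \<longlonglongrightarrow> 0"
  proof (rule LIMSEQ_I)
    fix e :: real assume e: "0 < e"
    \<comment> \<open>Chosen so that the tail \<open>4 * B / K\<close> is at most
      \<open>e / 2\<close>; the added \<open>1\<close> keeps \<open>K\<close> positive when
      \<open>B = 0\<close>.\<close>
    define K where "K = 8 * B / e + 1"
    have K: "0 < K" using e B0 by (simp add: K_def add_nonneg_pos)
    have KB: "4 * B / K \<le> e / 2"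
    proof -
      have "8 * B \<le> e * K" using e by (simp add: K_def field_simps)
      then show ?thesis using K by (simp add: field_simps)
    qed
    have trunc: "D n \<omega> \<le> min (D n \<omega>) K + (D n \<omega>)\<^sup>2 / K" for n \<omega>
    proof (cases "D n \<omega> \<le> K")
      case False
      then have "D n \<omega> * K \<le> D n \<omega> * D n \<omega>" by (intro mult_left_mono) (auto simp: D_def)
      then have "D n \<omega> \<le> (D n \<omega>)\<^sup>2 / K" using K by (simp add: field_simps power2_eq_square)
      then show ?thesis using False K by simp
    qed (use K in simp)
    have D0: "0 \<le> D n \<omega>" for n \<omega> by (simp add: D_def)
    have Mm: "(\<lambda>\<omega>. min (D n \<omega>) K) \<in> borel_measurable M" for n using Dm by (intro borel_measurable_min) auto
    have Mb: "\<bar>min (D n \<omega>) K\<bar> \<le> K" for n \<omega> using D0[of n \<omega>] K by simp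
    have mi: "integrable M (\<lambda>\<omega>. min (D n \<omega>) K)" for n
      by (rule Bochner_Integration.integrable_bound[OF Di[of n] Mm]) (use D0 K in \<open>auto simp: min_def abs_if\<close>)
    have "(\<lambda>n. \<integral>\<omega>. min (D n \<omega>) K \<partial>M) \<longlonglongrightarrow> (\<integral>\<omega>. 0 \<partial>M)"
    proof (rule integral_dominated_convergence[where w = "\<lambda>_. K"])
      show "AE \<omega> in M. (\<lambda>n. min (D n \<omega>) K) \<longlonglongrightarrow> 0"
        using lim
      proof eventually_elim
        case (elim \<omega>)
        have "(\<lambda>n. min (D n \<omega>) K) \<longlonglongrightarrow> min \<bar>g \<omega> - g \<omega>\<bar> K"
          unfolding D_def by (intro tendsto_intros elim)
        then show ?case using K by simp
      qed
    qed (use Mm Mb in auto)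
    then have "(\<lambda>n. \<integral>\<omega>. min (D n \<omega>) K \<partial>M) \<longlonglongrightarrow> 0" by simp
    then obtain N where N: "\<And>n. n \<ge> N \<Longrightarrow> \<bar>\<integral>\<omega>. min (D n \<omega>) K \<partial>M\<bar> < e / 2"
      using LIMSEQ_D[of "\<lambda>n. \<integral>\<omega>. min (D n \<omega>) K \<partial>M" 0 "e / 2"] e by auto
    have "norm ((\<integral>\<omega>. D n \<omega> \<partial>M) - 0) < e" if "n \<ge> N" for n
    proof -
      have "(\<integral>\<omega>. D n \<omega> \<partial>M) \<le> (\<integral>\<omega>. min (D n \<omega>) K + (D n \<omega>)\<^sup>2 / K \<partial>M)"
        using trunc mi D2i Di by (intro integral_mono) auto
      also have "\<dots> = (\<integral>\<omega>. min (D n \<omega>) K \<partial>M) + (\<integral>\<omega>. (D n \<omega>)\<^sup>2 \<partial>M) / K" using mi D2i by simp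
      also have "(\<integral>\<omega>. (D n \<omega>)\<^sup>2 \<partial>M) / K \<le> 4 * B / K" using D2e K by (intro divide_right_mono) auto
      finally have "(\<integral>\<omega>. D n \<omega> \<partial>M) < e" using N[OF that] KB by linarith
      moreover have "0 \<le> (\<integral>\<omega>. D n \<omega> \<partial>M)" by (rule Bochner_Integration.integral_nonneg) (simp add: D_def)
      ultimately show ?thesis by simp
    qed
    then show "\<exists>N. \<forall>n\<ge>N. norm ((\<integral>\<omega>. D n \<omega> \<partial>M) - 0) < e" by blast
  qed
  then have "(\<lambda>n. (\<integral>\<omega>. f n \<omega> \<partial>M) - (\<integral>\<omega>. g \<omega> \<partial>M)) \<longlonglongrightarrow> 0"
  proof (rule Lim_null_comparison[rotated], intro always_eventually allI)
    fix n
    have "(\<integral>\<omega>. f n \<omega> \<partial>M) - (\<integral>\<omega>. g \<omega> \<partial>M) = (\<integral>\<omega>. f n \<omega> - g \<omega> \<partial>M)" using fi gi by simp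
    then show "norm ((\<integral>\<omega>. f n \<omega> \<partial>M) - (\<integral>\<omega>. g \<omega> \<partial>M)) \<le> (\<integral>\<omega>. D n \<omega> \<partial>M)"
      unfolding D_def by (metis integral_abs_bound real_norm_def)
  qed
  then show "(\<lambda>n. \<integral>\<omega>. f n \<omega> \<partial>M) \<longlonglongrightarrow> (\<integral>\<omega>. g \<omega> \<partial>M)" by (rule LIM_zero_cancel)
qed

section \<open>Left Riemann sums in time\<close>

lemma left_sum_error:
  fixes \<phi> :: "real \<Rightarrow> real"
  assumes h: "0 \<le> h" and cont: "continuous_on {s..s + real N * h} \<phi>"
    and osc: "\<And>x y. x \<in> {s..s + real N * h} \<Longrightarrow> y \<in> {s..s + real N * h} \<Longrightarrow> \<bar>x - y\<bar> \<le> h \<Longrightarrow> \<bar>\<phi> x - \<phi> y\<bar> \<le> e"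
  shows "K \<le> N \<Longrightarrow> \<bar>integral {s..s + real K * h} \<phi> - h * (\<Sum>k<K. \<phi> (s + real k * h))\<bar> \<le> e * (real K * h)"
proof (induction K)
  case (Suc K)
  let ?u = "s + real K * h" and ?v = "s + real (Suc K) * h"
  have uv: "s \<le> ?u" "?u \<le> ?v" "?v \<le> s + real N * h" "?v - ?u = h"
  proof -
    have "real (Suc K) * h \<le> real N * h" using Suc.prems h by (intro mult_right_mono) auto
    then show "s \<le> ?u" "?u \<le> ?v" "?v \<le> s + real N * h" "?v - ?u = h"
      using h by (auto simp: distrib_right)
  qed
  have sub: "{?u..?v} \<subseteq> {s..s + real N * h}" "{s..?v} \<subseteq> {s..s + real N * h}" using uv by auto
  have int: "\<phi> integrable_on {s..?v}" by (rule integrable_continuous_interval[OF continuous_on_subset[OF cont sub(2)]])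
  have int2: "\<phi> integrable_on {?u..?v}" by (rule integrable_continuous_interval[OF continuous_on_subset[OF cont sub(1)]])
  have comb: "integral {s..?v} \<phi> = integral {s..?u} \<phi> + integral {?u..?v} \<phi>"
    using Henstock_Kurzweil_Integration.integral_combine[OF uv(1,2) int] by simp
  have "\<bar>integral {?u..?v} (\<lambda>x. \<phi> x - \<phi> ?u)\<bar> \<le> e * (?v - ?u)"
  proof -
    have "norm (integral {?u..?v} (\<lambda>x. \<phi> x - \<phi> ?u)) \<le> e * (?v - ?u)"
    proof (rule integral_bound[OF uv(2)])
      show "continuous_on {?u..?v} (\<lambda>x. \<phi> x - \<phi> ?u)"
        by (intro continuous_intros continuous_on_subset[OF cont sub(1)])
      show "norm (\<phi> x - \<phi> ?u) \<le> e" if "x \<in> {?u..?v}" for x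
      proof -
        have "?u \<in> {?u..?v}" using uv by simp
        then have "x \<in> {s..s + real N * h}" "?u \<in> {s..s + real N * h}" using sub(1) that by blast+
        moreover have "\<bar>x - ?u\<bar> \<le> h" using that uv(4) by auto
        ultimately show ?thesis unfolding real_norm_def by (rule osc)
      qed
    qed
    then show ?thesis by simp
  qed
  moreover have "integral {?u..?v} (\<lambda>x. \<phi> x - \<phi> ?u) = integral {?u..?v} \<phi> - h * \<phi> ?u"
    using int2 uv by (subst Henstock_Kurzweil_Integration.integral_diff) auto
  ultimately have "\<bar>integral {?u..?v} \<phi> - h * \<phi> ?u\<bar> \<le> e * h" using uv(4) by simp
  moreover have "\<bar>integral {s..?u} \<phi> - h * (\<Sum>k<K. \<phi> (s + real k * h))\<bar> \<le> e * (real K * h)" using Suc by simp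
  moreover have "e * (real (Suc K) * h) = e * (real K * h) + e * h" by (simp add: algebra_simps)
  moreover have "h * (\<Sum>k<Suc K. \<phi> (s + real k * h)) = h * (\<Sum>k<K. \<phi> (s + real k * h)) + h * \<phi> ?u" by (simp add: distrib_left)
  ultimately show ?case unfolding comb by linarith
qed simp

lemma left_sums_tendsto_integral:
  fixes \<phi> :: "real \<Rightarrow> real"
  assumes st: "s \<le> t" and cont: "continuous_on {s..t} \<phi>" and r: "\<And>n. Suc n \<le> r n"
  shows "(\<lambda>n. (t - s) / real (r n) * (\<Sum>k<r n. \<phi> (s + real k * ((t - s) / real (r n))))) \<longlonglongrightarrow> integral {s..t} \<phi>"
proof (rule LIMSEQ_I)
  fix e :: real assume e: "0 < e"
  define e' where "e' = e / (2 * (t - s + 1))"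
  have e': "0 < e'" using e st by (simp add: e'_def)
  have e'e: "e' * (t - s) < e"
  proof -
    have "e * (t - s) < e * (2 * (t - s + 1))" using e st by (intro mult_strict_left_mono) auto
    then show ?thesis using st by (simp add: e'_def pos_divide_less_eq)
  qed
  have "uniformly_continuous_on {s..t} \<phi>" by (rule compact_uniformly_continuous[OF cont]) simp
  then obtain d where d: "d > 0" and ud: "\<And>x y. x \<in> {s..t} \<Longrightarrow> y \<in> {s..t} \<Longrightarrow> dist y x < d \<Longrightarrow> dist (\<phi> y) (\<phi> x) < e'"
    using e' unfolding uniformly_continuous_on_def by metis
  obtain N0 :: nat where N0: "(t - s) / d < real N0" using reals_Archimedean2 by blast
  have "norm ((t - s) / real (r n) * (\<Sum>k<r n. \<phi> (s + real k * ((t - s) / real (r n)))) - integral {s..t} \<phi>) < e" if n: "n \<ge> N0" for n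
  proof -
    define h where "h = (t - s) / real (r n)"
    have rn: "real (r n) > 0" "real N0 \<le> real (r n)" using r[of n] n by auto
    have h: "0 \<le> h" using st rn by (simp add: h_def)
    have t: "s + real (r n) * h = t" using rn by (simp add: h_def)
    have hd: "h < d"
    proof -
      have "(t - s) / d < real (r n)" using N0 rn by linarith
      then show ?thesis using d rn by (simp add: h_def field_simps)
    qed
    have "\<bar>integral {s..s + real (r n) * h} \<phi> - h * (\<Sum>k<r n. \<phi> (s + real k * h))\<bar> \<le> e' * (real (r n) * h)"
    proof (rule left_sum_error[OF h, where N = "r n"])
      show "continuous_on {s..s + real (r n) * h} \<phi>" unfolding t by (rule cont)
      show "\<bar>\<phi> x - \<phi> y\<bar> \<le> e'" if "x \<in> {s..s + real (r n) * h}" "y \<in> {s..s + real (r n) * h}" "\<bar>x - y\<bar> \<le> h" for x y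
        using ud[of y x] that hd unfolding t by (auto simp: dist_real_def)
    qed simp
    moreover have "real (r n) * h = t - s" using t by simp
    ultimately show ?thesis using e'e unfolding t h_def[symmetric] by simp
  qed
  then show "\<exists>N. \<forall>n\<ge>N. norm ((t - s) / real (r n) * (\<Sum>k<r n. \<phi> (s + real k * ((t - s) / real (r n)))) - integral {s..t} \<phi>) < e" by blast
qed

section \<open>The solution and its approximation by Ito sums\<close>

locale sde = wiener M Fl W
  for M :: "'a measure" and Fl and W :: "'m::finite \<Rightarrow> real \<Rightarrow> 'a \<Rightarrow> real" +
  fixes a :: "real^'d::finite \<Rightarrow> real^'d" and b :: "real^'d \<Rightarrow> real^'m^'d"
    and t0 T :: real and x0 :: "real^'d" and X :: "real \<Rightarrow> 'a \<Rightarrow> real^'d"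
  assumes t0: "0 \<le> t0" "t0 < T" and sol: "sde_solution M Fl W a b t0 T x0 X"
    and a_pc: "\<And>i. poly_cont (\<lambda>x. a x $ i)" and b_pc: "\<And>i j. poly_cont (\<lambda>x. b x $ i $ j)"
begin

lemma X_Fl: "t \<in> {t0..T} \<Longrightarrow> X t \<in> borel_measurable (Fl t)"
  using sol by (simp add: sde_solution_def)

lemma X_measurable: "t \<in> {t0..T} \<Longrightarrow> X t \<in> borel_measurable M"
proof -
  assume "t \<in> {t0..T}"
  from X_Fl[OF this] show ?thesis
    using filtration by (intro measurable_mono[of borel borel "Fl t" M, THEN subsetD]) (auto simp: filtration_on_def)
qed

lemma X_cont: "\<omega> \<in> space M \<Longrightarrow> continuous_on {t0..T} (\<lambda>t. X t \<omega>)"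
  using sol by (simp add: sde_solution_def)

lemma poly_cont_X_Fl: "poly_cont g \<Longrightarrow> t \<in> {t0..T} \<Longrightarrow> (\<lambda>\<omega>. g (X t \<omega>)) \<in> borel_measurable (Fl t)"
  by (rule measurable_compose[OF X_Fl poly_cont_measurable])

lemma poly_cont_X_path: "poly_cont g \<Longrightarrow> \<omega> \<in> space M \<Longrightarrow> continuous_on {t0..T} (\<lambda>t. g (X t \<omega>))"
  using continuous_on_compose2[OF poly_cont_continuous X_cont] by auto

definition coef :: "'d \<Rightarrow> 'm option \<Rightarrow> real^'d \<Rightarrow> real" where
  "coef i c x = (case c of None \<Rightarrow> a x $ i | Some j \<Rightarrow> b x $ i $ j)"

lemma coef_pc: "poly_cont (coef i c)"
  using a_pc b_pc by (cases c) (auto simp: coef_def[abs_def])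

definition coefX :: "'d \<Rightarrow> real \<Rightarrow> 'm option \<Rightarrow> 'a \<Rightarrow> real" where
  "coefX i u c \<omega> = coef i c (X u \<omega>)"

lemma coefX_measurable: "u \<in> {t0..T} \<Longrightarrow> coefX i u c \<in> borel_measurable (Fl u)"
  unfolding coefX_def[abs_def] by (rule poly_cont_X_Fl[OF coef_pc])

definition colX :: "'m \<Rightarrow> real \<Rightarrow> 'a \<Rightarrow> real^'d" where
  "colX j u \<omega> = (\<chi> i. b (X u \<omega>) $ i $ j)"

lemma colX_measurable: "u \<in> {t0..T} \<Longrightarrow> colX j u \<in> borel_measurable M"
proof -
  assume u: "u \<in> {t0..T}"
  have "continuous_on UNIV (\<lambda>x. \<chi> i. b x $ i $ j)"
    by (intro continuous_on_vec_lambda poly_cont_continuous b_pc)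
  then show ?thesis
    unfolding colX_def[abs_def] by (intro measurable_compose[OF X_measurable[OF u]] borel_measurable_continuous_onI)
qed

lemma drift_continuous: "\<omega> \<in> space M \<Longrightarrow> continuous_on {t0..T} (\<lambda>s. a (X s \<omega>))"
proof -
  assume w: "\<omega> \<in> space M"
  have "continuous_on UNIV (\<lambda>x. \<chi> i. a x $ i)"
    by (intro continuous_on_vec_lambda poly_cont_continuous a_pc)
  then have "continuous_on UNIV a" by simp
  from continuous_on_compose2[OF this X_cont[OF w]] show ?thesis by auto
qed

lemma ito_sums:
  assumes "t \<in> {t0..T}"
  obtains I :: "'m \<Rightarrow> 'a \<Rightarrow> real^'d" where "\<And>j. I j \<in> borel_measurable M"
    "AE \<omega> in M. X t \<omega> = x0 + integral {t0..t} (\<lambda>s. a (X s \<omega>)) + (\<Sum>j\<in>UNIV. I j \<omega>)"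
    "\<And>j e. 0 < e \<Longrightarrow> \<exists>\<delta>>0. \<forall>(N::nat) (p::nat \<Rightarrow> real).
        p 0 = t0 \<and> p N = t \<and> (\<forall>k<N. p k < p (Suc k) \<and> p (Suc k) - p k < \<delta>) \<longrightarrow>
        prob {\<omega>\<in>space M. norm ((\<Sum>k<N. (W j (p (Suc k)) \<omega> - W j (p k) \<omega>) *\<^sub>R colX j (p k) \<omega>) - I j \<omega>) > e} < e"
proof -
  from sol assms obtain I :: "'m \<Rightarrow> 'a \<Rightarrow> real^'d" where
    I: "\<And>j. ito_integral_is M (W j) (\<lambda>s \<omega>. \<chi> i. b (X s \<omega>) $ i $ j) t0 t (I j)"
    "AE \<omega> in M. X t \<omega> = x0 + integral {t0..t} (\<lambda>s. a (X s \<omega>)) + (\<Sum>j\<in>UNIV. I j \<omega>)"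
    unfolding sde_solution_def by blast
  show thesis
    by (rule that[OF _ I(2)]) (use I(1) in \<open>auto simp: ito_integral_is_def colX_def\<close>)
qed

text \<open>An increasing partition from \<open>t0\<close> to \<open>t0\<close> has
  \<open>N = 0\<close>, so its Riemann sum is empty. The definition of the integral then bounds the
  probability of \<open>norm (I j \<omega>) > e\<close> by \<open>e\<close> for every positive
  \<open>e\<close>, which forces \<open>I j\<close> to vanish almost surely.\<close>

lemma X_initial: "AE \<omega> in M. X t0 \<omega> = x0"
proof -
  have "t0 \<in> {t0..T}" using t0 by auto
  then obtain I :: "'m \<Rightarrow> 'a \<Rightarrow> real^'d" where I: "\<And>j. I j \<in> borel_measurable M"
    "AE \<omega> in M. X t0 \<omega> = x0 + integral {t0..t0} (\<lambda>s. a (X s \<omega>)) + (\<Sum>j\<in>UNIV. I j \<omega>)"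
    and lim: "\<And>j e. 0 < e \<Longrightarrow> \<exists>\<delta>>0. \<forall>(N::nat) (p::nat \<Rightarrow> real).
        p 0 = t0 \<and> p N = t0 \<and> (\<forall>k<N. p k < p (Suc k) \<and> p (Suc k) - p k < \<delta>) \<longrightarrow>
        prob {\<omega>\<in>space M. norm ((\<Sum>k<N. (W j (p (Suc k)) \<omega> - W j (p k) \<omega>) *\<^sub>R colX j (p k) \<omega>) - I j \<omega>) > e} < e"
    by (rule ito_sums) blast
  have small: "prob {\<omega>\<in>space M. norm (I j \<omega>) > e} < e" if e: "0 < e" for j e
  proof -
    obtain \<delta> where "\<forall>(N::nat) (p::nat \<Rightarrow> real).
        p 0 = t0 \<and> p N = t0 \<and> (\<forall>k<N. p k < p (Suc k) \<and> p (Suc k) - p k < \<delta>) \<longrightarrow>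
        prob {\<omega>\<in>space M. norm ((\<Sum>k<N. (W j (p (Suc k)) \<omega> - W j (p k) \<omega>) *\<^sub>R colX j (p k) \<omega>) - I j \<omega>) > e} < e"
      using lim[OF e, of j] by blast
    from this[rule_format, of "\<lambda>_. t0" 0] show ?thesis by simp
  qed
  have "AE \<omega> in M. norm (I j \<omega>) \<le> 1 / real (Suc n)" for j n
  proof -
    let ?E = "{\<omega>\<in>space M. norm (I j \<omega>) > 1 / real (Suc n)}"
    have m: "{\<omega>\<in>space M. norm (I j \<omega>) > e} \<in> events" for e using I(1)[of j] by measurable
    have "prob ?E \<le> e" if e: "0 < e" for e
    proof -
      \<comment> \<open>Threshold and probability bound are the same number in the definition of the
        integral, so both are taken below the fixed threshold
        \<open>1 / real (Suc n)\<close>.\<close>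
      define e' where "e' = min e (1 / real (Suc n))"
      have "prob ?E \<le> prob {\<omega>\<in>space M. norm (I j \<omega>) > e'}"
        using m by (intro finite_measure_mono) (auto simp: e'_def)
      also have "\<dots> < e'" using e by (intro small) (auto simp: e'_def)
      finally show ?thesis by (simp add: e'_def)
    qed
    then have "prob ?E \<le> 0 + e" if "0 < e" for e using that by simp
    then have "prob ?E \<le> 0" by (rule field_le_epsilon)
    then have "prob ?E = 0" by (simp add: measure_le_0_iff)
    then have "AE \<omega> in M. \<omega> \<notin> ?E" using prob_eq_0[OF m[of "1 / real (Suc n)"]] by blast
    with AE_space show ?thesis by eventually_elim (auto simp: not_less)
  qed
  then have "AE \<omega> in M. \<forall>j n. norm (I j \<omega>) \<le> 1 / real (Suc n)" by (simp add: AE_all_countable AE_finite_all del: of_nat_Suc)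
  then have "AE \<omega> in M. \<forall>j. I j \<omega> = 0"
  proof eventually_elim
    case (elim \<omega>)
    have "norm (I j \<omega>) \<le> 0" for j
    proof (rule field_le_epsilon)
      fix e :: real assume "0 < e"
      then obtain n where "1 / real (Suc n) < e" using nat_approx_posE by blast
      then show "norm (I j \<omega>) \<le> 0 + e" using elim by (metis add_0 less_imp_le order_trans)
    qed
    then show ?case by simp
  qed
  with I(2) show ?thesis by eventually_elim simp
qed

text \<open>For \<^term>\<open>s > t0\<close> a grid of \<^term>\<open>{s..t}\<close> is preceded by a fine partition of \<^term>\<open>{t0..s}\<close>,
  whose Riemann sum cancels against the one for time \<^term>\<open>s\<close>.\<close>
lemma ito_increment:
  assumes st: "t0 \<le> s" "s < t" "t \<le> T"
  obtains J :: "'m \<Rightarrow> 'a \<Rightarrow> real^'d" where "\<And>j. J j \<in> borel_measurable M"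
    "AE \<omega> in M. X t \<omega> - X s \<omega> = integral {s..t} (\<lambda>u. a (X u \<omega>)) + (\<Sum>j\<in>UNIV. J j \<omega>)"
    "\<And>j e. 0 < e \<Longrightarrow> \<exists>\<delta>>0. \<forall>N>0. (t - s) / real N < \<delta> \<longrightarrow>
        prob {\<omega>\<in>space M. norm ((\<Sum>k<N. (W j (s + real (Suc k) * ((t - s) / real N)) \<omega> - W j (s + real k * ((t - s) / real N)) \<omega>) *\<^sub>R
            colX j (s + real k * ((t - s) / real N)) \<omega>) - J j \<omega>) > e} < e"
proof -
  have tt: "t \<in> {t0..T}" "s \<in> {t0..T}" using st by auto
  obtain It :: "'m \<Rightarrow> 'a \<Rightarrow> real^'d" where Itm: "\<And>j. It j \<in> borel_measurable M"
    and Ite: "AE \<omega> in M. X t \<omega> = x0 + integral {t0..t} (\<lambda>s. a (X s \<omega>)) + (\<Sum>j\<in>UNIV. It j \<omega>)"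
    and Itl: "\<And>j e. 0 < e \<Longrightarrow> \<exists>\<delta>>0. \<forall>(N::nat) (p::nat \<Rightarrow> real).
        p 0 = t0 \<and> p N = t \<and> (\<forall>k<N. p k < p (Suc k) \<and> p (Suc k) - p k < \<delta>) \<longrightarrow>
        prob {\<omega>\<in>space M. norm ((\<Sum>k<N. (W j (p (Suc k)) \<omega> - W j (p k) \<omega>) *\<^sub>R colX j (p k) \<omega>) - It j \<omega>) > e} < e"
    by (rule ito_sums[OF tt(1)]) blast
  show thesis
  proof (cases "s = t0")
    case True
    show thesis
    proof (rule that[of It, OF Itm])
      show "AE \<omega> in M. X t \<omega> - X s \<omega> = integral {s..t} (\<lambda>u. a (X u \<omega>)) + (\<Sum>j\<in>UNIV. It j \<omega>)"
        using Ite X_initial by eventually_elim (simp add: True)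
      fix j and e :: real assume "0 < e"
      then obtain \<delta> where \<delta>: "\<delta> > 0" "\<And>(N::nat) (p::nat \<Rightarrow> real).
        p 0 = t0 \<and> p N = t \<and> (\<forall>k<N. p k < p (Suc k) \<and> p (Suc k) - p k < \<delta>) \<Longrightarrow>
        prob {\<omega>\<in>space M. norm ((\<Sum>k<N. (W j (p (Suc k)) \<omega> - W j (p k) \<omega>) *\<^sub>R colX j (p k) \<omega>) - It j \<omega>) > e} < e"
        using Itl[of e j] by blast
      have "prob {\<omega>\<in>space M. norm ((\<Sum>k<N. (W j (s + real (Suc k) * ((t - s) / real N)) \<omega> - W j (s + real k * ((t - s) / real N)) \<omega>) *\<^sub>R
            colX j (s + real k * ((t - s) / real N)) \<omega>) - It j \<omega>) > e} < e" if N: "N > 0" "(t - s) / real N < \<delta>" for N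
        by (rule \<delta>(2)[of "\<lambda>k. s + real k * ((t - s) / real N)" N])
           (use N st in \<open>auto simp: True distrib_right divide_simps\<close>)
      then show "\<exists>\<delta>>0. \<forall>N>0. (t - s) / real N < \<delta> \<longrightarrow>
        prob {\<omega>\<in>space M. norm ((\<Sum>k<N. (W j (s + real (Suc k) * ((t - s) / real N)) \<omega> - W j (s + real k * ((t - s) / real N)) \<omega>) *\<^sub>R
            colX j (s + real k * ((t - s) / real N)) \<omega>) - It j \<omega>) > e} < e"
        using \<delta>(1) by blast
    qed
  next
    case False
    then have s: "t0 < s" using st by simp
    obtain Is :: "'m \<Rightarrow> 'a \<Rightarrow> real^'d" where Ism: "\<And>j. Is j \<in> borel_measurable M"
      and Ise: "AE \<omega> in M. X s \<omega> = x0 + integral {t0..s} (\<lambda>s. a (X s \<omega>)) + (\<Sum>j\<in>UNIV. Is j \<omega>)"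
      and Isl: "\<And>j e. 0 < e \<Longrightarrow> \<exists>\<delta>>0. \<forall>(N::nat) (p::nat \<Rightarrow> real).
        p 0 = t0 \<and> p N = s \<and> (\<forall>k<N. p k < p (Suc k) \<and> p (Suc k) - p k < \<delta>) \<longrightarrow>
        prob {\<omega>\<in>space M. norm ((\<Sum>k<N. (W j (p (Suc k)) \<omega> - W j (p k) \<omega>) *\<^sub>R colX j (p k) \<omega>) - Is j \<omega>) > e} < e"
      by (rule ito_sums[OF tt(2)]) blast
    show thesis
    proof (rule that[of "\<lambda>j \<omega>. It j \<omega> - Is j \<omega>"])
      show "(\<lambda>\<omega>. It j \<omega> - Is j \<omega>) \<in> borel_measurable M" for j using Itm Ism by (rule borel_measurable_diff)
      show "AE \<omega> in M. X t \<omega> - X s \<omega> = integral {s..t} (\<lambda>u. a (X u \<omega>)) + (\<Sum>j\<in>UNIV. It j \<omega> - Is j \<omega>)"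
        using Ite Ise AE_space
      proof eventually_elim
        case (elim \<omega>)
        have "(\<lambda>u. a (X u \<omega>)) integrable_on {t0..t}"
          by (rule integrable_continuous_interval[OF continuous_on_subset[OF drift_continuous[OF elim(3)]]]) (use st in auto)
        then have "integral {t0..s} (\<lambda>u. a (X u \<omega>)) + integral {s..t} (\<lambda>u. a (X u \<omega>)) = integral {t0..t} (\<lambda>u. a (X u \<omega>))"
          using st by (intro Henstock_Kurzweil_Integration.integral_combine) auto
        then show ?case using elim by (simp add: sum_subtractf algebra_simps)
      qed
      fix j and e :: real assume e: "0 < e"
      then have half: "0 < e / 2" by simp
      obtain \<delta> where \<delta>: "\<delta> > 0" "\<And>(N::nat) (p::nat \<Rightarrow> real).
        p 0 = t0 \<and> p N = t \<and> (\<forall>k<N. p k < p (Suc k) \<and> p (Suc k) - p k < \<delta>) \<Longrightarrow>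
        prob {\<omega>\<in>space M. norm ((\<Sum>k<N. (W j (p (Suc k)) \<omega> - W j (p k) \<omega>) *\<^sub>R colX j (p k) \<omega>) - It j \<omega>) > e / 2} < e / 2"
        using Itl[OF half, of j] by blast
      obtain \<delta>' where \<delta>': "\<delta>' > 0" "\<And>(N::nat) (p::nat \<Rightarrow> real).
        p 0 = t0 \<and> p N = s \<and> (\<forall>k<N. p k < p (Suc k) \<and> p (Suc k) - p k < \<delta>') \<Longrightarrow>
        prob {\<omega>\<in>space M. norm ((\<Sum>k<N. (W j (p (Suc k)) \<omega> - W j (p k) \<omega>) *\<^sub>R colX j (p k) \<omega>) - Is j \<omega>) > e / 2} < e / 2"
        using Isl[OF half, of j] by blast
      \<comment> \<open>The initial block occurs in both Riemann sums, the one for time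
        \<open>t\<close> and the one for time \<open>s\<close>, and must be fine enough for
        either.\<close>
      obtain L0 :: nat where L0: "(s - t0) / min \<delta> \<delta>' < real L0" using reals_Archimedean2 by blast
      define L where "L = Suc L0"
      define l where "l = (s - t0) / real L"
      have L: "0 < real L" "(s - t0) / min \<delta> \<delta>' < real L" using L0 by (auto simp: L_def)
      have l: "0 < l" "l < \<delta>" "l < \<delta>'" "real L * l = s - t0"
      proof -
        have m: "0 < min \<delta> \<delta>'" using \<delta>(1) \<delta>'(1) by simp
        then have "s - t0 < real L * min \<delta> \<delta>'" using L(2) by (simp only: pos_divide_less_eq)
        then have "l < min \<delta> \<delta>'" unfolding l_def pos_divide_less_eq[OF L(1)] by (simp only: mult.commute)
        then show "l < \<delta>" "l < \<delta>'" by auto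
        show "0 < l" "real L * l = s - t0" using s L(1) by (auto simp: l_def)
      qed
      have "prob {\<omega>\<in>space M. norm ((\<Sum>k<N. (W j (s + real (Suc k) * ((t - s) / real N)) \<omega> - W j (s + real k * ((t - s) / real N)) \<omega>) *\<^sub>R
            colX j (s + real k * ((t - s) / real N)) \<omega>) - (It j \<omega> - Is j \<omega>)) > e} < e" if N: "N > 0" "(t - s) / real N < \<delta>" for N
      proof -
        define h where "h = (t - s) / real N"
        have h: "0 < h" "h < \<delta>" "real N * h = t - s" using N st by (simp_all add: h_def)
        \<comment> \<open>\<open>L\<close> steps of length \<open>l\<close> lead from
          \<open>t0\<close> to \<open>s\<close>, and \<open>N\<close> steps of length
          \<open>h\<close> from \<open>s\<close> to \<open>t\<close>. Both formulas give
          \<open>s\<close> at \<open>k = L\<close>.\<close>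
        define p where "p k = (if k \<le> L then t0 + real k * l else s + (real k - real L) * h)" for k
        have p1: "p k = t0 + real k * l" if "k \<le> L" for k using that by (simp add: p_def)
        have p2: "p (L + k) = s + real k * h" for k using l by (cases "k = 0") (auto simp: p_def)
        have sum_split: "(\<Sum>k<L + n. g k) = (\<Sum>k<L. g k) + (\<Sum>k<n. g (L + k))" for g :: "nat \<Rightarrow> real^'d" and n
          by (induction n) (simp_all add: add.assoc)
        have inc1: "p k < p (Suc k) \<and> p (Suc k) - p k < \<delta> \<and> p (Suc k) - p k < \<delta>'" if "k < L" for k
        proof -
          have "p (Suc k) = p k + l" using that by (simp add: p1 algebra_simps)
          then show ?thesis using l by simp
        qed
        have inc2: "p k < p (Suc k) \<and> p (Suc k) - p k < \<delta>" if kL: "L \<le> k" for k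
        proof -
          obtain k' where "k = L + k'" using le_Suc_ex[OF kL] by blast
          then have "p (Suc k) = p k + h" using p2[of k'] p2[of "Suc k'"] by (simp add: algebra_simps)
          then show ?thesis using h by simp
        qed
        let ?f = "\<lambda>k \<omega>. (W j (p (Suc k)) \<omega> - W j (p k) \<omega>) *\<^sub>R colX j (p k) \<omega>"
        let ?A = "{\<omega>\<in>space M. norm ((\<Sum>k<L + N. ?f k \<omega>) - It j \<omega>) > e / 2}"
        let ?B = "{\<omega>\<in>space M. norm ((\<Sum>k<L. ?f k \<omega>) - Is j \<omega>) > e / 2}"
        have pr: "p k \<in> {t0..T}" if kLN: "k \<le> L + N" for k
        proof (cases "k \<le> L")
          case True
          then have "real k * l \<le> real L * l" using l by (intro mult_right_mono) auto
          then show ?thesis using True l st by (auto simp: p1)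
        next
          case False
          then obtain k' where k': "k = L + k'" "k' \<le> N"
            by (intro that[of "k - L"]) (use kLN False in auto)
          then have "real k' * h \<le> real N * h" using h by (intro mult_right_mono) auto
          moreover have "0 \<le> real k' * h" using h by simp
          ultimately have "t0 \<le> s + real k' * h" "s + real k' * h \<le> T" using h(3) st by linarith+
          then show ?thesis unfolding k'(1) p2 by simp
        qed
        have fm: "?f k \<in> borel_measurable M" if "k < L + N" for k
        proof -
          have p: "p k \<in> {t0..T}" "p (Suc k) \<in> {t0..T}" by (rule pr, use that in simp)+
          then have "W j (p k) \<in> borel_measurable M" "W j (p (Suc k)) \<in> borel_measurable M"
            using t0 by (auto intro!: measurable_Fl_M[OF W_measurable])
          then show ?thesis
            using colX_measurable[OF p(1), of j] by (intro borel_measurable_scaleR borel_measurable_diff)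
        qed
        have p0: "p 0 = t0" "p L = s" "p (L + N) = t" using p1[of 0] p1[of L] p2[of N] l h(3) by simp_all
        have inc: "p k < p (Suc k) \<and> p (Suc k) - p k < \<delta>" for k
          using inc1[of k] inc2[of k] by (cases "k < L") auto
        have "prob ?A < e / 2" by (rule \<delta>(2)) (use p0 inc in blast)
        moreover have "prob ?B < e / 2" by (rule \<delta>'(2)) (use p0 inc1 in blast)
        moreover have Am: "?A \<in> events" "?B \<in> events"
        proof -
          have "(\<lambda>\<omega>. norm ((\<Sum>k<n. ?f k \<omega>) - F \<omega>)) \<in> borel_measurable M" if "n \<le> L + N" "F \<in> borel_measurable M" for n F
            by (rule measurable_compose[OF _ borel_measurable_norm], intro borel_measurable_diff borel_measurable_sum fm that) (use that in simp)
          from this[of "L + N" "It j"] this[of L "Is j"] show "?A \<in> events" "?B \<in> events"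
            using Itm Ism by (auto intro!: borel_measurable_less borel_measurable_const)
        qed
        moreover have "{\<omega>\<in>space M. norm ((\<Sum>k<N. (W j (s + real (Suc k) * h) \<omega> - W j (s + real k * h) \<omega>) *\<^sub>R
            colX j (s + real k * h) \<omega>) - (It j \<omega> - Is j \<omega>)) > e} \<subseteq> ?A \<union> ?B"
        proof
          fix \<omega> assume w: "\<omega> \<in> {\<omega>\<in>space M. norm ((\<Sum>k<N. (W j (s + real (Suc k) * h) \<omega> - W j (s + real k * h) \<omega>) *\<^sub>R
            colX j (s + real k * h) \<omega>) - (It j \<omega> - Is j \<omega>)) > e}"
          have "(\<Sum>k<L + N. ?f k \<omega>) = (\<Sum>k<L. ?f k \<omega>) + (\<Sum>k<N. ?f (L + k) \<omega>)"
            by (rule sum_split)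
          also have "(\<Sum>k<N. ?f (L + k) \<omega>) = (\<Sum>k<N. (W j (s + real (Suc k) * h) \<omega> - W j (s + real k * h) \<omega>) *\<^sub>R colX j (s + real k * h) \<omega>)"
            by (simp only: p2 add_Suc_right[symmetric])
          finally have eq: "(\<Sum>k<N. (W j (s + real (Suc k) * h) \<omega> - W j (s + real k * h) \<omega>) *\<^sub>R colX j (s + real k * h) \<omega>) - (It j \<omega> - Is j \<omega>)
             = ((\<Sum>k<L + N. ?f k \<omega>) - It j \<omega>) - ((\<Sum>k<L. ?f k \<omega>) - Is j \<omega>)" by simp
          have "e < norm (((\<Sum>k<L + N. ?f k \<omega>) - It j \<omega>) - ((\<Sum>k<L. ?f k \<omega>) - Is j \<omega>))" using w unfolding mem_Collect_eq eq by blast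
          also have "\<dots> \<le> norm ((\<Sum>k<L + N. ?f k \<omega>) - It j \<omega>) + norm ((\<Sum>k<L. ?f k \<omega>) - Is j \<omega>)" by (rule norm_triangle_ineq4)
          finally show "\<omega> \<in> ?A \<union> ?B" using w by auto
        qed
        then have "prob {\<omega>\<in>space M. norm ((\<Sum>k<N. (W j (s + real (Suc k) * h) \<omega> - W j (s + real k * h) \<omega>) *\<^sub>R
            colX j (s + real k * h) \<omega>) - (It j \<omega> - Is j \<omega>)) > e} \<le> prob (?A \<union> ?B)"
          using Am by (intro finite_measure_mono) auto
        moreover have "prob (?A \<union> ?B) \<le> prob ?A + prob ?B" using Am by (intro measure_Un_le)
        ultimately show ?thesis unfolding h_def[symmetric] by linarith
      qed
      then show "\<exists>\<delta>>0. \<forall>N>0. (t - s) / real N < \<delta> \<longrightarrow>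
        prob {\<omega>\<in>space M. norm ((\<Sum>k<N. (W j (s + real (Suc k) * ((t - s) / real N)) \<omega> - W j (s + real k * ((t - s) / real N)) \<omega>) *\<^sub>R
            colX j (s + real k * ((t - s) / real N)) \<omega>) - (It j \<omega> - Is j \<omega>)) > e} < e"
        using \<delta>(1) by blast
    qed
  qed
qed

end

subsection \<open>Moments of the solution\<close>

lemma norm_power_le:
  fixes x :: "real^'d::finite"
  assumes q: "0 < q"
  shows "(1 + norm x) ^ (2 * q) \<le> (1 + real CARD('d)) ^ (2 * q) * (1 + (\<Sum>i\<in>UNIV. (x $ i) ^ (2 * q)))"
proof -
  \<comment> \<open>The summand \<open>1\<close> is treated as one more coordinate, indexed by
    \<open>None\<close>.\<close>
  define y :: "'d option \<Rightarrow> real" where "y c = (case c of None \<Rightarrow> 1 | Some i \<Rightarrow> \<bar>x $ i\<bar>)" for c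
  have opt: "(\<Sum>c\<in>UNIV. f c) = f None + (\<Sum>i\<in>UNIV. f (Some i))" for f :: "'d option \<Rightarrow> real"
    unfolding UNIV_option_conv by (subst sum.insert) (auto simp: sum.reindex)
  have card: "card (UNIV :: 'd option set) = Suc CARD('d)"
    by simp
  have "1 + norm x \<le> (\<Sum>c\<in>UNIV. y c)"
    unfolding opt by (simp add: y_def norm_le_l1_cart)
  then have "(1 + norm x) ^ (2 * q) \<le> \<bar>\<Sum>c\<in>UNIV. y c\<bar> ^ (2 * q)" by (intro power_mono) auto
  also have "\<dots> \<le> real (card (UNIV :: 'd option set)) ^ (2 * q) * (\<Sum>c\<in>UNIV. \<bar>y c\<bar> ^ (2 * q))"
    by (rule power_sum_le) (use q in auto)
  also have "\<dots> = (1 + real CARD('d)) ^ (2 * q) * (1 + (\<Sum>i\<in>UNIV. (x $ i) ^ (2 * q)))"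
    unfolding card opt by (simp add: y_def power_even_abs)
  finally show ?thesis .
qed

text \<open>The left sums of the increasing exponential lie below its integral. The resulting factor
  \<open>1 / l\<close> is what lets a large \<open>l\<close> beat the constants in Gronwall's
  argument.\<close>

lemma exp_left_sum_le:
  fixes l h :: real
  assumes "0 < l" "0 \<le> h"
  shows "h * (\<Sum>k<N. exp (l * (real k * h))) \<le> exp (l * (real N * h)) / l"
proof (induction N)
  case (Suc N)
  have "1 + l * h \<le> exp (l * h)" by (rule exp_ge_add_one_self)
  then have "exp (l * (real N * h)) * (1 + l * h) \<le> exp (l * (real N * h)) * exp (l * h)" by (intro mult_left_mono) auto
  also have "\<dots> = exp (l * (real (Suc N) * h))" by (simp add: exp_add[symmetric] algebra_simps)
  finally have "exp (l * (real N * h)) * (1 + l * h) / l \<le> exp (l * (real (Suc N) * h)) / l"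
    using assms(1) by (intro divide_right_mono) auto
  moreover have "exp (l * (real N * h)) * (1 + l * h) / l = exp (l * (real N * h)) / l + h * exp (l * (real N * h))"
    using assms(1) by (simp add: distrib_left add_divide_distrib)
  ultimately have "exp (l * (real N * h)) / l + h * exp (l * (real N * h)) \<le> exp (l * (real (Suc N) * h)) / l" by simp
  then show ?case using Suc by (simp add: distrib_left)
qed (use assms in simp)

lemma sum_UNIV_option: "(\<Sum>c\<in>UNIV. f c) = f None + (\<Sum>i\<in>UNIV. f (Some i))"
  for f :: "'i::finite option \<Rightarrow> 'b::comm_monoid_add"
  unfolding UNIV_option_conv by (subst sum.insert) (auto simp: sum.reindex)

context sde
begin

lemma rsum_coefX:
  "rsum s h N (coefX i) \<omega> = h * (\<Sum>k<N. a (X (s + real k * h) \<omega>) $ i) +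
     (\<Sum>j\<in>UNIV. (\<Sum>k<N. (W j (s + real (Suc k) * h) \<omega> - W j (s + real k * h) \<omega>) *\<^sub>R colX j (s + real k * h) \<omega>) $ i)"
proof -
  have e: "s + real (Suc k) * h = s + real k * h + h" for k by (simp add: algebra_simps)
  have "rsum s h N (coefX i) \<omega> = (\<Sum>k<N. a (X (s + real k * h) \<omega>) $ i * h +
      (\<Sum>j\<in>UNIV. b (X (s + real k * h) \<omega>) $ i $ j * (W j (s + real k * h + h) \<omega> - W j (s + real k * h) \<omega>)))"
    unfolding rsum_def sum_UNIV_option by (simp add: coefX_def coef_def noise_def)
  also have "\<dots> = h * (\<Sum>k<N. a (X (s + real k * h) \<omega>) $ i) +
     (\<Sum>k<N. \<Sum>j\<in>UNIV. b (X (s + real k * h) \<omega>) $ i $ j * (W j (s + real k * h + h) \<omega> - W j (s + real k * h) \<omega>))"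
    by (simp add: sum.distrib sum_distrib_left mult.commute)
  also have "(\<Sum>k<N. \<Sum>j\<in>UNIV. b (X (s + real k * h) \<omega>) $ i $ j * (W j (s + real k * h + h) \<omega> - W j (s + real k * h) \<omega>)) =
      (\<Sum>j\<in>UNIV. \<Sum>k<N. b (X (s + real k * h) \<omega>) $ i $ j * (W j (s + real k * h + h) \<omega> - W j (s + real k * h) \<omega>))"
    by (rule sum.swap)
  also have "\<dots> = (\<Sum>j\<in>UNIV. (\<Sum>k<N. (W j (s + real (Suc k) * h) \<omega> - W j (s + real k * h) \<omega>) *\<^sub>R colX j (s + real k * h) \<omega>) $ i)"
    unfolding e by (simp add: colX_def mult.commute)
  finally show ?thesis .
qed

text \<open>The number of steps \<open>r n\<close> is chosen so large that each Ito sum misses its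
  limit by more than \<open>\<epsilon> n\<close> with probability less than
  \<open>\<epsilon> n\<close>, a summable sequence; Borel-Cantelli turns this into almost sure
  convergence. The floor \<open>n0\<close> lets the caller keep the step size at most
  \<open>1\<close>.\<close>

lemma rsum_conv:
  assumes st: "t0 \<le> s" "s < t" "t \<le> T"
  obtains r :: "nat \<Rightarrow> nat" where "\<And>n. Suc n \<le> r n" "\<And>n. n0 \<le> r n"
    "AE \<omega> in M. \<forall>i. (\<lambda>n. rsum s ((t - s) / real (r n)) (r n) (coefX i) \<omega>) \<longlonglongrightarrow> X t \<omega> $ i - X s \<omega> $ i"
proof -
  obtain J :: "'m \<Rightarrow> 'a \<Rightarrow> real^'d" where Jm: "\<And>j. J j \<in> borel_measurable M"
    and Je: "AE \<omega> in M. X t \<omega> - X s \<omega> = integral {s..t} (\<lambda>u. a (X u \<omega>)) + (\<Sum>j\<in>UNIV. J j \<omega>)"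
    and Jl: "\<And>j e. 0 < e \<Longrightarrow> \<exists>\<delta>>0. \<forall>N>0. (t - s) / real N < \<delta> \<longrightarrow>
        prob {\<omega>\<in>space M. norm ((\<Sum>k<N. (W j (s + real (Suc k) * ((t - s) / real N)) \<omega> - W j (s + real k * ((t - s) / real N)) \<omega>) *\<^sub>R
            colX j (s + real k * ((t - s) / real N)) \<omega>) - J j \<omega>) > e} < e"
    by (rule ito_increment[OF st]) blast
  define S where "S N j \<omega> = (\<Sum>k<N. (W j (s + real (Suc k) * ((t - s) / real N)) \<omega> - W j (s + real k * ((t - s) / real N)) \<omega>) *\<^sub>R
            colX j (s + real k * ((t - s) / real N)) \<omega>)" for N j \<omega>
  define \<epsilon> where "\<epsilon> n = (1 / 2 :: real) ^ n" for n
  have eps: "0 < \<epsilon> n" for n by (simp add: \<epsilon>_def)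
  define Q where "Q n N j \<longleftrightarrow> prob {\<omega>\<in>space M. norm (S N j \<omega> - J j \<omega>) > \<epsilon> n} < \<epsilon> n" for n N j
  have "\<forall>n j. \<exists>\<delta>>0. \<forall>N>0. (t - s) / real N < \<delta> \<longrightarrow> Q n N j"
    using Jl[OF eps] unfolding S_def Q_def by blast
  then obtain \<delta> where \<delta>: "\<And>n j. 0 < \<delta> n j" and
    \<delta>Q: "\<And>n j N. 0 < N \<Longrightarrow> (t - s) / real N < \<delta> n j \<Longrightarrow> Q n N j"
    by metis
  note \<delta>l = \<delta>Q[unfolded Q_def]
  have "\<exists>N. Suc n \<le> N \<and> n0 \<le> N \<and> (\<forall>j. (t - s) / real N < \<delta> n j)" for n
  proof -
    define d where "d = Min (range (\<delta> n))"
    have d: "0 < d" "\<And>j. d \<le> \<delta> n j" using \<delta> by (auto simp: d_def)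
    obtain N0 :: nat where N0: "(t - s) / d < real N0" using reals_Archimedean2 by blast
    define N where "N = max N0 (max (Suc n) n0)"
    have N: "0 < real N" "(t - s) / d < real N" using N0 by (auto simp: N_def)
    then have "(t - s) / real N < d" using d(1) by (simp add: pos_divide_less_eq mult.commute)
    then have "\<forall>j. (t - s) / real N < \<delta> n j" using d(2) less_le_trans by blast
    then show ?thesis by (intro exI[of _ N]) (auto simp: N_def)
  qed
  then obtain r where r: "\<And>n. Suc n \<le> r n" "\<And>n. n0 \<le> r n" "\<And>n j. (t - s) / real (r n) < \<delta> n j" by metis
  have r0: "0 < r n" for n using r(1)[of n] by simp
  have Sm: "S (r n) j \<in> borel_measurable M" for n j
  proof -
    let ?h = "(t - s) / real (r n)"
    have p: "s + real k * ?h \<in> {t0..T}" if "k \<le> r n" for k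
    proof -
      have "real k * ?h \<le> real (r n) * ?h" using that st by (intro mult_right_mono) auto
      also have "real (r n) * ?h = t - s" using r0[of n] by simp
      finally have 1: "real k * ?h \<le> t - s" .
      have 2: "0 \<le> real k * ?h" using st by (intro mult_nonneg_nonneg divide_nonneg_nonneg) auto
      have "t0 \<le> s + real k * ?h" "s + real k * ?h \<le> T" using 1 2 st by linarith+
      then show ?thesis by simp
    qed
    have "(\<lambda>\<omega>. (W j (s + real (Suc k) * ?h) \<omega> - W j (s + real k * ?h) \<omega>) *\<^sub>R colX j (s + real k * ?h) \<omega>) \<in> borel_measurable M" if k: "k < r n" for k
    proof -
      have pp: "s + real k * ?h \<in> {t0..T}" "s + real (Suc k) * ?h \<in> {t0..T}" by (rule p, use k in simp)+
      have nn: "0 \<le> u" if "u \<in> {t0..T}" for u using that t0 by simp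
      show ?thesis
        by (intro borel_measurable_scaleR borel_measurable_diff measurable_Fl_M[OF W_measurable[OF nn[OF pp(1)]]]
            measurable_Fl_M[OF W_measurable[OF nn[OF pp(2)]]] colX_measurable[OF pp(1)])
    qed
    then show ?thesis unfolding S_def[abs_def] by (intro borel_measurable_sum) simp
  qed
  have "AE \<omega> in M. \<forall>\<^sub>F n in sequentially. \<omega> \<in> space M - {\<omega>\<in>space M. norm (S (r n) j \<omega> - J j \<omega>) > \<epsilon> n}" for j
  proof (rule borel_cantelli_AE1)
    show "{\<omega>\<in>space M. norm (S (r n) j \<omega> - J j \<omega>) > \<epsilon> n} \<in> events" for n
      by (intro borel_measurable_less borel_measurable_const measurable_compose[OF _ borel_measurable_norm] borel_measurable_diff Sm Jm)
    show "summable (\<lambda>n. prob {\<omega>\<in>space M. norm (S (r n) j \<omega> - J j \<omega>) > \<epsilon> n})"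
    proof (rule summable_comparison_test')
      show "summable \<epsilon>" unfolding \<epsilon>_def by (rule summable_geometric) simp
      show "norm (prob {\<omega>\<in>space M. norm (S (r n) j \<omega> - J j \<omega>) > \<epsilon> n}) \<le> \<epsilon> n" if "0 \<le> n" for n
        using \<delta>l[OF r0 r(3)] by (simp add: less_imp_le)
    qed
  qed (simp add: emeasure_eq_measure)
  then have "AE \<omega> in M. \<forall>j. \<forall>\<^sub>F n in sequentially. \<omega> \<in> space M - {\<omega>\<in>space M. norm (S (r n) j \<omega> - J j \<omega>) > \<epsilon> n}"
    by (subst AE_all_countable) blast
  then have "AE \<omega> in M. \<forall>i. (\<lambda>n. rsum s ((t - s) / real (r n)) (r n) (coefX i) \<omega>) \<longlonglongrightarrow> X t \<omega> $ i - X s \<omega> $ i"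
    using Je AE_space
  proof eventually_elim
    case (elim \<omega>)
    have lim: "(\<lambda>n. S (r n) j \<omega>) \<longlonglongrightarrow> J j \<omega>" for j
    proof -
      have "\<forall>\<^sub>F n in sequentially. norm (S (r n) j \<omega> - J j \<omega>) \<le> \<epsilon> n"
        using elim(1)[rule_format, of j] by eventually_elim (use elim(3) in auto)
      moreover have "\<epsilon> \<longlonglongrightarrow> 0" unfolding \<epsilon>_def by (rule LIMSEQ_power_zero) simp
      ultimately have "(\<lambda>n. S (r n) j \<omega> - J j \<omega>) \<longlonglongrightarrow> 0" by (rule Lim_null_comparison)
      then show ?thesis by (rule LIM_zero_cancel)
    qed
    have ac: "continuous_on {s..t} (\<lambda>u. a (X u \<omega>))"
      by (rule continuous_on_subset[OF drift_continuous[OF elim(3)]]) (use st in auto)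
    show ?case
    proof
      fix i
      have "(\<lambda>n. (t - s) / real (r n) * (\<Sum>k<r n. a (X (s + real k * ((t - s) / real (r n))) \<omega>) $ i) + (\<Sum>j\<in>UNIV. S (r n) j \<omega> $ i))
        \<longlonglongrightarrow> integral {s..t} (\<lambda>u. a (X u \<omega>) $ i) + (\<Sum>j\<in>UNIV. J j \<omega> $ i)"
      proof (intro tendsto_add tendsto_sum tendsto_vec_nth lim)
        show "(\<lambda>n. (t - s) / real (r n) * (\<Sum>k<r n. a (X (s + real k * ((t - s) / real (r n))) \<omega>) $ i)) \<longlonglongrightarrow> integral {s..t} (\<lambda>u. a (X u \<omega>) $ i)"
          by (rule left_sums_tendsto_integral[where \<phi> = "\<lambda>u. a (X u \<omega>) $ i"])
             (use st r(1) ac in \<open>auto intro: continuous_on_component\<close>)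
      qed
      moreover have "integral {s..t} (\<lambda>u. a (X u \<omega>) $ i) = integral {s..t} (\<lambda>u. a (X u \<omega>)) $ i"
        using integrable_continuous_interval[OF ac] by simp
      moreover have "X t \<omega> $ i - X s \<omega> $ i = integral {s..t} (\<lambda>u. a (X u \<omega>)) $ i + (\<Sum>j\<in>UNIV. J j \<omega> $ i)"
        using arg_cong[OF elim(2), of "\<lambda>v. v $ i"] by simp
      ultimately show "(\<lambda>n. rsum s ((t - s) / real (r n)) (r n) (coefX i) \<omega>) \<longlonglongrightarrow> X t \<omega> $ i - X s \<omega> $ i"
        unfolding rsum_coefX S_def by simp
    qed
  qed
  then show thesis using that r by blast
qed

text \<open>Takes the place of a stopping time: quantities are multiplied by the indicator of this
  event, which decreases with \<open>s\<close>, instead of being frozen at a random time.\<close>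

definition stop :: "real \<Rightarrow> real \<Rightarrow> 'a set" where
  "stop R s = {\<omega>\<in>space M. \<forall>u\<in>{t0..s}. norm (X u \<omega>) \<le> R}"

text \<open>Path continuity reduces the condition on the whole interval to a countable dense subset,
  which keeps the event in \<open>Fl s\<close>.\<close>

lemma stop_sets:
  assumes s: "s \<in> {t0..T}" shows "stop R s \<in> sets (Fl s)"
proof -
  obtain D where D: "countable D" "D \<subseteq> {t0..s}" "{t0..s} \<subseteq> closure D" by (rule separable)
  have cl: "closure D \<subseteq> {t0..s}" by (rule closure_minimal[OF D(2)]) simp
  have "stop R s = {\<omega>\<in>space (Fl s). \<forall>u\<in>D. norm (X u \<omega>) \<le> R}"
  proof (intro set_eqI iffI)
    fix \<omega> assume "\<omega> \<in> stop R s" then show "\<omega> \<in> {\<omega>\<in>space (Fl s). \<forall>u\<in>D. norm (X u \<omega>) \<le> R}"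
      using D(2) by (auto simp: stop_def space_Fl)
  next
    fix \<omega> assume w: "\<omega> \<in> {\<omega>\<in>space (Fl s). \<forall>u\<in>D. norm (X u \<omega>) \<le> R}"
    then have w': "\<omega> \<in> space M" by (simp add: space_Fl)
    have "continuous_on (closure D) (\<lambda>u. norm (X u \<omega>))"
      by (intro continuous_on_norm continuous_on_subset[OF X_cont[OF w']]) (use cl s in auto)
    then have "norm (X u \<omega>) \<le> R" if "u \<in> {t0..s}" for u
      by (rule continuous_le_on_closure) (use that D(3) w in auto)
    then show "\<omega> \<in> stop R s" using w' by (simp add: stop_def)
  qed
  also have "\<dots> \<in> sets (Fl s)"
  proof (rule sets.sets_Collect_countable_All'[OF _ D(1)])
    fix u assume "u \<in> D"
    then have u: "u \<in> {t0..T}" "u \<le> s" "0 \<le> u" using D(2) s t0 by auto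
    have "(\<lambda>\<omega>. norm (X u \<omega>)) \<in> borel_measurable (Fl s)"
      by (rule measurable_Fl_mono[OF u(3,2)]) (rule measurable_compose[OF X_Fl[OF u(1)] borel_measurable_norm])
    then show "{\<omega>\<in>space (Fl s). norm (X u \<omega>) \<le> R} \<in> sets (Fl s)"
      by (rule borel_measurable_le[OF _ borel_measurable_const])
  qed
  finally show ?thesis .
qed

text \<open>The coefficients are switched off once the path has left the ball. They stay adapted and
  bounded, and on \<open>stop R t\<close> they agree with the true ones at all grid points up to
  \<open>t\<close>.\<close>

definition coefS :: "real \<Rightarrow> 'd \<Rightarrow> real \<Rightarrow> 'm option \<Rightarrow> 'a \<Rightarrow> real" where
  "coefS R i u c \<omega> = indicator (stop R u) \<omega> * coef i c (X u \<omega>)"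

lemma coefS_measurable: "u \<in> {t0..T} \<Longrightarrow> coefS R i u c \<in> borel_measurable (Fl u)"
  unfolding coefS_def[abs_def]
  by (intro borel_measurable_times borel_measurable_indicator stop_sets poly_cont_X_Fl[OF coef_pc])

lemma stop_sets_M: "s \<in> {t0..T} \<Longrightarrow> stop R s \<in> events"
  using stop_sets[of s R] filtration by (auto simp: filtration_on_def)

lemma coefS_eq_coefX:
  assumes "\<omega> \<in> stop R t" "u \<le> t" shows "coefS R i u c \<omega> = coefX i u c \<omega>"
proof -
  have "\<omega> \<in> stop R u" using assms by (auto simp: stop_def)
  then show ?thesis by (simp add: coefS_def coefX_def)
qed

text \<open>The indicator confines the path to a ball, on which a function of polynomial growth is
  bounded.\<close>

lemma stopped_power_integrable:
  assumes "poly_cont g" "u \<in> {t0..T}" "0 \<le> R"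
  shows "integrable M (\<lambda>\<omega>. indicator (stop R u) \<omega> * g (X u \<omega>))"
proof -
  obtain K r where K: "0 \<le> K" "\<And>x. \<bar>g x\<bar> \<le> K * (1 + norm x) ^ r" using poly_contE[OF assms(1)] by blast
  have m: "(\<lambda>\<omega>. indicator (stop R u) \<omega> * g (X u \<omega>)) \<in> borel_measurable M"
    by (intro borel_measurable_times borel_measurable_indicator stop_sets_M assms measurable_Fl_M[OF poly_cont_X_Fl])
  have "\<bar>indicator (stop R u) \<omega> * g (X u \<omega>)\<bar> \<le> K * (1 + R) ^ r" for \<omega>
  proof (cases "\<omega> \<in> stop R u")
    case True
    then have "norm (X u \<omega>) \<le> R" using assms(2) by (auto simp: stop_def)
    then have "K * (1 + norm (X u \<omega>)) ^ r \<le> K * (1 + R) ^ r" using K(1) by (intro mult_left_mono power_mono) auto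
    then show ?thesis using True K(2)[of "X u \<omega>"] by simp
  qed (use K(1) assms(3) in simp)
  then show ?thesis by (intro integrable_const_bound[OF _ m]) auto
qed

lemma power_component_pc: "poly_cont (\<lambda>x::real^'d. (x $ i) ^ k)"
proof (rule poly_contI)
  show "continuous_on UNIV (\<lambda>x::real^'d. (x $ i) ^ k)" by (intro continuous_intros)
  show "\<bar>(x $ i) ^ k\<bar> \<le> 1 * (1 + norm x) ^ k" for x :: "real^'d"
    unfolding power_abs mult_1 using component_le_norm_cart[of x i] by (intro power_mono) auto
qed

text \<open>An a priori bound on the stopped moments is fed through the linear growth condition into
  \<open>moment_rsum\<close> and returned for the solution by Fatou's lemma. The a priori constant
  \<open>S\<close> comes back divided by \<open>l\<close>, and \<open>A\<close> and \<open>B\<close>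
  do not involve \<open>R\<close>.\<close>

lemma stopped_moment_step:
  assumes q: "0 < q" and growth: "\<And>x i c. \<bar>coef i c x\<bar> \<le> K * (1 + norm x)"
  obtains A B :: real where "0 \<le> A" "0 \<le> B"
    "\<And>R S l t. 0 < R \<Longrightarrow> 0 < l \<Longrightarrow> 0 \<le> S \<Longrightarrow> t \<in> {t0..T} \<Longrightarrow>
      (\<And>u. u \<in> {t0..T} \<Longrightarrow> 1 + (\<Sum>i\<in>UNIV. \<integral>\<omega>. indicator (stop R u) \<omega> * (X u \<omega> $ i) ^ (2 * q) \<partial>M) \<le> S * exp (l * (u - t0))) \<Longrightarrow>
      1 + (\<Sum>i\<in>UNIV. \<integral>\<omega>. indicator (stop R t) \<omega> * (X t \<omega> $ i) ^ (2 * q) \<partial>M) \<le> A + B * S * exp (l * (t - t0)) / l"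
proof -
  obtain C where C: "0 \<le> C" and mom: "\<And>s h N y \<kappa> D. 0 \<le> s \<Longrightarrow> 0 < h \<Longrightarrow> h \<le> 1 \<Longrightarrow> y \<in> borel_measurable (Fl s) \<Longrightarrow> integrable M (\<lambda>\<omega>. y \<omega> ^ (2 * q)) \<Longrightarrow>
     (\<And>k c. k < N \<Longrightarrow> \<kappa> (s + real k * h) c \<in> borel_measurable (Fl (s + real k * h))) \<Longrightarrow>
     (\<And>k c. k < N \<Longrightarrow> integrable M (\<lambda>\<omega>. \<kappa> (s + real k * h) c \<omega> ^ (2 * q))) \<Longrightarrow>
     (\<And>k. k < N \<Longrightarrow> (\<Sum>c\<in>UNIV. \<integral>\<omega>. \<kappa> (s + real k * h) c \<omega> ^ (2 * q) \<partial>M) \<le> D k) \<Longrightarrow>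
     integrable M (\<lambda>\<omega>. (y \<omega> + rsum s h N \<kappa> \<omega>) ^ (2 * q)) \<and>
     (\<integral>\<omega>. (y \<omega> + rsum s h N \<kappa> \<omega>) ^ (2 * q) \<partial>M) \<le>
       exp (C * (real N * h)) * ((\<integral>\<omega>. y \<omega> ^ (2 * q) \<partial>M) + C * (h * (\<Sum>k<N. D k)))"
    using moment_rsum[OF q] by blast
  have K0: "0 \<le> K" using growth[of undefined undefined 0] by (simp, linarith?)
  \<comment> \<open>The constants of the growth condition and of \<open>norm_power_le\<close>,
    totalled over the noise sources.\<close>
  define G where "G = real (card (UNIV :: 'm option set)) * (K ^ (2 * q) * (1 + real CARD('d)) ^ (2 * q))"
  have G: "0 \<le> G" using K0 by (simp add: G_def)
  define L where "L = T - t0"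
  define A where "A = 1 + exp (C * L) * (\<Sum>i\<in>UNIV. (x0 $ i) ^ (2 * q))"
  define B where "B = real CARD('d) * (exp (C * L) * (C * G))"
  have sx: "0 \<le> (\<Sum>i\<in>UNIV. (x0 $ i) ^ (2 * q))" by (intro sum_nonneg) (simp add: zero_le_even_power)
  have A: "0 \<le> A" using sx by (simp add: A_def)
  have B: "0 \<le> B" using C G by (simp add: B_def)
  show thesis
  proof (rule that[OF A B])
    fix R S l t :: real
    assume R: "0 < R" and l: "0 < l" and S: "0 \<le> S" and t: "t \<in> {t0..T}"
      and bnd: "\<And>u. u \<in> {t0..T} \<Longrightarrow> 1 + (\<Sum>i\<in>UNIV. \<integral>\<omega>. indicator (stop R u) \<omega> * (X u \<omega> $ i) ^ (2 * q) \<partial>M) \<le> S * exp (l * (u - t0))"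
    have Ci: "integrable M (\<lambda>\<omega>. coefS R i u c \<omega> ^ (2 * q))" if u: "u \<in> {t0..T}" for i u c
    proof -
      have "poly_cont (\<lambda>x. coef i c x ^ k)" for k
        by (induction k) (auto intro: poly_cont_const poly_cont_mult coef_pc)
      from stopped_power_integrable[OF this u, of R] R
      have "integrable M (\<lambda>\<omega>. indicator (stop R u) \<omega> * coef i c (X u \<omega>) ^ (2 * q))" by simp
      also have "(\<lambda>\<omega>. indicator (stop R u) \<omega> * coef i c (X u \<omega>) ^ (2 * q)) = (\<lambda>\<omega>. coefS R i u c \<omega> ^ (2 * q))"
        using q by (auto simp: coefS_def fun_eq_iff indicator_def)
      finally show ?thesis .
    qed
    have Pi: "integrable M (\<lambda>\<omega>. indicator (stop R u) \<omega> * (X u \<omega> $ i) ^ (2 * q))" if u: "u \<in> {t0..T}" for i u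
      by (rule stopped_power_integrable[OF power_component_pc u]) (use R in simp)
    have CG: "(\<Sum>c\<in>UNIV. \<integral>\<omega>. coefS R i u c \<omega> ^ (2 * q) \<partial>M) \<le> G * (S * exp (l * (u - t0)))" if u: "u \<in> {t0..T}" for i u
    proof -
      have "(\<integral>\<omega>. coefS R i u c \<omega> ^ (2 * q) \<partial>M) \<le> (K ^ (2 * q) * (1 + real CARD('d)) ^ (2 * q)) * (S * exp (l * (u - t0)))" for c
      proof -
        define V where "V i \<omega> = indicator (stop R u) \<omega> * (X u \<omega> $ i) ^ (2 * q)" for i \<omega>
        have Vi: "integrable M (V i)" for i unfolding V_def by (rule Pi[OF u])
        let ?Z = "\<lambda>\<omega>. 1 + (\<Sum>i\<in>UNIV. V i \<omega>)"
        have pw: "coefS R i u c \<omega> ^ (2 * q) \<le> (K ^ (2 * q) * (1 + real CARD('d)) ^ (2 * q)) * ?Z \<omega>" for \<omega>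
        proof (cases "\<omega> \<in> stop R u")
          case True
          have "coefS R i u c \<omega> ^ (2 * q) = \<bar>coef i c (X u \<omega>)\<bar> ^ (2 * q)" using True by (simp add: coefS_def power_even_abs)
          also have "\<dots> \<le> (K * (1 + norm (X u \<omega>))) ^ (2 * q)" by (intro power_mono growth) simp
          also have "\<dots> = K ^ (2 * q) * (1 + norm (X u \<omega>)) ^ (2 * q)" by (rule power_mult_distrib)
          also have "\<dots> \<le> K ^ (2 * q) * ((1 + real CARD('d)) ^ (2 * q) * (1 + (\<Sum>i\<in>UNIV. (X u \<omega> $ i) ^ (2 * q))))"
            using K0 by (intro mult_left_mono norm_power_le[OF q]) simp
          finally show ?thesis using True by (simp add: V_def)
        next
          case False
          then have z: "coefS R i u c \<omega> ^ (2 * q) = 0" using q by (simp add: coefS_def zero_power)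
          show ?thesis unfolding z using False K0 by (simp add: V_def)
        qed
        have "(\<integral>\<omega>. coefS R i u c \<omega> ^ (2 * q) \<partial>M) \<le> (\<integral>\<omega>. (K ^ (2 * q) * (1 + real CARD('d)) ^ (2 * q)) * ?Z \<omega> \<partial>M)"
          by (rule integral_mono[OF Ci[OF u] _ pw]) (use Vi in simp)
        also have "\<dots> = (K ^ (2 * q) * (1 + real CARD('d)) ^ (2 * q)) * (1 + (\<Sum>i\<in>UNIV. \<integral>\<omega>. V i \<omega> \<partial>M))"
          using Vi by (simp add: prob_space)
        also have "\<dots> \<le> (K ^ (2 * q) * (1 + real CARD('d)) ^ (2 * q)) * (S * exp (l * (u - t0)))"
          unfolding V_def using K0 by (intro mult_left_mono bnd[OF u]) simp
        finally show ?thesis .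
      qed
      then have "(\<Sum>c\<in>UNIV. \<integral>\<omega>. coefS R i u c \<omega> ^ (2 * q) \<partial>M) \<le> (\<Sum>c\<in>(UNIV :: 'm option set). (K ^ (2 * q) * (1 + real CARD('d)) ^ (2 * q)) * (S * exp (l * (u - t0))))"
        by (intro sum_mono)
      then show ?thesis by (simp add: G_def mult.assoc)
    qed
    have comp: "(\<integral>\<omega>. indicator (stop R t) \<omega> * (X t \<omega> $ i) ^ (2 * q) \<partial>M) \<le> exp (C * L) * ((x0 $ i) ^ (2 * q) + C * (G * S * exp (l * (t - t0)) / l))" for i
    proof (cases "t = t0")
      case True
      have "(\<integral>\<omega>. indicator (stop R t) \<omega> * (X t \<omega> $ i) ^ (2 * q) \<partial>M) \<le> (\<integral>\<omega>. (x0 $ i) ^ (2 * q) \<partial>M)"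
      proof (rule integral_mono_AE[OF Pi[OF t]])
        show "AE \<omega> in M. indicator (stop R t) \<omega> * (X t \<omega> $ i) ^ (2 * q) \<le> (x0 $ i) ^ (2 * q)"
          using X_initial by eventually_elim (auto simp: True indicator_def zero_le_even_power)
      qed simp
      also have "\<dots> = 1 * ((x0 $ i) ^ (2 * q) + 0)" by (simp add: prob_space)
      also have "\<dots> \<le> exp (C * L) * ((x0 $ i) ^ (2 * q) + C * (G * S * exp (l * (t - t0)) / l))"
        using C G S l t0 by (intro mult_mono add_mono) (auto simp: L_def zero_le_even_power)
      finally show ?thesis .
    next
      case False
      then have t1: "t0 < t" "t \<le> T" using t by auto
      \<comment> \<open>A lower bound on the number of steps that keeps the step size at most
        \<open>1\<close>.\<close>
      obtain n0 :: nat where n0: "t - t0 \<le> real n0" using real_arch_simple by blast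
      obtain r where r: "\<And>n. Suc n \<le> r n" "\<And>n. n0 \<le> r n" and
        lim: "AE \<omega> in M. \<forall>i. (\<lambda>n. rsum t0 ((t - t0) / real (r n)) (r n) (coefX i) \<omega>) \<longlonglongrightarrow> X t \<omega> $ i - X t0 \<omega> $ i"
        by (rule rsum_conv[OF order_refl t1, of n0]) blast
      define h where "h n = (t - t0) / real (r n)" for n
      have rp: "0 < real (r n)" "real n0 \<le> real (r n)" for n using r[of n] by auto
      have h: "0 < h n" "h n \<le> 1" "real (r n) * h n = t - t0" for n
        using rp[of n] n0 t1 by (auto simp: h_def pos_divide_le_eq)
      have grid: "t0 + real k * h n \<in> {t0..T}" "t0 + real k * h n \<le> t" if "k < r n" for k n
      proof -
        have "real k * h n \<le> real (r n) * h n" using that h(1)[of n] by (intro mult_right_mono) auto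
        moreover have "0 \<le> real k * h n" using h(1)[of n] by simp
        ultimately have "t0 \<le> t0 + real k * h n" "t0 + real k * h n \<le> t" using h(3)[of n] by linarith+
        then show "t0 + real k * h n \<in> {t0..T}" "t0 + real k * h n \<le> t" using t1 by auto
      qed
      define Y where "Y n \<omega> = x0 $ i + rsum t0 (h n) (r n) (coefS R i) \<omega>" for n \<omega>
      have Y: "integrable M (\<lambda>\<omega>. Y n \<omega> ^ (2 * q)) \<and> (\<integral>\<omega>. Y n \<omega> ^ (2 * q) \<partial>M) \<le>
        exp (C * (real (r n) * h n)) * ((\<integral>\<omega>. (x0 $ i) ^ (2 * q) \<partial>M) + C * (h n * (\<Sum>k<r n. G * (S * exp (l * (real k * h n))))))" for n
        unfolding Y_def
      proof (rule mom)
        show "(\<Sum>c\<in>UNIV. \<integral>\<omega>. coefS R i (t0 + real k * h n) c \<omega> ^ (2 * q) \<partial>M) \<le> G * (S * exp (l * (real k * h n)))" if "k < r n" for k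
          using CG[OF grid(1)[OF that], of i] by simp
      qed (use t0 h grid coefS_measurable Ci in auto)
      have Yb: "(\<integral>\<omega>. Y n \<omega> ^ (2 * q) \<partial>M) \<le> exp (C * L) * ((x0 $ i) ^ (2 * q) + C * (G * S * exp (l * (t - t0)) / l))" for n
      proof -
        have "h n * (\<Sum>k<r n. G * (S * exp (l * (real k * h n)))) = G * S * (h n * (\<Sum>k<r n. exp (l * (real k * h n))))"
          by (simp add: sum_distrib_left mult_ac)
        also have "\<dots> \<le> G * S * (exp (l * (real (r n) * h n)) / l)"
          using G S l h(1)[of n] by (intro mult_left_mono exp_left_sum_le) auto
        finally have e: "h n * (\<Sum>k<r n. G * (S * exp (l * (real k * h n)))) \<le> G * S * exp (l * (t - t0)) / l" using h(3)[of n] by simp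
        have "(\<integral>\<omega>. Y n \<omega> ^ (2 * q) \<partial>M) \<le> exp (C * (t - t0)) * ((x0 $ i) ^ (2 * q) + C * (h n * (\<Sum>k<r n. G * (S * exp (l * (real k * h n))))))"
          using Y[of n] h(3)[of n] by (simp add: prob_space)
        also have "\<dots> \<le> exp (C * L) * ((x0 $ i) ^ (2 * q) + C * (G * S * exp (l * (t - t0)) / l))"
        proof (rule mult_mono)
          show "exp (C * (t - t0)) \<le> exp (C * L)" using C t1 by (simp add: L_def mult_left_mono)
          show "(x0 $ i) ^ (2 * q) + C * (h n * (\<Sum>k<r n. G * (S * exp (l * (real k * h n))))) \<le> (x0 $ i) ^ (2 * q) + C * (G * S * exp (l * (t - t0)) / l)"
            using e C by (intro add_left_mono mult_left_mono)
          show "0 \<le> (x0 $ i) ^ (2 * q) + C * (h n * (\<Sum>k<r n. G * (S * exp (l * (real k * h n)))))"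
            using C G S h(1)[of n] by (intro add_nonneg_nonneg mult_nonneg_nonneg sum_nonneg) (auto simp: zero_le_even_power)
        qed simp
        finally show ?thesis .
      qed
      have ind: "(\<lambda>\<omega>. indicator (stop R t) \<omega> :: real) \<in> borel_measurable M" by (intro borel_measurable_indicator stop_sets_M t)
      have Ym: "(\<lambda>\<omega>. Y n \<omega> ^ (2 * q)) \<in> borel_measurable M" for n using Y[of n] by (auto dest: borel_measurable_integrable)
      have Zi: "integrable M (\<lambda>\<omega>. indicator (stop R t) \<omega> * Y n \<omega> ^ (2 * q))" for n
        by (rule Bochner_Integration.integrable_bound[of M "\<lambda>\<omega>. Y n \<omega> ^ (2 * q)"])
           (use Y[of n] Ym[of n] ind in \<open>auto simp: indicator_def\<close>)
      show ?thesis
      proof (rule fatou_bound(2)[OF Zi])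
        show "0 \<le> indicator (stop R t) \<omega> * Y n \<omega> ^ (2 * q)" for n \<omega> by (intro mult_nonneg_nonneg) (auto simp: zero_le_even_power)
        show "(\<integral>\<omega>. indicator (stop R t) \<omega> * Y n \<omega> ^ (2 * q) \<partial>M) \<le> exp (C * L) * ((x0 $ i) ^ (2 * q) + C * (G * S * exp (l * (t - t0)) / l))" for n
        proof (rule order_trans[OF integral_mono[OF Zi] Yb[of n]])
          show "integrable M (\<lambda>\<omega>. Y n \<omega> ^ (2 * q))" using Y[of n] by simp
          show "indicator (stop R t) \<omega> * Y n \<omega> ^ (2 * q) \<le> Y n \<omega> ^ (2 * q)" for \<omega> by (auto simp: indicator_def zero_le_even_power)
        qed
        show "AE \<omega> in M. (\<lambda>n. indicator (stop R t) \<omega> * Y n \<omega> ^ (2 * q)) \<longlonglongrightarrow> indicator (stop R t) \<omega> * (X t \<omega> $ i) ^ (2 * q)"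
          using lim X_initial
        proof eventually_elim
          case (elim \<omega>)
          show ?case
          \<comment> \<open>On the event the stopped sums are the true ones, whose limit is known;
            off it the indicator makes both sides zero.\<close>
          proof (cases "\<omega> \<in> stop R t")
            case True
            have "rsum t0 (h n) (r n) (coefS R i) \<omega> = rsum t0 (h n) (r n) (coefX i) \<omega>" for n
              unfolding rsum_def by (intro sum.cong refl) (simp add: coefS_eq_coefX[OF True grid(2)])
            then have "Y n \<omega> = x0 $ i + rsum t0 ((t - t0) / real (r n)) (r n) (coefX i) \<omega>" for n
              by (simp add: Y_def h_def)
            moreover have "(\<lambda>n. (x0 $ i + rsum t0 ((t - t0) / real (r n)) (r n) (coefX i) \<omega>) ^ (2 * q)) \<longlonglongrightarrow> (x0 $ i + (X t \<omega> $ i - X t0 \<omega> $ i)) ^ (2 * q)"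
              by (intro tendsto_power tendsto_add tendsto_const elim(1)[rule_format])
            ultimately show ?thesis using True elim(2) by simp
          qed simp
        qed
        show "(\<lambda>\<omega>. indicator (stop R t) \<omega> * (X t \<omega> $ i) ^ (2 * q)) \<in> borel_measurable M"
          using Pi[OF t, of i] by (rule borel_measurable_integrable)
        show "0 \<le> indicator (stop R t) \<omega> * (X t \<omega> $ i) ^ (2 * q)" for \<omega> by (intro mult_nonneg_nonneg) (auto simp: zero_le_even_power)
      qed
    qed
    have "(\<Sum>i\<in>UNIV. \<integral>\<omega>. indicator (stop R t) \<omega> * (X t \<omega> $ i) ^ (2 * q) \<partial>M) \<le> (\<Sum>i\<in>UNIV. exp (C * L) * ((x0 $ i) ^ (2 * q) + C * (G * S * exp (l * (t - t0)) / l)))"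
      by (intro sum_mono comp)
    also have "\<dots> = exp (C * L) * (\<Sum>i\<in>UNIV. (x0 $ i) ^ (2 * q)) + B * S * exp (l * (t - t0)) / l"
      by (simp add: B_def sum_distrib_left distrib_left sum.distrib)
    finally show "1 + (\<Sum>i\<in>UNIV. \<integral>\<omega>. indicator (stop R t) \<omega> * (X t \<omega> $ i) ^ (2 * q) \<partial>M) \<le> A + B * S * exp (l * (t - t0)) / l"
      by (simp add: A_def)
  qed
qed

text \<open>Gronwall's argument in a weighted supremum norm: the supremum is finite because the
  stopped moments are bounded by a power of \<^term>\<open>R\<close>, but the resulting bound is free of \<^term>\<open>R\<close>.\<close>
lemma moment_bound:
  assumes q: "0 < q" and growth: "\<And>x i c. \<bar>coef i c x\<bar> \<le> K * (1 + norm x)"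
  obtains C where "\<And>t i. t \<in> {t0..T} \<Longrightarrow> integrable M (\<lambda>\<omega>. (X t \<omega> $ i) ^ (2 * q)) \<and> (\<integral>\<omega>. (X t \<omega> $ i) ^ (2 * q) \<partial>M) \<le> C"
proof -
  define m where "m R u = 1 + (\<Sum>i\<in>UNIV. \<integral>\<omega>. indicator (stop R u) \<omega> * (X u \<omega> $ i) ^ (2 * q) \<partial>M)" for R u
  obtain A B where A: "0 \<le> A" and B: "0 \<le> B" and
    step: "\<And>R S l t. 0 < R \<Longrightarrow> 0 < l \<Longrightarrow> 0 \<le> S \<Longrightarrow> t \<in> {t0..T} \<Longrightarrow>
      (\<And>u. u \<in> {t0..T} \<Longrightarrow> m R u \<le> S * exp (l * (u - t0))) \<Longrightarrow> m R t \<le> A + B * S * exp (l * (t - t0)) / l"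
    unfolding m_def by (rule stopped_moment_step[OF assms]) blast
  \<comment> \<open>With this \<open>l\<close> the estimate returns at most half of
    \<open>S\<close>, which can be absorbed on the left to give \<open>S \<le> 2 * A\<close> for
    every \<open>R\<close>.\<close>
  define l where "l = 2 * B + 1"
  have l: "0 < l" "B / l \<le> 1 / 2" using B by (auto simp: l_def field_simps)
  define C where "C = 2 * A * exp (l * (T - t0))"
  have nn: "0 \<le> (\<integral>\<omega>. indicator (stop R u) \<omega> * (X u \<omega> $ i) ^ (2 * q) \<partial>M)" for R u i
    by (intro Bochner_Integration.integral_nonneg mult_nonneg_nonneg) (auto simp: zero_le_even_power)
  have mC: "m R t \<le> C" if R: "0 < R" and t: "t \<in> {t0..T}" for R t
  proof -
    define S where "S = (SUP u\<in>{t0..T}. m R u * exp (- (l * (u - t0))))"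
    have "m R u * exp (- (l * (u - t0))) \<le> 1 + real CARD('d) * R ^ (2 * q)" if u: "u \<in> {t0..T}" for u
    proof -
      have "(\<integral>\<omega>. indicator (stop R u) \<omega> * (X u \<omega> $ i) ^ (2 * q) \<partial>M) \<le> (\<integral>\<omega>. R ^ (2 * q) \<partial>M)" for i
      proof (rule integral_mono)
        show "integrable M (\<lambda>\<omega>. indicator (stop R u) \<omega> * (X u \<omega> $ i) ^ (2 * q))"
          by (rule stopped_power_integrable[OF power_component_pc u]) (use R in simp)
        show "indicator (stop R u) \<omega> * (X u \<omega> $ i) ^ (2 * q) \<le> R ^ (2 * q)" for \<omega>
        proof (cases "\<omega> \<in> stop R u")
          case True
          then have "norm (X u \<omega>) \<le> R" using u by (auto simp: stop_def)
          then have "\<bar>X u \<omega> $ i\<bar> \<le> R" by (rule order_trans[OF component_le_norm_cart])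
          then have "\<bar>X u \<omega> $ i\<bar> ^ (2 * q) \<le> R ^ (2 * q)" by (intro power_mono) auto
          then show ?thesis using True by (simp add: power_even_abs)
        qed (use R in simp)
      qed simp
      then have "(\<Sum>i\<in>UNIV. \<integral>\<omega>. indicator (stop R u) \<omega> * (X u \<omega> $ i) ^ (2 * q) \<partial>M) \<le> (\<Sum>i\<in>(UNIV :: 'd set). R ^ (2 * q))"
        by (intro sum_mono) (simp add: prob_space)
      then have "m R u \<le> 1 + real CARD('d) * R ^ (2 * q)" by (simp add: m_def)
      moreover have "exp (- (l * (u - t0))) \<le> 1" using l u by simp
      moreover have "0 \<le> m R u" unfolding m_def by (intro add_nonneg_nonneg sum_nonneg nn) simp
      ultimately show ?thesis using mult_mono[of "m R u" "1 + real CARD('d) * R ^ (2 * q)" "exp (- (l * (u - t0)))" 1] by simp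
    qed
    then have bdd: "bdd_above ((\<lambda>u. m R u * exp (- (l * (u - t0)))) ` {t0..T})" by (intro bdd_aboveI2)
    have up: "m R u * exp (- (l * (u - t0))) \<le> S" if "u \<in> {t0..T}" for u
      unfolding S_def by (rule cSUP_upper[OF that bdd])
    have up': "m R u \<le> S * exp (l * (u - t0))" if "u \<in> {t0..T}" for u
    proof -
      have "m R u = (m R u * exp (- (l * (u - t0)))) * exp (l * (u - t0))" by (simp add: mult.assoc exp_add[symmetric])
      also have "\<dots> \<le> S * exp (l * (u - t0))" using up[OF that] by (intro mult_right_mono) auto
      finally show ?thesis .
    qed
    have m0: "0 \<le> m R u" for u unfolding m_def by (intro add_nonneg_nonneg sum_nonneg nn) simp
    have S0: "0 \<le> S" by (rule order_trans[OF _ up[OF t]]) (simp add: m0)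
    have "S \<le> A + B * S / l"
      unfolding S_def
    proof (rule cSUP_least)
      fix u assume u: "u \<in> {t0..T}"
      have "m R u \<le> A + B * S * exp (l * (u - t0)) / l" by (rule step[OF R l(1) S0 u up'])
      then have "m R u * exp (- (l * (u - t0))) \<le> (A + B * S * exp (l * (u - t0)) / l) * exp (- (l * (u - t0)))" by (intro mult_right_mono) auto
      also have "\<dots> = A * exp (- (l * (u - t0))) + B * S / l * (exp (l * (u - t0)) * exp (- (l * (u - t0))))" by (simp add: algebra_simps)
      also have "\<dots> \<le> A * 1 + B * S / l" using A l u by (intro add_mono mult_left_mono) (auto simp: exp_add[symmetric])
      finally show "m R u * exp (- (l * (u - t0))) \<le> A + B * (SUP u\<in>{t0..T}. m R u * exp (- (l * (u - t0)))) / l" by (simp add: S_def)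
    qed (use t0 in auto)
    also have "B * S / l \<le> 1 / 2 * S" using mult_right_mono[OF l(2) S0] by simp
    finally have S: "S \<le> 2 * A" by simp
    have "m R t \<le> S * exp (l * (t - t0))" by (rule up'[OF t])
    also have "\<dots> \<le> 2 * A * exp (l * (T - t0))" using S S0 A l t by (intro mult_mono) auto
    finally show ?thesis by (simp add: C_def)
  qed
  show thesis
  proof (rule that)
    fix t i assume t: "t \<in> {t0..T}"
    \<comment> \<open>Here \<open>R\<close> tends to infinity through the integers. A continuous
      path is bounded on the compact interval, so for each path the indicator is eventually
      \<open>1\<close>, and Fatou's lemma applies.\<close>
    define f where "f n \<omega> = indicator (stop (real (Suc n)) t) \<omega> * (X t \<omega> $ i) ^ (2 * q)" for n \<omega>
    have fi: "integrable M (f n)" for n unfolding f_def by (rule stopped_power_integrable[OF power_component_pc t]) simp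
    have fn: "0 \<le> f n \<omega>" for n \<omega> unfolding f_def by (intro mult_nonneg_nonneg) (auto simp: zero_le_even_power)
    have fC: "(\<integral>\<omega>. f n \<omega> \<partial>M) \<le> C" for n
    proof -
      have "(\<integral>\<omega>. f n \<omega> \<partial>M) \<le> (\<Sum>i\<in>UNIV. \<integral>\<omega>. indicator (stop (real (Suc n)) t) \<omega> * (X t \<omega> $ i) ^ (2 * q) \<partial>M)"
        unfolding f_def by (rule member_le_sum) (auto intro: nn)
      also have "\<dots> \<le> m (real (Suc n)) t" by (simp add: m_def)
      also have "\<dots> \<le> C" by (rule mC[OF _ t]) simp
      finally show ?thesis .
    qed
    have lim: "AE \<omega> in M. (\<lambda>n. f n \<omega>) \<longlonglongrightarrow> (X t \<omega> $ i) ^ (2 * q)"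
      using AE_space
    proof eventually_elim
      case (elim \<omega>)
      have "compact ((\<lambda>u. X u \<omega>) ` {t0..T})" by (rule compact_continuous_image[OF X_cont[OF elim]]) simp
      then have "bounded ((\<lambda>u. X u \<omega>) ` {t0..T})" by (rule compact_imp_bounded)
      then obtain Rb where Rb: "\<And>u. u \<in> {t0..T} \<Longrightarrow> norm (X u \<omega>) \<le> Rb" unfolding bounded_iff by blast
      obtain n0 :: nat where n0: "Rb \<le> real n0" using real_arch_simple by blast
      have "\<omega> \<in> stop (real (Suc n)) t" if "n \<ge> n0" for n
      proof -
        have "norm (X u \<omega>) \<le> real (Suc n)" if "u \<in> {t0..t}" for u
        proof -
          have "norm (X u \<omega>) \<le> Rb" using that t by (intro Rb) auto
          then show ?thesis using n0 \<open>n \<ge> n0\<close> by simp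
        qed
        then show ?thesis using elim by (simp add: stop_def)
      qed
      then have "f n \<omega> = (X t \<omega> $ i) ^ (2 * q)" if "n \<ge> n0" for n using that by (simp add: f_def)
      then have "\<forall>\<^sub>F n in sequentially. f n \<omega> = (X t \<omega> $ i) ^ (2 * q)" unfolding eventually_sequentially by blast
      then show ?case by (rule tendsto_eventually)
    qed
    have gm: "(\<lambda>\<omega>. (X t \<omega> $ i) ^ (2 * q)) \<in> borel_measurable M"
      by (rule measurable_Fl_M[OF poly_cont_X_Fl[OF power_component_pc t]])
    show "integrable M (\<lambda>\<omega>. (X t \<omega> $ i) ^ (2 * q)) \<and> (\<integral>\<omega>. (X t \<omega> $ i) ^ (2 * q) \<partial>M) \<le> C"
      using fatou_bound[OF fi fn fC lim gm] by (simp add: zero_le_even_power)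
  qed
qed

end

section \<open>Moments of the solution and of grid sums, uniform over all grids\<close>

lemma norm_eq_axis_sum_le: "norm (\<Sum>i\<in>UNIV. f i *\<^sub>R axis i 1 :: real^'d::finite) \<le> (\<Sum>i\<in>UNIV. \<bar>f i\<bar>)"
  by (rule order_trans[OF norm_sum]) simp

lemma axis_sum_component: "(\<Sum>i\<in>UNIV. f i *\<^sub>R axis i 1 :: real^'d::finite) $ k = f k"
proof -
  have "(\<Sum>i\<in>UNIV. f i *\<^sub>R axis i 1 :: real^'d) $ k = (\<Sum>i\<in>UNIV. if i = k then f k else 0)"
    unfolding sum_component by (intro sum.cong refl) (simp add: axis_def)
  then show ?thesis by simp
qed

lemma power_add_le:
  fixes x y :: real
  assumes "0 \<le> x" "0 \<le> y"
  shows "(x + y) ^ n \<le> 2 ^ n * (x ^ n + y ^ n)"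
proof -
  have "(x + y) ^ n \<le> (2 * max x y) ^ n" using assms by (intro power_mono) auto
  also have "\<dots> = 2 ^ n * max x y ^ n" by (rule power_mult_distrib)
  also have "\<dots> \<le> 2 ^ n * (x ^ n + y ^ n)" using assms by (intro mult_left_mono) (auto simp: max_def)
  finally show ?thesis .
qed

text \<open>Linear growth is stated through \<open>coef\<close>, which combines drift and diffusion
  and is defined inside \<open>sde\<close>; hence a second locale.\<close>

locale sde_growth = sde M Fl W a b t0 T x0 X
  for M :: "'a measure" and Fl and W :: "'m::finite \<Rightarrow> real \<Rightarrow> 'a \<Rightarrow> real"
    and a :: "real^'d::finite \<Rightarrow> real^'d" and b :: "real^'d \<Rightarrow> real^'m^'d"
    and t0 T :: real and x0 :: "real^'d" and X :: "real \<Rightarrow> 'a \<Rightarrow> real^'d" +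
  assumes growth: "\<exists>K. \<forall>x i c. \<bar>coef i c x\<bar> \<le> K * (1 + norm x)"
begin

lemma component_moment:
  assumes "0 < q"
  obtains C where "0 \<le> C" "\<And>t i. t \<in> {t0..T} \<Longrightarrow> integrable M (\<lambda>\<omega>. (X t \<omega> $ i) ^ (2 * q)) \<and> (\<integral>\<omega>. (X t \<omega> $ i) ^ (2 * q) \<partial>M) \<le> C"
proof -
  obtain K where "\<And>x i c. \<bar>coef i c x\<bar> \<le> K * (1 + norm x)" using growth by blast
  then obtain C where C: "\<And>t i. t \<in> {t0..T} \<Longrightarrow> integrable M (\<lambda>\<omega>. (X t \<omega> $ i) ^ (2 * q)) \<and> (\<integral>\<omega>. (X t \<omega> $ i) ^ (2 * q) \<partial>M) \<le> C"
    using moment_bound[OF assms] by blast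
  have "0 \<le> (\<integral>\<omega>. (X t0 \<omega> $ undefined) ^ (2 * q) \<partial>M)"
    by (rule Bochner_Integration.integral_nonneg) (simp add: zero_le_even_power)
  also have "\<dots> \<le> C" using C[of t0 undefined] t0 by auto
  finally have "0 \<le> C" .
  then show thesis using that C by blast
qed

lemma norm_moment:
  obtains C where "0 \<le> C" "\<And>t. t \<in> {t0..T} \<Longrightarrow> integrable M (\<lambda>\<omega>. (1 + norm (X t \<omega>)) ^ p) \<and> (\<integral>\<omega>. (1 + norm (X t \<omega>)) ^ p \<partial>M) \<le> C"
proof -
  \<comment> \<open>Component moments are available for positive even exponents, and
    \<open>2 * Suc p\<close> exceeds \<open>p\<close>.\<close>
  define q where "q = Suc p"
  obtain C where C0: "0 \<le> C" and C: "\<And>t i. t \<in> {t0..T} \<Longrightarrow> integrable M (\<lambda>\<omega>. (X t \<omega> $ i) ^ (2 * q)) \<and> (\<integral>\<omega>. (X t \<omega> $ i) ^ (2 * q) \<partial>M) \<le> C"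
    by (rule component_moment[of q]) (auto simp: q_def)
  define c where "c = (1 + real CARD('d)) ^ (2 * q)"
  have c: "0 \<le> c" by (simp add: c_def)
  show thesis
  proof (rule that)
    show "0 \<le> c * (1 + real CARD('d) * C)" using c C0 by simp
    fix t assume t: "t \<in> {t0..T}"
    have le: "(1 + norm (X t \<omega>)) ^ p \<le> c * (1 + (\<Sum>i\<in>UNIV. (X t \<omega> $ i) ^ (2 * q)))" for \<omega>
    proof -
      have "(1 + norm (X t \<omega>)) ^ p \<le> (1 + norm (X t \<omega>)) ^ (2 * q)" by (intro power_increasing) (auto simp: q_def)
      also have "\<dots> \<le> c * (1 + (\<Sum>i\<in>UNIV. (X t \<omega> $ i) ^ (2 * q)))" unfolding c_def by (rule norm_power_le) (simp add: q_def)
      finally show ?thesis .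
    qed
    have int: "integrable M (\<lambda>\<omega>. c * (1 + (\<Sum>i\<in>UNIV. (X t \<omega> $ i) ^ (2 * q))))" using C[OF t] by simp
    have m: "(\<lambda>\<omega>. (1 + norm (X t \<omega>)) ^ p) \<in> borel_measurable M"
      by (intro borel_measurable_power borel_measurable_add borel_measurable_const measurable_compose[OF X_measurable[OF t] borel_measurable_norm])
    have i: "integrable M (\<lambda>\<omega>. (1 + norm (X t \<omega>)) ^ p)"
      by (rule Bochner_Integration.integrable_bound[OF int m]) (use le in \<open>auto intro!: always_eventually order_trans[OF _ abs_ge_self]\<close>)
    have "(\<integral>\<omega>. (1 + norm (X t \<omega>)) ^ p \<partial>M) \<le> (\<integral>\<omega>. c * (1 + (\<Sum>i\<in>UNIV. (X t \<omega> $ i) ^ (2 * q))) \<partial>M)"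
      by (rule integral_mono[OF i int le])
    also have "\<dots> = c * (1 + (\<Sum>i\<in>UNIV. \<integral>\<omega>. (X t \<omega> $ i) ^ (2 * q) \<partial>M))" using C[OF t] by (simp add: prob_space)
    also have "\<dots> \<le> c * (1 + (\<Sum>i\<in>(UNIV :: 'd set). C))" using C[OF t] c by (intro mult_left_mono add_left_mono sum_mono) auto
    finally show "integrable M (\<lambda>\<omega>. (1 + norm (X t \<omega>)) ^ p) \<and> (\<integral>\<omega>. (1 + norm (X t \<omega>)) ^ p \<partial>M) \<le> c * (1 + real CARD('d) * C)"
      using i by simp
  qed
qed

lemma poly_cont_moment:
  assumes g: "poly_cont g"
  obtains C where "0 \<le> C" "\<And>t. t \<in> {t0..T} \<Longrightarrow> integrable M (\<lambda>\<omega>. g (X t \<omega>)) \<and> (\<integral>\<omega>. \<bar>g (X t \<omega>)\<bar> \<partial>M) \<le> C"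
proof -
  obtain K r where K: "0 \<le> K" "\<And>x. \<bar>g x\<bar> \<le> K * (1 + norm x) ^ r" using poly_contE[OF g] by blast
  obtain C where C: "0 \<le> C" "\<And>t. t \<in> {t0..T} \<Longrightarrow> integrable M (\<lambda>\<omega>. (1 + norm (X t \<omega>)) ^ r) \<and> (\<integral>\<omega>. (1 + norm (X t \<omega>)) ^ r \<partial>M) \<le> C"
    by (rule norm_moment[of r]) blast
  show thesis
  proof (rule that)
    show "0 \<le> K * C" using K(1) C(1) by simp
    fix t assume t: "t \<in> {t0..T}"
    have int: "integrable M (\<lambda>\<omega>. K * (1 + norm (X t \<omega>)) ^ r)" using C(2)[OF t] by simp
    have i: "integrable M (\<lambda>\<omega>. g (X t \<omega>))"
      by (rule Bochner_Integration.integrable_bound[OF int measurable_Fl_M[OF poly_cont_X_Fl[OF g t]]])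
         (use K in \<open>auto intro!: always_eventually order_trans[OF _ abs_ge_self]\<close>)
    have "(\<integral>\<omega>. \<bar>g (X t \<omega>)\<bar> \<partial>M) \<le> (\<integral>\<omega>. K * (1 + norm (X t \<omega>)) ^ r \<partial>M)"
      using i by (intro integral_mono int K integrable_abs)
    also have "\<dots> \<le> K * C" using C(2)[OF t] K(1) by (simp add: mult_left_mono)
    finally show "integrable M (\<lambda>\<omega>. g (X t \<omega>)) \<and> (\<integral>\<omega>. \<bar>g (X t \<omega>)\<bar> \<partial>M) \<le> K * C" using i by simp
  qed
qed

text \<open>Paths are continuous, and the second moments of \<open>g (X t \<omega>)\<close> are
  bounded uniformly in time, so \<open>expectation_tendsto_of_square_bound\<close> applies along
  sequences.\<close>

lemma expectation_continuous:
  assumes g: "poly_cont g"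
  shows "continuous_on {t0..T} (\<lambda>t. \<integral>\<omega>. g (X t \<omega>) \<partial>M)"
  unfolding continuous_on_sequentially
proof (intro allI ballI impI)
  fix u t assume "t \<in> {t0..T}" and "(\<forall>n. u n \<in> {t0..T}) \<and> u \<longlonglongrightarrow> t"
  then have t: "t \<in> {t0..T}" and u: "\<And>n. u n \<in> {t0..T}" and lim: "u \<longlonglongrightarrow> t" by auto
  have g2: "poly_cont (\<lambda>x. (g x)\<^sup>2)" unfolding power2_eq_square by (rule poly_cont_mult[OF g g])
  obtain C where C: "\<And>t. t \<in> {t0..T} \<Longrightarrow> integrable M (\<lambda>\<omega>. (g (X t \<omega>))\<^sup>2) \<and> (\<integral>\<omega>. \<bar>(g (X t \<omega>))\<^sup>2\<bar> \<partial>M) \<le> C"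
    using poly_cont_moment[OF g2] by metis
  have "(\<lambda>n. \<integral>\<omega>. g (X (u n) \<omega>) \<partial>M) \<longlonglongrightarrow> (\<integral>\<omega>. g (X t \<omega>) \<partial>M)"
  proof (rule expectation_tendsto_of_square_bound(2))
    show "AE \<omega> in M. (\<lambda>n. g (X (u n) \<omega>)) \<longlonglongrightarrow> g (X t \<omega>)"
      using AE_space
    proof eventually_elim
      case (elim \<omega>)
      then show ?case
        using poly_cont_X_path[OF g elim] t u lim unfolding continuous_on_sequentially comp_def by blast
    qed
    show "(\<lambda>\<omega>. g (X (u n) \<omega>)) \<in> borel_measurable M" for n by (rule measurable_Fl_M[OF poly_cont_X_Fl[OF g u]])
    show "(\<lambda>\<omega>. g (X t \<omega>)) \<in> borel_measurable M" by (rule measurable_Fl_M[OF poly_cont_X_Fl[OF g t]])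
    show "integrable M (\<lambda>\<omega>. (g (X (u n) \<omega>))\<^sup>2)" for n using C[OF u] by blast
    show "(\<integral>\<omega>. (g (X (u n) \<omega>))\<^sup>2 \<partial>M) \<le> C" for n using C[OF u[of n]] by simp
  qed
  then show "((\<lambda>t. \<integral>\<omega>. g (X t \<omega>) \<partial>M) \<circ> u) \<longlonglongrightarrow> (\<integral>\<omega>. g (X t \<omega>) \<partial>M)" by (simp add: comp_def)
qed

text \<open>\<open>k\<close> counts the steps taken from \<open>s\<close>, not the steps of a full
  partition. The bound \<open>h \<le> 1\<close> allows higher powers of \<open>h\<close> to be
  estimated by lower ones.\<close>

definition valid_grid :: "real \<Rightarrow> real \<Rightarrow> nat \<Rightarrow> bool" where
  "valid_grid s h k \<longleftrightarrow> t0 \<le> s \<and> 0 < h \<and> h \<le> 1 \<and> s + real k * h \<le> T"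

lemma valid_grid_point:
  assumes "valid_grid s h k" "l \<le> k"
  shows "s + real l * h \<in> {t0..T}" "0 \<le> s + real l * h" "valid_grid s h l"
proof -
  have h: "0 < h" "t0 \<le> s" "s + real k * h \<le> T" using assms by (auto simp: valid_grid_def)
  have "real l * h \<le> real k * h" using h assms(2) by (intro mult_right_mono) auto
  moreover have "0 \<le> real l * h" using h by simp
  ultimately have "t0 \<le> s + real l * h" "s + real l * h \<le> T" using h by linarith+
  then show "s + real l * h \<in> {t0..T}" "0 \<le> s + real l * h" "valid_grid s h l"
    using h t0 assms(1) by (simp_all add: valid_grid_def)
qed

lemma valid_grid_start: "valid_grid s h k \<Longrightarrow> s \<in> {t0..T}"
  using valid_grid_point(1)[of s h k 0] by simp

lemma rsum_coefX_measurable: "valid_grid s h k \<Longrightarrow> rsum s h k (coefX i) \<in> borel_measurable (Fl (s + real k * h))"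
proof (rule rsum_measurable)
  assume v: "valid_grid s h k"
  show "0 \<le> s" "0 \<le> h" using v t0 by (auto simp: valid_grid_def)
  show "coefX i (s + real l * h) c \<in> borel_measurable (Fl (s + real l * h))" if "l < k" for l c
    using valid_grid_point(1)[OF v, of l] that by (intro coefX_measurable) auto
qed

lemma coef_power_pc: "poly_cont (\<lambda>x. coef i c x ^ k)"
  by (induction k) (auto intro: poly_cont_const poly_cont_mult coef_pc)

text \<open>Starting the sum at zero makes the bound proportional to the elapsed time
  \<open>real k * h\<close>, which later measures how far the grid has moved from its start.\<close>

lemma rsum_coefX_moment:
  assumes q: "0 < q"
  obtains C where "0 \<le> C" "\<And>s h k i. valid_grid s h k \<Longrightarrow> integrable M (\<lambda>\<omega>. rsum s h k (coefX i) \<omega> ^ (2 * q)) \<and>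
    (\<integral>\<omega>. rsum s h k (coefX i) \<omega> ^ (2 * q) \<partial>M) \<le> C * (real k * h)"
proof -
  obtain C where C: "0 \<le> C" and mom: "\<And>s h N y \<kappa> D. 0 \<le> s \<Longrightarrow> 0 < h \<Longrightarrow> h \<le> 1 \<Longrightarrow> y \<in> borel_measurable (Fl s) \<Longrightarrow> integrable M (\<lambda>\<omega>. y \<omega> ^ (2 * q)) \<Longrightarrow>
     (\<And>k c. k < N \<Longrightarrow> \<kappa> (s + real k * h) c \<in> borel_measurable (Fl (s + real k * h))) \<Longrightarrow>
     (\<And>k c. k < N \<Longrightarrow> integrable M (\<lambda>\<omega>. \<kappa> (s + real k * h) c \<omega> ^ (2 * q))) \<Longrightarrow>
     (\<And>k. k < N \<Longrightarrow> (\<Sum>c\<in>UNIV. \<integral>\<omega>. \<kappa> (s + real k * h) c \<omega> ^ (2 * q) \<partial>M) \<le> D k) \<Longrightarrow>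
     integrable M (\<lambda>\<omega>. (y \<omega> + rsum s h N \<kappa> \<omega>) ^ (2 * q)) \<and>
     (\<integral>\<omega>. (y \<omega> + rsum s h N \<kappa> \<omega>) ^ (2 * q) \<partial>M) \<le>
       exp (C * (real N * h)) * ((\<integral>\<omega>. y \<omega> ^ (2 * q) \<partial>M) + C * (h * (\<Sum>k<N. D k)))"
    using moment_rsum[OF q] by blast
  have "\<exists>B\<ge>0. \<forall>t\<in>{t0..T}. integrable M (\<lambda>\<omega>. coef i c (X t \<omega>) ^ (2 * q)) \<and> (\<integral>\<omega>. \<bar>coef i c (X t \<omega>) ^ (2 * q)\<bar> \<partial>M) \<le> B" for i c
    by (rule poly_cont_moment[OF coef_power_pc[of i c "2 * q"]]) blast
  then obtain B where B0: "\<And>i c. 0 \<le> B i c" and B: "\<And>i c t. t \<in> {t0..T} \<Longrightarrow>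
     integrable M (\<lambda>\<omega>. coef i c (X t \<omega>) ^ (2 * q)) \<and> (\<integral>\<omega>. \<bar>coef i c (X t \<omega>) ^ (2 * q)\<bar> \<partial>M) \<le> B i c" by metis
  define D where "D = (\<Sum>i\<in>UNIV. \<Sum>c\<in>UNIV. B i c)"
  have D: "(\<Sum>c\<in>UNIV. B i c) \<le> D" for i unfolding D_def using B0 by (intro member_le_sum[of i UNIV "\<lambda>i. \<Sum>c\<in>UNIV. B i c"] sum_nonneg) auto
  have D0: "0 \<le> D" unfolding D_def by (intro sum_nonneg B0)
  define L where "L = T - t0"
  show thesis
  proof (rule that)
    show "0 \<le> exp (C * L) * (C * D)" using C D0 by simp
    fix s h k i assume v: "valid_grid s h k"
    have h: "0 \<le> s" "0 < h" "h \<le> 1" "real k * h \<le> L" using v t0 by (auto simp: valid_grid_def L_def)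
    have "integrable M (\<lambda>\<omega>. (0 + rsum s h k (coefX i) \<omega>) ^ (2 * q)) \<and>
     (\<integral>\<omega>. (0 + rsum s h k (coefX i) \<omega>) ^ (2 * q) \<partial>M) \<le>
       exp (C * (real k * h)) * ((\<integral>\<omega>. 0 ^ (2 * q) \<partial>M) + C * (h * (\<Sum>l<k. D)))"
    proof (rule mom[of s h "\<lambda>_. 0" k "coefX i" "\<lambda>_. D", OF h(1-3)])
      fix l assume l: "l < k"
      then have g: "s + real l * h \<in> {t0..T}" using valid_grid_point(1)[OF v, of l] by simp
      show "coefX i (s + real l * h) c \<in> borel_measurable (Fl (s + real l * h))" for c by (rule coefX_measurable[OF g])
      show "integrable M (\<lambda>\<omega>. coefX i (s + real l * h) c \<omega> ^ (2 * q))" for c using B[OF g] by (simp add: coefX_def)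
      have "(\<Sum>c\<in>UNIV. \<integral>\<omega>. coefX i (s + real l * h) c \<omega> ^ (2 * q) \<partial>M) \<le> (\<Sum>c\<in>UNIV. B i c)"
      proof (rule sum_mono)
        show "(\<integral>\<omega>. coefX i (s + real l * h) c \<omega> ^ (2 * q) \<partial>M) \<le> B i c" for c
          using B[OF g, of i c] by (simp add: coefX_def zero_le_even_power)
      qed
      then show "(\<Sum>c\<in>UNIV. \<integral>\<omega>. coefX i (s + real l * h) c \<omega> ^ (2 * q) \<partial>M) \<le> D" using D[of i] by linarith
    qed (use q in \<open>auto simp: zero_power\<close>)
    moreover have "exp (C * (real k * h)) * ((\<integral>\<omega>. 0 ^ (2 * q) \<partial>M) + C * (h * (\<Sum>l<k. D))) \<le> exp (C * L) * (C * D) * (real k * h)"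
    proof -
      have "exp (C * (real k * h)) * ((\<integral>\<omega>. 0 ^ (2 * q) \<partial>M) + C * (h * (\<Sum>l<k. D))) = exp (C * (real k * h)) * (C * D * (real k * h))"
        using q by (simp add: zero_power mult_ac)
      also have "\<dots> \<le> exp (C * L) * (C * D * (real k * h))" using C D0 h by (intro mult_right_mono) (auto intro: mult_left_mono)
      finally show ?thesis by (simp add: mult_ac)
    qed
    ultimately show "integrable M (\<lambda>\<omega>. rsum s h k (coefX i) \<omega> ^ (2 * q)) \<and>
      (\<integral>\<omega>. rsum s h k (coefX i) \<omega> ^ (2 * q) \<partial>M) \<le> exp (C * L) * (C * D) * (real k * h)" by simp
  qed
qed

text \<open>Fatou's lemma transfers the bound from the sums to the solution. The order
  \<open>t - s\<close> is weaker than the expected \<open>(t - s) ^ q\<close> but sufficient for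
  closeness in mean.\<close>

lemma increment_moment:
  assumes q: "0 < q"
  obtains C where "0 \<le> C" "\<And>s t i. t0 \<le> s \<Longrightarrow> s \<le> t \<Longrightarrow> t \<le> T \<Longrightarrow> integrable M (\<lambda>\<omega>. (X t \<omega> $ i - X s \<omega> $ i) ^ (2 * q)) \<and>
    (\<integral>\<omega>. (X t \<omega> $ i - X s \<omega> $ i) ^ (2 * q) \<partial>M) \<le> C * (t - s)"
proof -
  obtain C where C: "0 \<le> C" "\<And>s h k i. valid_grid s h k \<Longrightarrow> integrable M (\<lambda>\<omega>. rsum s h k (coefX i) \<omega> ^ (2 * q)) \<and>
    (\<integral>\<omega>. rsum s h k (coefX i) \<omega> ^ (2 * q) \<partial>M) \<le> C * (real k * h)"
    using rsum_coefX_moment[OF q] by blast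
  show thesis
  proof (rule that[OF C(1)])
    fix s t i assume st: "t0 \<le> s" "s \<le> t" "t \<le> T"
    show "integrable M (\<lambda>\<omega>. (X t \<omega> $ i - X s \<omega> $ i) ^ (2 * q)) \<and> (\<integral>\<omega>. (X t \<omega> $ i - X s \<omega> $ i) ^ (2 * q) \<partial>M) \<le> C * (t - s)"
    proof (cases "s = t")
      case False
      then have s: "s < t" using st by simp
      obtain n0 :: nat where n0: "t - s \<le> real n0" using real_arch_simple by blast
      obtain r where r: "\<And>n. Suc n \<le> r n" "\<And>n. n0 \<le> r n" and
        lim: "AE \<omega> in M. \<forall>i. (\<lambda>n. rsum s ((t - s) / real (r n)) (r n) (coefX i) \<omega>) \<longlonglongrightarrow> X t \<omega> $ i - X s \<omega> $ i"
        by (rule rsum_conv[OF st(1) s st(3), of n0]) blast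
      have rp: "0 < real (r n)" "real n0 \<le> real (r n)" for n using r[of n] by auto
      have v: "valid_grid s ((t - s) / real (r n)) (r n)" and e: "real (r n) * ((t - s) / real (r n)) = t - s" for n
        using rp[of n] n0 s st by (auto simp: valid_grid_def pos_divide_le_eq)
      note R = C(2)[OF v, of _ i, unfolded e]
      have lim': "AE \<omega> in M. (\<lambda>n. rsum s ((t - s) / real (r n)) (r n) (coefX i) \<omega> ^ (2 * q)) \<longlonglongrightarrow> (X t \<omega> $ i - X s \<omega> $ i) ^ (2 * q)"
        using lim by eventually_elim (intro tendsto_power, blast)
      have tt: "t \<in> {t0..T}" "s \<in> {t0..T}" using st by auto
      have m: "(\<lambda>\<omega>. (X t \<omega> $ i - X s \<omega> $ i) ^ (2 * q)) \<in> borel_measurable M"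
        using measurable_Fl_M[OF poly_cont_X_Fl[OF power_component_pc[of i 1] tt(1)]] measurable_Fl_M[OF poly_cont_X_Fl[OF power_component_pc[of i 1] tt(2)]]
        by (intro borel_measurable_power borel_measurable_diff) simp_all
      show ?thesis
        using fatou_bound[OF conjunct1[OF R] _ conjunct2[OF R] lim' m] by (simp add: zero_le_even_power)
    qed (use q in \<open>simp add: zero_power\<close>)
  qed
qed

text \<open>The coefficients are those at the true solution, so this is a Riemann sum for the
  increment \<open>X (s + real k * h) \<omega> - X s \<omega>\<close> and not an Euler
  approximation.\<close>

definition grid_sum :: "real \<Rightarrow> real \<Rightarrow> nat \<Rightarrow> 'a \<Rightarrow> real^'d" where
  "grid_sum s h k \<omega> = (\<Sum>i\<in>UNIV. rsum s h k (coefX i) \<omega> *\<^sub>R axis i 1)"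

text \<open>One random variable that dominates the solution at both times and the sum. Polynomial
  bounds on a grid are reduced to its moments, which are uniform over all grids.\<close>

definition weight :: "real \<Rightarrow> real \<Rightarrow> nat \<Rightarrow> 'a \<Rightarrow> real" where
  "weight s h k \<omega> = 1 + norm (X s \<omega>) + norm (X (s + real k * h) \<omega>) + norm (grid_sum s h k \<omega>)"

lemma weight_ge: "1 \<le> weight s h k \<omega>"
  by (simp add: weight_def)

lemma grid_sum_measurable: "valid_grid s h k \<Longrightarrow> grid_sum s h k \<in> borel_measurable (Fl (s + real k * h))"
  unfolding grid_sum_def[abs_def] by (intro borel_measurable_sum borel_measurable_scaleR rsum_coefX_measurable borel_measurable_const)

lemma X_measurable_grid: "valid_grid s h k \<Longrightarrow> X s \<in> borel_measurable (Fl (s + real k * h))"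
proof -
  assume v: "valid_grid s h k"
  have "X s \<in> borel_measurable (Fl s)" by (rule X_Fl[OF valid_grid_start[OF v]])
  then show ?thesis
  proof (rule measurable_mono[of borel borel "Fl s" "Fl (s + real k * h)", THEN subsetD, rotated -1])
    show "sets (Fl s) \<subseteq> sets (Fl (s + real k * h))"
      using filtration v t0 by (auto simp: filtration_on_def valid_grid_def)
  qed (auto simp: space_Fl)
qed

lemma weight_measurable: "valid_grid s h k \<Longrightarrow> weight s h k \<in> borel_measurable (Fl (s + real k * h))"
  unfolding weight_def[abs_def]
  by (intro borel_measurable_add borel_measurable_const measurable_compose[OF _ borel_measurable_norm] grid_sum_measurable X_measurable_grid X_Fl valid_grid_point(1)) auto

lemma weight_moment:
  obtains C where "0 \<le> C" "\<And>s h k. valid_grid s h k \<Longrightarrow> integrable M (\<lambda>\<omega>. weight s h k \<omega> ^ p) \<and> (\<integral>\<omega>. weight s h k \<omega> ^ p \<partial>M) \<le> C"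
proof -
  define q where "q = Suc p"
  have q: "0 < q" by (simp add: q_def)
  obtain C1 where C1: "0 \<le> C1" "\<And>t. t \<in> {t0..T} \<Longrightarrow> integrable M (\<lambda>\<omega>. (1 + norm (X t \<omega>)) ^ (2 * q)) \<and> (\<integral>\<omega>. (1 + norm (X t \<omega>)) ^ (2 * q) \<partial>M) \<le> C1"
    by (rule norm_moment[of "2 * q"]) blast
  obtain C2 where C2: "0 \<le> C2" "\<And>s h k i. valid_grid s h k \<Longrightarrow> integrable M (\<lambda>\<omega>. rsum s h k (coefX i) \<omega> ^ (2 * q)) \<and>
    (\<integral>\<omega>. rsum s h k (coefX i) \<omega> ^ (2 * q) \<partial>M) \<le> C2 * (real k * h)"
    using rsum_coefX_moment[OF q] by blast
  define c where "c = real (card (UNIV :: 'd option option set)) ^ (2 * q)"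
  have c: "0 \<le> c" by (simp add: c_def)
  define B where "B = c * (C1 + (C1 + real CARD('d) * (C2 * (T - t0))))"
  show thesis
  proof (rule that)
    show "0 \<le> B" using c C1(1) C2(1) t0 by (simp add: B_def)
    fix s h k assume v: "valid_grid s h k"
    let ?u = "s + real k * h"
    have g: "s \<in> {t0..T}" "?u \<in> {t0..T}" using valid_grid_start[OF v] valid_grid_point(1)[OF v order_refl] by auto
    \<comment> \<open>The two nested layers of \<open>option\<close> index the two solution values,
      the innermost elements the components of the sum.\<close>
    define y where "y \<omega> d = (case d of None \<Rightarrow> 1 + norm (X s \<omega>) | Some None \<Rightarrow> 1 + norm (X ?u \<omega>) | Some (Some i) \<Rightarrow> \<bar>rsum s h k (coefX i) \<omega>\<bar>)" for \<omega> d
    define Y where "Y \<omega> = c * ((1 + norm (X s \<omega>)) ^ (2 * q) + ((1 + norm (X ?u \<omega>)) ^ (2 * q) + (\<Sum>i\<in>UNIV. rsum s h k (coefX i) \<omega> ^ (2 * q))))" for \<omega>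
    have le: "weight s h k \<omega> ^ p \<le> Y \<omega>" for \<omega>
    proof -
      have "weight s h k \<omega> \<le> (\<Sum>d\<in>UNIV. y \<omega> d)"
        unfolding sum_UNIV_option using norm_eq_axis_sum_le[of "\<lambda>i. rsum s h k (coefX i) \<omega>"]
        by (simp add: y_def weight_def grid_sum_def)
      then have "weight s h k \<omega> ^ (2 * q) \<le> \<bar>\<Sum>d\<in>UNIV. y \<omega> d\<bar> ^ (2 * q)" using weight_ge[of s h k \<omega>] by (intro power_mono) auto
      also have "\<dots> \<le> c * (\<Sum>d\<in>UNIV. \<bar>y \<omega> d\<bar> ^ (2 * q))"
        unfolding c_def by (rule power_sum_le) (use q in auto)
      also have "\<dots> = Y \<omega>" unfolding sum_UNIV_option by (simp add: y_def Y_def power_even_abs)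
      finally have "weight s h k \<omega> ^ (2 * q) \<le> Y \<omega>" .
      moreover have "weight s h k \<omega> ^ p \<le> weight s h k \<omega> ^ (2 * q)" using weight_ge by (intro power_increasing) (auto simp: q_def)
      ultimately show ?thesis by linarith
    qed
    have Yi: "integrable M Y" unfolding Y_def using C1(2)[OF g(1)] C1(2)[OF g(2)] C2(2)[OF v] by simp
    have m: "(\<lambda>\<omega>. weight s h k \<omega> ^ p) \<in> borel_measurable M" by (intro borel_measurable_power measurable_Fl_M[OF weight_measurable[OF v]])
    have i: "integrable M (\<lambda>\<omega>. weight s h k \<omega> ^ p)"
    proof (rule Bochner_Integration.integrable_bound[OF Yi m])
      have "norm (weight s h k \<omega> ^ p) \<le> norm (Y \<omega>)" for \<omega>
        using le[of \<omega>] zero_le_power[of "weight s h k \<omega>" p] weight_ge[of s h k \<omega>] unfolding real_norm_def by linarith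
      then show "AE \<omega> in M. norm (weight s h k \<omega> ^ p) \<le> norm (Y \<omega>)" by simp
    qed
    have "(\<integral>\<omega>. weight s h k \<omega> ^ p \<partial>M) \<le> (\<integral>\<omega>. Y \<omega> \<partial>M)" by (rule integral_mono[OF i Yi le])
    also have "\<dots> = c * ((\<integral>\<omega>. (1 + norm (X s \<omega>)) ^ (2 * q) \<partial>M) + ((\<integral>\<omega>. (1 + norm (X ?u \<omega>)) ^ (2 * q) \<partial>M) + (\<Sum>i\<in>UNIV. \<integral>\<omega>. rsum s h k (coefX i) \<omega> ^ (2 * q) \<partial>M)))"
      unfolding Y_def using C1(2)[OF g(1)] C1(2)[OF g(2)] C2(2)[OF v] by simp
    also have "\<dots> \<le> c * (C1 + (C1 + (\<Sum>i\<in>(UNIV :: 'd set). C2 * (T - t0))))"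
    proof -
      have "C2 * (real k * h) \<le> C2 * (T - t0)" using v C2(1) by (intro mult_left_mono) (auto simp: valid_grid_def)
      then have "(\<integral>\<omega>. rsum s h k (coefX i) \<omega> ^ (2 * q) \<partial>M) \<le> C2 * (T - t0)" for i using C2(2)[OF v, of i] by linarith
      then show ?thesis using C1(2)[OF g(1)] C1(2)[OF g(2)] c by (intro mult_left_mono add_mono sum_mono) auto
    qed
    finally show "integrable M (\<lambda>\<omega>. weight s h k \<omega> ^ p) \<and> (\<integral>\<omega>. weight s h k \<omega> ^ p \<partial>M) \<le> B" using i by (simp add: B_def)
  qed
qed

text \<open>Continuity of \<^term>\<open>H\<close> along the grid: both arguments stay close to the starting value in
  fourth mean.\<close>
lemma grid_expectation_close:
  fixes H :: "(real^'d) \<times> (real^'d) \<Rightarrow> real"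
  assumes H: "poly_cont H"
  obtains A where "0 \<le> A" "\<And>e. 0 < e \<Longrightarrow> \<exists>C\<ge>0. \<forall>s h k. valid_grid s h k \<longrightarrow>
    integrable M (\<lambda>\<omega>. H (X (s + real k * h) \<omega>, X s \<omega> + grid_sum s h k \<omega>)) \<and>
    \<bar>(\<integral>\<omega>. H (X (s + real k * h) \<omega>, X s \<omega> + grid_sum s h k \<omega>) \<partial>M) - (\<integral>\<omega>. H (X s \<omega>, X s \<omega>) \<partial>M)\<bar> \<le> e * A + C * (real k * h)"
proof -
  obtain p where p: "\<And>e. 0 < e \<Longrightarrow> \<exists>C\<ge>0. \<forall>z y. \<bar>H (z + y) - H z\<bar> \<le> e * (1 + norm z + norm y) ^ p + C * norm y ^ 4"
    using poly_cont_modulus[OF H] by blast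
  obtain K r where K: "0 \<le> K" "\<And>x. \<bar>H x\<bar> \<le> K * (1 + norm x) ^ r" using poly_contE[OF H] by blast
  obtain Vp where Vp: "0 \<le> Vp" "\<And>s h k. valid_grid s h k \<Longrightarrow> integrable M (\<lambda>\<omega>. weight s h k \<omega> ^ p) \<and> (\<integral>\<omega>. weight s h k \<omega> ^ p \<partial>M) \<le> Vp" by (rule weight_moment[of p]) blast
  obtain Vr where Vr: "\<And>s h k. valid_grid s h k \<Longrightarrow> integrable M (\<lambda>\<omega>. weight s h k \<omega> ^ r) \<and> (\<integral>\<omega>. weight s h k \<omega> ^ r \<partial>M) \<le> Vr" by (rule weight_moment[of r]) blast
  obtain C1 where C1: "0 \<le> C1" "\<And>s t i. t0 \<le> s \<Longrightarrow> s \<le> t \<Longrightarrow> t \<le> T \<Longrightarrow> integrable M (\<lambda>\<omega>. (X t \<omega> $ i - X s \<omega> $ i) ^ (2 * 2)) \<and>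
    (\<integral>\<omega>. (X t \<omega> $ i - X s \<omega> $ i) ^ (2 * 2) \<partial>M) \<le> C1 * (t - s)" using increment_moment[of 2] by auto
  obtain C2 where C2: "0 \<le> C2" "\<And>s h k i. valid_grid s h k \<Longrightarrow> integrable M (\<lambda>\<omega>. rsum s h k (coefX i) \<omega> ^ (2 * 2)) \<and>
    (\<integral>\<omega>. rsum s h k (coefX i) \<omega> ^ (2 * 2) \<partial>M) \<le> C2 * (real k * h)"
    using rsum_coefX_moment[of 2] by auto
  define c where "c = real CARD('d) ^ 4"
  have c: "0 \<le> c" by (simp add: c_def)
  \<comment> \<open>The factor \<open>2 ^ 4\<close> separates the increments of the two arguments of
    \<open>H\<close>, and \<open>c\<close> the coordinates of each.\<close>
  define F where "F = 2 ^ 4 * (c * (real CARD('d) * C1) + c * (real CARD('d) * C2))"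
  have F: "0 \<le> F" using c C1(1) C2(1) by (simp add: F_def)
  \<comment> \<open>The \<open>4\<close> arises from bounding one plus the norms of the start pair
    and of its increment by \<open>4 * weight s h k \<omega>\<close>.\<close>
  define A where "A = 4 ^ p * Vp"
  have A: "0 \<le> A" using Vp(1) by (simp add: A_def)
  show thesis
  proof (rule that[OF A])
    fix e :: real assume e: "0 < e"
    obtain C where C: "0 \<le> C" and mod: "\<And>z y. \<bar>H (z + y) - H z\<bar> \<le> e * (1 + norm z + norm y) ^ p + C * norm y ^ 4" using p[OF e] by blast
    have "integrable M (\<lambda>\<omega>. H (X (s + real k * h) \<omega>, X s \<omega> + grid_sum s h k \<omega>)) \<and>
      \<bar>(\<integral>\<omega>. H (X (s + real k * h) \<omega>, X s \<omega> + grid_sum s h k \<omega>) \<partial>M) - (\<integral>\<omega>. H (X s \<omega>, X s \<omega>) \<partial>M)\<bar> \<le> e * A + (C * F) * (real k * h)"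
      if v: "valid_grid s h k" for s h k
    proof -
      let ?u = "s + real k * h"
      have g: "s \<in> {t0..T}" "?u \<in> {t0..T}" using valid_grid_start[OF v] valid_grid_point(1)[OF v order_refl] by auto
      have kh: "0 \<le> real k * h" using v by (simp add: valid_grid_def)
      note Xm = X_measurable[OF g(1)] X_measurable[OF g(2)]
      have Rm: "grid_sum s h k \<in> borel_measurable M"
        unfolding grid_sum_def[abs_def]
        by (intro borel_measurable_sum borel_measurable_scaleR measurable_Fl_M[OF rsum_coefX_measurable[OF v]] borel_measurable_const)
      have Hm: "(\<lambda>\<omega>. H (Y \<omega>, Z \<omega>)) \<in> borel_measurable M" if "Y \<in> borel_measurable M" "Z \<in> borel_measurable M" for Y Z
        by (rule measurable_compose[OF borel_measurable_Pair[OF that] poly_cont_measurable[OF H]])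
      have bound: "integrable M (\<lambda>\<omega>. H (Y \<omega>, Z \<omega>))" if m: "Y \<in> borel_measurable M" "Z \<in> borel_measurable M"
        and l: "\<And>\<omega>. 1 + norm (Y \<omega>) + norm (Z \<omega>) \<le> 2 * weight s h k \<omega>" for Y Z
      proof (rule Bochner_Integration.integrable_bound[OF _ Hm[OF m]])
        show "integrable M (\<lambda>\<omega>. K * (2 ^ r * weight s h k \<omega> ^ r))" using Vr[OF v] by simp
        have "norm (H (Y \<omega>, Z \<omega>)) \<le> norm (K * (2 ^ r * weight s h k \<omega> ^ r))" for \<omega>
        proof -
          have "norm (Y \<omega>, Z \<omega>) \<le> norm (Y \<omega>) + norm (Z \<omega>)" by (rule norm_Pair_le)
          then have "(1 + norm (Y \<omega>, Z \<omega>)) ^ r \<le> (2 * weight s h k \<omega>) ^ r" using l[of \<omega>] by (intro power_mono) auto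
          then have "K * (1 + norm (Y \<omega>, Z \<omega>)) ^ r \<le> K * (2 ^ r * weight s h k \<omega> ^ r)" using K(1) by (intro mult_left_mono) (auto simp: power_mult_distrib)
          then show ?thesis using K(2)[of "(Y \<omega>, Z \<omega>)"] unfolding real_norm_def by linarith
        qed
        then show "AE \<omega> in M. norm (H (Y \<omega>, Z \<omega>)) \<le> norm (K * (2 ^ r * weight s h k \<omega> ^ r))" by simp
      qed
      have i1: "integrable M (\<lambda>\<omega>. H (X ?u \<omega>, X s \<omega> + grid_sum s h k \<omega>))"
      proof (rule bound)
        show "1 + norm (X ?u \<omega>) + norm (X s \<omega> + grid_sum s h k \<omega>) \<le> 2 * weight s h k \<omega>" for \<omega>
        proof -
          have "1 + q + w \<le> 2 * (1 + p + q + r)" if le: "w \<le> p + r" and "0 \<le> p" "0 \<le> q" "0 \<le> r" for p q r w :: real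
          proof -
            have "1 + q + w \<le> 1 + q + (p + r)" using le by simp
            also have "\<dots> \<le> 2 * (1 + p + q + r)" using that by simp
            finally show ?thesis .
          qed
          from this[OF norm_triangle_ineq norm_ge_zero norm_ge_zero norm_ge_zero] show ?thesis unfolding weight_def .
        qed
      qed (use Xm Rm in \<open>auto intro: borel_measurable_add\<close>)
      have i2: "integrable M (\<lambda>\<omega>. H (X s \<omega>, X s \<omega>))"
      proof (rule bound)
        show "1 + norm (X s \<omega>) + norm (X s \<omega>) \<le> 2 * weight s h k \<omega>" for \<omega>
          unfolding weight_def by (simp add: algebra_simps)
      qed (use Xm in auto)
      define Y4 where "Y4 \<omega> = 2 ^ 4 * (c * (\<Sum>i\<in>UNIV. (X ?u \<omega> $ i - X s \<omega> $ i) ^ (2 * 2)) + c * (\<Sum>i\<in>UNIV. rsum s h k (coefX i) \<omega> ^ (2 * 2)))" for \<omega>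
      have st: "t0 \<le> s" "s \<le> ?u" "?u \<le> T" using g kh by auto
      have Y4i: "integrable M Y4" unfolding Y4_def using C1(2)[OF st] C2(2)[OF v] by simp
      have "(\<integral>\<omega>. Y4 \<omega> \<partial>M) = 2 ^ 4 * (c * (\<Sum>i\<in>UNIV. \<integral>\<omega>. (X ?u \<omega> $ i - X s \<omega> $ i) ^ (2 * 2) \<partial>M) + c * (\<Sum>i\<in>UNIV. \<integral>\<omega>. rsum s h k (coefX i) \<omega> ^ (2 * 2) \<partial>M))"
        unfolding Y4_def using C1(2)[OF st] C2(2)[OF v] by simp
      also have "\<dots> \<le> 2 ^ 4 * (c * (\<Sum>i\<in>(UNIV :: 'd set). C1 * (real k * h)) + c * (\<Sum>i\<in>(UNIV :: 'd set). C2 * (real k * h)))"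
      proof -
        have "(\<integral>\<omega>. (X ?u \<omega> $ i - X s \<omega> $ i) ^ (2 * 2) \<partial>M) \<le> C1 * (real k * h)" for i using C1(2)[OF st, of i] by simp
        then show ?thesis using C2(2)[OF v] c by (intro mult_left_mono add_mono sum_mono) auto
      qed
      also have "\<dots> = F * (real k * h)" by (simp add: F_def algebra_simps)
      finally have Y4e: "(\<integral>\<omega>. Y4 \<omega> \<partial>M) \<le> F * (real k * h)" .
      have pw: "\<bar>H (X ?u \<omega>, X s \<omega> + grid_sum s h k \<omega>) - H (X s \<omega>, X s \<omega>)\<bar> \<le> e * (4 ^ p * weight s h k \<omega> ^ p) + C * Y4 \<omega>" for \<omega>
      proof -
        let ?z = "(X s \<omega>, X s \<omega>)" and ?y = "(X ?u \<omega> - X s \<omega>, grid_sum s h k \<omega>)"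
        have ny: "norm ?y \<le> norm (X ?u \<omega> - X s \<omega>) + norm (grid_sum s h k \<omega>)" by (rule norm_Pair_le)
        have nz: "norm ?z \<le> norm (X s \<omega>) + norm (X s \<omega>)" by (rule norm_Pair_le)
        have V4: "4 * weight s h k \<omega> = 4 + 4 * norm (X s \<omega>) + 4 * norm (X ?u \<omega>) + 4 * norm (grid_sum s h k \<omega>)"
          by (simp add: weight_def algebra_simps)
        have "1 + norm ?z + norm ?y \<le> 4 * weight s h k \<omega>"
          using ny nz norm_triangle_ineq4[of "X ?u \<omega>" "X s \<omega>"] norm_ge_zero[of "X s \<omega>"] norm_ge_zero[of "X ?u \<omega>"] norm_ge_zero[of "grid_sum s h k \<omega>"]
          unfolding V4 by linarith
        then have "(1 + norm ?z + norm ?y) ^ p \<le> (4 * weight s h k \<omega>) ^ p" by (intro power_mono) auto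
        then have 1: "e * (1 + norm ?z + norm ?y) ^ p \<le> e * (4 ^ p * weight s h k \<omega> ^ p)" using e by (intro mult_left_mono) (auto simp: power_mult_distrib)
        have "norm ?y ^ 4 \<le> (norm (X ?u \<omega> - X s \<omega>) + norm (grid_sum s h k \<omega>)) ^ 4" using ny by (intro power_mono) auto
        also have "\<dots> \<le> 2 ^ 4 * (norm (X ?u \<omega> - X s \<omega>) ^ 4 + norm (grid_sum s h k \<omega>) ^ 4)" by (rule power_add_le) auto
        also have "\<dots> \<le> Y4 \<omega>"
        proof -
          have "norm (X ?u \<omega> - X s \<omega>) ^ 4 \<le> \<bar>\<Sum>i\<in>UNIV. \<bar>(X ?u \<omega> - X s \<omega>) $ i\<bar>\<bar> ^ 4"
            using norm_le_l1_cart[of "X ?u \<omega> - X s \<omega>"] by (intro power_mono) auto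
          also have "\<dots> \<le> c * (\<Sum>i\<in>UNIV. \<bar>\<bar>(X ?u \<omega> - X s \<omega>) $ i\<bar>\<bar> ^ 4)" unfolding c_def by (rule power_sum_le) auto
          finally have a: "norm (X ?u \<omega> - X s \<omega>) ^ 4 \<le> c * (\<Sum>i\<in>UNIV. (X ?u \<omega> $ i - X s \<omega> $ i) ^ (2 * 2))" by (simp add: power_even_abs)
          have "norm (grid_sum s h k \<omega>) ^ 4 \<le> \<bar>\<Sum>i\<in>UNIV. \<bar>rsum s h k (coefX i) \<omega>\<bar>\<bar> ^ 4"
            unfolding grid_sum_def using norm_eq_axis_sum_le[of "\<lambda>i. rsum s h k (coefX i) \<omega>"] by (intro power_mono) auto
          also have "\<dots> \<le> c * (\<Sum>i\<in>UNIV. \<bar>\<bar>rsum s h k (coefX i) \<omega>\<bar>\<bar> ^ 4)" unfolding c_def by (rule power_sum_le) auto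
          finally have b: "norm (grid_sum s h k \<omega>) ^ 4 \<le> c * (\<Sum>i\<in>UNIV. rsum s h k (coefX i) \<omega> ^ (2 * 2))" by (simp add: power_even_abs)
          show ?thesis unfolding Y4_def by (intro mult_left_mono add_mono a b) simp
        qed
        finally have 2: "C * norm ?y ^ 4 \<le> C * Y4 \<omega>" using C by (intro mult_left_mono)
        have "\<bar>H (?z + ?y) - H ?z\<bar> \<le> e * (4 ^ p * weight s h k \<omega> ^ p) + C * Y4 \<omega>"
          using mod[of ?z ?y] 1 2 by linarith
        then show ?thesis by simp
      qed
      have "\<bar>(\<integral>\<omega>. H (X ?u \<omega>, X s \<omega> + grid_sum s h k \<omega>) \<partial>M) - (\<integral>\<omega>. H (X s \<omega>, X s \<omega>) \<partial>M)\<bar> = \<bar>\<integral>\<omega>. H (X ?u \<omega>, X s \<omega> + grid_sum s h k \<omega>) - H (X s \<omega>, X s \<omega>) \<partial>M\<bar>"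
        using i1 i2 by simp
      also have "\<dots> \<le> (\<integral>\<omega>. \<bar>H (X ?u \<omega>, X s \<omega> + grid_sum s h k \<omega>) - H (X s \<omega>, X s \<omega>)\<bar> \<partial>M)" by (rule integral_abs_bound)
      also have "\<dots> \<le> (\<integral>\<omega>. e * (4 ^ p * weight s h k \<omega> ^ p) + C * Y4 \<omega> \<partial>M)"
        using i1 i2 pw Vp(2)[OF v] Y4i by (intro integral_mono integrable_abs Bochner_Integration.integrable_diff) auto
      also have "\<dots> = e * (4 ^ p * (\<integral>\<omega>. weight s h k \<omega> ^ p \<partial>M)) + C * (\<integral>\<omega>. Y4 \<omega> \<partial>M)"
        using Vp(2)[OF v] Y4i by simp
      also have "\<dots> \<le> e * (4 ^ p * Vp) + C * (F * (real k * h))"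
        using Vp(2)[OF v] Y4e e C by (intro add_mono mult_left_mono) auto
      finally show ?thesis using i1 by (simp add: A_def mult.assoc)
    qed
    then show "\<exists>C\<ge>0. \<forall>s h k. valid_grid s h k \<longrightarrow>
      integrable M (\<lambda>\<omega>. H (X (s + real k * h) \<omega>, X s \<omega> + grid_sum s h k \<omega>)) \<and>
      \<bar>(\<integral>\<omega>. H (X (s + real k * h) \<omega>, X s \<omega> + grid_sum s h k \<omega>) \<partial>M) - (\<integral>\<omega>. H (X s \<omega>, X s \<omega>) \<partial>M)\<bar> \<le> e * A + C * (real k * h)"
      using C F by (intro exI[of _ "C * F"]) auto
  qed
qed

end

subsection \<open>Dynkin's formula\<close>

context sde_growth
begin

definition grid :: "real \<Rightarrow> real \<Rightarrow> nat \<Rightarrow> 'a \<Rightarrow> (real^'d) \<times> (real^'d)" where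
  "grid s h k \<omega> = (X (s + real k * h) \<omega>, X s \<omega> + grid_sum s h k \<omega>)"

lemma grid_measurable:
  assumes "valid_grid s h k" "poly_cont H"
  shows "(\<lambda>\<omega>. H (grid s h k \<omega>)) \<in> borel_measurable (Fl (s + real k * h))"
  unfolding grid_def
  by (intro measurable_compose[OF borel_measurable_Pair poly_cont_measurable[OF assms(2)]] borel_measurable_add
        X_measurable_grid grid_sum_measurable X_Fl valid_grid_point(1) assms(1)) (use assms in auto)

lemma grid_close:
  assumes H: "poly_cont H"
  obtains A where "0 \<le> A" "\<And>e. 0 < e \<Longrightarrow> \<exists>C\<ge>0. \<forall>s h k. valid_grid s h k \<longrightarrow> integrable M (\<lambda>\<omega>. H (grid s h k \<omega>)) \<and>
    \<bar>(\<integral>\<omega>. H (grid s h k \<omega>) \<partial>M) - (\<integral>\<omega>. H (X s \<omega>, X s \<omega>) \<partial>M)\<bar> \<le> e * A + C * (real k * h)"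
  unfolding grid_def by (rule grid_expectation_close[OF H]) blast

text \<open>Closeness with \<open>e = 1\<close> reduces the claim to the diagonal, where the moments
  of the solution apply.\<close>

lemma grid_bound:
  assumes H: "poly_cont H"
  obtains B where "0 \<le> B" "\<And>s h k. valid_grid s h k \<Longrightarrow> integrable M (\<lambda>\<omega>. H (grid s h k \<omega>)) \<and> \<bar>\<integral>\<omega>. H (grid s h k \<omega>) \<partial>M\<bar> \<le> B"
proof -
  have "poly_cont (\<lambda>x. H (x, x))" by (rule poly_cont_compose_linear[OF H]) (intro bounded_linear_Pair bounded_linear_ident)
  then obtain D where D: "0 \<le> D" "\<And>t. t \<in> {t0..T} \<Longrightarrow> integrable M (\<lambda>\<omega>. H (X t \<omega>, X t \<omega>)) \<and> (\<integral>\<omega>. \<bar>H (X t \<omega>, X t \<omega>)\<bar> \<partial>M) \<le> D"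
    by (rule poly_cont_moment) blast
  obtain A where A: "0 \<le> A" and cl: "\<And>e. 0 < e \<Longrightarrow> \<exists>C\<ge>0. \<forall>s h k. valid_grid s h k \<longrightarrow> integrable M (\<lambda>\<omega>. H (grid s h k \<omega>)) \<and>
    \<bar>(\<integral>\<omega>. H (grid s h k \<omega>) \<partial>M) - (\<integral>\<omega>. H (X s \<omega>, X s \<omega>) \<partial>M)\<bar> \<le> e * A + C * (real k * h)"
    by (rule grid_close[OF H]) blast
  obtain C where C: "0 \<le> C" "\<And>s h k. valid_grid s h k \<Longrightarrow> integrable M (\<lambda>\<omega>. H (grid s h k \<omega>)) \<and>
    \<bar>(\<integral>\<omega>. H (grid s h k \<omega>) \<partial>M) - (\<integral>\<omega>. H (X s \<omega>, X s \<omega>) \<partial>M)\<bar> \<le> 1 * A + C * (real k * h)"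
    using cl[of 1] by (auto simp del: mult_1_left)
  show thesis
  proof (rule that)
    show "0 \<le> D + A + C * (T - t0)" using D(1) A C(1) t0 by simp
    fix s h k assume v: "valid_grid s h k"
    have "C * (real k * h) \<le> C * (T - t0)" using v C(1) by (intro mult_left_mono) (auto simp: valid_grid_def)
    moreover have "\<bar>\<integral>\<omega>. H (X s \<omega>, X s \<omega>) \<partial>M\<bar> \<le> D"
      using D(2)[OF valid_grid_start[OF v]] integral_abs_bound[of M "\<lambda>\<omega>. H (X s \<omega>, X s \<omega>)"] by linarith
    ultimately show "integrable M (\<lambda>\<omega>. H (grid s h k \<omega>)) \<and> \<bar>\<integral>\<omega>. H (grid s h k \<omega>) \<partial>M\<bar> \<le> D + A + C * (T - t0)"
      using C(2)[OF v] by linarith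
  qed
qed

definition eta :: "real \<Rightarrow> real \<Rightarrow> nat \<Rightarrow> 'a \<Rightarrow> real^'d" where
  "eta s h k \<omega> = (\<Sum>i\<in>UNIV. (\<Sum>c\<in>UNIV. coefX i (s + real k * h) c \<omega> * noise (s + real k * h) h c \<omega>) *\<^sub>R axis i 1)"

lemma grid_sum_Suc: "grid_sum s h (Suc k) \<omega> = grid_sum s h k \<omega> + eta s h k \<omega>"
  by (simp add: grid_sum_def eta_def rsum_Suc scaleR_add_left sum.distrib)

lemma eta_component: "eta s h k \<omega> $ i = (\<Sum>c\<in>UNIV. coefX i (s + real k * h) c \<omega> * noise (s + real k * h) h c \<omega>)"
  unfolding eta_def by (rule axis_sum_component)

lemma eta_measurable:
  assumes v: "valid_grid s h k" shows "eta s h k \<in> borel_measurable M"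
proof -
  have u: "0 \<le> s + real k * h" "0 \<le> h" "s + real k * h \<in> {t0..T}" using valid_grid_point[OF v order_refl] v by (auto simp: valid_grid_def)
  show ?thesis
    unfolding eta_def[abs_def]
    by (intro borel_measurable_sum borel_measurable_scaleR borel_measurable_times borel_measurable_const
        measurable_Fl_M[OF coefX_measurable[OF u(3)]] measurable_Fl_M[OF noise_measurable[OF u(1,2)]])
qed

text \<open>Weight and coefficients are known at the left grid point and hence independent of the
  increment, whose moments of order \<open>2 * q\<close> supply the factor
  \<open>h ^ q\<close>.\<close>

lemma eta_moment:
  assumes q: "0 < q"
  obtains C where "0 \<le> C" "\<And>s h k. valid_grid s h k \<Longrightarrow> integrable M (\<lambda>\<omega>. weight s h k \<omega> ^ p * norm (eta s h k \<omega>) ^ (2 * q)) \<and>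
    (\<integral>\<omega>. weight s h k \<omega> ^ p * norm (eta s h k \<omega>) ^ (2 * q) \<partial>M) \<le> C * h ^ q"
proof -
  obtain K where K: "\<And>x i c. \<bar>coef i c x\<bar> \<le> K * (1 + norm x)" using growth by blast
  have K0: "0 \<le> K" using K[of undefined undefined 0] by simp
  obtain B where B: "0 \<le> B" "\<And>s h k. valid_grid s h k \<Longrightarrow> integrable M (\<lambda>\<omega>. weight s h k \<omega> ^ (p + 2 * q)) \<and> (\<integral>\<omega>. weight s h k \<omega> ^ (p + 2 * q) \<partial>M) \<le> B"
    by (rule weight_moment[of "p + 2 * q"]) blast
  obtain g where g: "0 \<le> g" "\<And>u h U c. 0 \<le> u \<Longrightarrow> 0 < h \<Longrightarrow> h \<le> 1 \<Longrightarrow> U \<in> borel_measurable (Fl u) \<Longrightarrow> integrable M U \<Longrightarrow>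
    (\<And>\<omega>. 0 \<le> U \<omega>) \<Longrightarrow> (\<integral>\<omega>. U \<omega> * noise u h c \<omega> ^ (2 * q) \<partial>M) \<le> g * h ^ q * (\<integral>\<omega>. U \<omega> \<partial>M)"
    by (rule mult_noise_even_le[of q]) blast
  define N where "N = real (card (UNIV :: ('d \<times> 'm option) set)) ^ (2 * q)"
  have N: "0 \<le> N" by (simp add: N_def)
  define A where "A = K ^ (2 * q) * B"
  have A: "0 \<le> A" using K0 B(1) by (simp add: A_def)
  show thesis
  proof (rule that)
    show "0 \<le> N * (real (card (UNIV :: ('d \<times> 'm option) set)) * (g * A))" using N g(1) A by simp
    fix s h k assume v: "valid_grid s h k"
    let ?u = "s + real k * h"
    have h: "0 < h" "h \<le> 1" using v by (auto simp: valid_grid_def)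
    have u: "0 \<le> ?u" "?u \<in> {t0..T}" using valid_grid_point[OF v order_refl] by auto
    define U where "U d \<omega> = weight s h k \<omega> ^ p * coefX (fst d) ?u (snd d) \<omega> ^ (2 * q)" for d and \<omega>
    define Y where "Y \<omega> = N * (\<Sum>d\<in>UNIV. U d \<omega> * noise ?u h (snd d) \<omega> ^ (2 * q))" for \<omega>
    have U0: "0 \<le> U d \<omega>" for d \<omega> using weight_ge[of s h k \<omega>] by (simp add: U_def zero_le_even_power)
    have Um: "U d \<in> borel_measurable (Fl ?u)" for d
      unfolding U_def[abs_def] by (intro borel_measurable_times borel_measurable_power weight_measurable[OF v] coefX_measurable[OF u(2)])
    have Ule: "U d \<omega> \<le> K ^ (2 * q) * weight s h k \<omega> ^ (p + 2 * q)" for d \<omega>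
    proof -
      have "\<bar>coefX (fst d) ?u (snd d) \<omega>\<bar> \<le> K * weight s h k \<omega>"
      proof -
        have "K * (1 + norm (X ?u \<omega>)) \<le> K * weight s h k \<omega>" using K0 by (intro mult_left_mono) (auto simp: weight_def)
        then show ?thesis using K[of "fst d" "snd d" "X ?u \<omega>"] by (simp add: coefX_def)
      qed
      then have "\<bar>coefX (fst d) ?u (snd d) \<omega>\<bar> ^ (2 * q) \<le> (K * weight s h k \<omega>) ^ (2 * q)" by (intro power_mono) auto
      then have "weight s h k \<omega> ^ p * coefX (fst d) ?u (snd d) \<omega> ^ (2 * q) \<le> weight s h k \<omega> ^ p * (K * weight s h k \<omega>) ^ (2 * q)"
        using weight_ge[of s h k \<omega>] by (intro mult_left_mono) (auto simp: power_even_abs)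
      then show ?thesis by (simp add: U_def power_mult_distrib power_add mult_ac)
    qed
    have Vi: "integrable M (\<lambda>\<omega>. K ^ (2 * q) * weight s h k \<omega> ^ (p + 2 * q))" using B(2)[OF v] by simp
    have Ui: "integrable M (U d)" for d
    proof (rule Bochner_Integration.integrable_bound[OF Vi measurable_Fl_M[OF Um]])
      have "norm (U d \<omega>) \<le> norm (K ^ (2 * q) * weight s h k \<omega> ^ (p + 2 * q))" for \<omega>
        using U0[of d \<omega>] Ule[of d \<omega>] unfolding real_norm_def by linarith
      then show "AE \<omega> in M. norm (U d \<omega>) \<le> norm (K ^ (2 * q) * weight s h k \<omega> ^ (p + 2 * q))" by simp
    qed
    have UA: "(\<integral>\<omega>. U d \<omega> \<partial>M) \<le> A" for d
    proof -
      have "(\<integral>\<omega>. U d \<omega> \<partial>M) \<le> (\<integral>\<omega>. K ^ (2 * q) * weight s h k \<omega> ^ (p + 2 * q) \<partial>M)" by (rule integral_mono[OF Ui Vi Ule])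
      also have "\<dots> \<le> A" unfolding A_def using B(2)[OF v] K0 by (simp add: mult_left_mono)
      finally show ?thesis .
    qed
    have ni: "integrable M (\<lambda>\<omega>. U d \<omega> * noise ?u h (snd d) \<omega> ^ (2 * q))" for d
      by (rule mult_noise_power(1)[OF u(1) h(1) Um Ui])
    have ne: "(\<integral>\<omega>. U d \<omega> * noise ?u h (snd d) \<omega> ^ (2 * q) \<partial>M) \<le> (g * A) * h ^ q" for d
    proof -
      have "(\<integral>\<omega>. U d \<omega> * noise ?u h (snd d) \<omega> ^ (2 * q) \<partial>M) \<le> g * h ^ q * (\<integral>\<omega>. U d \<omega> \<partial>M)"
        by (rule g(2)[OF u(1) h Um Ui U0])
      also have "\<dots> \<le> g * h ^ q * A" using UA[of d] g(1) h by (intro mult_left_mono) auto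
      finally show ?thesis by (simp add: mult_ac)
    qed
    have Yi: "integrable M Y" unfolding Y_def using ni by simp
    have le: "weight s h k \<omega> ^ p * norm (eta s h k \<omega>) ^ (2 * q) \<le> Y \<omega>" for \<omega>
    proof -
      let ?z = "\<lambda>d. coefX (fst d) ?u (snd d) \<omega> * noise ?u h (snd d) \<omega>"
      have "norm (eta s h k \<omega>) \<le> (\<Sum>i\<in>UNIV. \<bar>\<Sum>c\<in>UNIV. ?z (i, c)\<bar>)"
        unfolding eta_def using norm_eq_axis_sum_le[of "\<lambda>i. \<Sum>c\<in>UNIV. ?z (i, c)"] by simp
      also have "\<dots> \<le> (\<Sum>i\<in>UNIV. \<Sum>c\<in>UNIV. \<bar>?z (i, c)\<bar>)" by (intro sum_mono sum_abs)
      also have "\<dots> = (\<Sum>d\<in>UNIV. \<bar>?z d\<bar>)" unfolding sum.cartesian_product UNIV_Times_UNIV by (intro sum.cong) auto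
      finally have "norm (eta s h k \<omega>) ^ (2 * q) \<le> \<bar>\<Sum>d\<in>UNIV. \<bar>?z d\<bar>\<bar> ^ (2 * q)" by (intro power_mono) auto
      also have "\<dots> \<le> N * (\<Sum>d\<in>UNIV. \<bar>\<bar>?z d\<bar>\<bar> ^ (2 * q))" unfolding N_def by (rule power_sum_le) (use q in auto)
      finally have "weight s h k \<omega> ^ p * norm (eta s h k \<omega>) ^ (2 * q) \<le> weight s h k \<omega> ^ p * (N * (\<Sum>d\<in>UNIV. \<bar>\<bar>?z d\<bar>\<bar> ^ (2 * q)))"
        using weight_ge[of s h k \<omega>] by (intro mult_left_mono) auto
      also have "\<dots> = Y \<omega>" by (simp add: Y_def U_def sum_distrib_left power_even_abs power_mult_distrib mult_ac)
      finally show ?thesis .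
    qed
    have m: "(\<lambda>\<omega>. weight s h k \<omega> ^ p * norm (eta s h k \<omega>) ^ (2 * q)) \<in> borel_measurable M"
      by (intro borel_measurable_times borel_measurable_power measurable_Fl_M[OF weight_measurable[OF v]] measurable_compose[OF eta_measurable[OF v] borel_measurable_norm])
    have i: "integrable M (\<lambda>\<omega>. weight s h k \<omega> ^ p * norm (eta s h k \<omega>) ^ (2 * q))"
    proof (rule Bochner_Integration.integrable_bound[OF Yi m])
      have "0 \<le> weight s h k \<omega> ^ p * norm (eta s h k \<omega>) ^ (2 * q)" for \<omega>
        using weight_ge[of s h k \<omega>] by (intro mult_nonneg_nonneg zero_le_power) auto
      then have "norm (weight s h k \<omega> ^ p * norm (eta s h k \<omega>) ^ (2 * q)) \<le> norm (Y \<omega>)" for \<omega>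
        using le[of \<omega>] unfolding real_norm_def by (smt (verit))
      then show "AE \<omega> in M. norm (weight s h k \<omega> ^ p * norm (eta s h k \<omega>) ^ (2 * q)) \<le> norm (Y \<omega>)" by simp
    qed
    have "(\<integral>\<omega>. weight s h k \<omega> ^ p * norm (eta s h k \<omega>) ^ (2 * q) \<partial>M) \<le> (\<integral>\<omega>. Y \<omega> \<partial>M)" by (rule integral_mono[OF i Yi le])
    also have "\<dots> = N * (\<Sum>d\<in>UNIV. \<integral>\<omega>. U d \<omega> * noise ?u h (snd d) \<omega> ^ (2 * q) \<partial>M)" unfolding Y_def using ni by simp
    also have "\<dots> \<le> N * (\<Sum>d\<in>(UNIV :: ('d \<times> 'm option) set). (g * A) * h ^ q)" by (intro mult_left_mono sum_mono ne N)
    finally show "integrable M (\<lambda>\<omega>. weight s h k \<omega> ^ p * norm (eta s h k \<omega>) ^ (2 * q)) \<and>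
      (\<integral>\<omega>. weight s h k \<omega> ^ p * norm (eta s h k \<omega>) ^ (2 * q) \<partial>M) \<le> N * (real (card (UNIV :: ('d \<times> 'm option) set)) * (g * A)) * h ^ q"
      using i by (simp add: mult_ac)
  qed
qed

text \<open>The coefficient of the noise \<open>c\<close> in the linear Taylor term. The first
  component of \<open>z\<close> stands for the solution at the grid point, the second for the point
  at which \<open>g\<close> is expanded.\<close>

definition first_order :: "(real^'d \<Rightarrow> real) \<Rightarrow> 'd \<Rightarrow> 'm option \<Rightarrow> (real^'d) \<times> (real^'d) \<Rightarrow> real" where
  "first_order g i c z = coef i c (fst z) * pd [i] g (snd z)"

definition second_order :: "(real^'d \<Rightarrow> real) \<Rightarrow> 'd \<Rightarrow> 'd \<Rightarrow> 'm option \<Rightarrow> 'm option \<Rightarrow> (real^'d) \<times> (real^'d) \<Rightarrow> real" where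
  "second_order g i k c c' z = coef i c (fst z) * coef k c' (fst z) * pd [k, i] g (snd z)"

text \<open>The generator with coefficients taken at the true grid value \<^term>\<open>fst z\<close> and derivatives at the
  Riemann sum \<^term>\<open>snd z\<close>.\<close>
definition frozen_gen :: "(real^'d \<Rightarrow> real) \<Rightarrow> (real^'d) \<times> (real^'d) \<Rightarrow> real" where
  "frozen_gen g z = (\<Sum>i\<in>UNIV. first_order g i None z) + (\<Sum>i\<in>UNIV. \<Sum>k\<in>UNIV. \<Sum>j\<in>UNIV. second_order g i k (Some j) (Some j) z) / 2"

lemma frozen_poly_cont:
  assumes g: "smoothp 2 g"
  shows "poly_cont (first_order g i c)" "poly_cont (second_order g i k c c')" "poly_cont (frozen_gen g)"
proof -
  have f: "poly_cont (\<lambda>z :: (real^'d) \<times> (real^'d). coef i c (fst z))" for i c by (rule poly_cont_compose_linear[OF coef_pc bounded_linear_fst])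
  have 1: "poly_cont (pd [i] g)" for i using smoothp_poly_cont[OF smoothp_pd[OF g, of "[i]"]] by (simp del: pd.simps)
  have 2: "poly_cont (pd [k, i] g)" for k i using smoothp_poly_cont[OF smoothp_pd[OF g, of "[k, i]"]] by (simp del: pd.simps)
  show h1: "poly_cont (first_order g i c)" for i c
    unfolding first_order_def[abs_def] by (rule poly_cont_mult[OF f poly_cont_compose_linear[OF 1 bounded_linear_snd]])
  show h2: "poly_cont (second_order g i k c c')" for i k c c'
    unfolding second_order_def[abs_def] by (rule poly_cont_mult[OF poly_cont_mult[OF f f] poly_cont_compose_linear[OF 2 bounded_linear_snd]])
  have "poly_cont (\<lambda>z. (\<Sum>i\<in>UNIV. first_order g i None z) + (1 / 2) * (\<Sum>i\<in>UNIV. \<Sum>k\<in>UNIV. \<Sum>j\<in>UNIV. second_order g i k (Some j) (Some j) z))"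
    by (intro poly_cont_add poly_cont_mult poly_cont_const poly_cont_sum h1 h2)
  then show "poly_cont (frozen_gen g)" unfolding frozen_gen_def[abs_def] by simp
qed

lemma frozen_gen_diag: "frozen_gen g (x, x) = gen a b g x"
proof -
  define F where "F i k j = second_order g i k (Some j) (Some j) (x, x)" for i k j
  have "(\<Sum>i\<in>UNIV. \<Sum>k\<in>UNIV. \<Sum>j\<in>UNIV. F i k j) = (\<Sum>i\<in>UNIV. \<Sum>j\<in>UNIV. \<Sum>k\<in>UNIV. F i k j)"
    by (rule sum.cong[OF refl], rule sum.swap)
  also have "\<dots> = (\<Sum>j\<in>UNIV. \<Sum>i\<in>UNIV. \<Sum>k\<in>UNIV. F i k j)" by (rule sum.swap)
  finally have "(\<Sum>i\<in>UNIV. \<Sum>k\<in>UNIV. \<Sum>j\<in>UNIV. second_order g i k (Some j) (Some j) (x, x)) = (\<Sum>j\<in>UNIV. \<Sum>i\<in>UNIV. \<Sum>k\<in>UNIV. second_order g i k (Some j) (Some j) (x, x))"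
    unfolding F_def .
  then show ?thesis by (simp add: frozen_gen_def gen_def first_order_def second_order_def coef_def del: pd.simps)
qed

text \<open>\<open>g\<close> is expanded at \<open>X s \<omega> + grid_sum s h k \<omega>\<close>
  along \<open>eta\<close>. In mean the linear term leaves the drift and the quadratic term its
  diagonal Wiener part; together they give \<open>h\<close> times \<open>frozen_gen\<close>. The
  rest is of order \<open>h\<^sup>2\<close>, apart from the portion \<open>e * h\<close> of the
  Taylor remainder.\<close>

lemma one_step:
  assumes g: "smoothp 2 g"
  obtains A where "0 \<le> A" "\<And>e. 0 < e \<Longrightarrow> \<exists>C\<ge>0. \<forall>s h k. valid_grid s h (Suc k) \<longrightarrow>
    \<bar>(\<integral>\<omega>. g (X s \<omega> + grid_sum s h (Suc k) \<omega>) \<partial>M) - (\<integral>\<omega>. g (X s \<omega> + grid_sum s h k \<omega>) \<partial>M) - h * (\<integral>\<omega>. frozen_gen g (grid s h k \<omega>) \<partial>M)\<bar>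
      \<le> h * (e * A + C * h)"
proof -
  obtain p where p: "\<And>e. 0 < e \<Longrightarrow> \<exists>C\<ge>0. \<forall>z y. \<bar>g (z + y) - g z - (\<Sum>i\<in>UNIV. y $ i * pd [i] g z) -
     (\<Sum>i\<in>UNIV. \<Sum>k\<in>UNIV. y $ i * y $ k * pd [k, i] g z) / 2\<bar> \<le> (norm y)\<^sup>2 * (e * (1 + norm z + norm y) ^ p + C * norm y ^ 4)"
    by (rule taylor_second_order_bound[OF g]) blast
  obtain E1 where E1: "0 \<le> E1" "\<And>s h k. valid_grid s h k \<Longrightarrow> integrable M (\<lambda>\<omega>. weight s h k \<omega> ^ (2 * p) * norm (eta s h k \<omega>) ^ (2 * 1)) \<and>
    (\<integral>\<omega>. weight s h k \<omega> ^ (2 * p) * norm (eta s h k \<omega>) ^ (2 * 1) \<partial>M) \<le> E1 * h ^ 1"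
    by (rule eta_moment[of 1 "2 * p", OF zero_less_one]) blast
  obtain E2 where E2: "0 \<le> E2" "\<And>s h k. valid_grid s h k \<Longrightarrow> integrable M (\<lambda>\<omega>. weight s h k \<omega> ^ 0 * norm (eta s h k \<omega>) ^ (2 * Suc p)) \<and>
    (\<integral>\<omega>. weight s h k \<omega> ^ 0 * norm (eta s h k \<omega>) ^ (2 * Suc p) \<partial>M) \<le> E2 * h ^ Suc p"
    by (rule eta_moment[of "Suc p" 0, OF zero_less_Suc]) blast
  obtain E3 where E3: "0 \<le> E3" "\<And>s h k. valid_grid s h k \<Longrightarrow> integrable M (\<lambda>\<omega>. weight s h k \<omega> ^ 0 * norm (eta s h k \<omega>) ^ (2 * Suc 2)) \<and>
    (\<integral>\<omega>. weight s h k \<omega> ^ 0 * norm (eta s h k \<omega>) ^ (2 * Suc 2) \<partial>M) \<le> E3 * h ^ Suc 2"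
    by (rule eta_moment[of "Suc 2" 0, OF zero_less_Suc]) blast
  \<comment> \<open>The products of two time increments, of order \<open>h\<^sup>2\<close>, which
    the generator does not contain.\<close>
  define Q where "Q z = (\<Sum>i\<in>UNIV. \<Sum>k\<in>UNIV. second_order g i k None None z)" for z
  have Q: "poly_cont Q" unfolding Q_def[abs_def] by (intro poly_cont_sum frozen_poly_cont(2)[OF g])
  obtain D where D: "0 \<le> D" "\<And>s h k. valid_grid s h k \<Longrightarrow> integrable M (\<lambda>\<omega>. Q (grid s h k \<omega>)) \<and> \<bar>\<integral>\<omega>. Q (grid s h k \<omega>) \<partial>M\<bar> \<le> D"
    by (rule grid_bound[OF Q]) blast
  have h1i: "integrable M (\<lambda>\<omega>. first_order g i c (grid s h k \<omega>))" if "valid_grid s h k" for s h k i c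
    by (rule grid_bound[OF frozen_poly_cont(1)[OF g, of i c]]) (use that in blast)
  have h2i: "integrable M (\<lambda>\<omega>. second_order g i l c c' (grid s h k \<omega>))" if "valid_grid s h k" for s h k i l c c'
    by (rule grid_bound[OF frozen_poly_cont(2)[OF g, of i l c c']]) (use that in blast)
  have gpc: "poly_cont (\<lambda>z :: (real^'d) \<times> (real^'d). g (snd z))"
    by (rule poly_cont_compose_linear[OF smoothp_poly_cont[OF g] bounded_linear_snd])
  have gi: "integrable M (\<lambda>\<omega>. g (X s \<omega> + grid_sum s h k \<omega>))" if v: "valid_grid s h k" for s h k
  proof -
    have "integrable M (\<lambda>\<omega>. g (snd (grid s h k \<omega>)))" by (rule grid_bound[OF gpc]) (use v in blast)
    then show ?thesis by (simp add: grid_def)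
  qed
  have A: "0 \<le> 4 ^ p * (E1 + E2)" using E1(1) E2(1) by simp
  show thesis
  proof (rule that[OF A])
    fix e :: real assume e: "0 < e"
    obtain C where C: "0 \<le> C" and tay: "\<And>z y. \<bar>g (z + y) - g z - (\<Sum>i\<in>UNIV. y $ i * pd [i] g z) -
       (\<Sum>i\<in>UNIV. \<Sum>k\<in>UNIV. y $ i * y $ k * pd [k, i] g z) / 2\<bar> \<le> (norm y)\<^sup>2 * (e * (1 + norm z + norm y) ^ p + C * norm y ^ 4)"
      using p[OF e] by blast
    have "\<bar>(\<integral>\<omega>. g (X s \<omega> + grid_sum s h (Suc k) \<omega>) \<partial>M) - (\<integral>\<omega>. g (X s \<omega> + grid_sum s h k \<omega>) \<partial>M) - h * (\<integral>\<omega>. frozen_gen g (grid s h k \<omega>) \<partial>M)\<bar>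
      \<le> h * (e * (4 ^ p * (E1 + E2)) + (C * E3 + D) * h)" if vS: "valid_grid s h (Suc k)" for s h k
    proof -
      have v: "valid_grid s h k" by (rule valid_grid_point(3)[OF vS]) simp
      let ?u = "s + real k * h"
      have h: "0 < h" "h \<le> 1" using v by (auto simp: valid_grid_def)
      have u: "0 \<le> ?u" using valid_grid_point[OF v order_refl] by auto
      have h1m: "(\<lambda>\<omega>. first_order g i c (grid s h k \<omega>)) \<in> borel_measurable (Fl ?u)" for i c by (rule grid_measurable[OF v frozen_poly_cont(1)[OF g]])
      have h2m: "(\<lambda>\<omega>. second_order g i l c c' (grid s h k \<omega>)) \<in> borel_measurable (Fl ?u)" for i l c c' by (rule grid_measurable[OF v frozen_poly_cont(2)[OF g]])
      define L1 where "L1 \<omega> = (\<Sum>i\<in>UNIV. \<Sum>c\<in>UNIV. first_order g i c (grid s h k \<omega>) * noise ?u h c \<omega>)" for \<omega>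
      define L2 where "L2 \<omega> = (\<Sum>i\<in>UNIV. \<Sum>l\<in>UNIV. \<Sum>c\<in>UNIV. \<Sum>c'\<in>UNIV. second_order g i l c c' (grid s h k \<omega>) * (noise ?u h c \<omega> * noise ?u h c' \<omega>))" for \<omega>
      note n1 = mult_noise_mean[OF u h(1) h1m h1i[OF v]]
      note n2 = mult_noise_noise[OF u h(1) h2m h2i[OF v]]
      have L1i: "integrable M L1" unfolding L1_def using n1(1) by simp
      have L2i: "integrable M L2" unfolding L2_def using n2(1) by simp
      have eL1: "(\<integral>\<omega>. L1 \<omega> \<partial>M) = h * (\<Sum>i\<in>UNIV. \<integral>\<omega>. first_order g i None (grid s h k \<omega>) \<partial>M)"
        unfolding L1_def using n1 by (simp add: sum_UNIV_option sum_distrib_left)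
      \<comment> \<open>Only equal noise indices contribute: the time index with
        \<open>h\<^sup>2\<close>, each Wiener component with \<open>h\<close>.\<close>
      have inner: "(\<Sum>c\<in>UNIV. \<Sum>c'\<in>UNIV. (\<integral>\<omega>. second_order g i l c c' (grid s h k \<omega>) \<partial>M) * (if c = c' then if c = None then h\<^sup>2 else h else 0)) =
        h\<^sup>2 * (\<integral>\<omega>. second_order g i l None None (grid s h k \<omega>) \<partial>M) + h * (\<Sum>j\<in>UNIV. \<integral>\<omega>. second_order g i l (Some j) (Some j) (grid s h k \<omega>) \<partial>M)" for i l
      proof -
        define F where "F c c' = (\<integral>\<omega>. second_order g i l c c' (grid s h k \<omega>) \<partial>M)" for c c'
        have "(\<Sum>c\<in>UNIV. \<Sum>c'\<in>UNIV. F c c' * (if c = c' then if c = None then h\<^sup>2 else h else 0)) = (\<Sum>c\<in>UNIV. \<Sum>c'\<in>UNIV. if c = c' then F c c' * (if c = None then h\<^sup>2 else h) else 0)"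
          by (intro sum.cong refl) auto
        also have "\<dots> = (\<Sum>c\<in>UNIV. F c c * (if c = None then h\<^sup>2 else h))" by simp
        also have "\<dots> = h\<^sup>2 * F None None + h * (\<Sum>j\<in>UNIV. F (Some j) (Some j))"
          by (simp add: sum_UNIV_option sum_distrib_left mult_ac)
        finally show ?thesis unfolding F_def .
      qed
      have eL2: "(\<integral>\<omega>. L2 \<omega> \<partial>M) = h\<^sup>2 * (\<integral>\<omega>. Q (grid s h k \<omega>) \<partial>M) + h * (\<Sum>i\<in>UNIV. \<Sum>l\<in>UNIV. \<Sum>j\<in>UNIV. \<integral>\<omega>. second_order g i l (Some j) (Some j) (grid s h k \<omega>) \<partial>M)"
      proof -
        have "(\<integral>\<omega>. L2 \<omega> \<partial>M) = (\<Sum>i\<in>UNIV. \<Sum>l\<in>UNIV. \<Sum>c\<in>UNIV. \<Sum>c'\<in>UNIV. (\<integral>\<omega>. second_order g i l c c' (grid s h k \<omega>) \<partial>M) * (if c = c' then if c = None then h\<^sup>2 else h else 0))"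
          unfolding L2_def n2(2)[symmetric] using n2(1) by simp
        also have "\<dots> = h\<^sup>2 * (\<Sum>i\<in>UNIV. \<Sum>l\<in>UNIV. \<integral>\<omega>. second_order g i l None None (grid s h k \<omega>) \<partial>M) + h * (\<Sum>i\<in>UNIV. \<Sum>l\<in>UNIV. \<Sum>j\<in>UNIV. \<integral>\<omega>. second_order g i l (Some j) (Some j) (grid s h k \<omega>) \<partial>M)"
          unfolding inner by (simp add: sum.distrib sum_distrib_left)
        also have "(\<Sum>i\<in>UNIV. \<Sum>l\<in>UNIV. \<integral>\<omega>. second_order g i l None None (grid s h k \<omega>) \<partial>M) = (\<integral>\<omega>. Q (grid s h k \<omega>) \<partial>M)"
          unfolding Q_def using h2i[OF v] by simp
        finally show ?thesis .
      qed
      have eG: "(\<integral>\<omega>. frozen_gen g (grid s h k \<omega>) \<partial>M) = (\<Sum>i\<in>UNIV. \<integral>\<omega>. first_order g i None (grid s h k \<omega>) \<partial>M) +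
        (\<Sum>i\<in>UNIV. \<Sum>l\<in>UNIV. \<Sum>j\<in>UNIV. \<integral>\<omega>. second_order g i l (Some j) (Some j) (grid s h k \<omega>) \<partial>M) / 2"
        unfolding frozen_gen_def using h1i[OF v] h2i[OF v] by simp
      define Y where "Y \<omega> = e * (4 ^ p * (weight s h k \<omega> ^ (2 * p) * norm (eta s h k \<omega>) ^ (2 * 1) + weight s h k \<omega> ^ 0 * norm (eta s h k \<omega>) ^ (2 * Suc p))) +
        C * (weight s h k \<omega> ^ 0 * norm (eta s h k \<omega>) ^ (2 * Suc 2))" for \<omega>
      have Yi: "integrable M Y" unfolding Y_def using E1(2)[OF v] E2(2)[OF v] E3(2)[OF v]
        by (intro Bochner_Integration.integrable_add integrable_mult_right) blast+
      have rem: "\<bar>g (X s \<omega> + grid_sum s h (Suc k) \<omega>) - g (X s \<omega> + grid_sum s h k \<omega>) - L1 \<omega> - L2 \<omega> / 2\<bar> \<le> Y \<omega>" for \<omega>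
      proof -
        let ?z = "X s \<omega> + grid_sum s h k \<omega>" and ?y = "eta s h k \<omega>" and ?v = "weight s h k \<omega>"
        have l1: "(\<Sum>i\<in>UNIV. ?y $ i * pd [i] g ?z) = L1 \<omega>"
          unfolding L1_def eta_component first_order_def grid_def coefX_def fst_conv snd_conv sum_distrib_right
          by (simp add: mult_ac del: pd.simps)
        have l2: "(\<Sum>i\<in>UNIV. \<Sum>l\<in>UNIV. ?y $ i * ?y $ l * pd [l, i] g ?z) = L2 \<omega>"
          unfolding L2_def eta_component second_order_def grid_def coefX_def fst_conv snd_conv sum_product sum_distrib_right
          by (simp add: sum_distrib_left mult_ac del: pd.simps)
        have "\<bar>g (?z + ?y) - g ?z - L1 \<omega> - L2 \<omega> / 2\<bar> \<le> (norm ?y)\<^sup>2 * (e * (1 + norm ?z + norm ?y) ^ p + C * norm ?y ^ 4)"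
          using tay[of ?z ?y] unfolding l1 l2 .
        \<comment> \<open>The exponent is doubled so that the power of \<open>norm ?y\<close>, once
          multiplied by the squared norm in front, is even and \<open>eta_moment\<close>
          applies.\<close>
        also have "\<dots> \<le> (norm ?y)\<^sup>2 * (e * (4 ^ p * (?v ^ (2 * p) + norm ?y ^ (2 * p))) + C * norm ?y ^ 4)"
        proof -
          have b: "1 + norm ?z \<le> ?v" using norm_triangle_ineq[of "X s \<omega>" "grid_sum s h k \<omega>"] norm_ge_zero[of "X ?u \<omega>"] unfolding weight_def by linarith
          have v1: "1 \<le> ?v" by (rule weight_ge)
          have "(1 + norm ?z + norm ?y) ^ p \<le> (?v + norm ?y) ^ p" using b by (intro power_mono) auto
          also have "\<dots> \<le> (?v + norm ?y) ^ (2 * p)" using v1 norm_ge_zero[of ?y] by (intro power_increasing) (auto simp del: norm_ge_zero)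
          also have "\<dots> \<le> 2 ^ (2 * p) * (?v ^ (2 * p) + norm ?y ^ (2 * p))" using v1 by (intro power_add_le) auto
          also have "2 ^ (2 * p) = (4 :: real) ^ p" by (simp add: power_mult)
          finally show ?thesis using e by (intro mult_left_mono add_right_mono) auto
        qed
        also have "\<dots> = Y \<omega>" unfolding Y_def by (simp add: power_add[symmetric] algebra_simps power2_eq_square eval_nat_numeral)
        finally show ?thesis by (simp add: grid_sum_Suc add.assoc)
      qed
      have i3: "integrable M (\<lambda>\<omega>. g (X s \<omega> + grid_sum s h (Suc k) \<omega>) - g (X s \<omega> + grid_sum s h k \<omega>) - L1 \<omega> - L2 \<omega> / 2)"
        using gi[OF vS] gi[OF v] L1i L2i by simp
      have "\<bar>(\<integral>\<omega>. g (X s \<omega> + grid_sum s h (Suc k) \<omega>) \<partial>M) - (\<integral>\<omega>. g (X s \<omega> + grid_sum s h k \<omega>) \<partial>M) - (\<integral>\<omega>. L1 \<omega> \<partial>M) - (\<integral>\<omega>. L2 \<omega> \<partial>M) / 2\<bar> =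
        \<bar>\<integral>\<omega>. g (X s \<omega> + grid_sum s h (Suc k) \<omega>) - g (X s \<omega> + grid_sum s h k \<omega>) - L1 \<omega> - L2 \<omega> / 2 \<partial>M\<bar>"
        using gi[OF vS] gi[OF v] L1i L2i by simp
      also have "\<dots> \<le> (\<integral>\<omega>. \<bar>g (X s \<omega> + grid_sum s h (Suc k) \<omega>) - g (X s \<omega> + grid_sum s h k \<omega>) - L1 \<omega> - L2 \<omega> / 2\<bar> \<partial>M)" by (rule integral_abs_bound)
      also have "\<dots> \<le> (\<integral>\<omega>. Y \<omega> \<partial>M)" by (rule integral_mono[OF integrable_abs[OF i3] Yi rem])
      also have "\<dots> = e * (4 ^ p * ((\<integral>\<omega>. weight s h k \<omega> ^ (2 * p) * norm (eta s h k \<omega>) ^ (2 * 1) \<partial>M) + (\<integral>\<omega>. weight s h k \<omega> ^ 0 * norm (eta s h k \<omega>) ^ (2 * Suc p) \<partial>M))) +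
        C * (\<integral>\<omega>. weight s h k \<omega> ^ 0 * norm (eta s h k \<omega>) ^ (2 * Suc 2) \<partial>M)"
        unfolding Y_def using E1(2)[OF v] E2(2)[OF v] E3(2)[OF v]
        by (subst Bochner_Integration.integral_add integral_mult_right_zero | intro Bochner_Integration.integrable_add integrable_mult_right | blast)+
      also have "\<dots> \<le> e * (4 ^ p * (E1 * h + E2 * h)) + C * (E3 * (h * h))"
      proof -
        have "E2 * h ^ Suc p \<le> E2 * (h * 1)" unfolding power_Suc using h E2(1) by (intro mult_left_mono power_le_one) auto
        moreover have "E3 * h ^ Suc 2 \<le> E3 * (h * h)"
        proof -
          have "h ^ Suc 2 \<le> h * h" using h power_decreasing[of 2 "Suc 2" h] by (simp add: power2_eq_square)
          then show ?thesis using E3(1) by (intro mult_left_mono)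
        qed
        ultimately show ?thesis using E1(2)[OF v] E2(2)[OF v] E3(2)[OF v] e C
          by (intro add_mono mult_left_mono) auto
      qed
      finally have R: "\<bar>(\<integral>\<omega>. g (X s \<omega> + grid_sum s h (Suc k) \<omega>) \<partial>M) - (\<integral>\<omega>. g (X s \<omega> + grid_sum s h k \<omega>) \<partial>M) - (\<integral>\<omega>. L1 \<omega> \<partial>M) - (\<integral>\<omega>. L2 \<omega> \<partial>M) / 2\<bar> \<le> e * (4 ^ p * (E1 * h + E2 * h)) + C * (E3 * (h * h))" .
      have S: "(\<integral>\<omega>. L1 \<omega> \<partial>M) + (\<integral>\<omega>. L2 \<omega> \<partial>M) / 2 = h * (\<integral>\<omega>. frozen_gen g (grid s h k \<omega>) \<partial>M) + h\<^sup>2 / 2 * (\<integral>\<omega>. Q (grid s h k \<omega>) \<partial>M)"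
        unfolding eL1 eL2 eG by (simp add: algebra_simps add_divide_distrib)
      have "\<bar>h\<^sup>2 / 2 * (\<integral>\<omega>. Q (grid s h k \<omega>) \<partial>M)\<bar> \<le> h\<^sup>2 * D"
      proof -
        have "\<bar>h\<^sup>2 / 2 * (\<integral>\<omega>. Q (grid s h k \<omega>) \<partial>M)\<bar> = h\<^sup>2 / 2 * \<bar>\<integral>\<omega>. Q (grid s h k \<omega>) \<partial>M\<bar>" by (simp add: abs_mult)
        also have "\<dots> \<le> h\<^sup>2 * D" using D(2)[OF v] by (intro mult_mono) auto
        finally show ?thesis .
      qed
      then have "\<bar>(\<integral>\<omega>. g (X s \<omega> + grid_sum s h (Suc k) \<omega>) \<partial>M) - (\<integral>\<omega>. g (X s \<omega> + grid_sum s h k \<omega>) \<partial>M) - h * (\<integral>\<omega>. frozen_gen g (grid s h k \<omega>) \<partial>M)\<bar>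
        \<le> e * (4 ^ p * (E1 * h + E2 * h)) + C * (E3 * (h * h)) + h\<^sup>2 * D"
        using R S by linarith
      also have "\<dots> = h * (e * (4 ^ p * (E1 + E2)) + (C * E3 + D) * h)" by (simp add: algebra_simps power2_eq_square)
      finally show ?thesis .
    qed
    moreover have "0 \<le> C * E3 + D" using C E3(1) D(1) by simp
    ultimately show "\<exists>C\<ge>0. \<forall>s h k. valid_grid s h (Suc k) \<longrightarrow>
      \<bar>(\<integral>\<omega>. g (X s \<omega> + grid_sum s h (Suc k) \<omega>) \<partial>M) - (\<integral>\<omega>. g (X s \<omega> + grid_sum s h k \<omega>) \<partial>M) - h * (\<integral>\<omega>. frozen_gen g (grid s h k \<omega>) \<partial>M)\<bar>
        \<le> h * (e * (4 ^ p * (E1 + E2)) + C * h)"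
      by blast
  qed
qed

end

text \<open>The hypothesis is anchored at the left endpoint of an increment. For difference
  quotients from the right this is immediate; from the left it yields \<open>\<psi> y\<close> at the
  moving point, and the continuity of \<open>\<psi>\<close> brings it to
  \<open>\<psi> t\<close>.\<close>

lemma has_derivative_of_increment_bound:
  fixes \<phi> \<psi> :: "real \<Rightarrow> real"
  assumes A: "0 \<le> A"
    and bd: "\<And>e. 0 < e \<Longrightarrow> \<exists>C\<ge>0. \<forall>s t. lo \<le> s \<longrightarrow> s < t \<longrightarrow> t \<le> hi \<longrightarrow> \<bar>\<phi> t - \<phi> s - (t - s) * \<psi> s\<bar> \<le> (t - s) * (e * A + C * (t - s))"
    and cont: "continuous_on {lo..hi} \<psi>" and t: "t \<in> {lo..hi}"
  shows "(\<phi> has_real_derivative \<psi> t) (at t within {lo..hi})"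
  unfolding has_field_derivative_iff Lim_within
proof (intro allI impI)
  fix e :: real assume e: "0 < e"
  define e' where "e' = e / (4 * (A + 1))"
  have e': "0 < e'" using A e by (simp add: e'_def)
  have eA: "e' * A \<le> e / 4"
  proof -
    have "e' * A \<le> e' * (A + 1)" using e' by simp
    also have "\<dots> = e / 4" using A unfolding e'_def by (simp add: field_simps)
    finally show ?thesis .
  qed
  obtain C where C: "0 \<le> C" "\<And>s t. lo \<le> s \<Longrightarrow> s < t \<Longrightarrow> t \<le> hi \<Longrightarrow> \<bar>\<phi> t - \<phi> s - (t - s) * \<psi> s\<bar> \<le> (t - s) * (e' * A + C * (t - s))"
    using bd[OF e'] by blast
  obtain d where d: "0 < d" "\<And>y. y \<in> {lo..hi} \<Longrightarrow> dist y t < d \<Longrightarrow> dist (\<psi> y) (\<psi> t) < e / 4"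
    using cont t e unfolding continuous_on_iff by (metis divide_pos_pos zero_less_numeral)
  define \<delta> where "\<delta> = min d (e / (4 * (C + 1)))"
  have \<delta>: "0 < \<delta>" using d(1) e C(1) by (simp add: \<delta>_def)
  have quot: "\<bar>(\<phi> v - \<phi> u) / (v - u) - \<psi> u\<bar> \<le> e / 2" if uv: "lo \<le> u" "u < v" "v \<le> hi" "v - u < \<delta>" for u v
  proof -
    have "C * (v - u) \<le> (C + 1) * (e / (4 * (C + 1)))" using uv C(1) by (intro mult_mono) (auto simp: \<delta>_def)
    also have "\<dots> = e / 4" using C(1) by (simp add: field_simps)
    finally have c: "e' * A + C * (v - u) \<le> e / 2" using eA by linarith
    have "(\<phi> v - \<phi> u) / (v - u) - \<psi> u = (\<phi> v - \<phi> u - (v - u) * \<psi> u) / (v - u)" using uv by (simp add: field_simps)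
    then have "\<bar>(\<phi> v - \<phi> u) / (v - u) - \<psi> u\<bar> = \<bar>\<phi> v - \<phi> u - (v - u) * \<psi> u\<bar> / (v - u)" using uv by (simp add: abs_divide)
    also have "\<dots> \<le> (v - u) * (e' * A + C * (v - u)) / (v - u)" using C(2)[OF uv(1-3)] uv by (intro divide_right_mono) auto
    also have "\<dots> = e' * A + C * (v - u)" using uv by simp
    finally show ?thesis using c by linarith
  qed
  show "\<exists>d>0. \<forall>y\<in>{lo..hi}. 0 < dist y t \<and> dist y t < d \<longrightarrow> dist ((\<phi> y - \<phi> t) / (y - t)) (\<psi> t) < e"
  proof (intro exI[of _ \<delta>] conjI ballI impI \<delta>)
    fix y assume y: "y \<in> {lo..hi}" and "0 < dist y t \<and> dist y t < \<delta>"
    then have ne: "y \<noteq> t" and dy: "\<bar>y - t\<bar> < \<delta>" by (auto simp: dist_real_def)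
    show "dist ((\<phi> y - \<phi> t) / (y - t)) (\<psi> t) < e"
    proof (cases "t < y")
      case True
      then show ?thesis using quot[of t y] y t dy e by (simp add: dist_real_def)
    next
      case False
      then have lt: "y < t" using ne by simp
      have "dist (\<psi> y) (\<psi> t) < e / 4" using d(2)[OF y] dy by (simp add: dist_real_def \<delta>_def)
      moreover have "\<bar>(\<phi> t - \<phi> y) / (t - y) - \<psi> y\<bar> \<le> e / 2" using quot[of y t] y t dy lt by simp
      moreover have "(\<phi> y - \<phi> t) / (y - t) = (\<phi> t - \<phi> y) / (t - y)" by (metis minus_diff_eq minus_divide_divide)
      ultimately show ?thesis using e unfolding dist_real_def by linarith
    qed
  qed
qed

text \<open>The library versions of Taylor's theorem ask for two-sided derivatives at the end points.\<close>
lemma taylor_lagrange_within: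
  fixes \<phi> :: "nat \<Rightarrow> real \<Rightarrow> real"
  assumes lt: "lo < t" and der: "\<And>k s. k \<le> n \<Longrightarrow> s \<in> {lo..t} \<Longrightarrow> (\<phi> k has_real_derivative \<phi> (Suc k) s) (at s within {lo..t})"
  shows "\<exists>\<xi>\<in>{lo<..<t}. \<phi> 0 t = (\<Sum>k\<le>n. \<phi> k lo * (t - lo) ^ k / fact k) + \<phi> (Suc n) \<xi> * (t - lo) ^ Suc n / fact (Suc n)"
proof -
  \<comment> \<open>The Taylor polynomial at the moving base point \<open>s\<close>, evaluated at
    \<open>t\<close>; its derivative in \<open>s\<close> telescopes to a single term.\<close>
  define P where "P m s = (\<Sum>k\<le>m. \<phi> k s * (t - s) ^ k / fact k)" for m s
  have P': "(P m has_real_derivative \<phi> (Suc m) s * (t - s) ^ m / fact m) (at s within {lo..t})" if "m \<le> n" "s \<in> {lo..t}" for m s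
    using that(1)
  proof (induction m)
    case 0
    then show ?case using der[of 0 s] that(2) by (simp add: P_def)
  next
    case (Suc m)
    have "((\<lambda>s. P m s + \<phi> (Suc m) s * (t - s) ^ Suc m / fact (Suc m)) has_real_derivative
       \<phi> (Suc m) s * (t - s) ^ m / fact m + (\<phi> (Suc (Suc m)) s * (t - s) ^ Suc m + - (real (Suc m) * (t - s) ^ m) * \<phi> (Suc m) s) / fact (Suc m)) (at s within {lo..t})"
    proof (rule DERIV_add[OF _ DERIV_cdivide[OF DERIV_mult]])
      show "(P m has_real_derivative \<phi> (Suc m) s * (t - s) ^ m / fact m) (at s within {lo..t})" using Suc by simp
      show "(\<phi> (Suc m) has_real_derivative \<phi> (Suc (Suc m)) s) (at s within {lo..t})" by (rule der[OF Suc.prems that(2)])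
      show "((\<lambda>s. (t - s) ^ Suc m) has_real_derivative - (real (Suc m) * (t - s) ^ m)) (at s within {lo..t})"
        by (auto intro!: derivative_eq_intros simp del: power_Suc)
    qed
    also have "(\<lambda>s. P m s + \<phi> (Suc m) s * (t - s) ^ Suc m / fact (Suc m)) = P (Suc m)" by (simp add: P_def fun_eq_iff)
    also have "\<phi> (Suc m) s * (t - s) ^ m / fact m + (\<phi> (Suc (Suc m)) s * (t - s) ^ Suc m + - (real (Suc m) * (t - s) ^ m) * \<phi> (Suc m) s) / fact (Suc m) =
        \<phi> (Suc (Suc m)) s * (t - s) ^ Suc m / fact (Suc m)"
      by (simp add: add_divide_distrib diff_divide_distrib fact_Suc del: power_Suc of_nat_Suc)
    finally show ?case .
  qed
  \<comment> \<open>The value that \<open>\<phi> (Suc n) \<xi> / fact (Suc n)\<close> has to take.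
    With it \<open>F\<close> has equal values at both ends, and Rolle's theorem produces the
    intermediate point.\<close>
  define c where "c = (\<phi> 0 t - P n lo) / (t - lo) ^ Suc n"
  have c: "c * (t - lo) ^ Suc n = \<phi> 0 t - P n lo" using lt by (simp add: c_def)
  define F where "F s = P n s + c * (t - s) ^ Suc n" for s
  have F': "(F has_real_derivative \<phi> (Suc n) s * (t - s) ^ n / fact n - c * (real (Suc n) * (t - s) ^ n)) (at s within {lo..t})" if "s \<in> {lo..t}" for s
  proof -
    have "(F has_real_derivative \<phi> (Suc n) s * (t - s) ^ n / fact n + c * - (real (Suc n) * (t - s) ^ n)) (at s within {lo..t})"
      unfolding F_def[abs_def]
    proof (rule DERIV_add[OF P'[OF order_refl that] DERIV_cmult])
      show "((\<lambda>s. (t - s) ^ Suc n) has_real_derivative - (real (Suc n) * (t - s) ^ n)) (at s within {lo..t})"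
        by (auto intro!: derivative_eq_intros simp del: power_Suc)
    qed
    then show ?thesis by simp
  qed
  have Fi: "(F has_real_derivative \<phi> (Suc n) s * (t - s) ^ n / fact n - c * (real (Suc n) * (t - s) ^ n)) (at s)" if "lo < s" "s < t" for s
    using F'[of s] that at_within_Icc_at[of lo s t] by simp
  have "\<exists>z. lo < z \<and> z < t \<and> DERIV F z :> 0"
  proof (rule Rolle[OF lt])
    have "P n t = \<phi> 0 t"
    proof -
      have "P n t = (\<Sum>k\<le>n. if k = 0 then \<phi> 0 t else 0)" unfolding P_def by (intro sum.cong) auto
      then show ?thesis by simp
    qed
    then show "F lo = F t" using c by (simp add: F_def del: power_Suc)
    show "continuous_on {lo..t} F" using F' DERIV_continuous unfolding continuous_on_eq_continuous_within by blast
    show "F differentiable (at x)" if "lo < x" "x < t" for x using Fi[OF that] real_differentiable_def by blast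
  qed
  then obtain z where z: "lo < z" "z < t" "DERIV F z :> 0" by blast
  then have "\<phi> (Suc n) z * (t - z) ^ n / fact n - c * (real (Suc n) * (t - z) ^ n) = 0"
    using DERIV_unique[OF Fi[OF z(1,2)] z(3)] by simp
  then have "(t - z) ^ n * (\<phi> (Suc n) z / fact n - c * real (Suc n)) = 0" by (simp add: algebra_simps)
  then have "\<phi> (Suc n) z / fact n = c * real (Suc n)" using z by simp
  then have "\<phi> (Suc n) z / fact n / real (Suc n) = c" by (simp del: of_nat_Suc)
  then have "\<phi> (Suc n) z / fact (Suc n) = c" by (simp add: fact_Suc mult.commute del: of_nat_Suc)
  then have "\<phi> (Suc n) z * (t - lo) ^ Suc n / fact (Suc n) = c * (t - lo) ^ Suc n" by (metis times_divide_eq_left)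
  then have "\<phi> 0 t = P n lo + \<phi> (Suc n) z * (t - lo) ^ Suc n / fact (Suc n)" using c by linarith
  then show ?thesis using z unfolding P_def by auto
qed

context sde_growth
begin

lemma grid_sum_0: "grid_sum s h 0 \<omega> = 0"
  by (simp add: grid_sum_def rsum_def)

text \<open>Summation of \<open>one_step\<close> over the grid. Replacing \<open>frozen_gen\<close>
  at a grid point by \<open>gen\<close> at the start costs at most
  \<open>e * A2 + C2 * (real k * h)\<close> per unit of time, so the accumulated error keeps the
  shape \<open>\<tau> * (e * A + C * \<tau>)\<close> with elapsed time
  \<open>\<tau>\<close>.\<close>

lemma grid_telescope:
  assumes g: "smoothp 2 g"
  obtains A where "0 \<le> A" "\<And>e. 0 < e \<Longrightarrow> \<exists>C\<ge>0. \<forall>s h k. valid_grid s h k \<longrightarrow>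
    \<bar>(\<integral>\<omega>. g (X s \<omega> + grid_sum s h k \<omega>) \<partial>M) - (\<integral>\<omega>. g (X s \<omega>) \<partial>M) - real k * h * (\<integral>\<omega>. gen a b g (X s \<omega>) \<partial>M)\<bar>
      \<le> real k * h * (e * A + C * (real k * h))"
proof -
  obtain A1 where A1: "0 \<le> A1" "\<And>e. 0 < e \<Longrightarrow> \<exists>C\<ge>0. \<forall>s h k. valid_grid s h (Suc k) \<longrightarrow>
    \<bar>(\<integral>\<omega>. g (X s \<omega> + grid_sum s h (Suc k) \<omega>) \<partial>M) - (\<integral>\<omega>. g (X s \<omega> + grid_sum s h k \<omega>) \<partial>M) - h * (\<integral>\<omega>. frozen_gen g (grid s h k \<omega>) \<partial>M)\<bar>
      \<le> h * (e * A1 + C * h)"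
    by (rule one_step[OF g]) blast
  obtain A2 where A2: "0 \<le> A2" "\<And>e. 0 < e \<Longrightarrow> \<exists>C\<ge>0. \<forall>s h k. valid_grid s h k \<longrightarrow> integrable M (\<lambda>\<omega>. frozen_gen g (grid s h k \<omega>)) \<and>
    \<bar>(\<integral>\<omega>. frozen_gen g (grid s h k \<omega>) \<partial>M) - (\<integral>\<omega>. frozen_gen g (X s \<omega>, X s \<omega>) \<partial>M)\<bar> \<le> e * A2 + C * (real k * h)"
    by (rule grid_close[OF frozen_poly_cont(3)[OF g]]) blast
  show thesis
  proof (rule that)
    show "0 \<le> A1 + A2" using A1(1) A2(1) by simp
    fix e :: real assume e: "0 < e"
    obtain C1 where C1: "0 \<le> C1" "\<And>s h k. valid_grid s h (Suc k) \<Longrightarrow>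
      \<bar>(\<integral>\<omega>. g (X s \<omega> + grid_sum s h (Suc k) \<omega>) \<partial>M) - (\<integral>\<omega>. g (X s \<omega> + grid_sum s h k \<omega>) \<partial>M) - h * (\<integral>\<omega>. frozen_gen g (grid s h k \<omega>) \<partial>M)\<bar>
        \<le> h * (e * A1 + C1 * h)" using A1(2)[OF e] by blast
    obtain C2 where C2: "0 \<le> C2" "\<And>s h k. valid_grid s h k \<Longrightarrow>
      \<bar>(\<integral>\<omega>. frozen_gen g (grid s h k \<omega>) \<partial>M) - (\<integral>\<omega>. gen a b g (X s \<omega>) \<partial>M)\<bar> \<le> e * A2 + C2 * (real k * h)"
      using A2(2)[OF e] unfolding frozen_gen_diag by blast
    define D where "D \<tau> = e * (A1 + A2) + (C1 + C2) * \<tau>" for \<tau>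
    have main: "\<bar>(\<integral>\<omega>. g (X s \<omega> + grid_sum s h k \<omega>) \<partial>M) - (\<integral>\<omega>. g (X s \<omega>) \<partial>M) - real k * h * (\<integral>\<omega>. gen a b g (X s \<omega>) \<partial>M)\<bar>
      \<le> real k * h * D (real k * h)" if "valid_grid s h k" for s h k
      using that
    proof (induction k)
      case 0
      then show ?case by (simp add: grid_sum_0)
    next
      case (Suc k)
      have v: "valid_grid s h k" by (rule valid_grid_point(3)[OF Suc.prems]) simp
      have h: "0 < h" using v by (simp add: valid_grid_def)
      let ?\<tau> = "real (Suc k) * h"
      define I0 where "I0 = (\<integral>\<omega>. g (X s \<omega>) \<partial>M)"
      define I1 where "I1 = (\<integral>\<omega>. g (X s \<omega> + grid_sum s h k \<omega>) \<partial>M)"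
      define I2 where "I2 = (\<integral>\<omega>. g (X s \<omega> + grid_sum s h (Suc k) \<omega>) \<partial>M)"
      define J where "J = (\<integral>\<omega>. frozen_gen g (grid s h k \<omega>) \<partial>M)"
      define L where "L = (\<integral>\<omega>. gen a b g (X s \<omega>) \<partial>M)"
      have kh: "0 \<le> real k * h" "real k * h \<le> ?\<tau>" "h \<le> ?\<tau>" using h by (auto simp: algebra_simps)
      have a1: "\<bar>I1 - I0 - real k * h * L\<bar> \<le> real k * h * D ?\<tau>"
      proof -
        have "\<bar>I1 - I0 - real k * h * L\<bar> \<le> real k * h * D (real k * h)" using Suc.IH[OF v] unfolding I1_def I0_def L_def .
        also have "\<dots> \<le> real k * h * D ?\<tau>" unfolding D_def using kh C1(1) C2(1) by (intro mult_left_mono add_left_mono) auto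
        finally show ?thesis .
      qed
      have a2: "\<bar>I2 - I1 - h * J\<bar> \<le> h * (e * A1 + C1 * ?\<tau>)"
      proof -
        have "h * (e * A1 + C1 * h) \<le> h * (e * A1 + C1 * ?\<tau>)" using h kh C1(1) by (intro mult_left_mono add_left_mono) auto
        then show ?thesis using C1(2)[OF Suc.prems] unfolding I2_def I1_def J_def by linarith
      qed
      have a3: "\<bar>h * (J - L)\<bar> \<le> h * (e * A2 + C2 * ?\<tau>)"
      proof -
        have "C2 * (real k * h) \<le> C2 * ?\<tau>" using kh C2(1) by (intro mult_left_mono)
        then have "\<bar>J - L\<bar> \<le> e * A2 + C2 * ?\<tau>" using C2(2)[OF v] unfolding J_def L_def by linarith
        then show ?thesis using h by (simp add: abs_mult mult_left_mono)
      qed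
      have "I2 - I0 - ?\<tau> * L = (I1 - I0 - real k * h * L) + (I2 - I1 - h * J) + h * (J - L)" by (simp add: algebra_simps)
      then have "\<bar>I2 - I0 - ?\<tau> * L\<bar> \<le> real k * h * D ?\<tau> + h * (e * A1 + C1 * ?\<tau>) + h * (e * A2 + C2 * ?\<tau>)"
        using a1 a2 a3 by linarith
      also have "\<dots> = ?\<tau> * D ?\<tau>" by (simp add: D_def algebra_simps)
      finally show ?case unfolding I2_def I0_def L_def .
    qed
    show "\<exists>C\<ge>0. \<forall>s h k. valid_grid s h k \<longrightarrow>
      \<bar>(\<integral>\<omega>. g (X s \<omega> + grid_sum s h k \<omega>) \<partial>M) - (\<integral>\<omega>. g (X s \<omega>) \<partial>M) - real k * h * (\<integral>\<omega>. gen a b g (X s \<omega>) \<partial>M)\<bar>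
        \<le> real k * h * (e * (A1 + A2) + C * (real k * h))"
      using main C1(1) C2(1) unfolding D_def by (intro exI[of _ "C1 + C2"]) auto
  qed
qed

text \<open>The bound of \<open>grid_telescope\<close> depends on a grid only through
  \<open>real k * h = t - s\<close>, so it survives refinement of the mesh. Along the grids of
  \<open>rsum_conv\<close> the Riemann sums converge almost surely to the increment of the solution,
  and bounded second moments carry the expectations along.\<close>

lemma dynkin_increment:
  assumes g: "smoothp 2 g"
  obtains A where "0 \<le> A" "\<And>e. 0 < e \<Longrightarrow> \<exists>C\<ge>0. \<forall>s t. t0 \<le> s \<longrightarrow> s < t \<longrightarrow> t \<le> T \<longrightarrow>
    \<bar>(\<integral>\<omega>. g (X t \<omega>) \<partial>M) - (\<integral>\<omega>. g (X s \<omega>) \<partial>M) - (t - s) * (\<integral>\<omega>. gen a b g (X s \<omega>) \<partial>M)\<bar> \<le> (t - s) * (e * A + C * (t - s))"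
proof -
  obtain A where A: "0 \<le> A" and tel: "\<And>e. 0 < e \<Longrightarrow> \<exists>C\<ge>0. \<forall>s h k. valid_grid s h k \<longrightarrow>
    \<bar>(\<integral>\<omega>. g (X s \<omega> + grid_sum s h k \<omega>) \<partial>M) - (\<integral>\<omega>. g (X s \<omega>) \<partial>M) - real k * h * (\<integral>\<omega>. gen a b g (X s \<omega>) \<partial>M)\<bar>
      \<le> real k * h * (e * A + C * (real k * h))"
    by (rule grid_telescope[OF g]) blast
  have gpc: "poly_cont g" by (rule smoothp_poly_cont[OF g])
  have gs: "poly_cont (\<lambda>z :: (real^'d) \<times> (real^'d). g (snd z))" by (rule poly_cont_compose_linear[OF gpc bounded_linear_snd])
  have gs2: "poly_cont (\<lambda>z :: (real^'d) \<times> (real^'d). (g (snd z))\<^sup>2)" unfolding power2_eq_square by (rule poly_cont_mult[OF gs gs])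
  obtain B where B: "\<And>s h k. valid_grid s h k \<Longrightarrow> integrable M (\<lambda>\<omega>. (g (snd (grid s h k \<omega>)))\<^sup>2) \<and> \<bar>\<integral>\<omega>. (g (snd (grid s h k \<omega>)))\<^sup>2 \<partial>M\<bar> \<le> B"
    by (rule grid_bound[OF gs2]) blast
  have lim: "\<exists>h k. (\<forall>n. valid_grid s (h n) (k n) \<and> real (k n) * h n = t - s) \<and> (\<lambda>n. \<integral>\<omega>. g (X s \<omega> + grid_sum s (h n) (k n) \<omega>) \<partial>M) \<longlonglongrightarrow> (\<integral>\<omega>. g (X t \<omega>) \<partial>M)"
    if st: "t0 \<le> s" "s < t" "t \<le> T" for s t
  proof -
    obtain n0 :: nat where n0: "t - s \<le> real n0" using real_arch_simple by blast
    obtain r where r: "\<And>n. Suc n \<le> r n" "\<And>n. n0 \<le> r n" and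
      conv: "AE \<omega> in M. \<forall>i. (\<lambda>n. rsum s ((t - s) / real (r n)) (r n) (coefX i) \<omega>) \<longlonglongrightarrow> X t \<omega> $ i - X s \<omega> $ i"
      by (rule rsum_conv[OF st, of n0]) blast
    define h where "h n = (t - s) / real (r n)" for n
    have rp: "0 < real (r n)" "real n0 \<le> real (r n)" for n using r[of n] by auto
    have v: "valid_grid s (h n) (r n)" and e: "real (r n) * h n = t - s" for n
      using rp[of n] n0 st by (auto simp: h_def valid_grid_def pos_divide_le_eq)
    have tt: "t \<in> {t0..T}" using st by auto
    have "(\<lambda>n. \<integral>\<omega>. g (X s \<omega> + grid_sum s (h n) (r n) \<omega>) \<partial>M) \<longlonglongrightarrow> (\<integral>\<omega>. g (X t \<omega>) \<partial>M)"
    proof (rule expectation_tendsto_of_square_bound(2))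
      show "AE \<omega> in M. (\<lambda>n. g (X s \<omega> + grid_sum s (h n) (r n) \<omega>)) \<longlonglongrightarrow> g (X t \<omega>)"
        using conv
      proof eventually_elim
        case (elim \<omega>)
        have "(\<lambda>n. grid_sum s (h n) (r n) \<omega>) \<longlonglongrightarrow> X t \<omega> - X s \<omega>"
        proof (rule vec_tendstoI)
          show "(\<lambda>n. grid_sum s (h n) (r n) \<omega> $ i) \<longlonglongrightarrow> (X t \<omega> - X s \<omega>) $ i" for i
            using elim unfolding grid_sum_def axis_sum_component h_def by simp
        qed
        then have "(\<lambda>n. X s \<omega> + grid_sum s (h n) (r n) \<omega>) \<longlonglongrightarrow> X s \<omega> + (X t \<omega> - X s \<omega>)" by (intro tendsto_add tendsto_const)
        then have "(\<lambda>n. g (X s \<omega> + grid_sum s (h n) (r n) \<omega>)) \<longlonglongrightarrow> g (X s \<omega> + (X t \<omega> - X s \<omega>))"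
          by (rule continuous_on_tendsto_compose[OF poly_cont_continuous[OF gpc]]) auto
        then show ?case by simp
      qed
      show "(\<lambda>\<omega>. g (X s \<omega> + grid_sum s (h n) (r n) \<omega>)) \<in> borel_measurable M" for n
        using measurable_Fl_M[OF grid_measurable[OF v gs]] by (simp add: grid_def)
      show "(\<lambda>\<omega>. g (X t \<omega>)) \<in> borel_measurable M" by (rule measurable_Fl_M[OF poly_cont_X_Fl[OF gpc tt]])
      show "integrable M (\<lambda>\<omega>. (g (X s \<omega> + grid_sum s (h n) (r n) \<omega>))\<^sup>2)" for n using B[OF v[of n]] by (simp add: grid_def)
      show "(\<integral>\<omega>. (g (X s \<omega> + grid_sum s (h n) (r n) \<omega>))\<^sup>2 \<partial>M) \<le> B" for n using B[OF v[of n]] by (simp add: grid_def)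
    qed
    then show ?thesis using v e by blast
  qed
  show thesis
  proof (rule that[OF A])
    fix e :: real assume "0 < e"
    then obtain C where C: "0 \<le> C" "\<And>s h k. valid_grid s h k \<Longrightarrow>
      \<bar>(\<integral>\<omega>. g (X s \<omega> + grid_sum s h k \<omega>) \<partial>M) - (\<integral>\<omega>. g (X s \<omega>) \<partial>M) - real k * h * (\<integral>\<omega>. gen a b g (X s \<omega>) \<partial>M)\<bar>
        \<le> real k * h * (e * A + C * (real k * h))" using tel by blast
    have "\<bar>(\<integral>\<omega>. g (X t \<omega>) \<partial>M) - (\<integral>\<omega>. g (X s \<omega>) \<partial>M) - (t - s) * (\<integral>\<omega>. gen a b g (X s \<omega>) \<partial>M)\<bar> \<le> (t - s) * (e * A + C * (t - s))"
      if st: "t0 \<le> s" "s < t" "t \<le> T" for s t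
    proof -
      obtain h k where hk: "\<And>n. valid_grid s (h n) (k n)" "\<And>n. real (k n) * h n = t - s"
        and l: "(\<lambda>n. \<integral>\<omega>. g (X s \<omega> + grid_sum s (h n) (k n) \<omega>) \<partial>M) \<longlonglongrightarrow> (\<integral>\<omega>. g (X t \<omega>) \<partial>M)"
        using lim[OF st] by blast
      have "(\<lambda>n. \<bar>(\<integral>\<omega>. g (X s \<omega> + grid_sum s (h n) (k n) \<omega>) \<partial>M) - (\<integral>\<omega>. g (X s \<omega>) \<partial>M) - (t - s) * (\<integral>\<omega>. gen a b g (X s \<omega>) \<partial>M)\<bar>) \<longlonglongrightarrow>
        \<bar>(\<integral>\<omega>. g (X t \<omega>) \<partial>M) - (\<integral>\<omega>. g (X s \<omega>) \<partial>M) - (t - s) * (\<integral>\<omega>. gen a b g (X s \<omega>) \<partial>M)\<bar>"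
        by (intro tendsto_rabs tendsto_diff tendsto_const l)
      then show ?thesis
        using C(2)[OF hk(1)] unfolding hk(2) by (intro LIMSEQ_le_const2) auto
    qed
    then show "\<exists>C\<ge>0. \<forall>s t. t0 \<le> s \<longrightarrow> s < t \<longrightarrow> t \<le> T \<longrightarrow>
      \<bar>(\<integral>\<omega>. g (X t \<omega>) \<partial>M) - (\<integral>\<omega>. g (X s \<omega>) \<partial>M) - (t - s) * (\<integral>\<omega>. gen a b g (X s \<omega>) \<partial>M)\<bar> \<le> (t - s) * (e * A + C * (t - s))"
      using C(1) by blast
  qed
qed

lemma dynkin:
  assumes g: "smoothp 2 g" and pc: "poly_cont (gen a b g)" and t: "t \<in> {t0..T}"
  shows "((\<lambda>t. \<integral>\<omega>. g (X t \<omega>) \<partial>M) has_real_derivative (\<integral>\<omega>. gen a b g (X t \<omega>) \<partial>M)) (at t within {t0..T})"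
proof -
  obtain A where A: "0 \<le> A" "\<And>e. 0 < e \<Longrightarrow> \<exists>C\<ge>0. \<forall>s t. t0 \<le> s \<longrightarrow> s < t \<longrightarrow> t \<le> T \<longrightarrow>
    \<bar>(\<integral>\<omega>. g (X t \<omega>) \<partial>M) - (\<integral>\<omega>. g (X s \<omega>) \<partial>M) - (t - s) * (\<integral>\<omega>. gen a b g (X s \<omega>) \<partial>M)\<bar> \<le> (t - s) * (e * A + C * (t - s))"
    by (rule dynkin_increment[OF g]) blast
  show ?thesis by (rule has_derivative_of_increment_bound[OF A expectation_continuous[OF pc] t])
qed

text \<open>Each application of the generator costs two derivatives of its argument and asks of the
  coefficients only as many derivatives as remain afterwards.\<close>

lemma smoothp_gen_power:
  assumes f: "smoothp (2 * n) f" and a: "\<And>i. smoothp (2 * n) (\<lambda>x. a x $ i)" and b: "\<And>i j. smoothp (2 * n) (\<lambda>x. b x $ i $ j)"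
  shows "k \<le> n \<Longrightarrow> smoothp (2 * (n - k)) ((gen a b ^^ k) f)"
proof (induction k)
  case (Suc k)
  have e: "2 * (n - k) = Suc (Suc (2 * (n - Suc k)))" using Suc.prems by simp
  have "smoothp (Suc (Suc (2 * (n - Suc k)))) ((gen a b ^^ k) f)" using Suc unfolding e by simp
  then have "smoothp (2 * (n - Suc k)) (gen a b ((gen a b ^^ k) f))"
    by (rule smoothp_gen) (auto intro: smoothp_mono[OF a] smoothp_mono[OF b])
  then show ?case by simp
qed (simp add: f)

lemma expectation_taylor:
  assumes f: "smoothp (2 * Suc n) f" and a: "\<And>i. smoothp (2 * Suc n) (\<lambda>x. a x $ i)" and b: "\<And>i j. smoothp (2 * Suc n) (\<lambda>x. b x $ i $ j)"
    and t: "t0 < t" "t \<le> T"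
  shows "\<exists>\<xi>\<in>{t0<..<t}. (\<integral>\<omega>. f (X t \<omega>) \<partial>M) = (\<Sum>k\<le>n. (gen a b ^^ k) f x0 * (t - t0) ^ k / fact k) +
    (\<integral>\<omega>. (gen a b ^^ Suc n) f (X \<xi> \<omega>) \<partial>M) * (t - t0) ^ Suc n / fact (Suc n)"
proof -
  define \<phi> where "\<phi> k s = (\<integral>\<omega>. (gen a b ^^ k) f (X s \<omega>) \<partial>M)" for k s
  note sm = smoothp_gen_power[OF f a b]
  have "(\<phi> k has_real_derivative \<phi> (Suc k) s) (at s within {t0..t})" if k: "k \<le> n" and s: "s \<in> {t0..t}" for k s
  proof -
    have "smoothp (2 * (Suc n - k)) ((gen a b ^^ k) f)" by (rule sm) (use k in simp)
    then have "smoothp 2 ((gen a b ^^ k) f)" by (rule smoothp_mono) (use k in simp)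
    moreover have "poly_cont ((gen a b ^^ Suc k) f)" by (rule smoothp_poly_cont[OF sm]) (use k in simp)
    ultimately have "(\<phi> k has_real_derivative \<phi> (Suc k) s) (at s within {t0..T})"
      unfolding \<phi>_def[abs_def] using s t by (simp add: dynkin)
    then show ?thesis by (rule DERIV_subset) (use t in auto)
  qed
  from taylor_lagrange_within[of t0 t n \<phi>, OF t(1) this] obtain \<xi> where \<xi>: "\<xi> \<in> {t0<..<t}"
    "\<phi> 0 t = (\<Sum>k\<le>n. \<phi> k t0 * (t - t0) ^ k / fact k) + \<phi> (Suc n) \<xi> * (t - t0) ^ Suc n / fact (Suc n)" by blast
  \<comment> \<open>The initial value is deterministic, so the expectation disappears from the
    Taylor coefficients.\<close>
  have ini: "\<phi> k t0 = (gen a b ^^ k) f x0" if k: "k \<le> n" for k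
  proof -
    have "poly_cont ((gen a b ^^ k) f)" by (rule smoothp_poly_cont[OF sm]) (use k in simp)
    from measurable_Fl_M[OF poly_cont_X_Fl[OF this]] have m: "(\<lambda>\<omega>. (gen a b ^^ k) f (X t0 \<omega>)) \<in> borel_measurable M" using t0 by simp
    have "\<phi> k t0 = (\<integral>\<omega>. (gen a b ^^ k) f x0 \<partial>M)" unfolding \<phi>_def
      by (rule integral_cong_AE[OF m]) (use X_initial in \<open>auto elim!: eventually_mono\<close>)
    then show ?thesis by (simp add: prob_space)
  qed
  have "(\<Sum>k\<le>n. \<phi> k t0 * (t - t0) ^ k / fact k) = (\<Sum>k\<le>n. (gen a b ^^ k) f x0 * (t - t0) ^ k / fact k)"
    by (intro sum.cong) (auto simp: ini)
  note eq = \<xi>(2)[unfolded this]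
  have "\<phi> 0 t = (\<integral>\<omega>. f (X t \<omega>) \<partial>M)" by (simp add: \<phi>_def)
  with eq show ?thesis unfolding \<phi>_def[of "Suc n"] by (intro bexI[OF _ \<xi>(1)]) simp
qed

end

section \<open>Identification of the tree sums with the Taylor terms\<close>

lemma lts_sum_elem_diff:
  fixes a :: "real^'d::finite \<Rightarrow> real^'d" and b :: "real^'d \<Rightarrow> real^'m::finite^'d"
  assumes sm: "smoothp (2 * k) f" "\<And>i. smoothp (2 * k) (\<lambda>x. a x $ i)" "\<And>i j. smoothp (2 * k) (\<lambda>x. b x $ i $ j)"
  shows "lts_sum (\<lambda>r. r = k) (\<lambda>tr (js :: nat \<Rightarrow> 'm). elem_diff f a b tr js x * \<tau> ^ rho tr) = (gen a b ^^ k) f x * \<tau> ^ k / fact k"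
proof -
  have "lts_sum (\<lambda>r. r = k) (\<lambda>tr (js :: nat \<Rightarrow> 'm). elem_diff f a b tr js x * \<tau> ^ rho tr) =
    (\<Sum>tr\<in>{tr \<in> lts. rho tr = k}. tree_term f a b tr x * (\<tau> ^ k / fact k))"
    unfolding lts_sum_def tree_term_def sum_distrib_right by (intro sum.cong refl) (auto simp: field_simps)
  also have "\<dots> = (\<Sum>tr\<in>{tr \<in> lts. rho tr = k}. tree_term f a b tr x) * (\<tau> ^ k / fact k)" by (rule sum_distrib_right[symmetric])
  finally show ?thesis unfolding gen_power_tree_sum[OF sm] by simp
qed

lemma lts_sum_le_eq_sum_levels: "lts_sum (\<lambda>r. r \<le> n) G = (\<Sum>k\<le>n. lts_sum (\<lambda>r. r = k) G)"
proof -
  define F where "F tr = (\<Sum>js\<in>PiE {..<nsig tr div 2} (\<lambda>_. UNIV). G tr js / (2 ^ (nsig tr div 2) * fact (rho tr)))" for tr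
  have "(\<Sum>k\<le>n. sum F {tr \<in> {tr \<in> lts. rho tr \<le> n}. rho tr = k}) = sum F {tr \<in> lts. rho tr \<le> n}"
    by (rule sum.group[OF finite_lts_le]) auto
  moreover have "{tr \<in> {tr \<in> lts. rho tr \<le> n}. rho tr = k} = {tr \<in> lts. rho tr = k}" if "k \<le> n" for k using that by auto
  ultimately show ?thesis unfolding lts_sum_def F_def[symmetric] by simp
qed

context sde_growth
begin

lemma elem_diff_integrable:
  assumes sm: "smoothp l f" "\<And>i. smoothp l (\<lambda>x. a x $ i)" "\<And>i j. smoothp l (\<lambda>x. b x $ i $ j)"
    and tr: "tr \<in> lts" "2 * rho tr \<le> l" and s: "s \<in> {t0..T}"
  shows "integrable M (\<lambda>\<omega>. elem_diff f a b tr js (X s \<omega>))"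
  by (rule poly_cont_moment[OF smoothp_poly_cont[OF smoothp_elem_diff[OF sm tr, of js]]]) (use s in blast)

lemma lts_sum_expectation:
  assumes sm: "smoothp (2 * k) f" "\<And>i. smoothp (2 * k) (\<lambda>x. a x $ i)" "\<And>i j. smoothp (2 * k) (\<lambda>x. b x $ i $ j)" and s: "s \<in> {t0..T}"
  shows "lts_sum (\<lambda>r. r = k) (\<lambda>tr (js :: nat \<Rightarrow> 'm). (\<integral>\<omega>. elem_diff f a b tr js (X s \<omega>) \<partial>M) * \<tau> ^ rho tr) =
    (\<integral>\<omega>. (gen a b ^^ k) f (X s \<omega>) \<partial>M) * \<tau> ^ k / fact k"
proof -
  have int: "integrable M (\<lambda>\<omega>. elem_diff f a b tr js (X s \<omega>))" if "tr \<in> {tr \<in> lts. rho tr = k}" for tr js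
    using elem_diff_integrable[OF sm _ _ s] that by simp
  have "(\<integral>\<omega>. (gen a b ^^ k) f (X s \<omega>) \<partial>M) = (\<Sum>tr\<in>{tr \<in> lts. rho tr = k}. \<integral>\<omega>. tree_term f a b tr (X s \<omega>) \<partial>M)"
    unfolding gen_power_tree_sum[OF sm]
    by (rule Bochner_Integration.integral_sum) (unfold tree_term_def, intro Bochner_Integration.integrable_sum integrable_mult_right int)
  also have "\<dots> = (\<Sum>tr\<in>{tr \<in> lts. rho tr = k}. \<Sum>js\<in>PiE {..<nsig tr div 2} (\<lambda>_. UNIV :: 'm set). (1 / 2 ^ (nsig tr div 2)) * (\<integral>\<omega>. elem_diff f a b tr js (X s \<omega>) \<partial>M))"
    unfolding tree_term_def using int by (intro sum.cong refl) (simp add: Bochner_Integration.integral_sum)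
  finally have E: "(\<integral>\<omega>. (gen a b ^^ k) f (X s \<omega>) \<partial>M) = (\<Sum>tr\<in>{tr \<in> lts. rho tr = k}. \<Sum>js\<in>PiE {..<nsig tr div 2} (\<lambda>_. UNIV :: 'm set). (1 / 2 ^ (nsig tr div 2)) * (\<integral>\<omega>. elem_diff f a b tr js (X s \<omega>) \<partial>M))" .
  show ?thesis unfolding E lts_sum_def sum_distrib_right sum_divide_distrib
    by (intro sum.cong refl) (auto simp: field_simps)
qed

text \<open>Class invariance holds pointwise only for the sum over the index values, so the finite
  sum and the expectation are exchanged first; this rests on the integrability of each elementary
  differential separately.\<close>

lemma lts_sum_eq_ts_sum_expectation:
  assumes sm: "smoothp (2 * k) f" "\<And>i. smoothp (2 * k) (\<lambda>x. a x $ i)" "\<And>i j. smoothp (2 * k) (\<lambda>x. b x $ i $ j)" and s: "s \<in> {t0..T}"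
  shows "lts_sum (\<lambda>r. r = k) (\<lambda>tr (js :: nat \<Rightarrow> 'm). (\<integral>\<omega>. elem_diff f a b tr js (X s \<omega>) \<partial>M) * \<tau> ^ rho tr) =
    ts_sum (\<lambda>r. r = k) (\<lambda>tr (js :: nat \<Rightarrow> 'm). (\<integral>\<omega>. elem_diff f a b tr js (X s \<omega>) \<partial>M) * \<tau> ^ rho tr)"
proof (rule lts_sum_eq_ts_sum[OF _ finite_lts_level])
  fix t t' assume t: "t \<in> lts" "t' \<in> lts" and k: "rho t = k" and eq: "tree_equiv t t'"
  have k': "rho t' = k" using tree_equiv_rho[OF eq] k by simp
  have int: "integrable M (\<lambda>\<omega>. elem_diff f a b tr js (X s \<omega>))" if "tr = t \<or> tr = t'" for tr js
    using elem_diff_integrable[OF sm _ _ s] that t k k' by auto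
  have sw: "(\<Sum>js\<in>J. (\<integral>\<omega>. elem_diff f a b tr js (X s \<omega>) \<partial>M)) = (\<integral>\<omega>. (\<Sum>js\<in>J. elem_diff f a b tr js (X s \<omega>)) \<partial>M)" if "tr = t \<or> tr = t'" for tr J
    by (rule Bochner_Integration.integral_sum[symmetric]) (rule int[OF that])
  have "(\<Sum>js\<in>PiE {..<nsig t' div 2} (\<lambda>_. UNIV :: 'm set). (\<integral>\<omega>. elem_diff f a b t' js (X s \<omega>) \<partial>M)) =
    (\<Sum>js\<in>PiE {..<nsig t div 2} (\<lambda>_. UNIV). (\<integral>\<omega>. elem_diff f a b t js (X s \<omega>) \<partial>M))"
    unfolding sw[of t', simplified] sw[of t, simplified]
    by (subst elem_diff_sum_equiv[OF sm t _ eq]) (simp_all add: k)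
  then show "(\<Sum>js\<in>PiE {..<nsig t' div 2} (\<lambda>_. UNIV :: 'm set). (\<integral>\<omega>. elem_diff f a b t' js (X s \<omega>) \<partial>M) * \<tau> ^ rho t') =
    (\<Sum>js\<in>PiE {..<nsig t div 2} (\<lambda>_. UNIV). (\<integral>\<omega>. elem_diff f a b t js (X s \<omega>) \<partial>M) * \<tau> ^ rho t)"
    unfolding k k' sum_distrib_right[symmetric] by simp
qed

end

lemma lts_sum_eq_ts_sum_elem_diff:
  fixes a :: "real^'d::finite \<Rightarrow> real^'d" and b :: "real^'d \<Rightarrow> real^'m::finite^'d"
  assumes sm: "smoothp l f" "\<And>i. smoothp l (\<lambda>x. a x $ i)" "\<And>i j. smoothp l (\<lambda>x. b x $ i $ j)" and n: "2 * n \<le> l"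
  shows "lts_sum (\<lambda>r. r \<le> n) (\<lambda>tr (js :: nat \<Rightarrow> 'm). elem_diff f a b tr js x * \<tau> ^ rho tr) =
    ts_sum (\<lambda>r. r \<le> n) (\<lambda>tr (js :: nat \<Rightarrow> 'm). elem_diff f a b tr js x * \<tau> ^ rho tr)"
proof (rule lts_sum_eq_ts_sum[OF _ finite_lts_le])
  fix t t' assume t: "t \<in> lts" "t' \<in> lts" and k: "rho t \<le> n" and eq: "tree_equiv t t'"
  have "(\<Sum>js\<in>PiE {..<nsig t' div 2} (\<lambda>_. UNIV :: 'm set). elem_diff f a b t' js x) = (\<Sum>js\<in>PiE {..<nsig t div 2} (\<lambda>_. UNIV). elem_diff f a b t js x)"
    by (rule elem_diff_sum_equiv[OF sm t _ eq]) (use k n in simp)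
  then show "(\<Sum>js\<in>PiE {..<nsig t' div 2} (\<lambda>_. UNIV :: 'm set). elem_diff f a b t' js x * \<tau> ^ rho t') =
    (\<Sum>js\<in>PiE {..<nsig t div 2} (\<lambda>_. UNIV). elem_diff f a b t js x * \<tau> ^ rho t)"
    unfolding tree_equiv_rho[OF eq] sum_distrib_right[symmetric] by simp
qed

text \<open>The remainder is introduced as the difference \<open>R\<close>, so the expansion itself
  amounts to the agreement of the two finite sums. The formulas for \<open>R\<close> are stated for
  \<open>t0 < t\<close>, since the interval for \<xi> is empty otherwise. Integrability is asserted
  alongside because an integral has a default value without it.\<close>

theorem theorem1:
  fixes M :: "'a measure" and Fl :: "real \<Rightarrow> 'a measure"
    and W :: "'m::finite \<Rightarrow> real \<Rightarrow> 'a \<Rightarrow> real"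
    and a :: "real^'d::finite \<Rightarrow> real^'d" and b :: "real^'d \<Rightarrow> real^'m^'d"
    and f :: "real^'d \<Rightarrow> real"
    and X :: "real \<Rightarrow> 'a \<Rightarrow> real^'d"
    and x0 :: "real^'d" and t0 T t :: real and n :: nat
  assumes "prob_space M"
    and "filtration_on M Fl"
    and "wiener_process M Fl W"
    and "0 \<le> t0" and "t0 < T"
    and "a \<in> borel_measurable borel" and "b \<in> borel_measurable borel"
    and "\<exists>L. \<forall>x y. norm (a x - a y) \<le> L * norm (x - y) \<and>
                   (\<forall>j. norm ((\<chi> i. b x $ i $ j) - (\<chi> i. b y $ i $ j)) \<le> L * norm (x - y))"
    and "\<exists>K. \<forall>x. norm (a x) \<le> K * (1 + norm x) \<and>
                 (\<forall>j. norm (\<chi> i. b x $ i $ j) \<le> K * (1 + norm x))"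
    and "sde_solution M Fl W a b t0 T x0 X"
    and "CP (2 * (n + 1)) f"
    and "\<forall>i. CP (2 * (n + 1)) (\<lambda>x. a x $ i)"
    and "\<forall>i j. CP (2 * (n + 1)) (\<lambda>x. b x $ i $ j)"
    and "t \<in> {t0..T}"
  shows "integrable M (\<lambda>\<omega>. f (X t \<omega>)) \<and>
    lts_sum (\<lambda>r. r \<le> n) (\<lambda>tr (js :: nat \<Rightarrow> 'm). elem_diff f a b tr js x0 * (t - t0) ^ rho tr)
      = ts_sum (\<lambda>r. r \<le> n) (\<lambda>tr (js :: nat \<Rightarrow> 'm). elem_diff f a b tr js x0 * (t - t0) ^ rho tr) \<and>
    (t0 < t \<longrightarrow>
      (\<exists>\<xi> :: 'a \<Rightarrow> real. \<xi> \<in> borel_measurable M \<and> (\<forall>\<omega>\<in>space M. \<xi> \<omega> \<in> {t0<..<t}) \<and>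
         (\<forall>tr\<in>lts. \<forall>js :: nat \<Rightarrow> 'm. rho tr = n + 1 \<longrightarrow> integrable M (\<lambda>\<omega>. elem_diff f a b tr js (X (\<xi> \<omega>) \<omega>))) \<and>
         (let R = (\<integral>\<omega>. f (X t \<omega>) \<partial>M)
                  - lts_sum (\<lambda>r. r \<le> n)
                      (\<lambda>tr (js :: nat \<Rightarrow> 'm). elem_diff f a b tr js x0 * (t - t0) ^ rho tr)
          in R = lts_sum (\<lambda>r. r = n + 1)
                   (\<lambda>tr (js :: nat \<Rightarrow> 'm). (\<integral>\<omega>. elem_diff f a b tr js (X (\<xi> \<omega>) \<omega>) \<partial>M)
                                          * (t - t0) ^ rho tr)
           \<and> R = ts_sum (\<lambda>r. r = n + 1)
                   (\<lambda>tr (js :: nat \<Rightarrow> 'm). (\<integral>\<omega>. elem_diff f a b tr js (X (\<xi> \<omega>) \<omega>) \<partial>M)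
                                          * (t - t0) ^ rho tr))))"
proof -
  have e: "2 * (n + 1) = 2 * Suc n" by simp
  note CP = assms(11-13)[unfolded e]
  have f: "smoothp (2 * Suc n) f" by (rule CP_imp_smoothp[OF CP(1)])
  have a: "smoothp (2 * Suc n) (\<lambda>x. a x $ i)" for i using CP(2) by (blast intro: CP_imp_smoothp)
  have b: "smoothp (2 * Suc n) (\<lambda>x. b x $ i $ j)" for i j using CP(3) by (blast intro: CP_imp_smoothp)
  interpret prob_space M by fact
  interpret sde M Fl W a b t0 T x0 X
    by unfold_locales (use assms(2-5,10) smoothp_poly_cont[OF a] smoothp_poly_cont[OF b] in auto)
  interpret sde_growth M Fl W a b t0 T x0 X
  proof unfold_locales
    obtain K where K: "\<And>x. norm (a x) \<le> K * (1 + norm x)" "\<And>x j. norm (\<chi> i. b x $ i $ j) \<le> K * (1 + norm x)"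
      using assms(9) by blast
    have "\<bar>coef i c x\<bar> \<le> K * (1 + norm x)" for x i c
    proof (cases c)
      case None
      then show ?thesis using component_le_norm_cart[of "a x" i] K(1)[of x] by (simp add: coef_def)
    next
      case (Some j)
      then show ?thesis using component_le_norm_cart[of "\<chi> i. b x $ i $ j" i] K(2)[of x j] by (simp add: coef_def)
    qed
    then show "\<exists>K. \<forall>x i c. \<bar>coef i c x\<bar> \<le> K * (1 + norm x)" by blast
  qed
  have "integrable M (\<lambda>\<omega>. f (X t \<omega>))"
    by (rule poly_cont_moment[OF smoothp_poly_cont[OF f]]) (use assms(14) in blast)
  moreover have "lts_sum (\<lambda>r. r \<le> n) (\<lambda>tr (js :: nat \<Rightarrow> 'm). elem_diff f a b tr js x0 * (t - t0) ^ rho tr)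
      = ts_sum (\<lambda>r. r \<le> n) (\<lambda>tr (js :: nat \<Rightarrow> 'm). elem_diff f a b tr js x0 * (t - t0) ^ rho tr)"
    by (rule lts_sum_eq_ts_sum_elem_diff[OF f a b]) simp
  moreover have "\<exists>\<xi> :: 'a \<Rightarrow> real. \<xi> \<in> borel_measurable M \<and> (\<forall>\<omega>\<in>space M. \<xi> \<omega> \<in> {t0<..<t}) \<and>
         (\<forall>tr\<in>lts. \<forall>js :: nat \<Rightarrow> 'm. rho tr = n + 1 \<longrightarrow> integrable M (\<lambda>\<omega>. elem_diff f a b tr js (X (\<xi> \<omega>) \<omega>))) \<and>
         (let R = (\<integral>\<omega>. f (X t \<omega>) \<partial>M)
                  - lts_sum (\<lambda>r. r \<le> n)
                      (\<lambda>tr (js :: nat \<Rightarrow> 'm). elem_diff f a b tr js x0 * (t - t0) ^ rho tr)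
          in R = lts_sum (\<lambda>r. r = n + 1)
                   (\<lambda>tr (js :: nat \<Rightarrow> 'm). (\<integral>\<omega>. elem_diff f a b tr js (X (\<xi> \<omega>) \<omega>) \<partial>M)
                                          * (t - t0) ^ rho tr)
           \<and> R = ts_sum (\<lambda>r. r = n + 1)
                   (\<lambda>tr (js :: nat \<Rightarrow> 'm). (\<integral>\<omega>. elem_diff f a b tr js (X (\<xi> \<omega>) \<omega>) \<partial>M)
                                          * (t - t0) ^ rho tr))" if lt: "t0 < t"
  proof -
    have tT: "t \<le> T" using assms(14) by simp
    obtain s where s: "s \<in> {t0<..<t}" and
      eq: "(\<integral>\<omega>. f (X t \<omega>) \<partial>M) = (\<Sum>k\<le>n. (gen a b ^^ k) f x0 * (t - t0) ^ k / fact k) +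
        (\<integral>\<omega>. (gen a b ^^ Suc n) f (X s \<omega>) \<partial>M) * (t - t0) ^ Suc n / fact (Suc n)"
      using expectation_taylor[OF f a b lt tT] by blast
    have sT: "s \<in> {t0..T}" using s tT by auto
    have "lts_sum (\<lambda>r. r \<le> n) (\<lambda>tr (js :: nat \<Rightarrow> 'm). elem_diff f a b tr js x0 * (t - t0) ^ rho tr) =
      (\<Sum>k\<le>n. (gen a b ^^ k) f x0 * (t - t0) ^ k / fact k)"
      unfolding lts_sum_le_eq_sum_levels
      by (intro sum.cong refl lts_sum_elem_diff smoothp_mono[OF f] smoothp_mono[OF a] smoothp_mono[OF b]) simp_all
    then have R: "(\<integral>\<omega>. f (X t \<omega>) \<partial>M) - lts_sum (\<lambda>r. r \<le> n) (\<lambda>tr (js :: nat \<Rightarrow> 'm). elem_diff f a b tr js x0 * (t - t0) ^ rho tr) =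
      lts_sum (\<lambda>r. r = Suc n) (\<lambda>tr (js :: nat \<Rightarrow> 'm). (\<integral>\<omega>. elem_diff f a b tr js (X s \<omega>) \<partial>M) * (t - t0) ^ rho tr)"
      unfolding lts_sum_expectation[OF f a b sT] eq by linarith
    show ?thesis
      unfolding Let_def Suc_eq_plus1[symmetric]
      using s R lts_sum_eq_ts_sum_expectation[OF f a b sT] elem_diff_integrable[OF f a b _ _ sT]
      by (intro exI[of _ "\<lambda>_. s"]) simp
  qed
  ultimately show ?thesis by blast
qed

end
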